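(* Let $\Gamma$ be a countably infinite group and $\Sigma=\{\Gamma_n\}_{n=1}^\infty$ a sequence of finite-index normal subgroups of $\Gamma$ with $\bigcap_{n=1}^\infty\bigcup_{i\ge n}\Gamma_i=\{e\}$. Let $f\in\mathbb{Z}\Gamma$ be well-balanced and let $\lambda$ be the Haar probability measure on $X_f$. Then $$h_{\Sigma,\lambda}(X_f,\Gamma)=h_\Sigma(X_f,\Gamma)=\log\det_{\mathcal N\Gamma}f=\lim_{n\to\infty}[\Gamma:\Gamma_n]^{-1}\log|\mathrm{Fix}_{\Gamma_n}(X_f)|,$$ where $|\mathrm{Fix}_{\Gamma_n}(X_f)|$ is the number of connected components of the set $\mathrm{Fix}_{\Gamma_n}(X_f)$ of points of $X_f$ fixed by every element of $\Gamma_n$ (in particular the limit exists).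
   Context: Group ring and convolution: $\mathbb{R}\Gamma$ (resp. $\mathbb{Z}\Gamma$) is the set of finitely supported functions $\Gamma\to\mathbb{R}$ (resp. $\mathbb{Z}$), written $f=(f_s)_{s\in\Gamma}$; the product (convolution) of functions $g,h$ on $\Gamma$ (with values in $\mathbb{R}$ or, when $g\in\mathbb{Z}\Gamma$, $h$ may take values in $\mathbb{R}/\mathbb{Z}$) is $(gh)_w=\sum_{s\in\Gamma}g_sh_{s^{-1}w}=\sum_{s}g_{ws^{-1}}h_s$, whenever defined. The adjoint is $f^*_s=f_{s^{-1}}$. Well-balanced: $f\in\mathbb{R}\Gamma$ is well-balanced if (1) $\sum_s f_s=0$; (2) $f_s\le 0$ for all $s\neq e$; (3) $f=f^*$; (4) the support of $f$ generates $\Gamma$. Harmonic model: for well-balanced $f\in\mathbb{Z}\Gamma$, $X_f=\{x\in(\mathbb{R}/\mathbb{Z})^\Gamma: xf=0\}$, i.e. $\sum_s x_{ts}f_s=0$ in $\mathbb{R}/\mathbb{Z}$ for all $t\in\Gamma$; it is a compact abelian group (product topology) on which $\Gamma$ acts by continuous automorphisms via $(sx)_t=x_{s^{-1}t}$. (It is the Pontryagin dual of $\mathbb{Z}\Gamma/\mathbb{Z}\Gamma f$.) Fuglede–Kadison determinant: $\Gamma$ acts on $\ell^2(\Gamma,\mathbb{C})$ by $(sx)_t=x_{s^{-1}t}$; $\mathcal N\Gamma$ is the algebra of bounded operators commuting with this action, with trace $\mathrm{tr}(T)=\langle T\delta_e,\delta_e\rangle$. An element $g\in\mathbb{R}\Gamma$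 is identified with the operator $x\mapsto xg^*$. For a positive $T\in\mathcal N\Gamma$, its spectral measure is the Borel probability measure $\mu_T$ on $[0,\|T\|]$ with $\int p\,d\mu_T=\mathrm{tr}(p(T))$ for all polynomials $p$, and $\det_{\mathcal N\Gamma}T=\exp\int_{(0,\|T\|]}\log t\,d\mu_T(t)$. A well-balanced $f$ is a positive operator. Sofic entropy (with respect to $\Sigma$): let $\Gamma$ act by homeomorphisms on a compact metrizable space $X$ and let $\rho$ be a continuous pseudometric on $X$ which is dynamically generating (for $x\ne y$ there is $s$ with $\rho(sx,sy)>0$). For maps $\varphi,\psi:\Gamma/\Gamma_n\to X$ set $\rho_\infty(\varphi,\psi)=\max_{g\Gamma_n}\rho(\varphi(g\Gamma_n),\psi(g\Gamma_n))$ and $\rho_2(\varphi,\psi)=\big([\Gamma:\Gamma_n]^{-1}\sum_{g\Gamma_n}\rho(\varphi(g\Gamma_n),\psi(g\Gamma_n))^2\big)^{1/2}$. For $s\in\Gamma$ write $(\varphi\circ s)(g\Gamma_n)=\varphi(sg\Gamma_n)$ and $(s\circ\varphi)(g\Gamma_n)=s\varphi(g\Gamma_n)$. For finite nonempty $W\subset\Gamma$ and $\delta>0$, $\mathrm{Map}(W,\delta,\Gamma_n)$ is the set of $\varphi$ with $\rho_2(\varphi\circ s,s\circ\varphi)\le\delta$ for all $s\in W$; for a $\Gamma$-invariant Borel probability measure $\nu$ and finite $L\subset C(X)$, $\mathrm{Map}_\nu(W,L,\delta,\Gamma_n)$ is the set of $\varphi\in\mathrm{Map}(W,\delta,\Gamma_n)$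 with $|[\Gamma:\Gamma_n]^{-1}\sum_{g\Gamma_n}p(\varphi(g\Gamma_n))-\int p\,d\nu|\le\delta$ for all $p\in L$. $N_\varepsilon(Z,d)$ is the maximal cardinality of a subset of $Z$ whose distinct points have $d$-distance $>\varepsilon$. Then $h_\Sigma(X,\Gamma)=\sup_{\varepsilon>0}\inf_W\inf_{\delta>0}\limsup_n[\Gamma:\Gamma_n]^{-1}\log N_\varepsilon(\mathrm{Map}(W,\delta,\Gamma_n),\rho_\infty)$ and $h_{\Sigma,\nu}(X,\Gamma)=\sup_{\varepsilon}\inf_W\inf_L\inf_\delta\limsup_n[\Gamma:\Gamma_n]^{-1}\log N_\varepsilon(\mathrm{Map}_\nu(W,L,\delta,\Gamma_n),\rho_\infty)$; these quantities do not depend on the choice of $\rho$ and are unchanged if $\rho_\infty$ is replaced by $\rho_2$. *)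

theory Defs
  imports "HOL-Probability.Probability" "HOL-Computational_Algebra.Polynomial"
begin

section \<open>Groups (written additively: st = s + t, s^-1 = -s, e = 0)\<close>

definition subgrp :: "'g::group_add set \<Rightarrow> bool" where
  "subgrp H \<longleftrightarrow> 0 \<in> H \<and> (\<forall>a\<in>H. \<forall>b\<in>H. a + b \<in> H) \<and> (\<forall>a\<in>H. - a \<in> H)"

definition normal_subgrp :: "'g::group_add set \<Rightarrow> bool" where
  "normal_subgrp H \<longleftrightarrow> subgrp H \<and> (\<forall>g h. h \<in> H \<longrightarrow> g + h - g \<in> H)"

definition lcoset :: "'g::group_add \<Rightarrow> 'g set \<Rightarrow> 'g set" where
  "lcoset g H = (\<lambda>h. g + h) ` H"

definition cosets :: "'g::group_add set \<Rightarrow> 'g set set" where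
  "cosets H = range (\<lambda>g. lcoset g H)"

definition finite_index :: "'g::group_add set \<Rightarrow> bool" where
  "finite_index H \<longleftrightarrow> finite (cosets H)"

definition gen_subgrp :: "'g::group_add set \<Rightarrow> 'g set" where
  "gen_subgrp S = \<Inter> {H. subgrp H \<and> S \<subseteq> H}"

definition supp :: "('g \<Rightarrow> 'a::zero) \<Rightarrow> 'g set" where
  "supp f = {s. f s \<noteq> 0}"

definition well_balanced :: "('g::group_add \<Rightarrow> real) \<Rightarrow> bool" where
  "well_balanced f \<longleftrightarrow> finite (supp f) \<and> (\<Sum>s\<in>supp f. f s) = 0
     \<and> (\<forall>s. s \<noteq> 0 \<longrightarrow> f s \<le> 0) \<and> (\<forall>s. f (- s) = f s)
     \<and> gen_subgrp (supp f) = UNIV"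

section \<open>Harmonic model; R/Z is realised as the unit circle in C via t \<mapsto> exp(2 pi i t)\<close>

definition harmonic_model :: "('g::group_add \<Rightarrow> int) \<Rightarrow> ('g \<Rightarrow> complex) set" where
  "harmonic_model f = {x. (\<forall>t. cmod (x t) = 1) \<and>
      (\<forall>t. (\<Prod>s\<in>supp f. x (t + s) powi f s) = 1)}"

definition shift :: "'g::group_add \<Rightarrow> ('g \<Rightarrow> 'a) \<Rightarrow> ('g \<Rightarrow> 'a)" where
  "shift s x = (\<lambda>t. x (- s + t))"

definition fix_set :: "'g::group_add set \<Rightarrow> ('g \<Rightarrow> 'a) set \<Rightarrow> ('g \<Rightarrow> 'a) set" where
  "fix_set H X = {x \<in> X. \<forall>s\<in>H. shift s x = x}"

definition haar_measure :: "('g \<Rightarrow> complex) set \<Rightarrow> ('g \<Rightarrow> complex) measure" where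
  "haar_measure X = (THE \<mu>. prob_space \<mu> \<and> sets \<mu> = sets (restrict_space borel X) \<and>
     (\<forall>y\<in>X. \<forall>A\<in>sets \<mu>. (\<lambda>x t. x t * y t) ` A \<in> sets \<mu> \<and>
        measure \<mu> ((\<lambda>x t. x t * y t) ` A) = measure \<mu> A))"

text \<open>The dynamically generating continuous pseudometric used: distance of the e-coordinates.\<close>
definition rho0 :: "('g::zero \<Rightarrow> complex) \<Rightarrow> ('g \<Rightarrow> complex) \<Rightarrow> real" where
  "rho0 x y = cmod (x 0 - y 0)"

definition rho2 :: "'c set \<Rightarrow> ('x \<Rightarrow> 'x \<Rightarrow> real) \<Rightarrow> ('c \<Rightarrow> 'x) \<Rightarrow> ('c \<Rightarrow> 'x) \<Rightarrow> real" where
  "rho2 Q \<rho> \<phi> \<psi> = sqrt ((\<Sum>C\<in>Q. (\<rho> (\<phi> C) (\<psi> C))\<^sup>2) / real (card Q))"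

definition rhoinf :: "'c set \<Rightarrow> ('x \<Rightarrow> 'x \<Rightarrow> real) \<Rightarrow> ('c \<Rightarrow> 'x) \<Rightarrow> ('c \<Rightarrow> 'x) \<Rightarrow> real" where
  "rhoinf Q \<rho> \<phi> \<psi> = Max ((\<lambda>C. \<rho> (\<phi> C) (\<psi> C)) ` Q)"

definition sofic_maps ::
  "('g::group_add \<Rightarrow> 'x \<Rightarrow> 'x) \<Rightarrow> 'x set \<Rightarrow> ('x \<Rightarrow> 'x \<Rightarrow> real) \<Rightarrow> 'g set \<Rightarrow> 'g set \<Rightarrow> real
    \<Rightarrow> ('g set \<Rightarrow> 'x) set" where
  "sofic_maps act X \<rho> H W \<delta> = {\<phi> \<in> cosets H \<rightarrow>\<^sub>E X.
      \<forall>s\<in>W. rho2 (cosets H) \<rho> (\<lambda>C. \<phi> (lcoset s C)) (\<lambda>C. act s (\<phi> C)) \<le> \<delta>}"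

definition sofic_maps_meas ::
  "('g::group_add \<Rightarrow> 'x \<Rightarrow> 'x) \<Rightarrow> 'x set \<Rightarrow> ('x \<Rightarrow> 'x \<Rightarrow> real) \<Rightarrow> 'x measure \<Rightarrow> 'g set
    \<Rightarrow> 'g set \<Rightarrow> ('x \<Rightarrow> real) set \<Rightarrow> real \<Rightarrow> ('g set \<Rightarrow> 'x) set" where
  "sofic_maps_meas act X \<rho> \<nu> H W L \<delta> = {\<phi> \<in> sofic_maps act X \<rho> H W \<delta>.
      \<forall>p\<in>L. \<bar>(\<Sum>C\<in>cosets H. p (\<phi> C)) / real (card (cosets H)) - integral\<^sup>L \<nu> p\<bar> \<le> \<delta>}"

definition sep_number :: "('a \<Rightarrow> 'a \<Rightarrow> real) \<Rightarrow> real \<Rightarrow> 'a set \<Rightarrow> ereal" where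
  "sep_number d \<epsilon> Z = Sup {ereal (real (card F)) | F. F \<subseteq> Z \<and> finite F \<and>
      (\<forall>a\<in>F. \<forall>b\<in>F. a \<noteq> b \<longrightarrow> d a b > \<epsilon>)}"

definition elog :: "ereal \<Rightarrow> ereal" where
  "elog x = (if x \<le> 0 then -\<infinity> else if x = \<infinity> then \<infinity> else ereal (ln (real_of_ereal x)))"

definition sofic_entropy ::
  "('g::group_add \<Rightarrow> 'x \<Rightarrow> 'x) \<Rightarrow> 'x set \<Rightarrow> ('x \<Rightarrow> 'x \<Rightarrow> real) \<Rightarrow> (nat \<Rightarrow> 'g set) \<Rightarrow> ereal" where
  "sofic_entropy act X \<rho> Gs =
     (SUP \<epsilon>\<in>{0::real<..}. INF W\<in>{W. finite W \<and> W \<noteq> {}}. INF \<delta>\<in>{0::real<..}.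
        limsup (\<lambda>n. elog (sep_number (rhoinf (cosets (Gs n)) \<rho>) \<epsilon> (sofic_maps act X \<rho> (Gs n) W \<delta>))
                    / ereal (real (card (cosets (Gs n))))))"

definition sofic_meas_entropy ::
  "('g::group_add \<Rightarrow> 'x::topological_space \<Rightarrow> 'x) \<Rightarrow> 'x set \<Rightarrow> ('x \<Rightarrow> 'x \<Rightarrow> real) \<Rightarrow> 'x measure \<Rightarrow> (nat \<Rightarrow> 'g set)
     \<Rightarrow> ereal" where
  "sofic_meas_entropy act X \<rho> \<nu> Gs =
     (SUP \<epsilon>\<in>{0::real<..}. INF W\<in>{W. finite W \<and> W \<noteq> {}}.
        INF L\<in>{L. finite L \<and> (\<forall>p\<in>L. continuous_on X p)}. INF \<delta>\<in>{0::real<..}.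
        limsup (\<lambda>n. elog (sep_number (rhoinf (cosets (Gs n)) \<rho>) \<epsilon>
                             (sofic_maps_meas act X \<rho> \<nu> (Gs n) W L \<delta>))
                    / ereal (real (card (cosets (Gs n))))))"

text \<open>The operator x \<mapsto> x g^* on functions Gamma \<rightarrow> C, for finitely supported g.\<close>
definition conv_op :: "('g::group_add \<Rightarrow> real) \<Rightarrow> ('g \<Rightarrow> complex) \<Rightarrow> ('g \<Rightarrow> complex)" where
  "conv_op g x = (\<lambda>w. \<Sum>s\<in>{s. g (- s) \<noteq> 0}. x (w - s) * complex_of_real (g (- s)))"

definition l2 :: "('g \<Rightarrow> complex) \<Rightarrow> bool" where
  "l2 x \<longleftrightarrow> (\<lambda>t. (cmod (x t))\<^sup>2) summable_on UNIV"

definition l2norm :: "('g \<Rightarrow> complex) \<Rightarrow> real" where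
  "l2norm x = sqrt (\<Sum>\<^sub>\<infinity>t. (cmod (x t))\<^sup>2)"

definition op_norm :: "(('g \<Rightarrow> complex) \<Rightarrow> ('g \<Rightarrow> complex)) \<Rightarrow> real" where
  "op_norm T = Sup {l2norm (T x) | x. l2 x \<and> l2norm x \<le> 1}"

definition delta_e :: "'g::zero \<Rightarrow> complex" where
  "delta_e = (\<lambda>t. if t = 0 then 1 else 0)"

text \<open>tr(T) = <T delta_e, delta_e> = (T delta_e)(e).\<close>
definition vN_trace :: "(('g::zero \<Rightarrow> complex) \<Rightarrow> ('g \<Rightarrow> complex)) \<Rightarrow> complex" where
  "vN_trace T = T delta_e 0"

definition poly_op :: "real poly \<Rightarrow> (('g \<Rightarrow> complex) \<Rightarrow> ('g \<Rightarrow> complex)) \<Rightarrow> ('g \<Rightarrow> complex) \<Rightarrow> ('g \<Rightarrow> complex)" where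
  "poly_op p T = (\<lambda>x w. \<Sum>i\<le>degree p. complex_of_real (coeff p i) * (T ^^ i) x w)"

definition spectral_measure :: "(('g::zero \<Rightarrow> complex) \<Rightarrow> ('g \<Rightarrow> complex)) \<Rightarrow> real measure" where
  "spectral_measure T = (THE \<mu>. prob_space \<mu> \<and> sets \<mu> = sets (restrict_space borel {0..op_norm T}) \<and>
      (\<forall>p. complex_of_real (integral\<^sup>L \<mu> (poly p)) = vN_trace (poly_op p T)))"

definition fk_log_det :: "(('g::zero \<Rightarrow> complex) \<Rightarrow> ('g \<Rightarrow> complex)) \<Rightarrow> ereal" where
  "fk_log_det T =
     enn2ereal (\<integral>\<^sup>+ t. indicator {0<..op_norm T} t * ennreal (max 0 (ln t)) \<partial>spectral_measure T)
   - enn2ereal (\<integral>\<^sup>+ t. indicator {0<..op_norm T} t * ennreal (max 0 (- ln t)) \<partial>spectral_measure T)"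

end

theory Submission
  imports Defs "Jordan_Normal_Form.Schur_Decomposition" "Jordan_Normal_Form.Char_Poly"
begin

text \<open>
  The periodic points of \<open>X_f\<close> under \<open>\<Gamma>_n\<close> are the torus solutions of the Laplacian of a finite
  weighted graph on \<open>\<Gamma>/\<Gamma>_n\<close>; modulo constants their number is the reduced determinant \<open>\<tau>_n\<close> of that
  Laplacian (the number of spanning trees). Let \<open>N\<close> be the index of \<open>\<Gamma>_n\<close>.

  The basic tool is a vertex set \<open>B\<close> of size at most \<open>N / (r + 1)\<close> that meets every ball of radius
  \<open>2 r\<close>. Imposing Dirichlet conditions on \<open>B\<close> makes the Laplacian invertible with bounds independent
  of \<open>n\<close>, and changes \<open>\<tau>_n\<close> only by a factor \<open>exp (o(N))\<close> as \<open>r\<close> grows.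

  Determinant: comparing \<open>\<tau>_n\<close> with \<open>det (\<kappa> + \<Delta>_n)\<close> through \<open>B\<close> gives upper and lower bounds for
  \<open>log \<tau>_n / N\<close> that differ by a quantity vanishing with \<open>\<kappa>\<close>. The moments of the spectral measure
  are eventually the normalised traces of the powers of \<open>\<Delta>_n\<close>, so the limit is the integral of \<open>log\<close>.

  Upper bound: off a few cosets a sofic map is an approximate solution of the Laplace equation
  modulo 1; it is therefore close to an exact solution off a sparse set plus a harmonic extension
  of discretised boundary data, and there are at most \<open>\<tau>_n exp (o(N))\<close> of those.

  Lower bound: translate the \<open>\<tau>_n\<close> periodic points by a random point \<open>y\<close> of the finite group of those
  torus points that solve the equation off \<open>B\<close> and are \<open>q\<close>-torsion on \<open>B\<close>. A character trivial on that
  group is the Laplacian of a bounded integer function vanishing on \<open>B\<close>; being integral, this function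
  decays to zero within a bounded distance, so the character is already trivial on \<open>X_f\<close>. Hence the
  orbit averages of nontrivial characters have small second moment, and most translates are
  equidistributed with respect to Haar measure while remaining uniformly separated.
\<close>


section \<open>Determinants and eigenvalues of matrices given by functions\<close>

text \<open>Two obstacles shape the estimates. As \<open>ln\<close> is unbounded at 0, convergence
  of moments does not control the small eigenvalues of the quotient Laplacians. The control is
  electrical: a diagonal Green function is an effective resistance, at most 2 R when the Dirichlet
  set is within distance R. Killing or releasing a vertex therefore costs a factor linear in R, and
  a potential t at most (1 + 2 R t)^N; with N / (r + 1) Dirichlet vertices the linear factors cost
  only about ln r / r per vertex. Separation is measured by the supremum \<open>rhoinf\<close>, and
  f has no summable inverse because its coefficients sum to zero. The maximum principle relative to
  a set meeting every ball takes the place of such an inverse; its constants (d + 1)^R are harmless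
  because R is fixed before n. In the lower bound the same translate is added to all periodic
  points, so their differences, hence their separation, are unchanged; its defects lie on B and are
  too sparse for approximate equivariance to notice. The spectral and the Haar measure are definite
  descriptions, so existence and uniqueness have to be established; both arise as weak limits of
  finite averages.\<close>

definition fmat :: "nat \<Rightarrow> (nat \<Rightarrow> nat \<Rightarrow> 'a) \<Rightarrow> 'a Matrix.mat" where
  "fmat N A = Matrix.mat N N (\<lambda>(i, j). A i j)"

text \<open>Matrices are functions of two indices, so that a row is replaced by function update as
  in \<open>A(e := r)\<close>; only the N by N block is read.\<close>

definition fdet :: "nat \<Rightarrow> (nat \<Rightarrow> nat \<Rightarrow> 'a::comm_ring_1) \<Rightarrow> 'a" where
  "fdet N A = Determinant.det (fmat N A)"

lemma fmat_carrier [simp]: "fmat N A \<in> carrier_mat N N"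
  and fmat_dim [simp]: "dim_row (fmat N A) = N" "dim_col (fmat N A) = N"
  and fmat_index [simp]: "i < N \<Longrightarrow> j < N \<Longrightarrow> fmat N A $$ (i, j) = A i j"
  by (auto simp: fmat_def)

lemma fmat_cong: "(\<And>i j. i < N \<Longrightarrow> j < N \<Longrightarrow> A i j = B i j) \<Longrightarrow> fmat N A = fmat N B"
  by (intro eq_matI) auto

lemma fdet_cong: "(\<And>i j. i < N \<Longrightarrow> j < N \<Longrightarrow> A i j = B i j) \<Longrightarrow> fdet N A = fdet N B"
  unfolding fdet_def by (metis fmat_cong)

lemma fdet_of_int: "fdet N (\<lambda>i j. of_int (A i j)) = (of_int (fdet N A) :: 'a::comm_ring_1)"
proof -
  have "fmat N (\<lambda>i j. of_int (A i j) :: 'a) = map_mat of_int (fmat N A)"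
    by (intro eq_matI) auto
  then show ?thesis
    unfolding fdet_def by (metis of_int_hom.hom_det)
qed

lemma fdet_identity: "fdet N (\<lambda>i j. if i = j then 1 else 0 :: 'a::comm_ring_1) = 1"
proof -
  have "fmat N (\<lambda>i j. if i = j then 1 else 0 :: 'a) = 1\<^sub>m N"
    by (intro eq_matI) auto
  then show ?thesis
    unfolding fdet_def by simp
qed

text \<open>The cofactors of row e do not read row e, so a single vector \<open>C\<close> computes
  the determinant for every replacement row r. Replacing row e by another row of A gives two equal
  rows, whence the orthogonality relations.\<close>

lemma fdet_cofactors:
  fixes A :: "nat \<Rightarrow> nat \<Rightarrow> 'a::comm_ring_1"
  assumes e: "e < N"
  obtains C where "\<And>r. fdet N (A(e := r)) = (\<Sum>j<N. r j * C j)"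
    and "\<And>i. i < N \<Longrightarrow> i \<noteq> e \<Longrightarrow> (\<Sum>j<N. A i j * C j) = 0"
proof
  define C where "C j = cofactor (fmat N A) e j" for j
  show row: "fdet N (A(e := r)) = (\<Sum>j<N. r j * C j)" for r
  proof -
    have "cofactor (fmat N (A(e := r))) e j = C j" if "j < N" for j
    proof -
      have "mat_delete (fmat N (A(e := r))) e j = mat_delete (fmat N A) e j"
        using e that by (intro eq_matI) (auto simp: mat_delete_def)
      then show ?thesis by (simp add: cofactor_def C_def)
    qed
    then show ?thesis
      unfolding fdet_def using e
      by (subst laplace_expansion_row[OF fmat_carrier e]) (auto intro!: sum.cong)
  qed
  show "(\<Sum>j<N. A i j * C j) = 0" if "i < N" "i \<noteq> e" for i
  proof -
    have "fdet N (A(e := A i)) = 0"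
      unfolding fdet_def
      by (rule det_identical_rows[OF fmat_carrier that(2) that(1) e])
        (use that e in \<open>auto intro!: eq_vecI simp: fmat_def\<close>)
    with row show ?thesis by simp
  qed
qed

lemma fdet_nonzeroI:
  fixes A :: "nat \<Rightarrow> nat \<Rightarrow> 'a::field"
  assumes "\<And>x i. (\<And>i. i < N \<Longrightarrow> (\<Sum>j<N. A i j * x j) = 0) \<Longrightarrow> i < N \<Longrightarrow> x i = 0"
  shows "fdet N A \<noteq> 0"
proof
  assume "fdet N A = 0"
  then obtain v where v: "v \<in> carrier_vec N" "v \<noteq> 0\<^sub>v N" "fmat N A *\<^sub>v v = 0\<^sub>v N"
    unfolding fdet_def using det_0_iff_vec_prod_zero_field[OF fmat_carrier] by blast
  have "(\<Sum>j<N. A i j * vec_index v j) = 0" if "i < N" for i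
  proof -
    have "vec_index (fmat N A *\<^sub>v v) i = 0" using v(3) that by simp
    moreover have "vec_index (fmat N A *\<^sub>v v) i = (\<Sum>j<N. A i j * vec_index v j)"
      using that v(1) by (auto simp: scalar_prod_def lessThan_atLeast0 intro!: sum.cong)
    ultimately show ?thesis by simp
  qed
  then have "vec_index v i = 0" if "i < N" for i
    using assms[of "vec_index v" i] that by blast
  then have "v = 0\<^sub>v N"
    using v(1) by (intro eq_vecI) auto
  with v(2) show False by simp
qed

text \<open>Each cofactor vector \<open>C e\<close>, divided by the determinant, is a column of the
  inverse matrix; the solution is superposed from these columns.\<close>

lemma fdet_solve:
  fixes A :: "nat \<Rightarrow> nat \<Rightarrow> 'a::field"
  assumes "fdet N A \<noteq> 0"
  obtains x where "\<And>i. i < N \<Longrightarrow> (\<Sum>j<N. A i j * x j) = b i"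
proof -
  have "\<exists>C. (\<forall>r. fdet N (A(e := r)) = (\<Sum>j<N. r j * C j)) \<and>
      (\<forall>i<N. i \<noteq> e \<longrightarrow> (\<Sum>j<N. A i j * C j) = 0)" if "e < N" for e
    using fdet_cofactors[OF that, of A] by metis
  then obtain C where C: "\<And>e r. e < N \<Longrightarrow> fdet N (A(e := r)) = (\<Sum>j<N. r j * C e j)"
    and C0: "\<And>e i. e < N \<Longrightarrow> i < N \<Longrightarrow> i \<noteq> e \<Longrightarrow> (\<Sum>j<N. A i j * C e j) = 0"
    by metis
  have C1: "(\<Sum>j<N. A i j * C e j) = (if i = e then fdet N A else 0)" if "e < N" "i < N" for e i
    using C[of e "A e"] C0[of e i] that by auto
  define x where "x j = (\<Sum>e<N. b e * C e j) / fdet N A" for j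
  have "(\<Sum>j<N. A i j * x j) = b i" if "i < N" for i
  proof -
    have "(\<Sum>j<N. A i j * x j) * fdet N A = (\<Sum>j<N. \<Sum>e<N. b e * (A i j * C e j))"
      unfolding x_def sum_distrib_right using assms
      by (intro sum.cong refl) (simp add: sum_distrib_left sum_distrib_right sum_divide_distrib mult_ac)
    also have "\<dots> = (\<Sum>e<N. b e * (\<Sum>j<N. A i j * C e j))"
      by (subst sum.swap) (simp add: sum_distrib_left)
    also have "\<dots> = (\<Sum>e<N. if i = e then b e * fdet N A else 0)"
      using that by (intro sum.cong refl) (simp add: C1)
    also have "\<dots> = b i * fdet N A"
      using that by (simp add: sum.delta)
    finally show ?thesis using assms by simp
  qed
  then show ?thesis using that by blast
qed

text \<open>Cramer's rule: the determinant times coordinate k is the determinant of A with column k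
  replaced by the integral right-hand side.\<close>

lemma fdet_mult_Ints:
  fixes A :: "nat \<Rightarrow> nat \<Rightarrow> int" and x :: "nat \<Rightarrow> real"
  assumes int: "\<And>i. i < N \<Longrightarrow> (\<Sum>j<N. of_int (A i j) * x j) \<in> \<int>" and k: "k < N"
  shows "of_int (fdet N A) * x k \<in> \<int>"
proof -
  let ?A = "fmat N (\<lambda>i j. of_int (A i j) :: real)"
  let ?v = "Matrix.vec N x"
  have "\<exists>m::int. (\<Sum>j<N. of_int (A i j) * x j) = of_int m" if "i < N" for i
    using int[OF that] by (auto elim: Ints_cases)
  then obtain m :: "nat \<Rightarrow> int" where m: "\<And>i. i < N \<Longrightarrow> (\<Sum>j<N. of_int (A i j) * x j) = of_int (m i)"
    by metis
  have Av: "vec_index (?A *\<^sub>v ?v) i = of_int (m i)" if "i < N" for i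
    using that m[OF that] by (auto simp: scalar_prod_def lessThan_atLeast0 intro!: sum.cong)
  have "replace_col ?A (?A *\<^sub>v ?v) k = fmat N (\<lambda>i j. of_int (if j = k then m i else A i j))"
    by (intro eq_matI) (auto simp: replace_col_def Av simp del: index_mult_mat_vec)
  then have "x k * fdet N (\<lambda>i j. of_int (A i j)) = fdet N (\<lambda>i j. of_int (if j = k then m i else A i j))"
    using cramer_lemma_mat[OF fmat_carrier, of ?v N k "\<lambda>i j. of_int (A i j) :: real"] k
    by (simp add: fdet_def)
  then show ?thesis
    unfolding fdet_of_int by (metis Ints_of_int mult.commute)
qed

section \<open>Powers, traces and eigenvalues of symmetric matrices\<close>

primrec fpow :: "nat \<Rightarrow> (nat \<Rightarrow> nat \<Rightarrow> 'a::comm_ring_1) \<Rightarrow> nat \<Rightarrow> nat \<Rightarrow> nat \<Rightarrow> 'a" where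
  "fpow N A 0 i j = (if i = j then 1 else 0)"
| "fpow N A (Suc k) i j = (\<Sum>l<N. fpow N A k i l * A l j)"

lemma fmat_fpow: "fmat N (fpow N A k) = fmat N A ^\<^sub>m k"
proof (induction k)
  case 0
  show ?case by (intro eq_matI) auto
next
  case (Suc k)
  have "fmat N (fpow N A (Suc k)) = fmat N (fpow N A k) * fmat N A"
    by (intro eq_matI) (auto simp: scalar_prod_def lessThan_atLeast0 intro!: sum.cong)
  then show ?case unfolding Suc by (simp only: pow_mat.simps)
qed

lemma sum_diag_mult_commute:
  fixes A B :: "'a::comm_ring_1 Matrix.mat"
  assumes "A \<in> carrier_mat N N" "B \<in> carrier_mat N N"
  shows "(\<Sum>i<N. (A * B) $$ (i, i)) = (\<Sum>i<N. (B * A) $$ (i, i))"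
proof -
  have "(\<Sum>i<N. (A * B) $$ (i, i)) = (\<Sum>i<N. \<Sum>j<N. A $$ (i, j) * B $$ (j, i))"
    using assms by (auto simp: scalar_prod_def lessThan_atLeast0 intro!: sum.cong)
  also have "\<dots> = (\<Sum>j<N. \<Sum>i<N. B $$ (j, i) * A $$ (i, j))"
    by (subst sum.swap) (simp add: mult.commute)
  also have "\<dots> = (\<Sum>i<N. (B * A) $$ (i, i))"
    using assms by (auto simp: scalar_prod_def lessThan_atLeast0 intro!: sum.cong)
  finally show ?thesis .
qed

lemma upper_triangular_pow:
  fixes B :: "'a::comm_ring_1 Matrix.mat"
  assumes B: "B \<in> carrier_mat N N" "upper_triangular B"
  shows "(\<forall>i<N. \<forall>j<i. (B ^\<^sub>m k) $$ (i, j) = 0) \<and> (\<forall>i<N. (B ^\<^sub>m k) $$ (i, i) = (B $$ (i, i)) ^ k)"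
proof (induction k)
  case 0
  show ?case using B by auto
next
  case (Suc k)
  have c: "B ^\<^sub>m k \<in> carrier_mat N N" using B by simp
  have low: "B $$ (i, j) = 0" if "j < i" "i < N" for i j
    using B that by auto
  have e: "(B ^\<^sub>m Suc k) $$ (i, j) = (\<Sum>l<N. (B ^\<^sub>m k) $$ (i, l) * B $$ (l, j))" if "i < N" "j < N" for i j
    using that B c by (auto simp: scalar_prod_def lessThan_atLeast0 intro!: sum.cong)
  have "(B ^\<^sub>m Suc k) $$ (i, j) = 0" if "i < N" "j < i" for i j
  proof -
    have "(B ^\<^sub>m k) $$ (i, l) * B $$ (l, j) = 0" if l: "l < N" for l
    proof (cases "l < i")
      case True then show ?thesis using Suc \<open>i < N\<close> by simp
    next
      case False then show ?thesis using low[of j l] l \<open>j < i\<close> by simp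
    qed
    then show ?thesis using e that by simp
  qed
  moreover have "(B ^\<^sub>m Suc k) $$ (i, i) = (B $$ (i, i)) ^ Suc k" if "i < N" for i
  proof -
    have "(B ^\<^sub>m k) $$ (i, l) * B $$ (l, i) = (if l = i then (B $$ (i, i)) ^ Suc k else 0)" if l: "l < N" for l
      using Suc low[of i l] low[of l i] \<open>i < N\<close> l
      by (cases l i rule: linorder_cases) (auto simp: mult.commute)
    then show ?thesis using e that by (simp add: sum.delta)
  qed
  ultimately show ?case by blast
qed

text \<open>The form q = <A v, v> is its own conjugate by symmetry, and it equals a times the
  positive square norm of v.\<close>

lemma symmetric_complex_eigenvalue_real:
  fixes A :: "nat \<Rightarrow> nat \<Rightarrow> real" and v :: "nat \<Rightarrow> complex"
  assumes sym: "\<And>i j. i < N \<Longrightarrow> j < N \<Longrightarrow> A i j = A j i"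
    and eig: "\<And>i. i < N \<Longrightarrow> (\<Sum>j<N. of_real (A i j) * v j) = a * v i"
    and nz: "k < N" "v k \<noteq> 0"
  shows "Im a = 0"
proof -
  define q where "q = (\<Sum>i<N. \<Sum>j<N. of_real (A i j) * v j * cnj (v i))"
  have "cnj q = (\<Sum>i<N. \<Sum>j<N. of_real (A i j) * cnj (v j) * v i)"
    by (simp add: q_def)
  also have "\<dots> = (\<Sum>j<N. \<Sum>i<N. of_real (A i j) * cnj (v j) * v i)"
    by (rule sum.swap)
  also have "\<dots> = q"
    unfolding q_def by (intro sum.cong refl) (auto simp: sym mult_ac)
  finally have "cnj q = q" .
  have q: "q = a * of_real (\<Sum>i<N. (cmod (v i))\<^sup>2)"
  proof -
    have "q = (\<Sum>i<N. (\<Sum>j<N. of_real (A i j) * v j) * cnj (v i))"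
      by (simp add: q_def sum_distrib_right)
    also have "\<dots> = (\<Sum>i<N. a * of_real ((cmod (v i))\<^sup>2))"
      by (intro sum.cong refl) (simp add: eig mult.assoc complex_norm_square del: of_real_power)
    finally show ?thesis by (simp add: sum_distrib_left)
  qed
  have "0 < (cmod (v k))\<^sup>2" using nz by simp
  also have "\<dots> \<le> (\<Sum>i<N. (cmod (v i))\<^sup>2)"
    using nz by (intro member_le_sum) auto
  finally have pos: "(\<Sum>i<N. (cmod (v i))\<^sup>2) > 0" .
  have "Im q = 0" using \<open>cnj q = q\<close> by (metis complex_cnj_complex_of_real complex_eq_iff cnj.simps(2) neg_equal_zero)
  moreover have "Im q = Im a * (\<Sum>i<N. (cmod (v i))\<^sup>2)"
    unfolding q by simp
  ultimately show "Im a = 0" using pos by simp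
qed

text \<open>Schur triangularisation over the complex numbers is enough: the diagonal gives the
  determinants of all shifts and the traces of all powers, with multiplicities. Symmetry makes the
  diagonal real, after which the real or the imaginary part of a complex eigenvector is a real
  one.\<close>

lemma symmetric_eigenvalues:
  fixes A :: "nat \<Rightarrow> nat \<Rightarrow> real"
  assumes sym: "\<And>i j. i < N \<Longrightarrow> j < N \<Longrightarrow> A i j = A j i"
  obtains lam :: "nat \<Rightarrow> real" where
    "\<And>k. k < N \<Longrightarrow> \<exists>v::nat \<Rightarrow> real. (\<exists>j<N. v j \<noteq> 0) \<and> (\<forall>i<N. (\<Sum>j<N. A i j * v j) = lam k * v i)"
    "\<And>t. fdet N (\<lambda>i j. A i j + (if i = j then t else 0)) = (\<Prod>k<N. t + lam k)"
    "\<And>m. (\<Sum>i<N. fpow N A m i i) = (\<Sum>k<N. lam k ^ m)"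
proof -
  define B where "B = fmat N (\<lambda>i j. complex_of_real (A i j))"
  have Bc: "B \<in> carrier_mat N N" by (simp add: B_def)
  obtain es where es: "char_poly B = (\<Prod>a\<leftarrow>es. [:- a, 1:])" "length es = N"
    using char_poly_factorized[OF Bc] by blast
  obtain U P Q where UPQ: "schur_decomposition B es = (U, P, Q)"
    by (cases "schur_decomposition B es") auto
  have sch: "similar_mat_wit B U P Q" "upper_triangular U" "diag_mat U = es"
    using schur_decomposition[OF Bc es(1) UPQ] by auto
  note w = similar_mat_witD2[OF Bc sch(1)]
  have Ud: "U $$ (i, i) = es ! i" if "i < N" for i
    using sch(3) that w by (auto simp: diag_mat_def)
  have eig: "\<exists>v::nat \<Rightarrow> complex. (\<exists>j<N. v j \<noteq> 0) \<and>
      (\<forall>i<N. (\<Sum>j<N. of_real (A i j) * v j) = es ! k * v i)" if k: "k < N" for k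
  proof -
    have "poly (char_poly B) (es ! k) = 0"
      unfolding es(1) using k es(2) by (auto simp: poly_prod_list prod_list_zero_iff intro!: image_eqI[of _ _ "es ! k"])
    then have "eigenvalue B (es ! k)"
      using eigenvalue_root_char_poly[OF Bc] by blast
    then obtain v where v: "v \<in> carrier_vec N" "v \<noteq> 0\<^sub>v N" "B *\<^sub>v v = es ! k \<cdot>\<^sub>v v"
      using Bc by (auto simp: eigenvalue_def eigenvector_def)
    have "\<exists>j<N. vec_index v j \<noteq> 0"
    proof (rule ccontr)
      assume "\<not> ?thesis"
      then have "v = 0\<^sub>v N" using v(1) by (intro eq_vecI) auto
      with v(2) show False by simp
    qed
    moreover have "(\<Sum>j<N. of_real (A i j) * vec_index v j) = es ! k * vec_index v i" if "i < N" for i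
    proof -
      have "vec_index (B *\<^sub>v v) i = (\<Sum>j<N. of_real (A i j) * vec_index v j)"
        using that v(1) by (auto simp: B_def scalar_prod_def lessThan_atLeast0 intro!: sum.cong)
      then show ?thesis using v that by simp
    qed
    ultimately show ?thesis by blast
  qed
  have real: "es ! k = of_real (Re (es ! k))" if k: "k < N" for k
  proof -
    obtain v j where "j < N" "v j \<noteq> 0" "\<forall>i<N. (\<Sum>j<N. of_real (A i j) * v j) = es ! k * v i"
      using eig[OF k] by blast
    then have "Im (es ! k) = 0"
      using symmetric_complex_eigenvalue_real[of N A v "es ! k" j] sym by blast
    then show ?thesis by (simp add: complex_eq_iff)
  qed
  define lam where "lam k = Re (es ! k)" for k
  show ?thesis
  proof (rule that[of lam])
    show "\<exists>v::nat \<Rightarrow> real. (\<exists>j<N. v j \<noteq> 0) \<and> (\<forall>i<N. (\<Sum>j<N. A i j * v j) = lam k * v i)" if k: "k < N" for k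
    proof -
      obtain v j where v: "j < N" "v j \<noteq> 0" "\<And>i. i < N \<Longrightarrow> (\<Sum>j<N. of_real (A i j) * v j) = es ! k * v i"
        using eig[OF k] by blast
      have *: "(\<Sum>j<N. of_real (A i j) * v j) = of_real (lam k) * v i" if "i < N" for i
        using v(3)[OF that] real[OF k] by (simp add: lam_def)
      have "(\<Sum>j<N. A i j * Re (v j)) = lam k * Re (v i)" "(\<Sum>j<N. A i j * Im (v j)) = lam k * Im (v i)" if "i < N" for i
        using arg_cong[OF *[OF that], of Re] arg_cong[OF *[OF that], of Im] by simp_all
      moreover have "Re (v j) \<noteq> 0 \<or> Im (v j) \<noteq> 0"
        using v(2) by (simp add: complex_eq_iff)
      ultimately show ?thesis
        using v(1) by (elim disjE) (rule exI[of _ "\<lambda>j. Re (v j)"], blast, rule exI[of _ "\<lambda>j. Im (v j)"], blast)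
    qed
    show "fdet N (\<lambda>i j. A i j + (if i = j then t else 0)) = (\<Prod>k<N. t + lam k)" for t
    proof -
      let ?T = "fmat N (\<lambda>i j. complex_of_real (A i j + (if i = j then t else 0)))"
      have carr: "{?T, of_real t \<cdot>\<^sub>m 1\<^sub>m N + U, P, Q} \<subseteq> carrier_mat N N"
        using w by auto
      have "?T = of_real t \<cdot>\<^sub>m 1\<^sub>m N + B"
        by (intro eq_matI) (auto simp: B_def)
      also have "\<dots> = P * (of_real t \<cdot>\<^sub>m 1\<^sub>m N + U) * Q"
      proof -
        have "P * (of_real t \<cdot>\<^sub>m 1\<^sub>m N + U) = of_real t \<cdot>\<^sub>m P + P * U"
          using w by (simp add: mult_add_distrib_mat[of P N N _ N U] mult_smult_distrib[of P N N "1\<^sub>m N" N])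
        then have "P * (of_real t \<cdot>\<^sub>m 1\<^sub>m N + U) * Q = of_real t \<cdot>\<^sub>m (P * Q) + P * U * Q"
          using w by (simp add: add_mult_distrib_mat[of "of_real t \<cdot>\<^sub>m P" N N "P * U" Q N] mult_smult_assoc_mat[of P N N Q N])
        then show ?thesis using w by simp
      qed
      finally have "similar_mat ?T (of_real t \<cdot>\<^sub>m 1\<^sub>m N + U)"
        using carr w by (intro similar_matI[where P = P and Q = Q and n = N]) auto
      then have "Determinant.det ?T = Determinant.det (of_real t \<cdot>\<^sub>m 1\<^sub>m N + U)"
        by (rule det_similar)
      also have "\<dots> = prod_list (diag_mat (of_real t \<cdot>\<^sub>m 1\<^sub>m N + U))"
      proof (rule det_upper_triangular[where n = N])
        show "upper_triangular (of_real t \<cdot>\<^sub>m 1\<^sub>m N + U)"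
          using w upper_triangularD[OF sch(2)] by (intro upper_triangularI) auto
      qed (use w in auto)
      also have "\<dots> = (\<Prod>k<N. of_real t + es ! k)"
        using w Ud by (auto simp: diag_mat_def prod.list_conv_set_nth lessThan_atLeast0 intro!: prod.cong)
      also have "\<dots> = of_real (\<Prod>k<N. t + lam k)"
        using real by (simp add: lam_def)
      finally have "fdet N (\<lambda>i j. complex_of_real (A i j + (if i = j then t else 0))) = of_real (\<Prod>k<N. t + lam k)"
        by (simp only: fdet_def)
      moreover have real_mat: "fmat N (\<lambda>i j. complex_of_real (A i j + (if i = j then t else 0))) =
          map_mat of_real (fmat N (\<lambda>i j. A i j + (if i = j then t else 0)))"
        by (intro eq_matI) auto
      have "fdet N (\<lambda>i j. complex_of_real (A i j + (if i = j then t else 0))) =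
          of_real (fdet N (\<lambda>i j. A i j + (if i = j then t else 0)))"
        unfolding fdet_def real_mat by (rule of_real_hom.hom_det)
      ultimately show ?thesis by (simp only: of_real_eq_iff)
    qed
    show "(\<Sum>i<N. fpow N A m i i) = (\<Sum>k<N. lam k ^ m)" for m
    proof -
      have "similar_mat_wit (B ^\<^sub>m m) (U ^\<^sub>m m) P Q"
        by (rule similar_mat_wit_pow[OF sch(1)])
      note w' = similar_mat_witD2[OF _ this, of N N]
      have "(\<Sum>i<N. (B ^\<^sub>m m) $$ (i, i)) = (\<Sum>i<N. (U ^\<^sub>m m) $$ (i, i))"
      proof -
        have c: "U ^\<^sub>m m \<in> carrier_mat N N" using w by simp
        have "B ^\<^sub>m m = P * (U ^\<^sub>m m) * Q" using w' Bc by simp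
        then have "(\<Sum>i<N. (B ^\<^sub>m m) $$ (i, i)) = (\<Sum>i<N. (Q * (P * (U ^\<^sub>m m))) $$ (i, i))"
          using sum_diag_mult_commute[of "P * (U ^\<^sub>m m)" N Q] w c by (metis mult_carrier_mat)
        moreover have "Q * (P * (U ^\<^sub>m m)) = U ^\<^sub>m m"
          using w c assoc_mult_mat[of Q N N P N "U ^\<^sub>m m" N] by simp
        ultimately show ?thesis by simp
      qed
      also have "\<dots> = (\<Sum>k<N. of_real (lam k ^ m))"
      proof (intro sum.cong refl)
        fix k assume "k \<in> {..<N}"
        then show "(U ^\<^sub>m m) $$ (k, k) = of_real (lam k ^ m)"
          using upper_triangular_pow[of U N m] w sch(2) Ud real[of k] by (simp add: lam_def)
      qed
      finally have "(\<Sum>i<N. (B ^\<^sub>m m) $$ (i, i)) = of_real (\<Sum>k<N. lam k ^ m)" by simp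
      moreover have "(B ^\<^sub>m m) $$ (i, i) = of_real (fpow N A m i i)" if "i < N" for i
      proof -
        have "fpow N (\<lambda>i j. complex_of_real (A i j)) m i j = of_real (fpow N A m i j)" for i j
          by (induction m arbitrary: j) auto
        then show ?thesis
          unfolding B_def fmat_fpow[symmetric] using that by simp
      qed
      ultimately have "of_real (\<Sum>i<N. fpow N A m i i) = (of_real (\<Sum>k<N. lam k ^ m) :: complex)"
        by simp
      then show ?thesis using of_real_eq_iff by blast
    qed
  qed
qed

section \<open>Counting torus solutions of integer linear systems\<close>

text \<open>The kernel of A on (R/Z)^N, each class represented by its point of the half-open cube;
  extensionality outside {..<N} makes cardinalities meaningful.\<close>

definition torus_sol :: "nat \<Rightarrow> (nat \<Rightarrow> nat \<Rightarrow> int) \<Rightarrow> (nat \<Rightarrow> real) set" where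
  "torus_sol N A = {y \<in> {..<N} \<rightarrow>\<^sub>E {0..<1}. \<forall>i<N. (\<Sum>j<N. of_int (A i j) * y j) \<in> \<int>}"

text \<open>By Cramer's rule every coordinate is an integral multiple of 1 / |det A|, and [0, 1)
  contains finitely many of these.\<close>

lemma finite_torus_sol:
  assumes "fdet N A \<noteq> 0"
  shows "finite (torus_sol N A)"
proof -
  define D where "D = \<bar>fdet N A\<bar>"
  have D: "D > 0" using assms by (simp add: D_def)
  have "torus_sol N A \<subseteq> {..<N} \<rightarrow>\<^sub>E ((\<lambda>m. real_of_int m / D) ` {0..D})"
  proof
    fix y assume y: "y \<in> torus_sol N A"
    have "y k \<in> (\<lambda>m. real_of_int m / D) ` {0..D}" if k: "k < N" for k
    proof -
      have "of_int (fdet N A) * y k \<in> \<int>"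
        using y k by (intro fdet_mult_Ints) (auto simp: torus_sol_def)
      then have "of_int D * y k \<in> \<int>"
        unfolding D_def by (cases "fdet N A \<ge> 0") (auto dest: Ints_minus)
      then obtain m where m: "of_int D * y k = of_int m" by (auto elim: Ints_cases)
      have y01: "0 \<le> y k" "y k \<le> 1" using y k by (auto simp: torus_sol_def PiE_iff less_imp_le)
      have "0 \<le> real_of_int D * y k" "real_of_int D * y k \<le> D"
        using D y01 by (auto simp: mult_left_le)
      then have "m \<in> {0..D}" unfolding m by auto
      moreover have "y k = m / D" using m D by (simp add: field_simps)
      ultimately show ?thesis by blast
    qed
    with y show "y \<in> {..<N} \<rightarrow>\<^sub>E ((\<lambda>m. real_of_int m / D) ` {0..D})"
      by (auto simp: torus_sol_def PiE_iff)
  qed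
  then show ?thesis by (rule finite_subset) (auto intro: finite_PiE)
qed

text \<open>As t runs through [0, P), the affine function b + t \<rho> sweeps a half-open interval
  of length n, which contains exactly n integers wherever it starts.\<close>

lemma card_shifted_Ints:
  fixes b \<rho> P :: real and n :: nat
  assumes "\<rho> > 0" "P * \<rho> = real n"
  shows "card {t \<in> {0..<P}. b + t * \<rho> \<in> \<int>} = n" "finite {t \<in> {0..<P}. b + t * \<rho> \<in> \<int>}"
proof -
  have "bij_betw (\<lambda>m. (real_of_int m - b) / \<rho>) {\<lceil>b\<rceil>..<\<lceil>b\<rceil> + int n} {t \<in> {0..<P}. b + t * \<rho> \<in> \<int>}"
  proof (rule bij_betw_imageI)
    show "inj_on (\<lambda>m. (real_of_int m - b) / \<rho>) {\<lceil>b\<rceil>..<\<lceil>b\<rceil> + int n}"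
      using assms by (auto simp: inj_on_def)
    show "(\<lambda>m. (real_of_int m - b) / \<rho>) ` {\<lceil>b\<rceil>..<\<lceil>b\<rceil> + int n} = {t \<in> {0..<P}. b + t * \<rho> \<in> \<int>}"
    proof (intro equalityI subsetI)
      fix t assume "t \<in> (\<lambda>m. (real_of_int m - b) / \<rho>) ` {\<lceil>b\<rceil>..<\<lceil>b\<rceil> + int n}"
      then obtain m where m: "t = (real_of_int m - b) / \<rho>" "\<lceil>b\<rceil> \<le> m" "m < \<lceil>b\<rceil> + int n"
        by (metis (no_types, lifting) atLeastLessThan_iff image_iff)
      have "b \<le> m" "m < b + n" using m(2,3) by linarith+
      then have "0 \<le> t" "t * \<rho> < P * \<rho>" using m(1) assms by auto
      then have "t < P" "0 \<le> t" using assms(1) mult_less_cancel_right_pos by blast+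
      moreover have "b + t * \<rho> = m" using m(1) assms by (simp add: field_simps)
      ultimately show "t \<in> {t \<in> {0..<P}. b + t * \<rho> \<in> \<int>}" by auto
    next
      fix t assume t: "t \<in> {t \<in> {0..<P}. b + t * \<rho> \<in> \<int>}"
      then obtain m where m: "b + t * \<rho> = of_int m" by (auto elim: Ints_cases)
      have "0 \<le> t * \<rho>" "t * \<rho> < P * \<rho>" using t assms(1) by (auto intro: mult_strict_right_mono)
      then have "b \<le> m" "m < b + n" using m assms by linarith+
      then have "m \<in> {\<lceil>b\<rceil>..<\<lceil>b\<rceil> + int n}" by (auto simp: ceiling_le_iff) linarith
      moreover have "t = (real_of_int m - b) / \<rho>" using m assms by (simp add: field_simps)
      ultimately show "t \<in> (\<lambda>m. (real_of_int m - b) / \<rho>) ` {\<lceil>b\<rceil>..<\<lceil>b\<rceil> + int n}" by blast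
    qed
  qed
  from bij_betw_same_card[OF this] bij_betw_finite[OF this]
  show "card {t \<in> {0..<P}. b + t * \<rho> \<in> \<int>} = n" "finite {t \<in> {0..<P}. b + t * \<rho> \<in> \<int>}"
    by auto
qed

text \<open>Reduction to the representatives used in \<open>torus_sol\<close>: group operations of
  the torus are carried out on the reals and reduced afterwards.\<close>

definition tfrac :: "nat \<Rightarrow> (nat \<Rightarrow> real) \<Rightarrow> nat \<Rightarrow> real" where
  "tfrac N y = restrict (\<lambda>j. frac (y j)) {..<N}"

lemma tfrac_PiE: "tfrac N y \<in> {..<N} \<rightarrow>\<^sub>E {0..<1}"
  by (auto simp: tfrac_def frac_lt_1)

lemma tfrac_id: "y \<in> {..<N} \<rightarrow>\<^sub>E {0..<1} \<Longrightarrow> tfrac N y = y"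
  by (rule ext) (force simp: tfrac_def restrict_def PiE_iff extensional_def frac_eq)

lemma tfrac_add_tfrac: "tfrac N (\<lambda>j. tfrac N x j + y j) = tfrac N (\<lambda>j. x j + y j)"
  by (rule ext) (auto simp: tfrac_def restrict_def frac_def floor_add_int[symmetric] algebra_simps)

lemma Ints_add_left_iff: "(x::real) \<in> \<int> \<Longrightarrow> x + y \<in> \<int> \<longleftrightarrow> y \<in> \<int>"
  by (metis Ints_add Ints_diff add_diff_cancel_left')

lemma sum_tfrac_Ints_iff:
  "(\<Sum>j<N. of_int (r j) * tfrac N y j) + s \<in> \<int> \<longleftrightarrow> (\<Sum>j<N. of_int (r j) * y j) + s \<in> \<int>"
proof -
  have "(\<Sum>j<N. of_int (r j) * y j) = (\<Sum>j<N. of_int (r j) * of_int \<lfloor>y j\<rfloor>) + (\<Sum>j<N. of_int (r j) * tfrac N y j)"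
    by (auto simp: tfrac_def frac_def sum.distrib[symmetric] algebra_simps intro!: sum.cong)
  moreover have "(\<Sum>j<N. of_int (r j) * of_int \<lfloor>y j\<rfloor>) \<in> (\<int> :: real set)"
    by (intro Ints_sum Ints_mult Ints_of_int)
  ultimately show ?thesis
    using Ints_add_left_iff[of "\<Sum>j<N. of_int (r j) * of_int \<lfloor>y j\<rfloor>" "(\<Sum>j<N. of_int (r j) * tfrac N y j) + s"]
    by (simp only: add.assoc)
qed

lemma sum_tfrac_Ints_iff':
  "(\<Sum>j<N. of_int (r j) * tfrac N y j) \<in> \<int> \<longleftrightarrow> (\<Sum>j<N. of_int (r j) * y j) \<in> \<int>"
  using sum_tfrac_Ints_iff[where s = 0] by simp

text \<open>Both sides count the pairs of a solution and a time at which the line through it in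
  direction \<open>g\<close> (where \<open>A g\<close> is the \<open>e\<close>-th unit vector) meets a solution of the other system.\<close>
lemma card_torus_sol_change_row:
  fixes A :: "nat \<Rightarrow> nat \<Rightarrow> int"
  assumes e: "e < N" and pos: "fdet N A > 0" "fdet N (A(e := r)) > 0"
  shows "card (torus_sol N A) * fdet N (A(e := r)) = card (torus_sol N (A(e := r))) * fdet N A"
proof -
  let ?A' = "A(e := r)"
  define p where "p = nat (fdet N A)"
  define q where "q = nat (fdet N ?A')"
  have p: "fdet N A = int p" "p > 0" and q: "fdet N ?A' = int q" "q > 0"
    using pos by (auto simp: p_def q_def)
  obtain C where C: "\<And>r. fdet N (A(e := r)) = (\<Sum>j<N. r j * C j)"
    and C0: "\<And>i. i < N \<Longrightarrow> i \<noteq> e \<Longrightarrow> (\<Sum>j<N. A i j * C j) = 0"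
    using fdet_cofactors[OF e, of A] by blast
  define g where "g j = real_of_int (C j) / p" for j
  have lin: "(\<Sum>j<N. of_int (s j) * g j) = of_int (\<Sum>j<N. s j * C j) / p" for s
    by (simp add: g_def sum_divide_distrib)
  have ge: "(\<Sum>j<N. of_int (A e j) * g j) = 1"
  proof -
    have "(\<Sum>j<N. A e j * C j) = int p" using C[of "A e"] p by simp
    then show ?thesis unfolding lin using p by simp
  qed
  have gi: "(\<Sum>j<N. of_int (A i j) * g j) = 0" if "i < N" "i \<noteq> e" for i
    unfolding lin C0[OF that] by simp
  have gr: "(\<Sum>j<N. of_int (r j) * g j) = real q / p"
    unfolding lin C[of r, symmetric] q by simp
  have shift: "(\<Sum>j<N. of_int (s j) * (y j + t * g j)) =
      (\<Sum>j<N. of_int (s j) * y j) + t * (\<Sum>j<N. of_int (s j) * g j)" for s y t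
    by (simp add: sum.distrib sum_distrib_left algebra_simps)
  \<comment> \<open>p g is the integer vector \<open>C\<close>, so the line closes up on the torus
    after time p. In that time row r increases by q and row e of A by p, which gives the two
    counts.\<close>
  define T where "T y = {t \<in> {0..<real p}. (\<Sum>j<N. of_int (r j) * y j) + t * (real q / p) \<in> \<int>}" for y
  define T' where "T' y = {t \<in> {0..<real p}. - (\<Sum>j<N. of_int (A e j) * y j) + t * 1 \<in> \<int>}" for y
  have T: "card (T y) = q" "finite (T y)" for y
    using card_shifted_Ints[of "real q / p" p q] p(2) q(2) by (simp_all add: T_def)
  have T': "card (T' y) = p" "finite (T' y)" for y
    unfolding T'_def by (rule card_shifted_Ints; use p(2) in simp)+
  define F where "F = Sigma (torus_sol N A) T"
  define F' where "F' = Sigma (torus_sol N ?A') T'"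
  have fin: "finite (torus_sol N A)" "finite (torus_sol N ?A')"
    using pos by (auto intro!: finite_torus_sol)
  have "card F = card (torus_sol N A) * q"
    using fin T by (simp add: F_def card_SigmaI)
  moreover have "card F' = card (torus_sol N ?A') * p"
    using fin T' by (simp add: F'_def card_SigmaI)
  moreover have "card F = card F'"
  proof (rule bij_betw_same_card[where f = "\<lambda>(y, t). (tfrac N (\<lambda>j. y j + t * g j), t)"], 
      rule bij_betw_byWitness[where f' = "\<lambda>(y, t). (tfrac N (\<lambda>j. y j + (- t) * g j), t)"])
    have cancel: "tfrac N (\<lambda>j. tfrac N (\<lambda>j. y j + t * g j) j + (- t) * g j) = y"
      if "y \<in> {..<N} \<rightarrow>\<^sub>E {0..<1}" for y t
      using tfrac_add_tfrac[of N "\<lambda>j. y j + t * g j" "\<lambda>j. (- t) * g j"] tfrac_id[OF that] by simp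
    show "\<forall>a\<in>F. (case case a of (y, t) \<Rightarrow> (tfrac N (\<lambda>j. y j + t * g j), t) of
        (y, t) \<Rightarrow> (tfrac N (\<lambda>j. y j + (- t) * g j), t)) = a"
      using cancel by (auto simp: F_def torus_sol_def)
    show "\<forall>a\<in>F'. (case case a of (y, t) \<Rightarrow> (tfrac N (\<lambda>j. y j + (- t) * g j), t) of
        (y, t) \<Rightarrow> (tfrac N (\<lambda>j. y j + t * g j), t)) = a"
      using cancel[where t = "- t" for t] by (auto simp: F'_def torus_sol_def)
    show "(\<lambda>(y, t). (tfrac N (\<lambda>j. y j + t * g j), t)) ` F \<subseteq> F'"
    proof (clarify)
      fix y t assume "(y, t) \<in> F"
      then have y: "\<And>i. i < N \<Longrightarrow> (\<Sum>j<N. of_int (A i j) * y j) \<in> \<int>" and t: "t \<in> {0..<real p}"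
        and yr: "(\<Sum>j<N. of_int (r j) * y j) + t * (real q / p) \<in> \<int>"
        by (auto simp: F_def T_def torus_sol_def)
      have "(\<Sum>j<N. of_int (A e j) * tfrac N (\<lambda>j. y j + t * g j) j) + (- t) \<in> \<int>"
        unfolding sum_tfrac_Ints_iff shift ge using y e by simp
      then have "- (\<Sum>j<N. of_int (A e j) * tfrac N (\<lambda>j. y j + t * g j) j) + t * 1 \<in> \<int>"
        using Ints_minus by fastforce
      moreover have "(\<Sum>j<N. of_int (?A' i j) * tfrac N (\<lambda>j. y j + t * g j) j) \<in> \<int>" if "i < N" for i
        unfolding sum_tfrac_Ints_iff' shift using y[OF that] yr gi[OF that] gr by (cases "i = e") auto
      ultimately show "(tfrac N (\<lambda>j. y j + t * g j), t) \<in> F'"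
        unfolding F'_def T'_def torus_sol_def using t tfrac_PiE by blast
    qed
    show "(\<lambda>(y, t). (tfrac N (\<lambda>j. y j + (- t) * g j), t)) ` F' \<subseteq> F"
    proof (clarify)
      fix y t assume a: "(y, t) \<in> F'"
      then have y: "y \<in> {..<N} \<rightarrow>\<^sub>E {0..<1}" and yi: "\<And>i. i < N \<Longrightarrow> i \<noteq> e \<Longrightarrow> (\<Sum>j<N. of_int (A i j) * y j) \<in> \<int>"
        and yr: "(\<Sum>j<N. of_int (r j) * y j) \<in> \<int>" and t: "t \<in> {0..<real p}"
        and ye: "- (\<Sum>j<N. of_int (A e j) * y j) + t \<in> \<int>"
        using e by (auto simp: F'_def T'_def torus_sol_def split: if_splits)
      have "(\<Sum>j<N. of_int (A e j) * y j) + (- t) \<in> \<int>"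
        using Ints_minus[OF ye] by simp
      then have "(\<Sum>j<N. of_int (A i j) * tfrac N (\<lambda>j. y j + (- t) * g j) j) \<in> \<int>" if "i < N" for i
        unfolding sum_tfrac_Ints_iff' shift using ge gi[OF that] yi[OF that] by (cases "i = e") auto
      moreover have "(\<Sum>j<N. of_int (r j) * tfrac N (\<lambda>j. y j + (- t) * g j) j) + t * (real q / p) \<in> \<int>"
        unfolding sum_tfrac_Ints_iff shift gr using yr by simp
      ultimately show "(tfrac N (\<lambda>j. y j + (- t) * g j), t) \<in> F"
        using t by (auto simp: F_def T_def torus_sol_def intro!: tfrac_PiE)
    qed
  qed
  ultimately show ?thesis
    unfolding p q by (metis of_nat_mult)
qed


section \<open>Green functions and determinants on finite weighted graphs\<close>

text \<open>Loops, c i i > 0, are allowed because a generator may fall into the subgroup; they count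
  towards the degree d and cancel in the Laplacian.\<close>

locale wgraph =
  fixes N :: nat and c :: "nat \<Rightarrow> nat \<Rightarrow> int" and d :: int
  assumes N_pos: "0 < N" and d_pos: "1 \<le> d"
    and c_nonneg: "\<And>i j. 0 \<le> c i j"
    and c_sym: "\<And>i j. i < N \<Longrightarrow> j < N \<Longrightarrow> c i j = c j i"
    and c_sum: "\<And>i. i < N \<Longrightarrow> (\<Sum>j<N. c i j) = d"
    and connected: "\<And>i j. i < N \<Longrightarrow> j < N \<Longrightarrow> (i, j) \<in> {(i, j). i < N \<and> j < N \<and> 0 < c i j}\<^sup>*"
begin

definition adj :: "(nat \<times> nat) set" where
  "adj = {(i, j). i < N \<and> j < N \<and> 0 < c i j}"

definition lap :: "(nat \<Rightarrow> real) \<Rightarrow> nat \<Rightarrow> real" where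
  "lap x i = of_int d * x i - (\<Sum>j<N. of_int (c i j) * x j)"

text \<open>The identity rows in \<open>S\<close> make the determinant the principal minor off \<open>S\<close>.\<close>
definition kmat :: "(nat \<Rightarrow> real) \<Rightarrow> nat set \<Rightarrow> nat \<Rightarrow> nat \<Rightarrow> real" where
  "kmat k S i j = (if i \<in> S then if i = j then 1 else 0
     else (if i = j then of_int d + k i else 0) - of_int (c i j))"

definition imat :: "nat set \<Rightarrow> nat \<Rightarrow> nat \<Rightarrow> int" where
  "imat S i j = (if i \<in> S then if i = j then 1 else 0 else (if i = j then d else 0) - c i j)"

definition reaches :: "nat \<Rightarrow> nat set \<Rightarrow> nat \<Rightarrow> bool" where
  "reaches l S i \<longleftrightarrow> (\<exists>m\<le>l. \<exists>s\<in>S. (i, s) \<in> adj ^^ m)"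

lemma adj_sym: "(i, j) \<in> adj \<longleftrightarrow> (j, i) \<in> adj"
  by (auto simp: adj_def c_sym)

lemma adj_lt: "(i, j) \<in> adj \<Longrightarrow> i < N \<and> j < N"
  by (auto simp: adj_def)

lemma relpow_adj_lt: "(i, j) \<in> adj ^^ m \<Longrightarrow> i < N \<Longrightarrow> j < N"
  by (cases m) (auto dest: adj_lt)

lemma relpow_adj_sym: "(i, j) \<in> adj ^^ m \<Longrightarrow> (j, i) \<in> adj ^^ m"
proof (induction m arbitrary: j)
  case (Suc m)
  then obtain k where "(i, k) \<in> adj ^^ m" "(k, j) \<in> adj" by auto
  with Suc.IH have "(k, i) \<in> adj ^^ m" "(j, k) \<in> adj" using adj_sym by blast+
  then show ?case by (rule relpow_Suc_I2[rotated])
qed auto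

lemma connected_relpow:
  assumes "i < N" "j < N"
  obtains m where "(i, j) \<in> adj ^^ m"
  using connected[OF assms] rtrancl_imp_relpow unfolding adj_def by blast

lemma reaches_mono: "reaches l S i \<Longrightarrow> l \<le> l' \<Longrightarrow> S \<subseteq> S' \<Longrightarrow> reaches l' S' i"
  unfolding reaches_def by (meson order_trans subsetD)

lemma lap_row: "i < N \<Longrightarrow> (\<Sum>j<N. kmat k S i j * x j) = (if i \<in> S then x i else lap x i + k i * x i)"
proof -
  assume i: "i < N"
  show ?thesis
  proof (cases "i \<in> S")
    case True
    have "(\<Sum>j<N. kmat k S i j * x j) = (\<Sum>j<N. if i = j then x j else 0)"
      using True by (intro sum.cong) (auto simp: kmat_def)
    then show ?thesis using True i by (simp add: sum.delta)
  next
    case False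
    have "(\<Sum>j<N. kmat k S i j * x j) =
        (\<Sum>j<N. (if i = j then (of_int d + k i) * x j else 0) - of_int (c i j) * x j)"
      using False by (intro sum.cong) (auto simp: kmat_def algebra_simps)
    then show ?thesis using False i by (simp add: sum_subtractf sum.delta lap_def algebra_simps)
  qed
qed

lemma kmat_imat: "kmat (\<lambda>_. 0) S i j = of_int (imat S i j)"
  by (simp add: kmat_def imat_def)

lemma imat_row: "i < N \<Longrightarrow> (\<Sum>j<N. of_int (imat S i j) * x j) = (if i \<in> S then x i else lap x i)"
  using lap_row[of i "\<lambda>_. 0" S x] by (simp add: kmat_imat)

lemma lap_alt: "i < N \<Longrightarrow> lap x i = (\<Sum>j<N. of_int (c i j) * (x i - x j))"
proof -
  assume i: "i < N"
  have "(\<Sum>j<N. of_int (c i j) * (x i - x j)) = of_int (\<Sum>j<N. c i j) * x i - (\<Sum>j<N. of_int (c i j) * x j)"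
    by (simp add: algebra_simps sum_subtractf sum_distrib_left)
  then show ?thesis using c_sum[OF i] by (simp add: lap_def)
qed

lemma lap_add: "lap (\<lambda>j. x j + y j) i = lap x i + lap y i"
  and lap_diff: "lap (\<lambda>j. x j - y j) i = lap x i - lap y i"
  and lap_uminus: "lap (\<lambda>j. - x j) i = - lap x i"
  by (simp_all add: lap_def algebra_simps sum.distrib sum_subtractf sum_distrib_left sum_negf)

lemma lap_const: "i < N \<Longrightarrow> lap (\<lambda>_. a) i = 0"
  by (simp add: lap_alt)

lemma lap_cong: "i < N \<Longrightarrow> (\<And>j. j < N \<Longrightarrow> x j = y j) \<Longrightarrow> lap x i = lap y i"
  by (simp add: lap_def)

lemma sum_lap_commute: "(\<Sum>i<N. x i * lap y i) = (\<Sum>i<N. lap x i * y i)"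
proof -
  have "(\<Sum>i<N. \<Sum>j<N. of_int (c i j) * (x i * y j)) = (\<Sum>j<N. \<Sum>i<N. of_int (c i j) * (x i * y j))"
    by (rule sum.swap)
  also have "\<dots> = (\<Sum>j<N. \<Sum>i<N. of_int (c j i) * (x i * y j))"
    by (intro sum.cong refl) (simp add: c_sym)
  finally show ?thesis
    by (simp add: lap_def algebra_simps sum_subtractf sum_distrib_left sum_distrib_right)
qed

lemma sum_lap: "(\<Sum>i<N. lap x i) = 0"
  using sum_lap_commute[of "\<lambda>_. 1" x] by (simp add: lap_const)

text \<open>Summation by parts. The right-hand side runs over ordered pairs and so counts every edge
  twice, hence the factor 2.\<close>

lemma energy: "(\<Sum>i<N. x i * lap x i) * 2 = (\<Sum>i<N. \<Sum>j<N. of_int (c i j) * (x i - x j)\<^sup>2)"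
proof -
  have "(\<Sum>i<N. x i * lap x i) = (\<Sum>i<N. \<Sum>j<N. of_int (c i j) * (x i * (x i - x j)))"
    by (intro sum.cong refl) (simp add: lap_alt sum_distrib_left mult_ac)
  moreover have "\<dots> = (\<Sum>i<N. \<Sum>j<N. of_int (c i j) * (x j * (x j - x i)))"
    by (subst sum.swap) (intro sum.cong refl, simp add: c_sym)
  ultimately have "(\<Sum>i<N. x i * lap x i) * 2 = (\<Sum>i<N. \<Sum>j<N. of_int (c i j) * (x i * (x i - x j)))
      + (\<Sum>i<N. \<Sum>j<N. of_int (c i j) * (x j * (x j - x i)))" by simp
  also have "\<dots> = (\<Sum>i<N. \<Sum>j<N. of_int (c i j) * (x i - x j)\<^sup>2)"
    unfolding sum.distrib[symmetric] by (intro sum.cong refl) (simp add: power2_eq_square algebra_simps)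
  finally show ?thesis .
qed

text \<open>The Laplacian at i is a weighted sum of the gaps z i - z j. The edge to k contributes
  its gap at least once, and the other neighbours, which exceed z i by at most a, can compensate no
  more than d a.\<close>

lemma sum_c_bound:
  assumes "i < N" "(i, k) \<in> adj" "\<And>j. j < N \<Longrightarrow> 0 < c i j \<Longrightarrow> z j \<le> z i + a" "0 \<le> a"
  shows "z i - z k \<le> max 0 (lap z i) + of_int d * a"
proof (cases "z i - z k \<le> 0")
  case True
  then show ?thesis using assms(4) d_pos by (smt (verit) mult_nonneg_nonneg of_int_0_le_iff)
next
  case False
  have k: "k < N" "1 \<le> c i k" using assms(2) by (auto simp: adj_def)
  have "lap z i = of_int (c i k) * (z i - z k) + (\<Sum>j\<in>{..<N} - {k}. of_int (c i j) * (z i - z j))"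
    using k assms(1) by (simp add: lap_alt sum.remove)
  moreover have "of_int (c i k) * (z i - z k) \<ge> 1 * (z i - z k)"
    using k False by (intro mult_right_mono) auto
  moreover have "(\<Sum>j\<in>{..<N} - {k}. of_int (c i j) * (z i - z j)) \<ge> (\<Sum>j\<in>{..<N} - {k}. of_int (c i j) * (- a))"
  proof (intro sum_mono)
    fix j assume j: "j \<in> {..<N} - {k}"
    show "of_int (c i j) * (- a) \<le> of_int (c i j) * (z i - z j)"
    proof (cases "c i j = 0")
      case False
      then have "- a \<le> z i - z j" using assms(3)[of j] j c_nonneg[of i j] by fastforce
      then show ?thesis using c_nonneg[of i j] by (intro mult_left_mono) auto
    qed simp
  qed
  moreover have "(\<Sum>j\<in>{..<N} - {k}. of_int (c i j) * (- a)) \<ge> - (of_int d * a)"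
  proof -
    have "(\<Sum>j\<in>{..<N} - {k}. c i j) \<le> d"
      using k assms(1) c_sum[of i] by (simp add: sum.remove[of _ k])
    then have "of_int (\<Sum>j\<in>{..<N} - {k}. c i j) * a \<le> of_int d * a"
      using assms(4) by (intro mult_right_mono) (simp_all only: of_int_le_iff)
    then show ?thesis by (simp add: sum_distrib_right sum_negf)
  qed
  ultimately show ?thesis unfolding mult_1 by linarith
qed

text \<open>A function that is almost maximal at a point is almost maximal at its neighbours, up to a
  factor; iterating along a path to \<open>S\<close> bounds the maximum.\<close>
lemma path_bound:
  assumes "(i, s) \<in> adj ^^ m" "i < N" "s \<in> S" "0 \<le> a" "0 \<le> \<eta>"
    and "\<And>l j. l \<le> m \<Longrightarrow> (i, j) \<in> adj ^^ l \<Longrightarrow> z j \<le> M"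
    and "\<And>l j. l < m \<Longrightarrow> (i, j) \<in> adj ^^ l \<Longrightarrow> j \<notin> S \<Longrightarrow> 0 \<le> z j \<Longrightarrow> lap z j \<le> \<eta>"
    and "\<And>s. s \<in> S \<Longrightarrow> z s \<le> 0" and "M - a \<le> z i"
  shows "M \<le> (of_int d + 1) ^ m * (a + \<eta>)"
  using assms
proof (induction m arbitrary: i a)
  case 0
  then have "z i \<le> 0" by auto
  then have "M \<le> a + \<eta>" using 0(4,5,9) by linarith
  then show ?case by simp
next
  case (Suc m)
  have big: "a + \<eta> \<le> (of_int d + 1) ^ Suc m * (a + \<eta>)"
    using d_pos Suc.prems(4,5) mult_right_mono[of 1 "(of_int d + 1) ^ Suc m" "a + \<eta>"] one_le_power[of "of_int d + 1 :: real" "Suc m"]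
    by (simp del: power_Suc)
  show ?case
  proof (cases "i \<in> S \<or> z i < 0")
    case True
    then have "z i \<le> 0" using Suc.prems(8) by auto
    then show ?thesis using Suc.prems big by linarith
  next
    case False
    obtain k where k: "(i, k) \<in> adj" "(k, s) \<in> adj ^^ m"
      using Suc.prems(1) relpow_Suc_D2 by metis
    have kN: "k < N" using k(1) adj_lt by blast
    have step: "(i, j) \<in> adj ^^ Suc l" if "(k, j) \<in> adj ^^ l" for j l
      using k(1) that by (rule relpow_Suc_I2)
    have "lap z i \<le> \<eta>"
      using Suc.prems(7)[of 0 i] False by auto
    moreover have "z j \<le> z i + a" if "j < N" "0 < c i j" for j
    proof -
      have "(i, j) \<in> adj ^^ 1" using that Suc.prems(2) by (auto simp: adj_def)
      then have "z j \<le> M" using Suc.prems(6)[of 1 j] by simp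
      then show ?thesis using Suc.prems(9) by linarith
    qed
    then have "z i - z k \<le> max 0 (lap z i) + of_int d * a"
      using sum_c_bound[OF Suc.prems(2) k(1), of z a] Suc.prems(4) by blast
    ultimately have "M - ((of_int d + 1) * a + \<eta>) \<le> z k"
      using Suc.prems(5,9) by (auto simp: algebra_simps max_def split: if_splits)
    then have "M \<le> (of_int d + 1) ^ m * (((of_int d + 1) * a + \<eta>) + \<eta>)"
      using Suc.prems(4,5) d_pos step
      by (intro Suc.IH[OF k(2) kN Suc.prems(3) _ Suc.prems(5) _ _ Suc.prems(8)])
        (auto intro: Suc.prems(6)[of "Suc l" for l] Suc.prems(7)[of "Suc l" for l])
    \<comment> \<open>One step along the path turns the deficit a below M into (d + 1) a + \<eta>;
      as d is at least 1, the deficit plus \<eta> grows by the factor d + 1 at most.\<close>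
    also have "\<dots> \<le> (of_int d + 1) ^ m * ((of_int d + 1) * (a + \<eta>))"
      using d_pos Suc.prems(5) mult_left_mono[of 1 "of_int d" \<eta>]
      by (intro mult_left_mono) (auto simp: algebra_simps)
    finally show ?thesis by (simp add: mult_ac)
  qed
qed

text \<open>At a maximum the deficit in \<open>path_bound\<close> is 0, and the path to S has length
  at most R.\<close>

lemma maximum_bound:
  assumes S: "\<And>i. i < N \<Longrightarrow> reaches R S i" and "0 \<le> \<eta>"
    and lap: "\<And>i. i < N \<Longrightarrow> i \<notin> S \<Longrightarrow> 0 \<le> z i \<Longrightarrow> lap z i \<le> \<eta>" and zS: "\<And>s. s \<in> S \<Longrightarrow> z s \<le> 0" and "j < N"
  shows "z j \<le> (of_int d + 1) ^ R * \<eta>"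
proof -
  define M where "M = Max (z ` {..<N})"
  have "M \<in> z ` {..<N}" unfolding M_def using N_pos by (intro Max_in) auto
  then obtain i where i: "i < N" "z i = M" by auto
  have zM: "z j \<le> M" if "j < N" for j unfolding M_def using that by (intro Max_ge) auto
  obtain m s where m: "m \<le> R" "s \<in> S" "(i, s) \<in> adj ^^ m" using S[OF i(1)] unfolding reaches_def by blast
  have "M \<le> (of_int d + 1) ^ m * (0 + \<eta>)"
    by (rule path_bound[where z = z, OF m(3) i(1) m(2) _ assms(2)])
      (use i zM lap zS relpow_adj_lt[OF _ i(1)] in auto)
  also have "\<dots> \<le> (of_int d + 1) ^ R * \<eta>"
    using d_pos assms(2) m(1) by (auto intro!: mult_right_mono power_increasing)
  finally show ?thesis using zM[OF assms(5)] by linarith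
qed

text \<open>Two reasons for which the Laplacian plus k, with Dirichlet conditions on S, is
  invertible on a connected graph: a grounded vertex, or strictly positive killing
  everywhere.\<close>

definition kills :: "(nat \<Rightarrow> real) \<Rightarrow> nat set \<Rightarrow> bool" where
  "kills k S \<longleftrightarrow> (\<forall>i<N. 0 \<le> k i) \<and> ((\<exists>s\<in>S. s < N) \<or> (\<forall>i<N. 0 < k i))"

text \<open>If S contains a vertex, \<open>path_bound\<close> without errors transports the maximum
  to S. Otherwise the Laplacian is non-negative at a maximum, and the strictly positive potential
  excludes a positive value there.\<close>

lemma nonpos_principle:
  assumes k: "kills k S" and le: "\<And>i. i < N \<Longrightarrow> i \<notin> S \<Longrightarrow> lap z i + k i * z i \<le> 0"
    and zS: "\<And>s. s \<in> S \<Longrightarrow> s < N \<Longrightarrow> z s \<le> 0" and "j < N"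
  shows "z j \<le> 0"
proof -
  define M where "M = Max (z ` {..<N})"
  have "M \<in> z ` {..<N}" unfolding M_def using N_pos by (intro Max_in) auto
  then obtain i where i: "i < N" "z i = M" by auto
  have zM: "z j \<le> M" if "j < N" for j unfolding M_def using that by (intro Max_ge) auto
  have le': "lap z j \<le> 0" if "j < N" "j \<notin> S" "0 \<le> z j" for j
    using le[OF that(1,2)] k that by (smt (verit) kills_def mult_nonneg_nonneg)
  have "M \<le> 0"
  proof (cases "\<exists>s\<in>S. s < N")
    case True
    then obtain s where s: "s \<in> S" "s < N" by blast
    obtain m where m: "(i, s) \<in> adj ^^ m" using connected_relpow[OF i(1) s(2)] .
    have "M \<le> (of_int d + 1) ^ m * (0 + 0)"
      by (rule path_bound[where z = z and S = "S \<inter> {..<N}", OF m i(1) _ _ _])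
        (use s i zM le' zS relpow_adj_lt[OF _ i(1)] in auto)
    then show ?thesis by simp
  next
    case False
    then have "0 < k i" "i \<notin> S" using k i by (auto simp: kills_def)
    have "0 \<le> lap z i"
      unfolding lap_alt[OF i(1)] using c_nonneg zM i by (intro sum_nonneg mult_nonneg_nonneg) auto
    then have "k i * M \<le> 0" using le[OF i(1) \<open>i \<notin> S\<close>] unfolding i(2) by linarith
    then show ?thesis using \<open>0 < k i\<close> by (simp add: mult_le_0_iff)
  qed
  then show ?thesis using zM[OF assms(4)] by linarith
qed

lemma kmat_det_nonzero:
  assumes "kills k S" shows "fdet N (kmat k S) \<noteq> 0"
proof (rule fdet_nonzeroI)
  fix x i assume x: "\<And>i. i < N \<Longrightarrow> (\<Sum>j<N. kmat k S i j * x j) = 0" and i: "i < N"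
  have r: "(if i \<in> S then x i else lap x i + k i * x i) = 0" if "i < N" for i
    using x[OF that] that by (simp add: lap_row)
  have "x i \<le> 0"
    by (rule nonpos_principle[OF assms _ _ i]) (use r in \<open>fastforce+\<close>)
  moreover have "- x i \<le> 0"
    by (rule nonpos_principle[OF assms _ _ i, where z = "\<lambda>j. - x j"]) (use r in \<open>fastforce simp: lap_uminus\<close>)+
  ultimately show "x i = 0" by simp
qed

lemma dirichlet_solution:
  assumes "kills k S"
  obtains x where "\<And>i. i < N \<Longrightarrow> i \<in> S \<Longrightarrow> x i = b i" "\<And>i. i < N \<Longrightarrow> i \<notin> S \<Longrightarrow> lap x i + k i * x i = b i"
proof -
  obtain x where x: "\<And>i. i < N \<Longrightarrow> (\<Sum>j<N. kmat k S i j * x j) = b i"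
    using fdet_solve[OF kmat_det_nonzero[OF assms]] by blast
  have "(if i \<in> S then x i else lap x i + k i * x i) = b i" if "i < N" for i
    using x[OF that] that by (simp add: lap_row)
  then show ?thesis by (intro that[of x]) (metis, metis)
qed

text \<open>g is column e of the inverse of \<open>kmat k S\<close>, and the cofactors of row e are
  the determinant times g. Making e a Dirichlet vertex or changing k at e alters row e alone, so
  both new determinants are read off from the diagonal value g e.\<close>

lemma green_function:
  assumes k: "kills k S" and e: "e < N" "e \<notin> S"
  obtains g where "\<And>i. i < N \<Longrightarrow> 0 \<le> g i" "\<And>i. i < N \<Longrightarrow> i \<in> S \<Longrightarrow> g i = 0"
    "\<And>i. i < N \<Longrightarrow> i \<notin> S \<Longrightarrow> lap g i + k i * g i = (if i = e then 1 else 0)"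
    "1 \<le> (of_int d + k e) * g e"
    "fdet N (kmat k (insert e S)) = g e * fdet N (kmat k S)"
    "\<And>t. fdet N (kmat (k(e := k e + t)) S) = (1 + t * g e) * fdet N (kmat k S)"
proof -
  obtain g where g: "\<And>i. i < N \<Longrightarrow> i \<in> S \<Longrightarrow> g i = (if i = e then 1 else 0)"
    "\<And>i. i < N \<Longrightarrow> i \<notin> S \<Longrightarrow> lap g i + k i * g i = (if i = e then 1 else (0::real))"
    using dirichlet_solution[OF k, where b = "\<lambda>i. if i = e then 1 else 0"] by blast
  have gS: "g i = 0" if "i < N" "i \<in> S" for i using g(1)[OF that] e that by auto
  have nonneg: "0 \<le> g i" if "i < N" for i
  proof -
    have "- g i \<le> 0"
    proof (rule nonpos_principle[OF k _ _ that, where z = "\<lambda>j. - g j"])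
      show "lap (\<lambda>j. - g j) i + k i * (- g i) \<le> 0" if "i < N" "i \<notin> S" for i
        using g(2)[OF that] by (simp add: lap_uminus split: if_splits)
    qed (simp add: gS)
    then show ?thesis by simp
  qed
  have row: "(\<Sum>j<N. kmat k S i j * g j) = (if i = e then 1 else 0)" if "i < N" for i
    using that g(2) gS e by (auto simp: lap_row)
  obtain C where C: "\<And>r. fdet N ((kmat k S)(e := r)) = (\<Sum>j<N. r j * C j)"
    and C0: "\<And>i. i < N \<Longrightarrow> i \<noteq> e \<Longrightarrow> (\<Sum>j<N. kmat k S i j * C j) = 0"
    using fdet_cofactors[OF e(1), of "kmat k S"] by blast
  define D where "D = fdet N (kmat k S)"
  have D: "D = (\<Sum>j<N. kmat k S e j * C j)" using C[of "kmat k S e"] by (simp add: D_def)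
  \<comment> \<open>The cofactor vector and D g solve the same equations; the maximum principle for
    the difference and for its negative gives uniqueness.\<close>
  have "C i - D * g i = 0" if "i < N" for i
  proof -
    have r: "(\<Sum>j<N. kmat k S i j * (C j - D * g j)) = 0" if "i < N" for i
    proof -
      have "(\<Sum>j<N. kmat k S i j * (C j - D * g j)) = (\<Sum>j<N. kmat k S i j * C j) - D * (\<Sum>j<N. kmat k S i j * g j)"
        by (simp add: algebra_simps sum_subtractf sum_distrib_left)
      then show ?thesis using C0[OF that] D[symmetric] row[OF that] by (cases "i = e") auto
    qed
    have r': "(if i \<in> S then C i - D * g i else lap (\<lambda>j. C j - D * g j) i + k i * (C i - D * g i)) = 0" if "i < N" for i
      using r[OF that] that by (simp add: lap_row)
    have "C i - D * g i \<le> 0"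
      by (rule nonpos_principle[OF k _ _ that, where z = "\<lambda>j. C j - D * g j"]) (use r' in \<open>fastforce+\<close>)
    moreover have "- (C i - D * g i) \<le> 0"
    proof (rule nonpos_principle[OF k _ _ that, where z = "\<lambda>j. - (C j - D * g j)"])
      show "lap (\<lambda>j. - (C j - D * g j)) i + k i * - (C i - D * g i) \<le> 0" if "i < N" "i \<notin> S" for i
        using r'[OF that(1)] that(2) unfolding lap_uminus by (simp add: algebra_simps)
    qed (use r' in fastforce)
    ultimately show ?thesis by linarith
  qed
  then have Ce: "C e = g e * D" using e(1) by (simp add: mult.commute)
  have kill: "fdet N (kmat k (insert e S)) = g e * D"
  proof -
    have "kmat k (insert e S) = (kmat k S)(e := (\<lambda>j. if j = e then 1 else 0))"
      by (auto simp: kmat_def fun_eq_iff)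
    then have "fdet N (kmat k (insert e S)) = (\<Sum>j<N. (if j = e then 1 else 0) * C j)"
      using C by simp
    also have "\<dots> = (\<Sum>j<N. if j = e then C j else 0)" by (intro sum.cong) auto
    also have "\<dots> = C e" using e(1) by (simp add: sum.delta')
    finally show ?thesis using Ce by simp
  qed
  have pot: "fdet N (kmat (k(e := k e + t)) S) = (1 + t * g e) * D" for t
  proof -
    have "kmat (k(e := k e + t)) S = (kmat k S)(e := (\<lambda>j. kmat k S e j + (if j = e then t else 0)))"
      using e(2) by (auto simp: kmat_def fun_eq_iff)
    then have "fdet N (kmat (k(e := k e + t)) S) = (\<Sum>j<N. (kmat k S e j + (if j = e then t else 0)) * C j)"
      using C by simp
    also have "\<dots> = (\<Sum>j<N. kmat k S e j * C j) + (\<Sum>j<N. if j = e then t * C j else 0)"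
      unfolding sum.distrib[symmetric] by (intro sum.cong) (auto simp: algebra_simps)
    also have "\<dots> = D + t * C e" using e(1) D by (simp add: sum.delta')
    finally show ?thesis using Ce by (simp add: algebra_simps)
  qed
  have "1 \<le> (of_int d + k e) * g e"
  proof -
    have "0 \<le> (\<Sum>j<N. of_int (c e j) * g j)" using nonneg c_nonneg by (intro sum_nonneg) auto
    moreover have "lap g e + k e * g e = 1" using g(2) e by simp
    ultimately show ?thesis by (simp add: lap_def algebra_simps)
  qed
  with that[of g] nonneg gS g(2) kill pot show ?thesis unfolding D_def by blast
qed

text \<open>g e is an effective resistance between e and S. Cauchy-Schwarz along a shortest path
  bounds its square by the length times the energy over ordered pairs, and that energy is at most 2
  g e by the equation that g solves.\<close>

lemma green_diag_le:
  assumes kn: "\<And>i. i < N \<Longrightarrow> 0 \<le> k i" and e: "e < N" "e \<notin> S" and near: "reaches R S e"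
    and g: "\<And>i. i < N \<Longrightarrow> i \<in> S \<Longrightarrow> g i = 0"
    "\<And>i. i < N \<Longrightarrow> i \<notin> S \<Longrightarrow> lap g i + k i * g i = (if i = e then 1 else 0)"
    "0 \<le> g e"
  shows "g e \<le> 2 * real R"
proof -
  define P where "P m \<longleftrightarrow> (\<exists>s\<in>S. (e, s) \<in> adj ^^ m)" for m
  have ex: "\<exists>m\<le>R. P m" using near by (auto simp: reaches_def P_def)
  \<comment> \<open>Minimality of the length makes the vertices of the path distinct, so that no
    edge is used twice in the energy below.\<close>
  define m where "m = (LEAST m. P m)"
  have Pm: "P m" and min: "\<And>l. P l \<Longrightarrow> m \<le> l" and mR: "m \<le> R"
    using ex unfolding m_def by (auto intro: LeastI Least_le order_trans[OF Least_le])
  obtain s where s: "s \<in> S" "(e, s) \<in> adj ^^ m" using Pm by (auto simp: P_def)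
  obtain f where f: "f 0 = e" "f m = s" "\<And>i. i < m \<Longrightarrow> (f i, f (Suc i)) \<in> adj"
    using s(2) unfolding relpow_fun_conv by blast
  have sub: "(f a, f b) \<in> adj ^^ (b - a)" if "a \<le> b" "b \<le> m" for a b
    unfolding relpow_fun_conv by (rule exI[of _ "\<lambda>i. f (a + i)"]) (use f(3) that in auto)
  have "inj_on f {..<m}"
  proof (rule linorder_inj_onI)
    fix a b assume ab: "a < b" "b \<in> {..<m}"
    show "f a \<noteq> f b"
    proof
      assume eq: "f a = f b"
      have "(e, f a) \<in> adj ^^ a" using sub[of 0 a] f(1) ab by simp
      moreover have "(f a, s) \<in> adj ^^ (m - b)" using sub[of b m] f(2) ab eq by simp
      ultimately have "(e, s) \<in> adj ^^ (a + (m - b))" unfolding relpow_add by blast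
      then have "m \<le> a + (m - b)" using s(1) min by (auto simp: P_def)
      then show False using ab by auto
    qed
  qed auto
  then have inj: "inj_on (\<lambda>i. (f i, f (Suc i))) {..<m}" by (auto simp: inj_on_def)
  have gs: "g s = 0" using g(1) s relpow_adj_lt[OF s(2) e(1)] by blast
  have "g e = (\<Sum>i<m. g (f i) - g (f (Suc i)))"
    using sum_lessThan_telescope'[of "\<lambda>i. g (f i)" m] f gs by simp
  then have "(g e)\<^sup>2 \<le> real m * (\<Sum>i<m. (g (f i) - g (f (Suc i)))\<^sup>2)"
    using Cauchy_Schwarz_ineq_sum[of "\<lambda>_. 1" "\<lambda>i. g (f i) - g (f (Suc i))" "{..<m}"] by simp
  also have "(\<Sum>i<m. (g (f i) - g (f (Suc i)))\<^sup>2) = (\<Sum>(a, b)\<in>(\<lambda>i. (f i, f (Suc i))) ` {..<m}. (g a - g b)\<^sup>2)"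
    using inj by (simp add: sum.reindex)
  also have "\<dots> \<le> (\<Sum>(a, b)\<in>(\<lambda>i. (f i, f (Suc i))) ` {..<m}. of_int (c a b) * (g a - g b)\<^sup>2)"
  proof (intro sum_mono, clarsimp)
    fix i assume "i < m"
    then have "1 \<le> c (f i) (f (Suc i))" using f(3)[of i] by (simp add: adj_def)
    then have "1 * (g (f i) - g (f (Suc i)))\<^sup>2 \<le> of_int (c (f i) (f (Suc i))) * (g (f i) - g (f (Suc i)))\<^sup>2"
      by (intro mult_right_mono) auto
    then show "(g (f i) - g (f (Suc i)))\<^sup>2 \<le> of_int (c (f i) (f (Suc i))) * (g (f i) - g (f (Suc i)))\<^sup>2" by simp
  qed
  also have "\<dots> \<le> (\<Sum>(a, b)\<in>{..<N} \<times> {..<N}. of_int (c a b) * (g a - g b)\<^sup>2)"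
    using f(3) adj_lt c_nonneg by (intro sum_mono2) (auto intro!: mult_nonneg_nonneg)
  also have "\<dots> = (\<Sum>i<N. g i * lap g i) * 2"
    unfolding energy by (simp add: sum.cartesian_product)
  also have "(\<Sum>i<N. g i * lap g i) \<le> (\<Sum>i<N. if i = e then g e else 0)"
  proof (intro sum_mono)
    fix i assume i: "i \<in> {..<N}"
    show "g i * lap g i \<le> (if i = e then g e else 0)"
    proof (cases "i \<in> S")
      case True
      then show ?thesis using g(1) i e by auto
    next
      case False
      then have "lap g i = (if i = e then 1 else 0) - k i * g i" using g(2)[of i] i by simp
      then have "g i * lap g i = g i * (if i = e then 1 else 0) - k i * (g i)\<^sup>2"
        by (simp add: right_diff_distrib power2_eq_square)
      moreover have "0 \<le> k i * (g i)\<^sup>2" using kn i by simp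
      ultimately show ?thesis by auto
    qed
  qed
  also have "\<dots> = g e" using e(1) by simp
  finally have "(g e)\<^sup>2 \<le> real m * (g e * 2)" by (simp add: mult_left_mono)
  then have "g e \<le> 2 * real m"
    using g(3) by (cases "g e = 0") (auto simp: power2_eq_square)
  then show ?thesis using mR by linarith
qed

text \<open>With all vertices killed the matrix is the identity. Releasing e divides the determinant
  by g e, which is positive because (d + k e) g e is at least 1.\<close>

lemma kmat_det_pos:
  assumes "kills k S" shows "0 < fdet N (kmat k S)"
  using assms
proof (induction "card ({..<N} - S)" arbitrary: S)
  case 0
  then have "{..<N} \<subseteq> S" by auto
  then have "fdet N (kmat k S) = fdet N (\<lambda>i j. if i = j then 1 else 0)"
    by (intro fdet_cong) (auto simp: kmat_def)
  then show ?case by (simp add: fdet_identity)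
next
  case (Suc n)
  then obtain e where e: "e < N" "e \<notin> S"
    by (metis DiffD1 DiffD2 card.empty equals0I lessThan_iff nat.distinct(1))
  have "0 < fdet N (kmat k (insert e S))"
    using Suc.hyps(2) Suc.prems e
    by (intro Suc.hyps(1)) (auto simp: kills_def Diff_insert[of _ e S] card_Diff_singleton)
  moreover obtain g where "1 \<le> (of_int d + k e) * g e" "0 \<le> g e"
    "fdet N (kmat k (insert e S)) = g e * fdet N (kmat k S)"
    using green_function[OF Suc.prems e] e(1) by metis
  moreover from this have "0 < g e" by (cases "g e = 0") auto
  ultimately show ?case by (metis zero_less_mult_pos)
qed

section \<open>The number of torus solutions as a reduced determinant\<close>

lemma imat_det_pos: "s \<in> S \<Longrightarrow> s < N \<Longrightarrow> 0 < fdet N (imat S)"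
proof -
  assume "s \<in> S" "s < N"
  then have "0 < fdet N (kmat (\<lambda>_. 0) S)" by (intro kmat_det_pos) (auto simp: kills_def)
  then show ?thesis unfolding kmat_imat[abs_def] fdet_of_int by simp
qed

text \<open>The same induction as for positivity: by \<open>card_torus_sol_change_row\<close>,
  passing from the Laplacian row of e to a unit row changes the cardinality and the determinant in
  the same proportion.\<close>

lemma card_torus_sol_imat:
  assumes "s \<in> S" "s < N"
  shows "int (card (torus_sol N (imat S))) = fdet N (imat S)"
  using assms
proof (induction "card ({..<N} - S)" arbitrary: S)
  case 0
  then have S: "{..<N} \<subseteq> S" by auto
  then have "fdet N (imat S) = fdet N (\<lambda>i j. if i = j then 1 else 0)"
    by (intro fdet_cong) (auto simp: imat_def)
  moreover have "torus_sol N (imat S) = {restrict (\<lambda>_. 0) {..<N}}"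
  proof (intro equalityI subsetI)
    fix y assume y: "y \<in> torus_sol N (imat S)"
    have "y i = 0" if "i < N" for i
    proof -
      have "y i \<in> \<int>" using y that S by (auto simp: torus_sol_def imat_row dest!: spec[of _ i])
      moreover have "0 \<le> y i" "y i < 1" using y that by (auto simp: torus_sol_def PiE_iff)
      ultimately show ?thesis by (metis frac_eq_0_iff frac_eq)
    qed
    then show "y \<in> {restrict (\<lambda>_. 0) {..<N}}"
      using y by (auto simp: torus_sol_def PiE_iff extensional_def fun_eq_iff)
  qed (use S in \<open>auto simp: torus_sol_def imat_row\<close>)
  ultimately show ?case by (simp add: fdet_identity)
next
  case (Suc n)
  then obtain e where e: "e < N" "e \<notin> S"
    by (metis DiffD1 DiffD2 card.empty equals0I lessThan_iff nat.distinct(1))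
  have IH: "int (card (torus_sol N (imat (insert e S)))) = fdet N (imat (insert e S))"
    using Suc.hyps(2) Suc.prems e
    by (intro Suc.hyps(1)) (auto simp: Diff_insert[of _ e S] card_Diff_singleton)
  have ins: "imat (insert e S) = (imat S)(e := (\<lambda>j. if e = j then 1 else 0))"
    by (auto simp: imat_def fun_eq_iff)
  have pos: "0 < fdet N (imat S)" "0 < fdet N (imat (insert e S))"
    using Suc.prems imat_det_pos[of s S] imat_det_pos[of s "insert e S"] by auto
  have "card (torus_sol N (imat S)) * fdet N (imat (insert e S)) =
      card (torus_sol N (imat (insert e S))) * fdet N (imat S)"
    using card_torus_sol_change_row[OF e(1) pos(1)] pos(2) unfolding ins by blast
  then show ?case using pos(2) unfolding IH by simp
qed

text \<open>Grounding vertex 0 selects one representative from each class of solutions modulo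
  constants.\<close>

definition tau :: nat where "tau = card (torus_sol N (imat {0}))"

lemma tau_det: "real tau = fdet N (kmat (\<lambda>_. 0) {0})"
  using card_torus_sol_imat[of 0 "{0}"] N_pos
  unfolding kmat_imat[abs_def] fdet_of_int tau_def by (metis of_int_of_nat_eq singletonI)

lemma tau_pos: "1 \<le> tau"
proof -
  have "0 < real tau" unfolding tau_det using N_pos by (intro kmat_det_pos) (auto simp: kills_def)
  then show ?thesis by simp
qed

text \<open>The R-neighbourhoods of S and of E - S cover a connected graph, so they meet or are
  joined by an edge; crossing from one centre to the other takes at most R + 1 + R steps.\<close>

lemma linked_vertex:
  assumes dense: "\<And>i. i < N \<Longrightarrow> reaches R E i" and E: "E \<subseteq> {..<N}" and S: "S \<subset> E" "S \<noteq> {}"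
  obtains e where "e \<in> E" "e \<notin> S" "reaches (2 * R + 1) S e"
proof -
  let ?A = "{i. i < N \<and> reaches R S i}"
  have "\<exists>i j. i \<in> ?A \<and> j < N \<and> (i = j \<or> (j, i) \<in> adj) \<and> reaches R (E - S) j"
  proof (rule ccontr)
    assume none: "\<nexists>i j. i \<in> ?A \<and> j < N \<and> (i = j \<or> (j, i) \<in> adj) \<and> reaches R (E - S) j"
    have cover: "reaches R S j \<or> reaches R (E - S) j" if "j < N" for j
      using dense[OF that] unfolding reaches_def by blast
    have closed: "j \<in> ?A" if "i \<in> ?A" "(i, j) \<in> adj" for i j
      using none that cover adj_lt adj_sym by blast
    have "(i, j) \<in> adj\<^sup>* \<Longrightarrow> i \<in> ?A \<Longrightarrow> j \<in> ?A" for i j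
      by (induction rule: rtrancl_induct) (use closed in blast)+
    moreover obtain s where s: "s \<in> S" using S by blast
    moreover have "s \<in> ?A" using s S E by (auto simp: reaches_def intro!: exI[of _ 0])
    moreover obtain e where e: "e \<in> E - S" using S by blast
    moreover have "e < N" "s < N" using e s S E by auto
    then have "(s, e) \<in> adj\<^sup>*" using connected unfolding adj_def by blast
    ultimately have "e \<in> ?A" by blast
    moreover have "reaches R (E - S) e" using e by (auto simp: reaches_def intro!: exI[of _ 0])
    ultimately show False using none by blast
  qed
  then obtain i j where ij: "reaches R S i" "i = j \<or> (j, i) \<in> adj" "reaches R (E - S) j" by blast
  obtain a s where a: "a \<le> R" "s \<in> S" "(i, s) \<in> adj ^^ a" using ij(1) unfolding reaches_def by blast
  obtain b e where b: "b \<le> R" "e \<in> E - S" "(j, e) \<in> adj ^^ b" using ij(3) unfolding reaches_def by blast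
  have "(e, j) \<in> adj ^^ b" using b(3) by (rule relpow_adj_sym)
  moreover obtain l where l: "l \<le> 1" "(j, i) \<in> adj ^^ l"
    using ij(2) by (metis le_numeral_extra(4) relpow_0_I relpow_1 zero_le)
  ultimately have "(e, s) \<in> adj ^^ (b + l + a)" using a(3) unfolding relpow_add by blast
  moreover have "b + l + a \<le> 2 * R + 1" using a b l by linarith
  ultimately have "reaches (2 * R + 1) S e" using a(2) unfolding reaches_def by blast
  then show ?thesis using that b(2) by blast
qed

text \<open>E is killed one vertex at a time, starting from 0. At each stage
  \<open>linked_vertex\<close> provides a vertex within 2 R + 1 of those already killed, so the
  factor g e is at most 2 (2 R + 1).\<close>

lemma det_kill_dense_le:
  assumes dense: "\<And>i. i < N \<Longrightarrow> reaches R E i" and E: "E \<subseteq> {..<N}" "0 \<in> E"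
  shows "fdet N (kmat (\<lambda>_. 0) E) \<le> (2 * real (2 * R + 1)) ^ card E * tau"
proof -
  define K where "K = 2 * real (2 * R + 1)"
  have K: "1 \<le> K" by (simp add: K_def)
  have finE: "finite E" using E(1) finite_subset by blast
  have "fdet N (kmat (\<lambda>_. 0) E) \<le> K ^ card (E - S) * fdet N (kmat (\<lambda>_. 0) S)" if "S \<subseteq> E" "0 \<in> S" for S
    using that
  proof (induction "card (E - S)" arbitrary: S)
    case 0
    then have "S = E" using finE by auto
    then show ?case by simp
  next
    case (Suc n)
    then have "S \<subset> E" by auto
    then obtain e where e: "e \<in> E" "e \<notin> S" "reaches (2 * R + 1) S e"
      using linked_vertex[OF dense E(1)] Suc.prems by blast
    have eN: "e < N" using e E by auto
    have k: "kills (\<lambda>_. 0) S" using Suc.prems N_pos by (auto simp: kills_def)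
    obtain g where g: "\<And>i. i < N \<Longrightarrow> 0 \<le> g i" "\<And>i. i < N \<Longrightarrow> i \<in> S \<Longrightarrow> g i = 0"
      "\<And>i. i < N \<Longrightarrow> i \<notin> S \<Longrightarrow> lap g i + 0 * g i = (if i = e then 1 else 0)"
      "fdet N (kmat (\<lambda>_. 0) (insert e S)) = g e * fdet N (kmat (\<lambda>_. 0) S)"
      using green_function[OF k eN e(2)] by metis
    have "g e \<le> K"
      unfolding K_def by (rule green_diag_le[OF _ eN e(2,3) g(2,3)]) (use g(1) eN in auto)
    then have le: "fdet N (kmat (\<lambda>_. 0) (insert e S)) \<le> K * fdet N (kmat (\<lambda>_. 0) S)"
      unfolding g(4) using kmat_det_pos[OF k] by (intro mult_right_mono) auto
    have card: "card (E - S) = Suc (card (E - insert e S))"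
      using e finE by (metis DiffI Diff_insert card_Suc_Diff1 finite_Diff)
    have "fdet N (kmat (\<lambda>_. 0) E) \<le> K ^ card (E - insert e S) * fdet N (kmat (\<lambda>_. 0) (insert e S))"
    proof (rule Suc.hyps(1))
      show "n = card (E - insert e S)" using Suc.hyps(2) card by linarith
    qed (use Suc.prems e in auto)
    also have "\<dots> \<le> K ^ card (E - insert e S) * (K * fdet N (kmat (\<lambda>_. 0) S))"
      using le K by (intro mult_left_mono) auto
    finally show ?case unfolding card by (simp add: mult_ac)
  qed
  from this[of "{0}"] have "fdet N (kmat (\<lambda>_. 0) E) \<le> K ^ card (E - {0}) * tau"
    using E(2) by (simp add: tau_det)
  also have "\<dots> \<le> K ^ card E * tau"
    using K finE by (intro mult_right_mono power_increasing card_mono) auto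
  finally show ?thesis by (simp add: K_def)
qed

text \<open>The potential is switched on vertex by vertex. Each vertex m off B multiplies the
  determinant by 1 + t g m, and the resistance to B bounds g m by 2 R; the unit rows in B do not see
  the potential.\<close>

lemma det_potential_le:
  assumes dense: "\<And>i. i < N \<Longrightarrow> reaches R B i" and t: "0 \<le> t"
  shows "fdet N (kmat (\<lambda>_. t) B) \<le> (1 + 2 * real R * t) ^ N * fdet N (kmat (\<lambda>_. 0) B)"
proof -
  obtain s where s: "s \<in> B" "s < N"
    using dense[OF N_pos] relpow_adj_lt[OF _ N_pos] unfolding reaches_def by blast
  define k where "k m i = (if i < m then t else 0)" for m i :: nat
  have kk: "kills (k m) B" for m using s t by (auto simp: kills_def k_def)
  define L where "L = 1 + 2 * real R * t"
  have L: "1 \<le> L" using t by (simp add: L_def)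
  have step: "fdet N (kmat (k (Suc m)) B) \<le> L * fdet N (kmat (k m) B)" if m: "m < N" for m
  proof (cases "m \<in> B")
    case True
    have "kmat (k (Suc m)) B i j = kmat (k m) B i j" for i j
      using True by (auto simp: kmat_def k_def less_Suc_eq)
    then have "kmat (k (Suc m)) B = kmat (k m) B" by (intro ext)
    then show ?thesis using mult_right_mono[OF L less_imp_le[OF kmat_det_pos[OF kk[of m]]]] by simp
  next
    case False
    obtain g where g: "\<And>i. i < N \<Longrightarrow> 0 \<le> g i" "\<And>i. i < N \<Longrightarrow> i \<in> B \<Longrightarrow> g i = 0"
      "\<And>i. i < N \<Longrightarrow> i \<notin> B \<Longrightarrow> lap g i + k m i * g i = (if i = m then 1 else 0)"
      "\<And>t. fdet N (kmat ((k m)(m := k m m + t)) B) = (1 + t * g m) * fdet N (kmat (k m) B)"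
      using green_function[OF kk m False] by metis
    have "g m \<le> 2 * real R"
      by (rule green_diag_le[OF _ m False dense[OF m] g(2,3)]) (use g(1) m t in \<open>auto simp: k_def\<close>)
    then have "1 + t * g m \<le> L" unfolding L_def using t by (simp add: mult_left_mono mult.commute)
    moreover have "k (Suc m) = (k m)(m := k m m + t)" by (auto simp: k_def fun_eq_iff)
    ultimately show ?thesis
      using g(4)[of t] kmat_det_pos[OF kk[of m]] by (simp add: mult_right_mono)
  qed
  have "fdet N (kmat (k m) B) \<le> L ^ m * fdet N (kmat (k 0) B)" if "m \<le> N" for m
    using that
  proof (induction m)
    case (Suc m)
    have "fdet N (kmat (k (Suc m)) B) \<le> L * fdet N (kmat (k m) B)" using step Suc by simp
    also have "\<dots> \<le> L * (L ^ m * fdet N (kmat (k 0) B))" using Suc L by (intro mult_left_mono) auto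
    finally show ?case by (simp add: mult_ac)
  qed simp
  from this[of N] have "fdet N (kmat (k N) B) \<le> L ^ N * fdet N (kmat (k 0) B)" by simp
  moreover have "fdet N (kmat (k N) B) = fdet N (kmat (\<lambda>_. t) B)"
    by (intro fdet_cong) (auto simp: kmat_def k_def)
  moreover have "k 0 = (\<lambda>_. 0)" by (auto simp: k_def)
  ultimately show ?thesis by (simp add: L_def)
qed

text \<open>Three moves: kill B, at the price of d + t per vertex because g e is at least 1 / (d +
  t); remove the potential while B is grounded; release all of B except 0.\<close>

lemma det_resolvent_le:
  assumes dense: "\<And>i. i < N \<Longrightarrow> reaches R B i" and B: "B \<subseteq> {..<N}" "0 \<in> B" and t: "0 < t"
  shows "fdet N (kmat (\<lambda>_. t) {}) \<le>
    (of_int d + t) ^ card B * (1 + 2 * real R * t) ^ N * (2 * real (2 * R + 1)) ^ card B * tau"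
proof -
  have finB: "finite B" using B(1) finite_subset by blast
  have kk: "kills (\<lambda>_. t) S" for S using t by (auto simp: kills_def)
  have "S \<subseteq> {..<N} \<Longrightarrow> fdet N (kmat (\<lambda>_. t) {}) \<le> (of_int d + t) ^ card S * fdet N (kmat (\<lambda>_. t) S)" if "finite S" for S
    using that
  proof (induction S)
    case (insert e S)
    have e: "e < N" using insert by auto
    obtain g where g: "1 \<le> (of_int d + t) * g e" "fdet N (kmat (\<lambda>_. t) (insert e S)) = g e * fdet N (kmat (\<lambda>_. t) S)"
      using green_function[OF kk e insert.hyps(2)] by metis
    have "fdet N (kmat (\<lambda>_. t) {}) \<le> (of_int d + t) ^ card S * fdet N (kmat (\<lambda>_. t) S)" using insert by auto
    also have "fdet N (kmat (\<lambda>_. t) S) \<le> ((of_int d + t) * g e) * fdet N (kmat (\<lambda>_. t) S)"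
      using mult_right_mono[OF g(1) less_imp_le[OF kmat_det_pos[OF kk]]] by simp
    also have "\<dots> = (of_int d + t) * fdet N (kmat (\<lambda>_. t) (insert e S))" using g(2) by simp
    finally show ?case using insert d_pos t by (simp add: mult_left_mono mult_ac)
  qed simp
  from this[OF finB B(1)]
  have "fdet N (kmat (\<lambda>_. t) {}) \<le> (of_int d + t) ^ card B * fdet N (kmat (\<lambda>_. t) B)" .
  also have "\<dots> \<le> (of_int d + t) ^ card B * ((1 + 2 * real R * t) ^ N * ((2 * real (2 * R + 1)) ^ card B * tau))"
    using det_potential_le[OF dense, of t] det_kill_dense_le[OF dense B] d_pos t
    by (intro mult_left_mono order_trans[OF det_potential_le[OF dense]]) auto
  finally show ?thesis by (simp add: mult_ac)
qed

text \<open>Laplacians sum to zero, so the Green function with potential t has total mass 1 / t, and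
  g 0 is at most 1 / t. This compares the determinant with the one grounded at 0, which in turn only
  decreases when the potential is removed.\<close>

lemma det_resolvent_ge:
  fixes t :: real
  assumes t: "0 < t"
  shows "t * tau \<le> fdet N (kmat (\<lambda>_. t) {})"
proof -
  have k0: "kills (\<lambda>_. t) {}" using t by (auto simp: kills_def)
  have e0: "0 \<notin> ({} :: nat set)" by simp
  obtain g where g: "\<And>i. i < N \<Longrightarrow> 0 \<le> g i"
    "\<And>i. i < N \<Longrightarrow> i \<notin> {} \<Longrightarrow> lap g i + t * g i = (if i = 0 then 1 else 0)"
    "fdet N (kmat (\<lambda>_. t) {0}) = g 0 * fdet N (kmat (\<lambda>_. t) {})"
    using green_function[OF k0 N_pos e0] by metis
  have "t * g 0 \<le> (\<Sum>i<N. t * g i)" using g(1) t N_pos by (intro member_le_sum) auto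
  also have "\<dots> = (\<Sum>i<N. lap g i + t * g i)" by (simp add: sum.distrib sum_lap)
  also have "\<dots> = (\<Sum>i<N. if i = 0 then 1 else 0)" using g(2) by (intro sum.cong) auto
  also have "\<dots> = 1" using N_pos by simp
  finally have tg: "t * g 0 \<le> 1" .
  define k where "k m i = (if i < m then t else 0)" for m i :: nat
  have kk: "kills (k m) {0}" for m using N_pos t by (auto simp: kills_def k_def)
  have "fdet N (kmat (k m) {0}) \<le> fdet N (kmat (k (Suc m)) {0})" if m: "m < N" for m
  proof (cases "m = 0")
    case True
    have "kmat (k (Suc m)) {0} i j = kmat (k m) {0} i j" for i j
      using True by (auto simp: kmat_def k_def less_Suc_eq)
    then have "kmat (k (Suc m)) {0} = kmat (k m) {0}" by (intro ext)
    then show ?thesis by simp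
  next
    case False
    obtain h where h: "0 \<le> h m"
      "\<And>t. fdet N (kmat ((k m)(m := k m m + t)) {0}) = (1 + t * h m) * fdet N (kmat (k m) {0})"
      using green_function[OF kk[of m] m] False m by (metis singletonD)
    moreover have "k (Suc m) = (k m)(m := k m m + t)" by (auto simp: k_def fun_eq_iff)
    ultimately show ?thesis
      using h(2)[of t] kmat_det_pos[OF kk[of m]] t by (simp add: algebra_simps)
  qed
  then have "fdet N (kmat (k 0) {0}) \<le> fdet N (kmat (k m) {0})" if "m \<le> N" for m
    using that by (induction m) (auto intro: order_trans)
  moreover have "k 0 = (\<lambda>_. 0)" by (auto simp: k_def)
  ultimately have "tau \<le> fdet N (kmat (k N) {0})"
    unfolding tau_det by (metis order_refl)
  also have "fdet N (kmat (k N) {0}) = fdet N (kmat (\<lambda>_. t) {0})"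
    by (intro fdet_cong) (auto simp: kmat_def k_def)
  finally have "t * tau \<le> t * g 0 * fdet N (kmat (\<lambda>_. t) {})"
    unfolding g(3) using t by (simp add: mult_left_mono)
  also have "\<dots> \<le> 1 * fdet N (kmat (\<lambda>_. t) {})"
    using tg kmat_det_pos[OF k0] by (intro mult_right_mono) auto
  finally show ?thesis by simp
qed

text \<open>In a connected graph a ball that is not yet everything gains a vertex whenever its
  radius grows by one.\<close>

lemma card_ball_ge:
  assumes "i < N" "r < N"
  shows "r + 1 \<le> card {j. reaches r {i} j}"
  using assms(2)
proof (induction r)
  case 0
  have "{j. reaches 0 {i} j} = {i}" by (auto simp: reaches_def)
  then show ?case by simp
next
  case (Suc r)
  let ?A = "\<lambda>r. {j. reaches r {i} j}"
  have sub: "?A r \<subseteq> {..<N}" for r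
    using relpow_adj_lt[OF relpow_adj_sym assms(1)] by (auto simp: reaches_def)
  have mono: "?A r \<subseteq> ?A (Suc r)" using reaches_mono[of r "{i}" _ "Suc r" "{i}"] by auto
  have IH: "r + 1 \<le> card (?A r)" using Suc by simp
  show ?case
  proof (cases "?A r = {..<N}")
    case True
    then have "?A (Suc r) = {..<N}" using mono sub by blast
    then show ?thesis using Suc by simp
  next
    case False
    have "\<exists>a b. a \<in> ?A r \<and> b \<notin> ?A r \<and> (a, b) \<in> adj"
    proof (rule ccontr)
      assume none: "\<nexists>a b. a \<in> ?A r \<and> b \<notin> ?A r \<and> (a, b) \<in> adj"
      have base: "i \<in> ?A r" by (auto simp: reaches_def intro!: exI[of _ 0])
      have "j \<in> ?A r" if "(i, j) \<in> adj\<^sup>*" for j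
        using that by (induction rule: rtrancl_induct) (use base none in blast)+
      then have "{..<N} \<subseteq> ?A r" using connected assms(1) unfolding adj_def by blast
      with False sub show False by blast
    qed
    then obtain a b where ab: "a \<in> ?A r" "b \<notin> ?A r" "(a, b) \<in> adj" by blast
    obtain m where m: "m \<le> r" "(a, i) \<in> adj ^^ m" using ab(1) by (auto simp: reaches_def)
    have "(b, i) \<in> adj ^^ Suc m" using ab(3) m(2) adj_sym by (intro relpow_Suc_I2[of b a]) auto
    then have "b \<in> ?A (Suc r)" using m(1) by (auto simp: reaches_def intro!: exI[of _ "Suc m"] simp del: relpow.simps)
    then have "?A r \<subset> ?A (Suc r)" using mono ab(2) by blast
    then have "card (?A r) < card (?A (Suc r))" using sub finite_subset by (intro psubset_card_mono) blast+
    then show ?thesis using IH by linarith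
  qed
qed

text \<open>The centres of a largest family of disjoint r-balls among those containing 0. Each ball
  has at least r + 1 vertices, and maximality leaves no vertex farther than 2 r from the centres.
  Vertex 0 is kept because \<open>tau\<close> is grounded there.\<close>

lemma sparse_dense_set:
  assumes "r < N"
  obtains B where "B \<subseteq> {..<N}" "0 \<in> B" "card B * (r + 1) \<le> N" "\<And>i. i < N \<Longrightarrow> reaches (2 * r) B i"
proof -
  let ?ball = "\<lambda>i. {j. reaches r {i} j}"
  define Q where "Q B \<longleftrightarrow> B \<subseteq> {..<N} \<and> 0 \<in> B \<and> disjoint_family_on ?ball B" for B
  have "Q {0}" using N_pos by (auto simp: Q_def disjoint_family_on_def)
  moreover have "card B < Suc N" if "Q B" for B
    using that card_mono[of "{..<N}" B] by (auto simp: Q_def less_Suc_eq_le)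
  ultimately obtain B where B: "Q B" "\<And>B'. Q B' \<Longrightarrow> card B' \<le> card B"
    using ex_has_greatest_nat[of Q "{0}" card "Suc N"] by (metis less_imp_le)
  have sub: "?ball i \<subseteq> {..<N}" if "i < N" for i
    using relpow_adj_lt[OF relpow_adj_sym that] by (auto simp: reaches_def)
  have fin: "finite B" using B(1) finite_subset unfolding Q_def by blast
  have "card B * (r + 1) = (\<Sum>i\<in>B. r + 1)" by simp
  also have "\<dots> \<le> (\<Sum>i\<in>B. card (?ball i))"
    using B(1) assms card_ball_ge by (intro sum_mono) (auto simp: Q_def)
  also have "\<dots> = card (\<Union>i\<in>B. ?ball i)"
    using B(1) fin sub finite_subset[OF sub]
    by (intro card_UN_disjoint'[symmetric]) (auto simp: Q_def)
  also have "\<dots> \<le> card {..<N}"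
    using B(1) sub by (intro card_mono) (auto simp: Q_def)
  finally have "card B * (r + 1) \<le> N" by simp
  moreover have "reaches (2 * r) B i" if i: "i < N" for i
  proof (cases "i \<in> B")
    case True
    then show ?thesis by (auto simp: reaches_def intro!: exI[of _ 0])
  next
    case False
    have "\<not> Q (insert i B)" using B(2)[of "insert i B"] False fin by auto
    then obtain b where b: "b \<in> B" "?ball i \<inter> ?ball b \<noteq> {}"
      using B(1) i unfolding Q_def disjoint_family_on_def by blast
    then obtain x m n where m: "m \<le> r" "(x, i) \<in> adj ^^ m" and n: "n \<le> r" "(x, b) \<in> adj ^^ n"
      by (auto simp: reaches_def)
    have "(i, b) \<in> adj ^^ (m + n)"
      unfolding relpow_add using relpow_adj_sym[OF m(2)] n(2) by blast
    then show ?thesis using b(1) m(1) n(1) unfolding reaches_def by (intro exI[of _ "m + n"]) auto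
  qed
  ultimately show ?thesis using that B(1) unfolding Q_def by blast
qed

text \<open>Rayleigh quotient: the energy is non-negative, and (a - b)^2 is at most 2 a^2 + 2
  b^2.\<close>

lemma lap_eigenvalue_bounds:
  assumes "j < N" "v j \<noteq> 0" "\<And>i. i < N \<Longrightarrow> lap v i = a * v i"
  shows "0 \<le> a" "a \<le> 2 * of_int d"
proof -
  have "0 < (v j)\<^sup>2" using assms by simp
  also have "\<dots> \<le> (\<Sum>i<N. (v i)\<^sup>2)" using assms by (intro member_le_sum) auto
  finally have pos: "0 < (\<Sum>i<N. (v i)\<^sup>2)" .
  have e: "(\<Sum>i<N. v i * lap v i) = a * (\<Sum>i<N. (v i)\<^sup>2)"
    unfolding sum_distrib_left by (intro sum.cong) (auto simp: assms(3) power2_eq_square)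
  have "0 \<le> (\<Sum>i<N. v i * lap v i) * 2"
    unfolding energy using c_nonneg by (intro sum_nonneg) auto
  then show "0 \<le> a" using pos unfolding e by (simp add: zero_le_mult_iff)
  have "(\<Sum>i<N. v i * lap v i) * 2 \<le> (\<Sum>i<N. \<Sum>j<N. of_int (c i j) * (2 * (v i)\<^sup>2 + 2 * (v j)\<^sup>2))"
    unfolding energy
  proof (intro sum_mono mult_left_mono)
    show "(v i - v j)\<^sup>2 \<le> 2 * (v i)\<^sup>2 + 2 * (v j)\<^sup>2" for i j
      using zero_le_power2[of "v i + v j"] by (simp add: power2_eq_square algebra_simps)
  qed (use c_nonneg in auto)
  also have "\<dots> = (\<Sum>i<N. \<Sum>j<N. of_int (c i j) * (2 * (v i)\<^sup>2)) + (\<Sum>j<N. \<Sum>i<N. of_int (c i j) * (2 * (v j)\<^sup>2))"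
    by (subst (3) sum.swap) (simp add: sum.distrib algebra_simps)
  also have "(\<Sum>j<N. \<Sum>i<N. of_int (c i j) * (2 * (v j)\<^sup>2)) = (\<Sum>j<N. \<Sum>i<N. of_int (c j i) * (2 * (v j)\<^sup>2))"
    by (intro sum.cong refl) (simp add: c_sym)
  also have "(\<Sum>i<N. \<Sum>j<N. of_int (c i j) * (2 * (v i)\<^sup>2)) = (\<Sum>i<N. of_int d * (2 * (v i)\<^sup>2))"
    by (intro sum.cong refl) (simp only: sum_distrib_right[symmetric] of_int_sum[symmetric] c_sum lessThan_iff)
  finally have "a * (\<Sum>i<N. (v i)\<^sup>2) * 2 \<le> 4 * of_int d * (\<Sum>i<N. (v i)\<^sup>2)"
    unfolding e by (simp add: sum_distrib_left mult_ac)
  then show "a \<le> 2 * of_int d" using pos by simp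
qed

lemma laplacian_eigenvalues:
  obtains lam :: "nat \<Rightarrow> real" where "\<And>k. k < N \<Longrightarrow> 0 \<le> lam k \<and> lam k \<le> 2 * of_int d"
    "\<And>t. fdet N (kmat (\<lambda>_. t) {}) = (\<Prod>k<N. t + lam k)"
    "\<And>m. (\<Sum>i<N. fpow N (\<lambda>i j. of_int (imat {} i j)) m i i) = (\<Sum>k<N. lam k ^ m)"
proof -
  let ?A = "\<lambda>i j. real_of_int (imat {} i j)"
  have sym: "?A i j = ?A j i" if "i < N" "j < N" for i j
    using that by (simp add: imat_def c_sym)
  obtain lam where lam: "\<And>k. k < N \<Longrightarrow> \<exists>v::nat \<Rightarrow> real. (\<exists>j<N. v j \<noteq> 0) \<and> (\<forall>i<N. (\<Sum>j<N. ?A i j * v j) = lam k * v i)"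
    "\<And>t. fdet N (\<lambda>i j. ?A i j + (if i = j then t else 0)) = (\<Prod>k<N. t + lam k)"
    "\<And>m. (\<Sum>i<N. fpow N ?A m i i) = (\<Sum>k<N. lam k ^ m)"
    using symmetric_eigenvalues[of N ?A] sym by blast
  have "0 \<le> lam k \<and> lam k \<le> 2 * of_int d" if k: "k < N" for k
  proof -
    obtain v j where "j < N" "v j \<noteq> 0" "\<And>i. i < N \<Longrightarrow> (\<Sum>j<N. ?A i j * v j) = lam k * v i"
      using lam(1)[OF k] by blast
    then show ?thesis using lap_eigenvalue_bounds[of j v "lam k"] by (simp add: imat_row)
  qed
  moreover have "fdet N (kmat (\<lambda>_. t) {}) = (\<Prod>k<N. t + lam k)" for t
    unfolding lam(2)[symmetric] by (intro fdet_cong) (auto simp: kmat_def imat_def)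
  ultimately show ?thesis using that lam(3) by blast
qed

end


section \<open>The quotient graphs\<close>

lemma open_coordinate_vimage:
  "open U \<Longrightarrow> open ((\<lambda>x::'a \<Rightarrow> 'b::topological_space. x t) -` U)"
  by (rule open_vimage[OF _ continuous_on_product_coordinates])

text \<open>The library instances require an index type of class \<open>countable\<close>; here the group is
  countable only by hypothesis.\<close>

instance "fun" :: (type, t0_space) t0_space
proof
  fix x y :: "'a \<Rightarrow> 'b" assume "x \<noteq> y"
  then obtain t where ne: "x t \<noteq> y t" by blast
  obtain U where U: "open U" "\<not> (x t \<in> U \<longleftrightarrow> y t \<in> U)"
    by (rule exE[OF t0_space_class.t0_space[OF ne]], erule conjE, rule that)
  show "\<exists>U. open U \<and> \<not> (x \<in> U \<longleftrightarrow> y \<in> U)"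
    by (intro exI[of _ "(\<lambda>x. x t) -` U"] conjI open_coordinate_vimage U(1)) (use U(2) in \<open>unfold vimage_eq\<close>)
qed

instance "fun" :: (type, t1_space) t1_space
proof
  fix x y :: "'a \<Rightarrow> 'b" assume "x \<noteq> y"
  then obtain t where "x t \<noteq> y t" by blast
  then obtain U where "open U" "x t \<in> U" "y t \<notin> U" using t1_space by blast
  then show "\<exists>U. open U \<and> x \<in> U \<and> y \<notin> U"
    by (intro exI[of _ "(\<lambda>x. x t) -` U"]) (simp add: open_coordinate_vimage)
qed

instance "fun" :: (type, t2_space) t2_space
proof
  fix x y :: "'a \<Rightarrow> 'b" assume "x \<noteq> y"
  then obtain t where "x t \<noteq> y t" by blast
  then obtain U V where "open U" "open V" "x t \<in> U" "y t \<in> V" "U \<inter> V = {}"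
    using hausdorff[of "x t" "y t"] by metis
  then show "\<exists>U V. open U \<and> open V \<and> x \<in> U \<and> y \<in> V \<and> U \<inter> V = {}"
    by (intro exI[of _ "(\<lambda>x. x t) -` U"] exI[of _ "(\<lambda>x. x t) -` V"])
      (simp add: open_coordinate_vimage vimage_Int[symmetric])
qed

section \<open>Cosets, the unit circle and connected components\<close>

lemma lcoset_eq_iff:
  assumes "subgrp H"
  shows "lcoset a H = lcoset b H \<longleftrightarrow> - a + b \<in> H"
proof
  assume "lcoset a H = lcoset b H"
  moreover have "b \<in> lcoset b H" using assms by (auto simp: lcoset_def subgrp_def image_iff intro!: bexI[of _ 0])
  ultimately obtain h where "h \<in> H" "b = a + h" by (auto simp: lcoset_def)
  then show "- a + b \<in> H" by (simp add: add.assoc[symmetric])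
next
  assume ab: "- a + b \<in> H"
  then have ba: "- b + a \<in> H" using assms unfolding subgrp_def by (metis minus_add minus_minus)
  show "lcoset a H = lcoset b H"
  proof (intro equalityI subsetI)
    fix x assume "x \<in> lcoset a H"
    then obtain h where h: "h \<in> H" "x = a + h" by (auto simp: lcoset_def)
    then have "x = b + ((- b + a) + h)" by (simp add: add.assoc[symmetric])
    then show "x \<in> lcoset b H" using ba h assms unfolding lcoset_def subgrp_def by blast
  next
    fix x assume "x \<in> lcoset b H"
    then obtain h where h: "h \<in> H" "x = b + h" by (auto simp: lcoset_def)
    then have "x = a + ((- a + b) + h)" by (simp add: add.assoc[symmetric])
    then show "x \<in> lcoset a H" using ab h assms unfolding lcoset_def subgrp_def by blast
  qed
qed

lemma lcoset_lcoset: "lcoset s (lcoset g H) = lcoset (s + g) H"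
  by (auto simp: lcoset_def image_image add.assoc)

lemma prod_cis_powi: "(\<Prod>s\<in>A. cis (a s) powi k s) = cis (\<Sum>s\<in>A. of_int (k s) * a s)"
proof (induction A rule: infinite_finite_induct)
  case (insert x A)
  then show ?case by (simp add: cis_power_int cis_mult)
qed auto

lemma cis_2pi_eq_1_iff: "cis (2 * pi * x) = 1 \<longleftrightarrow> x \<in> \<int>"
proof
  assume "cis (2 * pi * x) = 1"
  then have "cos (2 * pi * x) = 1" by (metis cis.simps(1) one_complex.simps(1))
  then obtain n :: int where "2 * pi * x = of_int n * 2 * pi" using cos_one_2pi_int by auto
  then show "x \<in> \<int>" by simp
qed (auto elim!: Ints_cases simp: cis_multiple_2pi)

lemma cis_2pi_eq_iff: "cis (2 * pi * x) = cis (2 * pi * y) \<longleftrightarrow> x - y \<in> \<int>"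
proof -
  have "cis (2 * pi * x) = cis (2 * pi * y) \<longleftrightarrow> cis (2 * pi * x) / cis (2 * pi * y) = 1"
    by simp
  also have "\<dots> \<longleftrightarrow> cis (2 * pi * (x - y)) = 1"
    by (simp add: cis_divide right_diff_distrib)
  finally show ?thesis by (simp add: cis_2pi_eq_1_iff)
qed

lemma unit_circle_cis_2pi:
  assumes "cmod z = 1"
  obtains x where "0 \<le> x" "x < 1" "z = cis (2 * pi * x)"
proof -
  obtain t where t: "0 \<le> t" "t < 2 * pi" "z = cis t"
    using Arg2pi_ge_0[of z] Arg2pi_lt_2pi[of z] Arg2pi_eq[of z] assms by (auto simp: cis_conv_exp)
  show ?thesis by (rule that[of "t / (2 * pi)"]) (use t in auto)
qed

text \<open>In a finite family of disjoint closed sets every member is open and closed relative to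
  the union, so a connected set meeting it stays inside.\<close>

lemma components_finite_Union_closed:
  fixes F :: "'a::topological_space set set"
  assumes fin: "finite F" and closed: "\<And>C. C \<in> F \<Longrightarrow> closed C" and con: "\<And>C. C \<in> F \<Longrightarrow> connected C"
    and ne: "{} \<notin> F" and disj: "\<And>C C'. C \<in> F \<Longrightarrow> C' \<in> F \<Longrightarrow> C \<noteq> C' \<Longrightarrow> C \<inter> C' = {}"
  shows "components (\<Union>F) = F"
proof -
  have sub: "C \<in> components (\<Union>F)" if C: "C \<in> F" for C
    unfolding in_components_maximal
  proof (intro conjI allI impI)
    show "C \<noteq> {}" "C \<subseteq> \<Union>F" "connected C" using C ne con by auto
    fix D assume D: "D \<noteq> {} \<and> C \<subseteq> D \<and> D \<subseteq> \<Union>F \<and> connected D"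
    have "closed (\<Union>(F - {C}))" using fin closed by (intro closed_Union) auto
    moreover have "C \<inter> C' = {}" if "C' \<in> F - {C}" for C' using disj[OF C, of C'] that by auto
    then have "C \<inter> \<Union>(F - {C}) \<inter> D = {}" by blast
    moreover have cover: "D \<subseteq> C \<union> \<Union>(F - {C})" using D C by auto
    ultimately have "C \<inter> D = {} \<or> \<Union>(F - {C}) \<inter> D = {}"
      using D closed[OF C] by (intro connected_closedD) auto
    moreover have "C \<inter> D = C" "C \<noteq> {}" using D ne C by auto
    ultimately show "D = C" using cover D by blast
  qed
  moreover have "C \<in> F" if C: "C \<in> components (\<Union>F)" for C
  proof -
    obtain x where x: "x \<in> C" using C in_components_nonempty by blast
    then obtain C' where C': "C' \<in> F" "x \<in> C'" using C in_components_subset by blast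
    then have "C = C'" using components_eq[OF C sub[OF C'(1)]] x by blast
    then show ?thesis using C' by simp
  qed
  ultimately show ?thesis by blast
qed

text \<open>The quotient group appears through a numbering \<open>ix\<close> of its elements and a
  section \<open>rep\<close>, so that the matrix results over {..<N} apply to functions on it.
  Normality makes \<open>ix\<close> compatible with addition on either side.\<close>

locale quot =
  fixes H :: "'g::group_add set" and f :: "'g \<Rightarrow> int" and ix :: "'g \<Rightarrow> nat" and rep :: "nat \<Rightarrow> 'g" and N :: nat
  assumes wb: "well_balanced (\<lambda>s. real_of_int (f s))" and inf: "infinite (UNIV :: 'g set)"
    and normal: "normal_subgrp H" and N_card: "N = card (cosets H)"
    and ix_lt: "\<And>a. ix a < N" and ix_rep: "\<And>i. i < N \<Longrightarrow> ix (rep i) = i"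
    and ix_eq: "\<And>a b. ix a = ix b \<longleftrightarrow> - a + b \<in> H"

lemma quot_exists:
  assumes "well_balanced (\<lambda>s. real_of_int (f s))" "infinite (UNIV :: 'g::group_add set)"
    "normal_subgrp (H :: 'g set)" "finite_index H"
  obtains ix rep where "quot H f ix rep (card (cosets H))"
proof -
  have sub: "subgrp H" using assms by (simp add: normal_subgrp_def)
  obtain h where h: "bij_betw h {0..<card (cosets H)} (cosets H)"
    using assms ex_bij_betw_nat_finite unfolding finite_index_def by blast
  define ix where "ix g = inv_into {0..<card (cosets H)} h (lcoset g H)" for g
  have in_c: "lcoset g H \<in> cosets H" for g by (auto simp: cosets_def)
  have im: "lcoset g H \<in> h ` {0..<card (cosets H)}" for g
    using h in_c[of g] by (simp add: bij_betw_def)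
  have hix: "h (ix g) = lcoset g H" "ix g < card (cosets H)" for g
    using f_inv_into_f[OF im[of g]] inv_into_into[OF im[of g]] by (simp_all add: ix_def)
  have "\<exists>g. ix g = i" if "i < card (cosets H)" for i
  proof -
    have "h i \<in> cosets H" using h that by (auto simp: bij_betw_def)
    then obtain g where "h i = lcoset g H" by (auto simp: cosets_def)
    then have "ix g = i" using h that inv_into_f_f[of h "{0..<card (cosets H)}" i] by (simp add: ix_def bij_betw_def)
    then show ?thesis ..
  qed
  then obtain rep where rep: "\<And>i. i < card (cosets H) \<Longrightarrow> ix (rep i) = i" by metis
  have "ix a = ix b \<longleftrightarrow> - a + b \<in> H" for a b
    using hix lcoset_eq_iff[OF sub] by (metis ix_def)
  then show ?thesis
    using that[of ix rep] assms hix rep by (simp add: quot_def)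
qed

context quot
begin

lemma subgrp_H: "subgrp H" using normal by (simp add: normal_subgrp_def)
lemma H_0: "0 \<in> H" and H_add: "a \<in> H \<Longrightarrow> b \<in> H \<Longrightarrow> a + b \<in> H" and H_minus: "a \<in> H \<Longrightarrow> - a \<in> H"
  using subgrp_H by (auto simp: subgrp_def)
lemma H_conj: "h \<in> H \<Longrightarrow> g + h - g \<in> H" using normal by (simp add: normal_subgrp_def)

lemma fin_supp: "finite (supp f)" and sum_f: "(\<Sum>s\<in>supp f. f s) = 0"
  and f_nonpos: "s \<noteq> 0 \<Longrightarrow> f s \<le> 0" and f_sym: "f (- s) = f s" and supp_gen: "gen_subgrp (supp f) = UNIV"
proof -
  have s: "supp (\<lambda>s. real_of_int (f s)) = supp f" by (simp add: supp_def)
  have "real_of_int (\<Sum>s\<in>supp f. f s) = 0" using wb by (simp add: well_balanced_def s)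
  then show "(\<Sum>s\<in>supp f. f s) = 0" by linarith
  show "finite (supp f)" "s \<noteq> 0 \<Longrightarrow> f s \<le> 0" "f (- s) = f s" "gen_subgrp (supp f) = UNIV"
    using wb by (auto simp: well_balanced_def s)
qed

lemma ix_add: "ix a = ix b \<Longrightarrow> ix (a + s) = ix (b + s)"
proof -
  assume "ix a = ix b"
  then have "- s + (- a + b) - (- s) \<in> H" using ix_eq H_conj by blast
  moreover have "- (a + s) + (b + s) = - s + (- a + b) - (- s)" by (simp only: minus_add diff_conv_add_uminus minus_minus add.assoc)
  ultimately show ?thesis using ix_eq by metis
qed

lemma ix_add_left: "ix (s + a) = ix (s + b) \<longleftrightarrow> ix a = ix b"
  by (simp add: ix_eq minus_add add.assoc[symmetric])

lemma ix_minus: "ix a = ix b \<Longrightarrow> ix (- a) = ix (- b)"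
proof -
  assume "ix a = ix b"
  then have "- a + b \<in> H" using ix_eq by blast
  then have "a + (- a + b) - a \<in> H" by (rule H_conj)
  then have "b - a \<in> H" by (simp add: add.assoc[symmetric])
  then have "- (b - a) \<in> H" by (rule H_minus)
  then show ?thesis by (simp add: ix_eq)
qed

lemma ix_add_H: "h \<in> H \<Longrightarrow> ix (a + h) = ix a"
  using ix_eq[of "a + h" a] H_minus by (simp add: minus_add)

lemma ix_H_add: "h \<in> H \<Longrightarrow> ix (h + a) = ix a"
proof -
  assume "h \<in> H"
  then have "ix h = ix 0" using ix_add_H[of h 0] by simp
  from ix_add[OF this, of a] show ?thesis by simp
qed

text \<open>The Cayley graph of the quotient: weights of generators with the same image add up, and
  generators inside H become loops.\<close>

definition cc :: "nat \<Rightarrow> nat \<Rightarrow> int" where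
  "cc i j = (\<Sum>s\<in>supp f - {0}. if ix (rep i + s) = j then - f s else 0)"

definition dd :: int where "dd = f 0"

lemma ix_rep_add: "ix (rep (ix a) + s) = ix (a + s)"
  by (rule ix_add) (simp add: ix_rep ix_lt)

lemma ix_sum_edge: "(\<Sum>j<N. if ix a = j then g j else 0) = g (ix a)"
  using ix_lt[of a] by (simp add: sum.delta)

lemma dd_eq: "dd = - (\<Sum>s\<in>supp f - {0}. f s)"
proof (cases "0 \<in> supp f")
  case True
  then show ?thesis using sum_f fin_supp by (simp add: dd_def sum.remove[of _ 0])
next
  case False
  then show ?thesis using sum_f by (simp add: dd_def supp_def Diff_triv)
qed

text \<open>If the integer f 0 were not positive, all other coefficients would have to vanish, being
  non-positive with sum - f 0; the support would lie in {0} and could not generate an infinite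
  group.\<close>

lemma dd_pos: "1 \<le> dd"
proof (rule ccontr)
  assume "\<not> 1 \<le> dd"
  then have "(\<Sum>s\<in>supp f - {0}. - f s) \<le> 0" by (simp add: dd_eq sum_negf)
  moreover have "0 \<le> - f s" if "s \<in> supp f - {0}" for s using that f_nonpos by auto
  ultimately have "- f s = 0" if "s \<in> supp f - {0}" for s
    using that fin_supp sum_nonneg_0[of "supp f - {0}" "\<lambda>s. - f s"] sum_nonneg[of "supp f - {0}" "\<lambda>s. - f s"]
    by (metis (no_types, lifting) finite_Diff order_antisym)
  then have "supp f \<subseteq> {0}" by (auto simp: supp_def)
  then have "{0} \<in> {H. subgrp H \<and> supp f \<subseteq> H}" by (auto simp: subgrp_def)
  then have "gen_subgrp (supp f) \<subseteq> {0}" unfolding gen_subgrp_def by blast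
  then show False using supp_gen inf by (metis finite.emptyI finite_insert finite_subset)
qed

lemma cc_ix: "cc (ix a) j = (\<Sum>s\<in>supp f - {0}. if ix (a + s) = j then - f s else 0)"
  by (simp add: cc_def ix_rep_add)

lemma cc_nonneg: "0 \<le> cc i j"
  unfolding cc_def using f_nonpos by (intro sum_nonneg) auto

lemma cc_edge: "s \<in> supp f - {0} \<Longrightarrow> 0 < cc (ix a) (ix (a + s))"
proof -
  assume s: "s \<in> supp f - {0}"
  then have "f s \<noteq> 0" "f s \<le> 0" using f_nonpos by (auto simp: supp_def)
  then have "0 < (if ix (a + s) = ix (a + s) then - f s else 0)" by simp
  also have "\<dots> \<le> cc (ix a) (ix (a + s))"
    unfolding cc_ix using s fin_supp f_nonpos
    by (intro member_le_sum[of s "supp f - {0}" "\<lambda>s'. if ix (a + s') = ix (a + s) then - f s' else 0"]) auto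
  finally show ?thesis .
qed

lemma cc_edgeD: "0 < cc (ix a) j \<Longrightarrow> \<exists>s\<in>supp f - {0}. j = ix (a + s)"
proof (rule ccontr)
  assume "0 < cc (ix a) j" and "\<not> (\<exists>s\<in>supp f - {0}. j = ix (a + s))"
  moreover from this have "cc (ix a) j = 0" unfolding cc_ix by (intro sum.neutral) auto
  ultimately show False by simp
qed

lemma supp_minus: "- s \<in> supp f \<longleftrightarrow> s \<in> supp f"
  by (simp add: supp_def f_sym)

lemma cc_sym: "i < N \<Longrightarrow> j < N \<Longrightarrow> cc i j = cc j i"
proof -
  assume ij: "i < N" "j < N"
  have flip: "ix (a + s) = ix b \<longleftrightarrow> ix (b + (- s)) = ix a" for a b s
    using ix_add[of "a + s" b "- s"] ix_add[of "b + (- s)" a s] by (auto simp: add.assoc)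
  have "cc i j = (\<Sum>s\<in>supp f - {0}. if ix (rep j + (- s)) = i then - f (- s) else 0)"
    unfolding cc_def using flip[of "rep i" _ "rep j"] ij by (intro sum.cong) (auto simp: ix_rep f_sym)
  also have "\<dots> = cc j i"
    unfolding cc_def by (rule sum.reindex_bij_witness[of _ uminus uminus]) (auto simp: supp_minus)
  finally show ?thesis .
qed

lemma cc_sum: "i < N \<Longrightarrow> (\<Sum>j<N. cc i j) = dd"
  unfolding cc_def by (subst sum.swap) (simp add: ix_lt dd_eq sum_negf)

text \<open>The elements whose right translation keeps every vertex in its component form a subgroup
  containing the support of f, hence the whole group. Having both directions in \<open>K\<close>
  gives closure under inverses.\<close>

lemma cc_connected: "i < N \<Longrightarrow> j < N \<Longrightarrow> (i, j) \<in> {(i, j). i < N \<and> j < N \<and> 0 < cc i j}\<^sup>*"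
proof -
  let ?E = "{(i, j). i < N \<and> j < N \<and> 0 < cc i j}"
  define K where "K = {g. \<forall>a. (ix a, ix (a + g)) \<in> ?E\<^sup>* \<and> (ix (a + g), ix a) \<in> ?E\<^sup>*}"
  have "subgrp K"
    unfolding subgrp_def
  proof (intro conjI ballI)
    show "0 \<in> K" by (simp add: K_def)
    fix x assume x: "x \<in> K"
    show "- x \<in> K"
      unfolding K_def
    proof (intro CollectI allI)
      fix a
      have "(ix (a - x), ix (a - x + x)) \<in> ?E\<^sup>* \<and> (ix (a - x + x), ix (a - x)) \<in> ?E\<^sup>*"
        using x unfolding K_def by blast
      then show "(ix a, ix (a + - x)) \<in> ?E\<^sup>* \<and> (ix (a + - x), ix a) \<in> ?E\<^sup>*" by simp
    qed
    fix y assume y: "y \<in> K"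
    show "x + y \<in> K"
      unfolding K_def
    proof (intro CollectI allI)
      fix a
      have "(ix a, ix (a + x)) \<in> ?E\<^sup>*" "(ix (a + x), ix a) \<in> ?E\<^sup>*" using x by (auto simp: K_def)
      moreover have "(ix (a + x), ix (a + x + y)) \<in> ?E\<^sup>*" "(ix (a + x + y), ix (a + x)) \<in> ?E\<^sup>*"
        using y unfolding K_def by blast+
      ultimately show "(ix a, ix (a + (x + y))) \<in> ?E\<^sup>* \<and> (ix (a + (x + y)), ix a) \<in> ?E\<^sup>*"
        unfolding add.assoc by (meson rtrancl_trans)
    qed
  qed
  moreover have "supp f \<subseteq> K"
  proof
    fix s assume s: "s \<in> supp f"
    show "s \<in> K"
    proof (cases "s = 0")
      case False
      then have "(ix a, ix (a + s)) \<in> ?E" "(ix (a + s), ix a) \<in> ?E" for a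
        using cc_edge[of s a] s ix_lt by (auto simp: cc_sym)
      then show ?thesis unfolding K_def by blast
    qed (simp add: K_def)
  qed
  ultimately have "gen_subgrp (supp f) \<subseteq> K" unfolding gen_subgrp_def by blast
  then have K: "K = UNIV" using supp_gen by blast
  assume "i < N" "j < N"
  moreover have "(ix (rep i), ix (rep i + (- rep i + rep j))) \<in> ?E\<^sup>*"
    using K unfolding K_def by blast
  ultimately show ?thesis by (simp add: ix_rep add.assoc[symmetric])
qed

sublocale wgraph N cc dd
  using ix_lt[of 0] dd_pos cc_nonneg cc_sym cc_sum cc_connected by unfold_locales auto

lemma lap_ix: "lap y (ix t) = (\<Sum>s\<in>supp f. of_int (f s) * y (ix (t + s)))"
proof -
  have "(\<Sum>j<N. of_int (cc (ix t) j) * y j) = (\<Sum>j<N. \<Sum>s\<in>supp f - {0}. if ix (t + s) = j then - of_int (f s) * y j else 0)"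
    unfolding cc_ix of_int_sum sum_distrib_right by (intro sum.cong refl) auto
  also have "\<dots> = (\<Sum>s\<in>supp f - {0}. \<Sum>j<N. if ix (t + s) = j then - of_int (f s) * y j else 0)"
    by (rule sum.swap)
  also have "\<dots> = - (\<Sum>s\<in>supp f - {0}. of_int (f s) * y (ix (t + s)))"
    by (simp add: ix_sum_edge sum_negf)
  finally have "lap y (ix t) = of_int (f 0) * y (ix (t + 0)) + (\<Sum>s\<in>supp f - {0}. of_int (f s) * y (ix (t + s)))"
    unfolding lap_def by (simp add: dd_def)
  then show ?thesis
  proof (cases "0 \<in> supp f")
    case True
    then show ?thesis using \<open>lap y (ix t) = _\<close> fin_supp by (simp add: sum.remove[of _ 0])
  next
    case False
    then show ?thesis using \<open>lap y (ix t) = _\<close> by (simp add: supp_def Diff_triv)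
  qed
qed

definition emb :: "(nat \<Rightarrow> real) \<Rightarrow> 'g \<Rightarrow> complex" where
  "emb y = (\<lambda>t. cis (2 * pi * y (ix t)))"

lemma prod_emb: "(\<Prod>s\<in>supp f. emb y (t + s) powi f s) = cis (2 * pi * lap y (ix t))"
  by (simp add: emb_def prod_cis_powi lap_ix sum_distrib_left mult_ac)

lemma emb_in_fix:
  assumes "\<And>i. i < N \<Longrightarrow> lap y i \<in> \<int>"
  shows "emb y \<in> fix_set H (harmonic_model f)"
proof -
  have "shift s (emb y) = emb y" if "s \<in> H" for s
    using ix_H_add[OF H_minus[OF that]] by (auto simp: shift_def emb_def fun_eq_iff)
  moreover have "emb y \<in> harmonic_model f"
    using assms ix_lt by (auto simp: harmonic_model_def prod_emb cis_2pi_eq_1_iff) (simp add: emb_def)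
  ultimately show ?thesis by (simp add: fix_set_def)
qed

lemma fix_emb:
  assumes x: "x \<in> fix_set H (harmonic_model f)"
  obtains y where "x = emb y" "\<And>i. i < N \<Longrightarrow> lap y i \<in> \<int>" "\<And>i. i < N \<Longrightarrow> 0 \<le> y i \<and> y i < 1"
proof -
  have "\<exists>u. 0 \<le> u \<and> u < 1 \<and> x (rep i) = cis (2 * pi * u)" for i
    using x unit_circle_cis_2pi[of "x (rep i)"] by (auto simp: fix_set_def harmonic_model_def) metis
  then obtain y where y: "\<And>i. 0 \<le> y i \<and> y i < 1 \<and> x (rep i) = cis (2 * pi * y i)" by metis
  \<comment> \<open>\<open>shift\<close> gives invariance under left translation by H, whereas
    \<open>ix\<close> classifies the cosets a + H; normality, through \<open>ix_minus\<close>,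
    reconciles the two.\<close>
  have per: "x t = x t'" if "ix t = ix t'" for t t'
  proof -
    have "ix (- t) = ix (- t')" using that by (rule ix_minus)
    then have "t - t' \<in> H" using ix_eq by simp
    then have "shift (t - t') x = x" using x by (simp add: fix_set_def)
    then have "x (- (t - t') + t) = x t" by (metis shift_def)
    then show ?thesis by (simp add: minus_diff_eq add.assoc)
  qed
  have xy: "x = emb y"
    using per[of _ "rep (ix t)" for t] y by (auto simp: emb_def fun_eq_iff ix_rep ix_lt)
  moreover have "lap y i \<in> \<int>" if "i < N" for i
  proof -
    have "(\<Prod>s\<in>supp f. emb y (rep i + s) powi f s) = 1"
      using x unfolding xy by (auto simp: fix_set_def harmonic_model_def)
    then show ?thesis using that by (simp add: prod_emb cis_2pi_eq_1_iff ix_rep)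
  qed
  ultimately show ?thesis using that y by blast
qed

text \<open>The values of a Laplacian sum to zero, so the equation at vertex 0, which
  \<open>imat {0}\<close> replaces by grounding, follows from the others.\<close>

lemma lap_Ints_all:
  assumes "\<And>i. i < N \<Longrightarrow> i \<noteq> 0 \<Longrightarrow> lap y i \<in> \<int>" "i < N"
  shows "lap y i \<in> \<int>"
proof (cases "i = 0")
  case True
  have "lap y 0 + (\<Sum>i\<in>{..<N} - {0}. lap y i) = 0"
    using sum_lap[of y] N_pos by (simp add: sum.remove[of _ 0])
  moreover have "(\<Sum>i\<in>{..<N} - {0}. lap y i) \<in> \<int>" using assms by (intro Ints_sum) auto
  ultimately show ?thesis using True by (metis Ints_0 Ints_diff add_diff_cancel_right')
qed (use assms in auto)

lemma torus_sol_0: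
  assumes "y \<in> torus_sol N (imat {0})"
  shows "y 0 = 0" "\<And>i. i < N \<Longrightarrow> lap y i \<in> \<int>" "\<And>i. i < N \<Longrightarrow> 0 \<le> y i \<and> y i < 1"
proof -
  have y: "\<And>i. i < N \<Longrightarrow> (if i \<in> {0} then y i else lap y i) \<in> \<int>" "y \<in> {..<N} \<rightarrow>\<^sub>E {0..<1}"
    using assms by (auto simp: torus_sol_def imat_row split: if_splits)
  show b: "0 \<le> y i \<and> y i < 1" if "i < N" for i using y(2) that by (auto simp: PiE_iff)
  show "y 0 = 0" using y(1)[of 0] b[of 0] N_pos by (metis frac_eq frac_eq_0_iff singletonI)
  show "lap y i \<in> \<int>" if "i < N" for i
    by (rule lap_Ints_all[OF _ that]) (use y(1) in \<open>metis singletonD\<close>)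
qed

text \<open>Subtracting the value at vertex 0 writes each fixed point as a constant times a
  normalised solution. The fixed set is thus a disjoint union of translates of the circle of
  constants, one for each element of \<open>torus_sol N (imat {0})\<close>.\<close>

lemma card_components_fix: "card (components (fix_set H (harmonic_model f))) = tau"
proof -
  define C where "C y = (\<lambda>u t. u * emb y t) ` sphere 0 1" for y
  let ?K = "torus_sol N (imat {0})"
  have finK: "finite ?K"
    using imat_det_pos[of 0 "{0}"] N_pos by (intro finite_torus_sol) auto
  have inter: "y = y'" if yK: "y \<in> ?K" "y' \<in> ?K" and meet: "C y \<inter> C y' \<noteq> {}" for y y'
  proof -
    obtain x where "x \<in> C y" "x \<in> C y'" using meet by blast
    then obtain u u' where u: "cmod u = 1" "cmod u' = 1" "\<And>t. u * emb y t = u' * emb y' t"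
      unfolding C_def by (metis (no_types, lifting) imageE mem_sphere_0)
    have "emb y (rep 0) = 1" "emb y' (rep 0) = 1"
      using torus_sol_0(1)[OF yK(1)] torus_sol_0(1)[OF yK(2)] N_pos by (auto simp: emb_def ix_rep)
    then have "u = u'" using u(3)[of "rep 0"] by simp
    moreover have "u \<noteq> 0" using u(1) by auto
    ultimately have emb_eq: "emb y t = emb y' t" for t using u(3)[of t] by simp
    have "y i = y' i" if i: "i < N" for i
    proof -
      have "y i - y' i \<in> \<int>"
        using emb_eq[of "rep i"] i by (simp add: emb_def ix_rep cis_2pi_eq_iff)
      moreover have "\<bar>y i - y' i\<bar> < 1"
        using torus_sol_0(3)[OF yK(1) i] torus_sol_0(3)[OF yK(2) i] by auto
      ultimately show ?thesis by (metis Ints_nonzero_abs_less1 right_minus_eq)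
    qed
    then show ?thesis using yK unfolding torus_sol_def by (intro PiE_ext[of y "{..<N}" _ y']) auto
  qed
  have comp: "compact (C y)" and con: "connected (C y)" for y
  proof -
    have cont: "continuous_on (sphere 0 1) (\<lambda>u t. u * emb y t)"
      by (intro continuous_on_coordinatewise_then_product continuous_intros)
    then show "compact (C y)" unfolding C_def by (intro compact_continuous_image) auto
    have "connected (sphere (0::complex) 1)" by (intro connected_sphere) simp
    then show "connected (C y)" unfolding C_def using cont by (intro connected_continuous_image)
  qed
  have union: "\<Union>(C ` ?K) = fix_set H (harmonic_model f)"
  proof (intro equalityI subsetI)
    fix x assume "x \<in> \<Union>(C ` ?K)"
    then obtain y u where y: "y \<in> ?K" "cmod u = 1" "x = (\<lambda>t. u * emb y t)" by (auto simp: C_def)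
    obtain v where v: "u = cis (2 * pi * v)" using unit_circle_cis_2pi[OF y(2)] by metis
    have "x = emb (\<lambda>i. v + y i)" unfolding y(3) v by (simp add: emb_def cis_mult distrib_left)
    moreover have "lap (\<lambda>i. v + y i) i \<in> \<int>" if "i < N" for i
      using torus_sol_0(2)[OF y(1) that] by (simp add: lap_add lap_const that)
    ultimately show "x \<in> fix_set H (harmonic_model f)" using emb_in_fix by blast
  next
    fix x assume "x \<in> fix_set H (harmonic_model f)"
    then obtain y where y: "x = emb y" "\<And>i. i < N \<Longrightarrow> lap y i \<in> \<int>" using fix_emb by blast
    define z where "z = tfrac N (\<lambda>i. y i - y 0)"
    have "lap (\<lambda>i. y i - y 0) i \<in> \<int>" if "i < N" for i
      using y(2)[OF that] lap_diff[of y "\<lambda>_. y 0" i] by (simp add: lap_const that)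
    then have "(if i \<in> {0} then y i - y 0 else lap (\<lambda>i. y i - y 0) i) \<in> \<int>" if "i < N" for i
      using that by auto
    then have "z \<in> ?K"
      unfolding z_def torus_sol_def mem_Collect_eq sum_tfrac_Ints_iff'
      using tfrac_PiE[of N] by (simp add: imat_row)
    moreover have "x = (\<lambda>t. cis (2 * pi * y 0) * emb z t)"
    proof
      fix t
      have "z (ix t) = frac (y (ix t) - y 0)" using ix_lt by (simp add: z_def tfrac_def)
      then have "y (ix t) - (y 0 + z (ix t)) = of_int \<lfloor>y (ix t) - y 0\<rfloor>" by (simp add: frac_def)
      then have "y (ix t) - (y 0 + z (ix t)) \<in> \<int>" by simp
      then have "cis (2 * pi * y (ix t)) = cis (2 * pi * (y 0 + z (ix t)))" by (simp add: cis_2pi_eq_iff)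
      then show "x t = cis (2 * pi * y 0) * emb z t"
        unfolding y(1) by (simp add: emb_def cis_mult distrib_left)
    qed
    ultimately show "x \<in> \<Union>(C ` ?K)" unfolding C_def by (auto intro!: image_eqI[of _ _ "cis (2 * pi * y 0)"])
  qed
  have ne: "C y \<noteq> {}" for y by (auto simp: C_def)
  have "components (\<Union>(C ` ?K)) = C ` ?K"
  proof (rule components_finite_Union_closed)
    show "closed X" if "X \<in> C ` ?K" for X using that comp by (auto intro: compact_imp_closed)
    show "X \<inter> X' = {}" if "X \<in> C ` ?K" "X' \<in> C ` ?K" "X \<noteq> X'" for X X'
      using that inter by auto
  qed (use finK con ne in auto)
  moreover have "inj_on C ?K" using inter ne by (metis Int_absorb inj_onI)
  ultimately show ?thesis by (simp add: union tau_def card_image)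
qed

primrec wball :: "nat \<Rightarrow> 'g set" where
  "wball 0 = {0}"
| "wball (Suc r) = (\<lambda>(w, s). w + s) ` (wball r \<times> insert 0 (supp f))"

lemma finite_wball: "finite (wball r)"
  by (induction r) (auto simp: fin_supp)

lemma relpow_adj_wball: "(ix a, j) \<in> adj ^^ m \<Longrightarrow> \<exists>w\<in>wball m. j = ix (a + w)"
proof (induction m arbitrary: j)
  case (Suc m)
  then obtain k where k: "(ix a, k) \<in> adj ^^ m" "(k, j) \<in> adj" by auto
  then obtain w where w: "w \<in> wball m" "k = ix (a + w)" using Suc.IH by blast
  then obtain s where s: "s \<in> supp f - {0}" "j = ix (a + w + s)"
    using k(2) cc_edgeD[of "a + w" j] by (auto simp: adj_def)
  have "(\<lambda>(w, s). w + s) (w, s) \<in> wball (Suc m)"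
    unfolding wball.simps using w s by (intro imageI) auto
  then show ?case using s(2) by (intro bexI[of _ "w + s"]) (auto simp: add.assoc)
qed auto

lemma wball_relpow_adj: "w \<in> wball m \<Longrightarrow> \<exists>l\<le>m. (ix a, ix (a + w)) \<in> adj ^^ l"
proof (induction m arbitrary: w)
  case (Suc m)
  then obtain v s where v: "v \<in> wball m" "s \<in> insert 0 (supp f)" "w = v + s" by auto
  then obtain l where l: "l \<le> m" "(ix a, ix (a + v)) \<in> adj ^^ l" using Suc.IH by blast
  show ?case
  proof (cases "s = 0")
    case True
    then show ?thesis using l v by (auto intro!: exI[of _ l])
  next
    case False
    then have "(ix (a + v), ix (a + v + s)) \<in> adj"
      using v cc_edge[of s "a + v"] ix_lt by (auto simp: adj_def)
    then have "(ix a, ix (a + w)) \<in> adj ^^ Suc l" using l(2) v(3) by (auto simp: add.assoc)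
    then show ?thesis using l(1) by (intro exI[of _ "Suc l"]) auto
  qed
qed auto

end

section \<open>Convolution powers and traces\<close>

text \<open>The powers of f in the integral group ring. The value at 0 of the k-th power will be the
  k-th moment of the spectral measure.\<close>

primrec convpow :: "('g::group_add \<Rightarrow> int) \<Rightarrow> nat \<Rightarrow> 'g \<Rightarrow> int" where
  "convpow f 0 w = (if w = 0 then 1 else 0)"
| "convpow f (Suc k) w = (\<Sum>s\<in>supp f. convpow f k (w - s) * f s)"

lemma finite_supp_convpow: "finite (supp f) \<Longrightarrow> finite (supp (convpow f k))"
proof (induction k)
  case 0
  have "supp (convpow f 0) \<subseteq> {0}" by (auto simp: supp_def)
  then show ?case using finite_subset by blast
next
  case (Suc k)
  have "supp (convpow f (Suc k)) \<subseteq> (\<lambda>(v, s). v + s) ` (supp (convpow f k) \<times> supp f)"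
  proof
    fix w assume "w \<in> supp (convpow f (Suc k))"
    then obtain s where "s \<in> supp f" "convpow f k (w - s) \<noteq> 0"
      unfolding supp_def by (auto elim!: sum.not_neutral_contains_not_neutral)
    then show "w \<in> (\<lambda>(v, s). v + s) ` (supp (convpow f k) \<times> supp f)"
      by (auto simp: supp_def intro!: image_eqI[of _ _ "(w - s, s)"])
  qed
  then show ?case using Suc by (metis finite_SigmaI finite_imageI finite_subset)
qed

context quot
begin

lemma imat_ix: "imat {} (ix a) j = (\<Sum>s\<in>supp f. if ix (a + s) = j then f s else 0)"
proof -
  have "imat {} (ix a) j = (if ix (a + 0) = j then f 0 else 0) + (\<Sum>s\<in>supp f - {0}. if ix (a + s) = j then f s else 0)"
    unfolding imat_def cc_ix by (simp add: dd_def sum_negf[symmetric] if_distrib cong: if_cong)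
  then show ?thesis
  proof (cases "0 \<in> supp f")
    case True
    then show ?thesis using \<open>imat {} (ix a) j = _\<close> fin_supp by (simp add: sum.remove[of _ 0])
  next
    case False
    then show ?thesis using \<open>imat {} (ix a) j = _\<close> by (simp add: supp_def Diff_triv)
  qed
qed

text \<open>Powers of the quotient Laplacian are push-forwards of convolution powers. The summation
  set W is left arbitrary so that the induction may pass to a set containing all products v +
  s.\<close>

lemma fpow_imat:
  assumes "finite W" "supp (convpow f k) \<subseteq> W"
  shows "fpow N (imat {}) k (ix a) j = (\<Sum>w\<in>W. if ix (a + w) = j then convpow f k w else 0)"
  using assms
proof (induction k arbitrary: j W)
  case 0
  have "(\<Sum>w\<in>W. if ix (a + w) = j then convpow f 0 w else 0) = (\<Sum>w\<in>W. if w = 0 then if ix a = j then 1 else 0 else 0)"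
    by (intro sum.cong) auto
  moreover have "0 \<in> W" using 0 by (auto simp: supp_def)
  ultimately show ?case using 0 by (simp add: sum.delta')
next
  case (Suc k)
  let ?V = "supp (convpow f k)"
  \<comment> \<open>A product v + s may leave the support of the next power by cancellation, so it
    has to be added to W.\<close>
  let ?W = "W \<union> (\<lambda>(v, s). v + s) ` (?V \<times> supp f)"
  have finV: "finite ?V" using finite_supp_convpow[OF fin_supp] .
  have finW: "finite ?W" using finV fin_supp Suc.prems by auto
  have "fpow N (imat {}) (Suc k) (ix a) j = (\<Sum>l<N. \<Sum>v\<in>?V. if ix (a + v) = l then convpow f k v * imat {} l j else 0)"
    by (simp add: Suc.IH[OF finV order_refl] sum_distrib_right if_distrib[of "\<lambda>x. x * _"] cong: if_cong)
  also have "\<dots> = (\<Sum>v\<in>?V. convpow f k v * imat {} (ix (a + v)) j)"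
    by (subst sum.swap) (simp add: ix_sum_edge)
  also have "\<dots> = (\<Sum>v\<in>?V. \<Sum>s\<in>supp f. if ix (a + (v + s)) = j then convpow f k v * f s else 0)"
    unfolding imat_ix sum_distrib_left by (intro sum.cong refl) (simp add: add.assoc)
  \<comment> \<open>A dummy sum over w = v + s is inserted; exchanging the sums then leaves v = w -
    s as the only term.\<close>
  also have "\<dots> = (\<Sum>v\<in>?V. \<Sum>s\<in>supp f. \<Sum>w\<in>?W. if w = v + s then if ix (a + w) = j then convpow f k (w - s) * f s else 0 else 0)"
    using finW by (intro sum.cong refl) (auto simp: sum.delta)
  also have "\<dots> = (\<Sum>w\<in>?W. \<Sum>s\<in>supp f. \<Sum>v\<in>?V. if w = v + s then if ix (a + w) = j then convpow f k (w - s) * f s else 0 else 0)"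
    by (subst sum.swap[of _ "supp f" ?V], subst sum.swap[of _ ?W ?V]) (subst sum.swap[of _ ?W], rule refl)
  also have "\<dots> = (\<Sum>w\<in>?W. \<Sum>s\<in>supp f. if ix (a + w) = j then convpow f k (w - s) * f s else 0)"
  proof (intro sum.cong refl)
    fix w s
    have "(\<Sum>v\<in>?V. if w = v + s then if ix (a + w) = j then convpow f k (w - s) * f s else 0 else 0) =
        (\<Sum>v\<in>?V. if v = w - s then if ix (a + w) = j then convpow f k (w - s) * f s else 0 else 0)"
      by (intro sum.cong refl) (auto simp: eq_diff_eq)
    also have "\<dots> = (if ix (a + w) = j then convpow f k (w - s) * f s else 0)"
      using finV by (auto simp: sum.delta' supp_def)
    finally show "(\<Sum>v\<in>?V. if w = v + s then if ix (a + w) = j then convpow f k (w - s) * f s else 0 else 0) =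
        (if ix (a + w) = j then convpow f k (w - s) * f s else 0)" .
  qed
  also have "\<dots> = (\<Sum>w\<in>?W. if ix (a + w) = j then convpow f (Suc k) w else 0)"
    by (intro sum.cong refl) auto
  also have "\<dots> = (\<Sum>w\<in>W. if ix (a + w) = j then convpow f (Suc k) w else 0)"
    using finW Suc.prems by (intro sum.mono_neutral_right) (auto simp: supp_def simp del: convpow.simps)
  finally show ?case .
qed

text \<open>A diagonal entry sums the convolution power over the part of its support inside H. Once
  this part is at most the identity, the normalised trace on the quotient is the trace on the
  group.\<close>

lemma trace_fpow:
  assumes "supp (convpow f k) \<inter> H \<subseteq> {0}"
  shows "(\<Sum>i<N. fpow N (\<lambda>i j. real_of_int (imat {} i j)) k i i) = real N * of_int (convpow f k 0)"
proof -
  let ?V = "insert 0 (supp (convpow f k))"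
  have fin: "finite ?V" using finite_supp_convpow[OF fin_supp] by simp
  have "fpow N (imat {}) k i i = convpow f k 0" if i: "i < N" for i
  proof -
    have "fpow N (imat {}) k (ix (rep i)) i = (\<Sum>w\<in>?V. if ix (rep i + w) = i then convpow f k w else 0)"
      by (rule fpow_imat[OF fin]) auto
    also have "\<dots> = (\<Sum>w\<in>?V. if w = 0 then convpow f k w else 0)"
    proof (intro sum.cong refl)
      fix w assume w: "w \<in> ?V"
      have "ix (rep i + w) = ix (rep i) \<longleftrightarrow> w \<in> H"
        using ix_add_left[of "rep i" w 0] ix_eq[of 0 w] by auto
      then show "(if ix (rep i + w) = i then convpow f k w else 0) = (if w = 0 then convpow f k w else 0)"
        using w assms H_0 i by (auto simp: ix_rep)
    qed
    also have "\<dots> = convpow f k 0" using fin by (simp add: sum.delta')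
    finally show ?thesis using i by (simp add: ix_rep)
  qed
  moreover have "fpow N (\<lambda>i j. real_of_int (imat {} i j)) k i j = of_int (fpow N (imat {}) k i j)" for i j
    by (induction k arbitrary: j) auto
  ultimately show ?thesis by simp
qed

end


section \<open>Separated sofic maps: the upper bound\<close>

lemma norm_cis_diff_le: "cmod (cis a - cis b) \<le> \<bar>a - b\<bar>"
proof -
  have "cis a - cis b = cis b * (cis (a - b) - 1)" by (simp add: cis_mult right_diff_distrib)
  moreover have "cmod (cis (a - b) - 1) \<le> \<bar>a - b\<bar>"
    using iexp_approx1[of "a - b" 0] by (simp add: cis_conv_exp)
  ultimately show ?thesis by (simp add: norm_mult)
qed

lemma norm_cis_diff_mod_le:
  assumes "x - y - m \<in> \<int>"
  shows "cmod (cis (2 * pi * x) - cis (2 * pi * y)) \<le> 2 * pi * \<bar>m\<bar>"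
proof -
  have "x - (y + m) \<in> \<int>" using assms by (simp add: diff_diff_eq)
  then have "cis (2 * pi * x) = cis (2 * pi * (y + m))" by (simp only: cis_2pi_eq_iff)
  then show ?thesis using norm_cis_diff_le[of "2 * pi * (y + m)" "2 * pi * y"]
    by (simp add: algebra_simps abs_mult)
qed

text \<open>Were x at distance \<eta> or more from the integers, the real part alone would differ
  from 1 by at least 1 - cos (2 pi \<eta>), the cosine being decreasing on [0, pi].\<close>

lemma cis_near_1:
  assumes "cmod (cis (2 * pi * x) - 1) < 1 - cos (2 * pi * \<eta>)" "0 < \<eta>" "\<eta> \<le> 1 / 2"
  obtains m :: int where "\<bar>x - m\<bar> < \<eta>"
proof -
  define u where "u = x - of_int (round x)"
  have u: "\<bar>u\<bar> \<le> 1 / 2" using of_int_round_abs_le[of x] by (simp add: u_def abs_minus_commute)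
  have "cis (2 * pi * x) = cis (2 * pi * u)" by (simp add: cis_2pi_eq_iff u_def)
  then have "\<bar>cos (2 * pi * u) - 1\<bar> < 1 - cos (2 * pi * \<eta>)"
    using assms(1) abs_Re_le_cmod[of "cis (2 * pi * u) - 1"] by simp
  then have "cos (2 * pi * \<eta>) < cos (2 * pi * \<bar>u\<bar>)" by (cases "0 \<le> u") auto
  moreover have "cos (2 * pi * \<bar>u\<bar>) \<le> cos (2 * pi * \<eta>)" if "\<eta> \<le> \<bar>u\<bar>"
    using that u assms by (intro cos_monotone_0_pi_le) (auto simp: field_simps)
  ultimately have "\<bar>u\<bar> < \<eta>" by force
  then show ?thesis using that[of "round x"] by (simp add: u_def)
qed

lemma norm_powi_diff_le:
  assumes "cmod a = 1" "cmod b = 1"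
  shows "cmod (a powi k - b powi k) \<le> \<bar>of_int k\<bar> * cmod (a - b)"
proof (cases "0 \<le> k")
  case True
  then show ?thesis using norm_power_diff[of a b "nat k"] assms by (simp add: power_int_def)
next
  case False
  have inv: "inverse a = cnj a" "inverse b = cnj b" using assms by (simp_all add: inverse_complex_def complex_eq_iff cmod_def)
  have "cmod (inverse a ^ nat (- k) - inverse b ^ nat (- k)) \<le> real (nat (- k)) * cmod (inverse a - inverse b)"
    using assms by (intro norm_power_diff) (auto simp: norm_inverse)
  also have "cmod (inverse a - inverse b) = cmod (a - b)"
    unfolding inv by (metis complex_cnj_diff complex_mod_cnj)
  finally show ?thesis using False by (simp add: power_int_def power_inverse)
qed

lemma norm_powi_1: "cmod a = 1 \<Longrightarrow> cmod (a powi k) = 1"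
  by (simp add: norm_power_int)

lemma norm_prod_powi_diff_le:
  assumes "\<And>s. s \<in> A \<Longrightarrow> cmod (a s) = 1" "\<And>s. s \<in> A \<Longrightarrow> cmod (b s) = 1"
    and "\<And>s. s \<in> A \<Longrightarrow> cmod (a s - b s) \<le> e"
  shows "cmod ((\<Prod>s\<in>A. a s powi k s) - (\<Prod>s\<in>A. b s powi k s)) \<le> (\<Sum>s\<in>A. \<bar>of_int (k s)\<bar>) * e"
proof -
  have "cmod ((\<Prod>s\<in>A. a s powi k s) - (\<Prod>s\<in>A. b s powi k s)) \<le> (\<Sum>s\<in>A. cmod (a s powi k s - b s powi k s))"
    using assms(1,2) by (intro norm_prod_diff) (auto simp: norm_powi_1)
  also have "\<dots> \<le> (\<Sum>s\<in>A. \<bar>of_int (k s)\<bar> * e)"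
  proof (intro sum_mono)
    fix s assume s: "s \<in> A"
    have "cmod (a s powi k s - b s powi k s) \<le> \<bar>of_int (k s)\<bar> * cmod (a s - b s)"
      using assms s by (intro norm_powi_diff_le) auto
    also have "\<dots> \<le> \<bar>of_int (k s)\<bar> * e" using assms s by (intro mult_left_mono) auto
    finally show "cmod (a s powi k s - b s powi k s) \<le> \<bar>of_int (k s)\<bar> * e" .
  qed
  finally show ?thesis by (simp add: sum_distrib_right)
qed

lemma sum_Pow_power_card:
  fixes t :: real
  assumes "finite A"
  shows "(\<Sum>E\<in>Pow A. t ^ card E) = (1 + t) ^ card A"
  using assms
proof (induction A)
  case (insert a A)
  have "(\<Sum>E\<in>insert a ` Pow A. t ^ card E) = (\<Sum>E\<in>Pow A. t * t ^ card E)"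
    using insert by (subst sum.reindex) (auto simp: inj_on_def card_insert_if finite_subset intro!: sum.cong)
  moreover have "Pow A \<inter> insert a ` Pow A = {}" using insert by auto
  ultimately show ?case using insert
    by (simp add: Pow_insert sum.union_disjoint sum_distrib_left[symmetric] algebra_simps)
qed simp

text \<open>Chernoff bound: for t at most 1 the weight t^(card E - m) is at least 1 on the sets
  counted, and the weights t^(card E) of all subsets sum to (1 + t)^(card A).\<close>

lemma card_small_subsets_le:
  assumes "finite A" "0 < t" "t \<le> 1" "0 \<le> m"
  shows "real (card {E. E \<subseteq> A \<and> real (card E) \<le> m}) \<le> t powr (- m) * (1 + t) ^ card A"
proof -
  have "1 \<le> t powr (- m) * t ^ card E" if "real (card E) \<le> m" for E
  proof -
    have "1 \<le> t powr (real (card E) - m)" using powr_mono'[of "real (card E) - m" 0 t] assms that by simp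
    then show ?thesis using assms by (simp add: powr_diff powr_minus powr_realpow divide_simps mult.commute)
  qed
  then have "real (card {E. E \<subseteq> A \<and> real (card E) \<le> m}) \<le> (\<Sum>E\<in>{E. E \<subseteq> A \<and> real (card E) \<le> m}. t powr (- m) * t ^ card E)"
    using sum_mono[of "{E. E \<subseteq> A \<and> real (card E) \<le> m}" "\<lambda>_. 1 :: real" "\<lambda>E. t powr (- m) * t ^ card E"]
    by auto
  also have "\<dots> \<le> (\<Sum>E\<in>Pow A. t powr (- m) * t ^ card E)"
    using assms by (intro sum_mono2) auto
  also have "\<dots> = t powr (- m) * (1 + t) ^ card A"
    using assms by (simp add: sum_distrib_left[symmetric] sum_Pow_power_card)
  finally show ?thesis .
qed

section \<open>Approximate solutions and harmonic extension\<close>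

context wgraph
begin

text \<open>Chosen as a function of \<open>E\<close> and \<open>b\<close>, so that in the counting
  argument maps with equal codes share the same extension.\<close>

definition hext :: "nat set \<Rightarrow> (nat \<Rightarrow> real) \<Rightarrow> nat \<Rightarrow> real" where
  "hext E b = (SOME x. (\<forall>i<N. i \<in> E \<longrightarrow> x i = b i) \<and> (\<forall>i<N. i \<notin> E \<longrightarrow> lap x i = 0))"

lemma kills_0: "s \<in> E \<Longrightarrow> s < N \<Longrightarrow> kills (\<lambda>_. 0) E"
  by (auto simp: kills_def)

lemma hext:
  assumes "s \<in> E" "s < N"
  shows "i < N \<Longrightarrow> i \<in> E \<Longrightarrow> hext E b i = b i" "i < N \<Longrightarrow> i \<notin> E \<Longrightarrow> lap (hext E b) i = 0"
proof -
  obtain x where "\<And>i. i < N \<Longrightarrow> i \<in> E \<Longrightarrow> x i = (if i \<in> E then b i else 0)"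
    "\<And>i. i < N \<Longrightarrow> i \<notin> E \<Longrightarrow> lap x i + 0 * x i = (if i \<in> E then b i else 0)"
    using dirichlet_solution[OF kills_0[OF assms], where b = "\<lambda>i. if i \<in> E then b i else 0"] by blast
  then have "\<exists>x. (\<forall>i<N. i \<in> E \<longrightarrow> x i = b i) \<and> (\<forall>i<N. i \<notin> E \<longrightarrow> lap x i = 0)"
    by (intro exI[of _ x]) simp
  from someI_ex[OF this]
  show "i < N \<Longrightarrow> i \<in> E \<Longrightarrow> hext E b i = b i" "i < N \<Longrightarrow> i \<notin> E \<Longrightarrow> lap (hext E b) i = 0"
    unfolding hext_def by blast+
qed

lemma harmonic_abs_le:
  assumes "s \<in> E" "s < N" "\<And>i. i < N \<Longrightarrow> i \<notin> E \<Longrightarrow> lap x i = 0"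
    and "\<And>i. i < N \<Longrightarrow> i \<in> E \<Longrightarrow> \<bar>x i\<bar> \<le> a" and "i < N"
  shows "\<bar>x i\<bar> \<le> a"
proof -
  have "x i - a \<le> 0"
    by (rule nonpos_principle[OF kills_0[OF assms(1,2)] _ _ assms(5), where z = "\<lambda>i. x i - a"])
      (use assms(3,4) in \<open>force simp: lap_diff[of x "\<lambda>_. a"] lap_const\<close>)+
  moreover have "- x i - a \<le> 0"
    by (rule nonpos_principle[OF kills_0[OF assms(1,2)] _ _ assms(5), where z = "\<lambda>i. - x i - a"])
      (use assms(3,4) in \<open>force simp: lap_diff[of "\<lambda>i. - x i" "\<lambda>_. a"] lap_uminus lap_const\<close>)+
  ultimately show ?thesis by linarith
qed

lemma dirichlet_abs_le:
  assumes dense: "\<And>i. i < N \<Longrightarrow> reaches R E i" and "0 \<le> \<eta>"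
    and "\<And>i. i < N \<Longrightarrow> i \<notin> E \<Longrightarrow> \<bar>lap x i\<bar> \<le> \<eta>" and "\<And>i. i \<in> E \<Longrightarrow> x i = 0" and "i < N"
  shows "\<bar>x i\<bar> \<le> (of_int d + 1) ^ R * \<eta>"
proof -
  have "x i \<le> (of_int d + 1) ^ R * \<eta>"
    using assms(3,4) by (intro maximum_bound[OF dense assms(2) _ _ assms(5)]) (auto simp: abs_le_iff)
  moreover have "- x i \<le> (of_int d + 1) ^ R * \<eta>"
    using assms(3,4) by (intro maximum_bound[OF dense assms(2) _ _ assms(5), where z = "\<lambda>i. - x i"])
      (auto simp: lap_uminus abs_le_iff)
  ultimately show ?thesis by linarith
qed

lemma reaches_nonempty:
  assumes "\<And>i. i < N \<Longrightarrow> reaches R E i"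
  obtains s where "s \<in> E" "s < N"
  using assms[OF N_pos] relpow_adj_lt[OF _ N_pos] unfolding reaches_def by blast

text \<open>y is split into four terms. z, zero on E, absorbs the distance of the Laplacian from the
  integers; the boundary values rounded down to multiples of 1 / q are extended harmonically; so is
  the rounding error r; the rest x vanishes on E and has integral Laplacian off E. Only z and the
  extension of r are lost, and both are small in the supremum norm.\<close>

lemma approx_decomposition:
  fixes q :: nat
  assumes dense: "\<And>i. i < N \<Longrightarrow> reaches R E i" and E: "E \<subseteq> {..<N}" and q: "0 < q" and \<eta>: "0 \<le> \<eta>"
    and y01: "\<And>i. i < N \<Longrightarrow> 0 \<le> y i \<and> y i < 1"
    and near: "\<And>i. i < N \<Longrightarrow> i \<notin> E \<Longrightarrow> \<exists>m::int. \<bar>lap y i - m\<bar> \<le> \<eta>"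
  obtains b \<xi> where "b \<in> E \<rightarrow>\<^sub>E {..<q}" "\<xi> \<in> torus_sol N (imat E)"
    "\<And>i. i < N \<Longrightarrow> \<exists>w. \<bar>w\<bar> \<le> 1 / q + (of_int d + 1) ^ R * \<eta> \<and> y i - (\<xi> i + hext E (\<lambda>j. real (b j) / q) i) - w \<in> \<int>"
proof -
  obtain s where s: "s \<in> E" "s < N" using reaches_nonempty[OF dense] by blast
  obtain m :: "nat \<Rightarrow> int" where m: "\<And>i. i < N \<Longrightarrow> i \<notin> E \<Longrightarrow> \<bar>lap y i - m i\<bar> \<le> \<eta>" using near by metis
  obtain z where zE: "\<And>i. i < N \<Longrightarrow> i \<in> E \<Longrightarrow> z i = (if i \<in> E then 0 else lap y i - m i)"
    and zl: "\<And>i. i < N \<Longrightarrow> i \<notin> E \<Longrightarrow> lap z i + 0 * z i = (if i \<in> E then 0 else lap y i - m i)"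
    using dirichlet_solution[OF kills_0[OF s], where b = "\<lambda>i. if i \<in> E then 0 else lap y i - m i"] by blast
  define b where "b = restrict (\<lambda>i. nat \<lfloor>q * y i\<rfloor>) E"
  have b: "real (b i) \<le> q * y i" "q * y i < real (b i) + 1" "b i < q" if "i \<in> E" for i
  proof -
    have i: "i < N" using that E by auto
    have nn: "0 \<le> \<lfloor>q * y i\<rfloor>" using y01[OF i] by simp
    show "real (b i) \<le> q * y i" "q * y i < real (b i) + 1"
      using nn that by (simp_all add: b_def)
    moreover have "q * y i < q" using y01[OF i] q by simp
    ultimately show "b i < q" by linarith
  qed
  let ?hb = "hext E (\<lambda>j. real (b j) / q)"
  define r where "r i = y i - real (b i) / q" for i
  have r: "\<bar>r i\<bar> \<le> 1 / q" if "i \<in> E" for i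
  proof -
    have "q * r i = q * y i - b i" using q by (simp add: r_def right_diff_distrib)
    then have "0 \<le> q * r i" "q * r i \<le> 1" using b[OF that] by linarith+
    then show ?thesis using q by (simp add: field_simps abs_if zero_le_mult_iff)
  qed
  let ?hr = "hext E r"
  define x where "x i = y i - z i - ?hb i - ?hr i" for i
  have xE: "x i = 0" if "i < N" "i \<in> E" for i
    using that zE hext(1)[OF s] by (simp add: x_def r_def)
  have xl: "lap x i = of_int (m i)" if i: "i < N" "i \<notin> E" for i
  proof -
    have "lap x i = lap y i - lap z i - lap ?hb i - lap ?hr i"
      unfolding x_def lap_diff ..
    then show ?thesis using zl[OF i] hext(2)[OF s i] i by simp
  qed
  have "tfrac N x \<in> torus_sol N (imat E)"
    unfolding torus_sol_def mem_Collect_eq sum_tfrac_Ints_iff'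
    using tfrac_PiE[of N] xE xl by (auto simp: imat_row)
  moreover have "b \<in> E \<rightarrow>\<^sub>E {..<q}" using b(3) by (auto simp: b_def)
  moreover have "\<exists>w. \<bar>w\<bar> \<le> 1 / q + (of_int d + 1) ^ R * \<eta> \<and> y i - (tfrac N x i + ?hb i) - w \<in> \<int>" if i: "i < N" for i
  proof (intro exI[of _ "?hr i + z i"] conjI)
    have "\<bar>?hr i\<bar> \<le> 1 / q"
      by (rule harmonic_abs_le[OF s]) (use hext[OF s] r i in auto)
    moreover have "\<bar>z i\<bar> \<le> (of_int d + 1) ^ R * \<eta>"
      by (rule dirichlet_abs_le[OF dense \<eta>]) (use zE zl m i E in auto)
    ultimately show "\<bar>?hr i + z i\<bar> \<le> 1 / q + (of_int d + 1) ^ R * \<eta>" by linarith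
    have "y i - (tfrac N x i + ?hb i) - (?hr i + z i) = of_int \<lfloor>x i\<rfloor>"
      using i by (simp add: tfrac_def frac_def x_def)
    then show "y i - (tfrac N x i + ?hb i) - (?hr i + z i) \<in> \<int>" by simp
  qed
  ultimately show ?thesis using that by blast
qed

end

section \<open>Coding separated sofic maps\<close>

context quot
begin

text \<open>The inverse turns left translation of cosets by - s into the step
  \<open>rep i + s\<close> of the graph, see \<open>lcoset_crep\<close>; the harmonic equation along
  the orbit then becomes the Laplacian on {..<N}.\<close>

definition crep :: "nat \<Rightarrow> 'g set" where
  "crep i = lcoset (- rep i) H"

lemma lcoset_uminus_eq: "lcoset (- a) H = crep (ix a)"
proof -
  have "ix (- a) = ix (- rep (ix a))" by (rule ix_minus) (simp add: ix_rep ix_lt)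
  then show ?thesis unfolding crep_def lcoset_eq_iff[OF subgrp_H] ix_eq .
qed

lemma lcoset_crep: "i < N \<Longrightarrow> lcoset (- s) (crep i) = crep (ix (rep i + s))"
proof -
  have "lcoset (- s) (crep i) = lcoset (- (rep i + s)) H"
    unfolding crep_def lcoset_lcoset by (simp add: minus_add)
  then show ?thesis by (simp only: lcoset_uminus_eq)
qed

lemma crep_bij: "bij_betw crep {..<N} (cosets H)"
  unfolding bij_betw_def
proof
  show "inj_on crep {..<N}"
  proof (rule inj_onI)
    fix i j assume ij: "i \<in> {..<N}" "j \<in> {..<N}" "crep i = crep j"
    then have "ix (- rep i) = ix (- rep j)" by (simp add: crep_def lcoset_eq_iff[OF subgrp_H] ix_eq)
    from ix_minus[OF this] show "i = j" using ij by (simp add: ix_rep)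
  qed
  show "crep ` {..<N} = cosets H"
  proof (intro equalityI subsetI)
    fix C assume "C \<in> cosets H"
    then obtain g where "C = lcoset (- (- g)) H" by (auto simp: cosets_def)
    then show "C \<in> crep ` {..<N}" unfolding lcoset_uminus_eq using ix_lt by auto
  qed (auto simp: crep_def cosets_def)
qed

lemma sum_cosets: "(\<Sum>C\<in>cosets H. F C) = (\<Sum>i<N. F (crep i))"
  using sum.reindex_bij_betw[OF crep_bij, of F] by simp

lemma finite_cosets: "finite (cosets H)" and card_cosets: "card (cosets H) = N"
  using bij_betw_finite[OF crep_bij] bij_betw_same_card[OF crep_bij] by auto

lemma rho2_le_iff:
  assumes "0 \<le> e"
  shows "rho2 (cosets H) \<rho> \<phi> \<psi> \<le> e \<longleftrightarrow> (\<Sum>i<N. (\<rho> (\<phi> (crep i)) (\<psi> (crep i)))\<^sup>2) \<le> e\<^sup>2 * N"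
proof -
  have "rho2 (cosets H) \<rho> \<phi> \<psi> \<le> e \<longleftrightarrow> (\<Sum>i<N. (\<rho> (\<phi> (crep i)) (\<psi> (crep i)))\<^sup>2) / N \<le> e\<^sup>2"
    unfolding rho2_def sum_cosets card_cosets using assms
    by (meson real_le_lsqrt sqrt_le_D)
  then show ?thesis using N_pos by (simp add: field_simps)
qed

lemma sum_abs_f: "(\<Sum>s\<in>supp f. \<bar>real_of_int (f s)\<bar>) = 2 * of_int dd"
proof -
  have 0: "0 \<in> supp f" using dd_pos by (simp add: dd_def supp_def)
  have "(\<Sum>s\<in>supp f. \<bar>real_of_int (f s)\<bar>) = \<bar>real_of_int (f 0)\<bar> + (\<Sum>s\<in>supp f - {0}. \<bar>real_of_int (f s)\<bar>)"
    using 0 fin_supp by (simp add: sum.remove)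
  also have "(\<Sum>s\<in>supp f - {0}. \<bar>real_of_int (f s)\<bar>) = (\<Sum>s\<in>supp f - {0}. - real_of_int (f s))"
    using f_nonpos by (intro sum.cong) auto
  also have "\<dots> = of_int dd" unfolding dd_eq by (simp add: sum_negf)
  also have "\<bar>real_of_int (f 0)\<bar> = of_int dd" using dd_pos by (simp add: dd_def)
  finally show ?thesis by simp
qed

lemma model_norm: "x \<in> harmonic_model f \<Longrightarrow> cmod (x t) = 1"
  and model_eq: "x \<in> harmonic_model f \<Longrightarrow> (\<Prod>s\<in>supp f. x (t + s) powi f s) = 1"
  by (auto simp: harmonic_model_def)

text \<open>By Chebyshev's inequality each generator has at most \<delta> N indices with defect
  above sqrt \<delta>; E is their union. Elsewhere the coordinates of the model point may be
  replaced by the values of y at the neighbours, which changes the product in the harmonic equation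
  by at most 2 f(0) sqrt \<delta>.\<close>

lemma sofic_map_defect:
  fixes \<delta> \<eta> :: real
  assumes \<phi>: "\<phi> \<in> sofic_maps shift (harmonic_model f) rho0 H (supp f) \<delta>" and \<delta>: "0 < \<delta>"
    and y: "\<And>i. i < N \<Longrightarrow> \<phi> (crep i) 0 = cis (2 * pi * y i)"
    and small: "2 * of_int dd * sqrt \<delta> < 1 - cos (2 * pi * \<eta>)" "0 < \<eta>" "\<eta> \<le> 1 / 2"
  obtains E where "E \<subseteq> {..<N}" "real (card E) \<le> card (supp f) * \<delta> * N"
    "\<And>i. i < N \<Longrightarrow> i \<notin> E \<Longrightarrow> \<exists>m::int. \<bar>lap y i - m\<bar> \<le> \<eta>"
proof -
  define D where "D s i = cmod (cis (2 * pi * y (ix (rep i + s))) - \<phi> (crep i) s)" for s i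
  have Xf: "\<phi> C \<in> harmonic_model f" if "C \<in> cosets H" for C
    using \<phi> that by (auto simp: sofic_maps_def)
  have crep_in: "crep i \<in> cosets H" for i by (auto simp: crep_def cosets_def)
  have D_sum: "(\<Sum>i<N. (D s i)\<^sup>2) \<le> \<delta>\<^sup>2 * N" if s: "s \<in> supp f" for s
  proof -
    \<comment> \<open>Coordinate s of a point is coordinate 0 of its shift by - s, so equivariance
      under - s is what controls \<open>D s\<close>.\<close>
    have "- s \<in> supp f" using s supp_minus by simp
    then have "rho2 (cosets H) rho0 (\<lambda>C. \<phi> (lcoset (- s) C)) (\<lambda>C. shift (- s) (\<phi> C)) \<le> \<delta>"
      using \<phi> by (auto simp: sofic_maps_def)
    then have "(\<Sum>i<N. (rho0 (\<phi> (lcoset (- s) (crep i))) (shift (- s) (\<phi> (crep i))))\<^sup>2) \<le> \<delta>\<^sup>2 * N"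
      using \<delta> by (subst (asm) rho2_le_iff) auto
    moreover have "rho0 (\<phi> (lcoset (- s) (crep i))) (shift (- s) (\<phi> (crep i))) = D s i" if "i < N" for i
      using that y[of "ix (rep i + s)"] ix_lt by (simp add: rho0_def shift_def D_def lcoset_crep)
    ultimately show ?thesis by simp
  qed
  define E where "E = (\<Union>s\<in>supp f. {i. i < N \<and> sqrt \<delta> < D s i})"
  have card1: "real (card {i. i < N \<and> sqrt \<delta> < D s i}) \<le> \<delta> * N" if s: "s \<in> supp f" for s
  proof -
    have "real (card {i. i < N \<and> sqrt \<delta> < D s i}) * \<delta> = (\<Sum>i\<in>{i. i < N \<and> sqrt \<delta> < D s i}. \<delta>)" by simp
    also have "\<dots> \<le> (\<Sum>i\<in>{i. i < N \<and> sqrt \<delta> < D s i}. (D s i)\<^sup>2)"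
    proof (intro sum_mono)
      fix i assume "i \<in> {i. i < N \<and> sqrt \<delta> < D s i}"
      then have "(sqrt \<delta>)\<^sup>2 \<le> (D s i)\<^sup>2" using \<delta> by (intro power_mono) auto
      then show "\<delta> \<le> (D s i)\<^sup>2" using \<delta> by simp
    qed
    also have "\<dots> \<le> (\<Sum>i<N. (D s i)\<^sup>2)" by (intro sum_mono2) auto
    also have "\<dots> \<le> \<delta>\<^sup>2 * N" by (rule D_sum[OF s])
    finally have "real (card {i. i < N \<and> sqrt \<delta> < D s i}) * \<delta> \<le> (\<delta> * N) * \<delta>"
      by (simp add: power2_eq_square mult_ac)
    then show ?thesis using \<delta> mult_le_cancel_right_pos by blast
  qed
  have "card E \<le> (\<Sum>s\<in>supp f. card {i. i < N \<and> sqrt \<delta> < D s i})"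
    unfolding E_def by (rule card_UN_le[OF fin_supp])
  then have "real (card E) \<le> (\<Sum>s\<in>supp f. real (card {i. i < N \<and> sqrt \<delta> < D s i}))"
    unfolding of_nat_sum[symmetric] by (rule of_nat_mono)
  also have "\<dots> \<le> (\<Sum>s\<in>supp f. \<delta> * N)" using card1 by (intro sum_mono)
  finally have "real (card E) \<le> card (supp f) * \<delta> * N" by simp
  moreover have "E \<subseteq> {..<N}" by (auto simp: E_def)
  moreover have "\<exists>m::int. \<bar>lap y i - m\<bar> \<le> \<eta>" if i: "i < N" "i \<notin> E" for i
  proof -
    have near: "D s i \<le> sqrt \<delta>" if "s \<in> supp f" for s using i that by (force simp: E_def)
    have "cis (2 * pi * lap y i) = (\<Prod>s\<in>supp f. emb y (rep i + s) powi f s)"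
      using i by (simp add: prod_emb ix_rep)
    also have "\<dots> = (\<Prod>s\<in>supp f. cis (2 * pi * y (ix (rep i + s))) powi f s)" by (simp add: emb_def)
    finally have c: "cis (2 * pi * lap y i) = (\<Prod>s\<in>supp f. cis (2 * pi * y (ix (rep i + s))) powi f s)" .
    have "cmod (cis (2 * pi * lap y i) - (\<Prod>s\<in>supp f. \<phi> (crep i) s powi f s)) \<le> (\<Sum>s\<in>supp f. \<bar>of_int (f s)\<bar>) * sqrt \<delta>"
      unfolding c using near model_norm[OF Xf[OF crep_in]]
      by (intro norm_prod_powi_diff_le) (auto simp: D_def)
    moreover have "(\<Prod>s\<in>supp f. \<phi> (crep i) s powi f s) = 1"
      using model_eq[OF Xf[OF crep_in], of i 0] by simp
    ultimately have "cmod (cis (2 * pi * lap y i) - 1) < 1 - cos (2 * pi * \<eta>)"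
      using small(1) by (simp add: sum_abs_f)
    then obtain m :: int where "\<bar>lap y i - m\<bar> < \<eta>" using cis_near_1 small by metis
    then show ?thesis by (intro exI[of _ m]) simp
  qed
  ultimately show ?thesis using that by blast
qed

text \<open>Each map is coded by its exceptional set E, rounded boundary values on E and B together,
  and an exact torus solution. At each coset two maps with the same code lie within 2 pi \<omega> of
  a common point, hence within \<epsilon> of each other, so the code is injective on a separated
  set. The bound multiplies the numbers of sets E, of boundary data and of torus solutions.\<close>

lemma separated_card_le:
  fixes q :: nat and \<delta> \<eta> \<epsilon> t \<sigma> :: real
  assumes F: "F \<subseteq> sofic_maps shift (harmonic_model f) rho0 H (supp f) \<delta>" "finite F"
    and sep: "\<And>a b. a \<in> F \<Longrightarrow> b \<in> F \<Longrightarrow> a \<noteq> b \<Longrightarrow> \<epsilon> < rhoinf (cosets H) rho0 a b"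
    and \<delta>: "0 < \<delta>" and r: "r < N" and q: "0 < q" and t: "0 < t" "t \<le> 1"
    and small: "2 * of_int dd * sqrt \<delta> < 1 - cos (2 * pi * \<eta>)" "0 < \<eta>" "\<eta> \<le> 1 / 2"
    and close: "4 * pi * (1 / q + (of_int dd + 1) ^ (2 * r) * \<eta>) \<le> \<epsilon>"
  defines "\<sigma> \<equiv> card (supp f) * \<delta>"
  shows "real (card F) \<le> t powr (- (\<sigma> * N)) * (1 + t) ^ N *
    (real q * (2 * real (4 * r + 1))) powr (\<sigma> * N + N / (r + 1)) * tau"
proof -
  obtain B where B: "B \<subseteq> {..<N}" "0 \<in> B" "card B * (r + 1) \<le> N" "\<And>i. i < N \<Longrightarrow> reaches (2 * r) B i"
    using sparse_dense_set[OF r] by blast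
  have \<sigma>: "0 \<le> \<sigma>" using \<delta> by (simp add: \<sigma>_def)
  have crep_in: "crep i \<in> cosets H" for i by (auto simp: crep_def cosets_def)
  define \<omega> where "\<omega> = 1 / q + (of_int dd + 1) ^ (2 * r) * \<eta>"
  define Q where "Q \<phi> E b \<xi> \<longleftrightarrow> E \<subseteq> {..<N} \<and> real (card E) \<le> \<sigma> * N \<and> b \<in> (E \<union> B) \<rightarrow>\<^sub>E {..<q} \<and>
      \<xi> \<in> torus_sol N (imat (E \<union> B)) \<and> (\<forall>i<N. \<exists>y w. \<phi> (crep i) 0 = cis (2 * pi * y) \<and> \<bar>w\<bar> \<le> \<omega> \<and>
        y - (\<xi> i + hext (E \<union> B) (\<lambda>j. real (b j) / q) i) - w \<in> \<int>)" for \<phi> :: "'g set \<Rightarrow> 'g \<Rightarrow> complex" and E b \<xi>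
  have "\<exists>E b \<xi>. Q \<phi> E b \<xi>" if \<phi>F: "\<phi> \<in> F" for \<phi>
  proof -
    have \<phi>: "\<phi> \<in> sofic_maps shift (harmonic_model f) rho0 H (supp f) \<delta>" using F \<phi>F by blast
    have "\<exists>y. 0 \<le> y \<and> y < 1 \<and> \<phi> (crep i) 0 = cis (2 * pi * y)" for i
    proof -
      have "\<phi> (crep i) \<in> harmonic_model f" using \<phi> crep_in by (auto simp: sofic_maps_def)
      then show ?thesis using unit_circle_cis_2pi[OF model_norm] by metis
    qed
    then obtain y where y: "\<And>i. 0 \<le> y i \<and> y i < 1 \<and> \<phi> (crep i) 0 = cis (2 * pi * y i)" by metis
    obtain E where E: "E \<subseteq> {..<N}" "real (card E) \<le> card (supp f) * \<delta> * N"
      "\<And>i. i < N \<Longrightarrow> i \<notin> E \<Longrightarrow> \<exists>m::int. \<bar>lap y i - m\<bar> \<le> \<eta>"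
      using sofic_map_defect[OF \<phi> \<delta> _ small, of y] y by blast
    have dense: "reaches (2 * r) (E \<union> B) i" if "i < N" for i
      using reaches_mono[OF B(4)[OF that]] by blast
    obtain b \<xi> where "b \<in> (E \<union> B) \<rightarrow>\<^sub>E {..<q}" "\<xi> \<in> torus_sol N (imat (E \<union> B))"
      "\<And>i. i < N \<Longrightarrow> \<exists>w. \<bar>w\<bar> \<le> \<omega> \<and> y i - (\<xi> i + hext (E \<union> B) (\<lambda>j. real (b j) / q) i) - w \<in> \<int>"
    proof (rule approx_decomposition[OF dense _ q, of \<eta> y])
      show "E \<union> B \<subseteq> {..<N}" using E B by blast
      show "0 \<le> \<eta>" using small by simp
      show "0 \<le> y i \<and> y i < 1" for i using y by blast
      show "\<exists>m::int. \<bar>lap y i - m\<bar> \<le> \<eta>" if "i < N" "i \<notin> E \<union> B" for i using E(3) that by blast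
    qed (assumption, rule that, assumption, assumption, unfold \<omega>_def, blast)
    note bx = this
    have "Q \<phi> E b \<xi>"
      unfolding Q_def
    proof (intro conjI allI impI)
      fix i assume "i < N"
      then obtain w where w: "\<bar>w\<bar> \<le> \<omega>" "y i - (\<xi> i + hext (E \<union> B) (\<lambda>j. real (b j) / q) i) - w \<in> \<int>"
        using bx(3) by blast
      then show "\<exists>y w. \<phi> (crep i) 0 = cis (2 * pi * y) \<and> \<bar>w\<bar> \<le> \<omega> \<and>
          y - (\<xi> i + hext (E \<union> B) (\<lambda>j. real (b j) / q) i) - w \<in> \<int>"
        using y[of i] by (intro exI[of _ "y i"] exI[of _ w]) simp
    qed (use E(1,2) bx(1,2) in \<open>auto simp: \<sigma>_def\<close>)
    then show ?thesis by blast
  qed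
  then obtain eE eb ex where data: "\<And>\<phi>. \<phi> \<in> F \<Longrightarrow> Q \<phi> (eE \<phi>) (eb \<phi>) (ex \<phi>)" by metis
  have inj: "inj_on (\<lambda>\<phi>. (eE \<phi>, eb \<phi>, ex \<phi>)) F"
  proof (rule inj_onI, rule ccontr)
    fix a b assume ab: "a \<in> F" "b \<in> F" "(eE a, eb a, ex a) = (eE b, eb b, ex b)" "a \<noteq> b"
    have "rhoinf (cosets H) rho0 a b \<le> \<epsilon>"
      unfolding rhoinf_def
    proof (intro Max.boundedI)
      fix v assume "v \<in> (\<lambda>C. rho0 (a C) (b C)) ` cosets H"
      moreover have "cosets H = crep ` {..<N}" using crep_bij by (simp add: bij_betw_def)
      ultimately obtain i where i: "i < N" "v = cmod (a (crep i) 0 - b (crep i) 0)"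
        by (auto simp: rho0_def)
      define x where "x = ex a i + hext (eE a \<union> B) (\<lambda>j. real (eb a j) / q) i"
      have "cmod (c (crep i) 0 - cis (2 * pi * x)) \<le> 2 * pi * \<omega>" if "c = a \<or> c = b" for c
      proof -
        have "\<exists>y w. c (crep i) 0 = cis (2 * pi * y) \<and> \<bar>w\<bar> \<le> \<omega> \<and> y - x - w \<in> \<int>"
          using data[of a] data[of b] ab that i(1) unfolding Q_def x_def by auto
        then obtain y w where yw: "c (crep i) 0 = cis (2 * pi * y)" "\<bar>w\<bar> \<le> \<omega>" "y - x - w \<in> \<int>" by blast
        have "cmod (c (crep i) 0 - cis (2 * pi * x)) \<le> 2 * pi * \<bar>w\<bar>"
          unfolding yw(1) by (rule norm_cis_diff_mod_le[OF yw(3)])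
        also have "\<dots> \<le> 2 * pi * \<omega>" using yw(2) by (intro mult_left_mono) auto
        finally show ?thesis .
      qed
      from this[of a] this[of b] have "v \<le> 2 * pi * \<omega> + 2 * pi * \<omega>"
        unfolding i(2) using norm_diff_triangle_le[of "a (crep i) 0" "cis (2 * pi * x)" "2 * pi * \<omega>" "b (crep i) 0" "2 * pi * \<omega>"]
        by (simp add: norm_minus_commute)
      also have "\<dots> \<le> \<epsilon>" using close by (simp add: \<omega>_def)
      finally show "v \<le> \<epsilon>" .
    qed (use finite_cosets crep_in in auto)
    with sep[OF ab(1,2,4)] show False by simp
  qed
  define K where "K = 2 * real (4 * r + 1)"
  have qK: "1 \<le> real q * K" unfolding K_def using q by (intro mult_ge1_I) auto
  define Es where "Es = {E. E \<subseteq> {..<N} \<and> real (card E) \<le> \<sigma> * N}"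
  define M where "M = (real q * K) powr (\<sigma> * N + N / (r + 1)) * tau"
  have finEs: "finite Es" unfolding Es_def by (rule finite_subset[of _ "Pow {..<N}"]) auto
  have finE: "finite (E \<union> B)" if "E \<in> Es" for E
    using that B(1) finite_subset[of _ "{..<N}"] by (auto simp: Es_def)
  have fint: "finite (torus_sol N (imat (E \<union> B)))" for E
    using imat_det_pos[of 0 "E \<union> B"] B(2) N_pos by (intro finite_torus_sol) auto
  have "card F \<le> card (Sigma Es (\<lambda>E. ((E \<union> B) \<rightarrow>\<^sub>E {..<q}) \<times> torus_sol N (imat (E \<union> B))))"
  proof (rule card_inj_on_le[OF inj])
    show "(\<lambda>\<phi>. (eE \<phi>, eb \<phi>, ex \<phi>)) ` F \<subseteq> Sigma Es (\<lambda>E. ((E \<union> B) \<rightarrow>\<^sub>E {..<q}) \<times> torus_sol N (imat (E \<union> B)))"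
      using data by (auto simp: Q_def Es_def)
    show "finite (Sigma Es (\<lambda>E. ((E \<union> B) \<rightarrow>\<^sub>E {..<q}) \<times> torus_sol N (imat (E \<union> B))))"
      using finEs finE fint by (intro finite_SigmaI finite_cartesian_product finite_PiE) auto
  qed
  also have "\<dots> = (\<Sum>E\<in>Es. q ^ card (E \<union> B) * card (torus_sol N (imat (E \<union> B))))"
    using finEs finE fint
    by (subst card_SigmaI) (auto simp: card_cartesian_product card_PiE intro!: finite_PiE)
  finally have "real (card F) \<le> real (\<Sum>E\<in>Es. q ^ card (E \<union> B) * card (torus_sol N (imat (E \<union> B))))"
    by (rule of_nat_mono)
  also have "\<dots> = (\<Sum>E\<in>Es. real q ^ card (E \<union> B) * real (card (torus_sol N (imat (E \<union> B)))))"
    by simp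
  also have "\<dots> \<le> (\<Sum>E\<in>Es. M)"
  proof (intro sum_mono)
    fix E assume E: "E \<in> Es"
    have "real (card (torus_sol N (imat (E \<union> B)))) = fdet N (kmat (\<lambda>_. 0) (E \<union> B))"
      using card_torus_sol_imat[of 0 "E \<union> B"] B(2) N_pos
      unfolding kmat_imat[abs_def] fdet_of_int by (metis UnI2 of_int_of_nat_eq)
    also have "\<dots> \<le> (2 * real (2 * (2 * r) + 1)) ^ card (E \<union> B) * tau"
      using reaches_mono[OF B(4)] B E by (intro det_kill_dense_le) (auto simp: Es_def)
    finally have le: "real (card (torus_sol N (imat (E \<union> B)))) \<le> K ^ card (E \<union> B) * tau"
      by (simp add: K_def)
    have "real (card (E \<union> B)) \<le> \<sigma> * N + N / (r + 1)"
    proof -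
      have "real (card (E \<union> B)) \<le> real (card E) + real (card B)"
        using card_Un_le[of E B] by linarith
      moreover have "real (card B) * (real r + 1) \<le> N"
        using B(3) by (metis of_nat_1 of_nat_add of_nat_le_iff of_nat_mult)
      then have "real (card B) \<le> N / (r + 1)" by (simp add: field_simps)
      ultimately show ?thesis using E by (simp add: Es_def)
    qed
    then have "(real q * K) powr real (card (E \<union> B)) \<le> (real q * K) powr (\<sigma> * N + N / (r + 1))"
      using qK by (intro powr_mono)
    then have pw: "(real q * K) ^ card (E \<union> B) \<le> (real q * K) powr (\<sigma> * N + N / (r + 1))"
      using qK by (simp add: powr_realpow)
    have "real q ^ card (E \<union> B) * real (card (torus_sol N (imat (E \<union> B)))) \<le> real q ^ card (E \<union> B) * (K ^ card (E \<union> B) * tau)"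
      using le by (intro mult_left_mono) auto
    also have "\<dots> = (real q * K) ^ card (E \<union> B) * tau" by (simp add: power_mult_distrib)
    also have "\<dots> \<le> M" unfolding M_def using pw by (intro mult_right_mono) auto
    finally show "real q ^ card (E \<union> B) * real (card (torus_sol N (imat (E \<union> B)))) \<le> M" .
  qed
  also have "\<dots> = real (card Es) * M" by simp
  also have "\<dots> \<le> (t powr (- (\<sigma> * N)) * (1 + t) ^ card {..<N}) * M"
  proof (rule mult_right_mono)
    show "real (card Es) \<le> t powr (- (\<sigma> * N)) * (1 + t) ^ card {..<N}"
      unfolding Es_def using t \<sigma> by (intro card_small_subsets_le) auto
    show "0 \<le> M" by (simp add: M_def)
  qed
  finally show ?thesis by (simp add: M_def K_def mult_ac add_ac)
qed

end


section \<open>Equidistribution of sparsely defective points\<close>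

context wgraph
begin

definition amat :: "nat \<Rightarrow> nat set \<Rightarrow> nat \<Rightarrow> nat \<Rightarrow> int" where
  "amat q B i j = (if i \<in> B then if i = j then int q else 0 else imat {} i j)"

definition agrp :: "nat \<Rightarrow> nat set \<Rightarrow> (nat \<Rightarrow> real) set" where
  "agrp q B = torus_sol N (amat q B)"

lemma amat_row:
  assumes "i < N"
  shows "(\<Sum>j<N. of_int (amat q B i j) * x j) = (if i \<in> B then real q * x i else lap x i)"
proof (cases "i \<in> B")
  case True
  then have "(\<Sum>j<N. of_int (amat q B i j) * x j) = (\<Sum>j<N. if i = j then real q * x j else 0)"
    by (intro sum.cong) (auto simp: amat_def)
  then show ?thesis using True assms by simp
next
  case False
  then have "(\<Sum>j<N. of_int (amat q B i j) * x j) = (\<Sum>j<N. of_int (imat {} i j) * x j)"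
    by (intro sum.cong) (auto simp: amat_def)
  then show ?thesis using False assms by (simp add: imat_row)
qed

lemma agrp_iff: "y \<in> agrp q B \<longleftrightarrow> y \<in> {..<N} \<rightarrow>\<^sub>E {0..<1} \<and> (\<forall>i<N. (if i \<in> B then real q * y i else lap y i) \<in> \<int>)"
  by (simp add: agrp_def torus_sol_def amat_row)

lemma tfrac_agrp:
  "(\<And>i. i < N \<Longrightarrow> (if i \<in> B then real q * x i else lap x i) \<in> \<int>) \<Longrightarrow> tfrac N x \<in> agrp q B"
  unfolding agrp_def torus_sol_def mem_Collect_eq sum_tfrac_Ints_iff' using tfrac_PiE[of N] by (simp add: amat_row)

lemma agrp_add: "y \<in> agrp q B \<Longrightarrow> y' \<in> agrp q B \<Longrightarrow> tfrac N (\<lambda>j. y j + y' j) \<in> agrp q B"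
  by (rule tfrac_agrp) (force simp: agrp_iff lap_add distrib_left)

lemma agrp_diff: "y \<in> agrp q B \<Longrightarrow> y' \<in> agrp q B \<Longrightarrow> tfrac N (\<lambda>j. y j - y' j) \<in> agrp q B"
  by (rule tfrac_agrp) (force simp: agrp_iff lap_diff right_diff_distrib)

lemma finite_agrp:
  assumes "s \<in> B" "s < N" "0 < q"
  shows "finite (agrp q B)"
proof -
  have "fdet N (\<lambda>i j. real_of_int (amat q B i j)) \<noteq> 0"
  proof (rule fdet_nonzeroI)
    fix x i assume x: "\<And>i. i < N \<Longrightarrow> (\<Sum>j<N. real_of_int (amat q B i j) * x j) = 0" and i: "i < N"
    have r: "(if i \<in> B then real q * x i else lap x i) = 0" if "i < N" for i
      using x[OF that] that by (simp add: amat_row)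
    have "\<bar>x i\<bar> \<le> 0"
    proof (rule harmonic_abs_le[OF assms(1,2) _ _ i])
      show "lap x i = 0" if "i < N" "i \<notin> B" for i using r[OF that(1)] that(2) by simp
      show "\<bar>x i\<bar> \<le> 0" if "i < N" "i \<in> B" for i using r[OF that(1)] that(2) assms(3) by simp
    qed
    then show "x i = 0" by simp
  qed
  then show ?thesis unfolding agrp_def fdet_of_int by (intro finite_torus_sol) simp
qed

lemma agrp_nonempty: "restrict (\<lambda>_. 0) {..<N} \<in> agrp q B"
  using tfrac_agrp[of B q "\<lambda>_. 0"] lap_const[of _ 0] by (simp add: tfrac_def)

lemma tfrac_pair_cancel:
  "y \<in> {..<N} \<rightarrow>\<^sub>E {0..<1} \<Longrightarrow> tfrac N (\<lambda>j. tfrac N (\<lambda>j. y j + z j) j - z j) = y"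
  "y \<in> {..<N} \<rightarrow>\<^sub>E {0..<1} \<Longrightarrow> tfrac N (\<lambda>j. tfrac N (\<lambda>j. y j - z j) j + z j) = y"
  using tfrac_add_tfrac[of N "\<lambda>j. y j + z j" "\<lambda>j. - z j"] tfrac_add_tfrac[of N "\<lambda>j. y j - z j" z]
  by (simp_all add: tfrac_id)

text \<open>Translation by y0 permutes the group and multiplies the sum by a number other than
  1.\<close>

lemma character_sum_zero:
  fixes k :: "nat \<Rightarrow> int"
  assumes y0: "y0 \<in> agrp q B" "(\<Sum>j<N. of_int (k j) * y0 j) \<notin> \<int>"
  shows "(\<Sum>y\<in>agrp q B. cis (2 * pi * (\<Sum>j<N. of_int (k j) * y j))) = 0"
proof -
  let ?\<chi> = "\<lambda>y. cis (2 * pi * (\<Sum>j<N. of_int (k j) * y j))"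
  have frac: "?\<chi> (tfrac N y) = ?\<chi> y" for y
    unfolding cis_2pi_eq_iff using sum_tfrac_Ints_iff[where r = k and N = N and y = y and s = "- (\<Sum>j<N. of_int (k j) * y j)"] by simp
  have pie: "y \<in> {..<N} \<rightarrow>\<^sub>E {0..<1}" if "y \<in> agrp q B" for y using that by (simp add: agrp_iff)
  have "(\<Sum>y\<in>agrp q B. ?\<chi> y) = (\<Sum>y\<in>agrp q B. ?\<chi> (tfrac N (\<lambda>j. y j + y0 j)))"
    by (rule sum.reindex_bij_witness[of _ "\<lambda>y. tfrac N (\<lambda>j. y j + y0 j)" "\<lambda>y. tfrac N (\<lambda>j. y j - y0 j)"])
      (use y0 pie in \<open>auto simp: tfrac_pair_cancel intro: agrp_add agrp_diff\<close>)
  also have "\<dots> = (\<Sum>y\<in>agrp q B. ?\<chi> y0 * ?\<chi> y)"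
    unfolding frac by (intro sum.cong refl) (simp add: cis_mult sum.distrib distrib_left add.commute)
  finally have eq: "(\<Sum>y\<in>agrp q B. ?\<chi> y) = ?\<chi> y0 * (\<Sum>y\<in>agrp q B. ?\<chi> y)"
    unfolding sum_distrib_left[of "?\<chi> y0", symmetric] .
  have "(?\<chi> y0 - 1) * (\<Sum>y\<in>agrp q B. ?\<chi> y) = 0"
    unfolding left_diff_distrib mult_1 by (simp only: eq[symmetric] diff_self)
  moreover have "?\<chi> y0 - 1 \<noteq> 0" using y0(2) by (simp add: cis_2pi_eq_1_iff)
  ultimately show ?thesis by (simp only: mult_eq_0_iff) blast
qed

text \<open>A character that is trivial on the finite group is an integral combination of Laplacian
  rows off \<open>B\<close>: the coefficients are read off by pairing with Green functions and, on \<open>B\<close>, with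
  harmonic extensions.\<close>
lemma trivial_character_potential:
  fixes k :: "nat \<Rightarrow> int" and M :: real
  assumes dense: "\<And>i. i < N \<Longrightarrow> reaches R B i" and B: "B \<subseteq> {..<N}"
    and k: "\<And>i. i < N \<Longrightarrow> \<bar>of_int (k i)\<bar> \<le> M"
    and q: "M + 2 * of_int d * ((of_int d + 1) ^ R * M) < real q"
    and triv: "\<And>y. y \<in> agrp q B \<Longrightarrow> (\<Sum>j<N. of_int (k j) * y j) \<in> \<int>"
  obtains u :: "nat \<Rightarrow> int" where "\<And>i. i < N \<Longrightarrow> lap (\<lambda>j. of_int (u j)) i = of_int (k i)"
    "\<And>i. i \<in> B \<Longrightarrow> u i = 0" "\<And>i. i < N \<Longrightarrow> \<bar>of_int (u i)\<bar> \<le> (of_int d + 1) ^ R * M"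
proof -
  obtain s where s: "s \<in> B" "s < N" using reaches_nonempty[OF dense] by blast
  have M: "0 \<le> M" using k[OF N_pos] by linarith
  have "0 \<le> 2 * of_int d * ((of_int d + 1) ^ R * M)" using d_pos M by simp
  then have q0: "0 < real q" using q M by linarith
  obtain v where vB: "\<And>i. i < N \<Longrightarrow> i \<in> B \<Longrightarrow> v i = (if i \<in> B then 0 else of_int (k i))"
    and vl: "\<And>i. i < N \<Longrightarrow> i \<notin> B \<Longrightarrow> lap v i + 0 * v i = (if i \<in> B then 0 else of_int (k i))"
    using dirichlet_solution[OF kills_0[OF s], where b = "\<lambda>i. if i \<in> B then 0 else of_int (k i)"] by blast
  have vb: "\<bar>v i\<bar> \<le> (of_int d + 1) ^ R * M" if "i < N" for i
    by (rule dirichlet_abs_le[OF dense M _ _ that]) (use vB vl k B in auto)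
  have triv': "(\<Sum>j<N. of_int (k j) * x j) \<in> \<int>"
    if "\<And>i. i < N \<Longrightarrow> (if i \<in> B then real q * x i else lap x i) \<in> \<int>" for x
    using triv[OF tfrac_agrp[OF that]] by (simp add: sum_tfrac_Ints_iff')
  have vint: "v e \<in> \<int>" if e: "e < N" for e
  proof (cases "e \<in> B")
    case True then show ?thesis using vB e by simp
  next
    case False
    obtain x where xB: "\<And>i. i < N \<Longrightarrow> i \<in> B \<Longrightarrow> x i = (if i = e then 1 else 0)"
      and xl: "\<And>i. i < N \<Longrightarrow> i \<notin> B \<Longrightarrow> lap x i + 0 * x i = (if i = e then 1 else 0)"
      using dirichlet_solution[OF kills_0[OF s], where b = "\<lambda>i. if i = e then 1 else 0"] by blast
    have xB0: "x i = 0" if "i < N" "i \<in> B" for i using xB[OF that] False that by auto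
    have "(\<Sum>j<N. of_int (k j) * x j) \<in> \<int>" by (rule triv') (use xB0 xl in auto)
    moreover have "(\<Sum>j<N. of_int (k j) * x j) = (\<Sum>j<N. lap v j * x j)"
    proof (intro sum.cong refl)
      fix j assume "j \<in> {..<N}"
      then show "of_int (k j) * x j = lap v j * x j" using xB0[of j] vl[of j] by (cases "j \<in> B") auto
    qed
    moreover have "\<dots> = (\<Sum>j<N. v j * lap x j)" by (simp add: sum_lap_commute)
    moreover have "\<dots> = (\<Sum>j<N. if j = e then v j else 0)"
    proof (intro sum.cong refl)
      fix j assume "j \<in> {..<N}"
      then show "v j * lap x j = (if j = e then v j else 0)"
        using xl[of j] vB[of j] False by (cases "j \<in> B") auto
    qed
    ultimately show ?thesis using e by simp
  qed
  \<comment> \<open>Pairing with the harmonic extension of 1 / q at e only shows that the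
    discrepancy at e is an integral multiple of q. The assumed size of q exceeds every possible
    discrepancy, so it vanishes.\<close>
  have lapB: "lap v e = of_int (k e)" if e: "e < N" "e \<in> B" for e
  proof -
    define x where "x = hext B (\<lambda>j. if j = e then 1 / q else 0)"
    have xB: "x i = (if i = e then 1 / q else 0)" if "i < N" "i \<in> B" for i
      unfolding x_def by (rule hext(1)[OF s that])
    have xl: "lap x i = 0" if "i < N" "i \<notin> B" for i unfolding x_def by (rule hext(2)[OF s that])
    have "(\<Sum>j<N. of_int (k j) * x j) \<in> \<int>" by (rule triv') (use xB xl q0 in auto)
    moreover have "(\<Sum>j<N. lap v j * x j) = 0"
      unfolding sum_lap_commute[symmetric]
    proof (intro sum.neutral ballI)
      fix j assume "j \<in> {..<N}"
      then show "v j * lap x j = 0" using vB[of j] xl[of j] by (cases "j \<in> B") auto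
    qed
    ultimately have "(\<Sum>j<N. (of_int (k j) - lap v j) * x j) \<in> \<int>"
      by (simp add: left_diff_distrib sum_subtractf)
    also have "(\<Sum>j<N. (of_int (k j) - lap v j) * x j) = (\<Sum>j<N. if j = e then (of_int (k j) - lap v j) / q else 0)"
    proof (intro sum.cong refl)
      fix j assume "j \<in> {..<N}"
      then show "(of_int (k j) - lap v j) * x j = (if j = e then (of_int (k j) - lap v j) / q else 0)"
        using vl[of j] xB[of j] e by (cases "j \<in> B") auto
    qed
    also have "\<dots> = (of_int (k e) - lap v e) / q" using e by simp
    finally have int: "(of_int (k e) - lap v e) / q \<in> \<int>" .
    have "\<bar>lap v e\<bar> \<le> 2 * of_int d * ((of_int d + 1) ^ R * M)"
    proof -
      have "\<bar>\<Sum>j<N. of_int (c e j) * v j\<bar> \<le> (\<Sum>j<N. of_int (c e j) * ((of_int d + 1) ^ R * M))"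
        using vb c_nonneg by (intro order_trans[OF sum_abs] sum_mono) (auto simp: abs_mult intro!: mult_left_mono)
      also have "\<dots> = of_int d * ((of_int d + 1) ^ R * M)"
        using c_sum[OF e(1)] by (metis of_int_sum sum_distrib_right)
      finally have 1: "\<bar>\<Sum>j<N. of_int (c e j) * v j\<bar> \<le> of_int d * ((of_int d + 1) ^ R * M)" .
      have "\<bar>of_int d * v e\<bar> \<le> of_int d * ((of_int d + 1) ^ R * M)"
        using vb[OF e(1)] d_pos by (simp add: abs_mult)
      with 1 show ?thesis unfolding lap_def by linarith
    qed
    then have "\<bar>of_int (k e) - lap v e\<bar> < q" using k[OF e(1)] q by linarith
    then have "\<bar>(of_int (k e) - lap v e) / q\<bar> < 1" using q0 by (simp add: abs_divide)
    then have "(of_int (k e) - lap v e) / q = 0" using int Ints_nonzero_abs_less1 by blast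
    then show ?thesis using q0 by simp
  qed
  define u where "u i = (if i < N then \<lfloor>v i\<rfloor> else 0)" for i
  have uv: "of_int (u i) = v i" if "i < N" for i using vint[OF that] that by (auto simp: u_def elim: Ints_cases)
  show ?thesis
  proof (rule that[of u])
    show "lap (\<lambda>j. of_int (u j)) i = of_int (k i)" if "i < N" for i
      using lap_cong[OF that, of "\<lambda>j. of_int (u j)" v] uv vl[OF that] lapB[OF that] by (cases "i \<in> B") auto
    show "u i = 0" if "i \<in> B" for i using that B vB by (auto simp: u_def)
    show "\<bar>of_int (u i)\<bar> \<le> (of_int d + 1) ^ R * M" if "i < N" for i using uv[OF that] vb[OF that] by simp
  qed
qed

text \<open>A discrete strong maximum principle. If |u| attained the current bound at i, harmonicity
  within distance R would propagate this value along a path to B, where u vanishes. As u is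
  integral, the bound drops by at least 1 with each layer of width R + 1.\<close>

lemma integer_potential_decay:
  fixes u :: "nat \<Rightarrow> int" and M :: nat
  assumes dense: "\<And>i. i < N \<Longrightarrow> reaches R B i" and uB: "\<And>i. i \<in> B \<Longrightarrow> u i = 0"
    and lap0: "\<And>i. i < N \<Longrightarrow> \<not> reaches r0 Z i \<Longrightarrow> lap (\<lambda>j. of_int (u j)) i = 0"
    and M: "\<And>i. i < N \<Longrightarrow> \<bar>u i\<bar> \<le> int M"
  shows "i < N \<Longrightarrow> \<not> reaches (r0 + n * (R + 1)) Z i \<Longrightarrow> \<bar>u i\<bar> \<le> int (M - n)"
proof (induction n arbitrary: i)
  case 0
  then show ?case using M by simp
next
  case (Suc n)
  have far: "\<not> reaches (r0 + n * (R + 1)) Z j" if "(i, j) \<in> adj ^^ l" "l \<le> R" for j l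
  proof
    assume "reaches (r0 + n * (R + 1)) Z j"
    then obtain m s where m: "m \<le> r0 + n * (R + 1)" "s \<in> Z" "(j, s) \<in> adj ^^ m" by (auto simp: reaches_def)
    have "(i, s) \<in> adj ^^ (l + m)" unfolding relpow_add using that m by blast
    then show False using Suc.prems(2) m that(2) by (auto simp: reaches_def)
  qed
  have IH: "\<bar>u j\<bar> \<le> int (M - n)" if "(i, j) \<in> adj ^^ l" "l \<le> R" for j l
    using Suc.IH[OF relpow_adj_lt[OF that(1) Suc.prems(1)] far[OF that]] .
  have lapj: "lap (\<lambda>j. of_int (u j)) j = 0" if "(i, j) \<in> adj ^^ l" "l \<le> R" for j l
  proof (rule lap0)
    show "j < N" by (rule relpow_adj_lt[OF that(1) Suc.prems(1)])
    show "\<not> reaches r0 Z j" using far[OF that] reaches_mono[of r0 Z j "r0 + n * (R + 1)" Z] by auto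
  qed
  obtain m s where m: "m \<le> R" "s \<in> B" "(i, s) \<in> adj ^^ m"
    using dense[OF Suc.prems(1)] by (auto simp: reaches_def)
  have contra: False if K: "\<sigma> * u i = int (M - n)" "0 < M - n" and \<sigma>: "\<sigma> = 1 \<or> \<sigma> = - 1" for \<sigma> :: int
  proof -
    define z where "z j = real_of_int (\<sigma> * u j)" for j
    have "real (M - n) \<le> (of_int d + 1) ^ m * (0 + 0)"
    proof (rule path_bound[where z = z and S = B, OF m(3) Suc.prems(1) m(2)])
      show "z j \<le> real (M - n)" if "l \<le> m" "(i, j) \<in> adj ^^ l" for l j
      proof -
        have "\<sigma> * u j \<le> int (M - n)" using IH[OF that(2)] that(1) m(1) \<sigma> by auto
        then show ?thesis unfolding z_def by linarith
      qed
      show "lap z j \<le> 0" if "l < m" "(i, j) \<in> adj ^^ l" for l j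
        using lapj[OF that(2)] that(1) m(1) \<sigma> lap_uminus[of "\<lambda>j. of_int (u j)" j] unfolding z_def by auto
      show "z s \<le> 0" if "s \<in> B" for s using uB[OF that] by (simp add: z_def)
      show "real (M - n) - 0 \<le> z i" using K(1) by (simp add: z_def)
    qed auto
    then show False using K(2) by simp
  qed
  have ui: "\<bar>u i\<bar> \<le> int (M - n)" using IH[of i 0] by simp
  show ?case
  proof (cases "0 < M - n")
    case True
    then have "u i \<noteq> int (M - n)" "- u i \<noteq> int (M - n)" using contra[of 1] contra[of "- 1"] by auto
    then show ?thesis using ui True by linarith
  qed (use ui in auto)
qed

end

text \<open>The dual group of the torus consists of the finitely supported integer functions; h
  lists the exponents of the character.\<close>

definition chi :: "('g \<Rightarrow> int) \<Rightarrow> ('g \<Rightarrow> complex) \<Rightarrow> complex" where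
  "chi h x = (\<Prod>w\<in>supp h. x w powi h w)"

lemma chi_mono: "finite W \<Longrightarrow> supp h \<subseteq> W \<Longrightarrow> chi h x = (\<Prod>w\<in>W. x w powi h w)"
  unfolding chi_def by (rule prod.mono_neutral_left) (auto simp: supp_def)

lemma prod_powi_distrib: "(\<Prod>i\<in>A. g i) powi k = (\<Prod>i\<in>A. (g i :: complex) powi k)"
  by (induction A rule: infinite_finite_induct) (auto simp: power_int_mult_distrib)

lemma powi_sum: "(x::complex) \<noteq> 0 \<Longrightarrow> x powi (\<Sum>i\<in>A. k i) = (\<Prod>i\<in>A. x powi k i)"
  by (induction A rule: infinite_finite_induct) (auto simp: power_int_add)

section \<open>Orbit averages of characters\<close>

context quot
begin

lemma chi_emb: "chi h (\<lambda>w. emb y (a + w)) = cis (2 * pi * (\<Sum>w\<in>supp h. of_int (h w) * y (ix (a + w))))"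
  by (simp add: chi_def emb_def prod_cis_powi sum_distrib_left mult_ac)

text \<open>Regrouping the factors by the values of v turns \<open>chi h\<close> into a product of
  powers of the defining equations of the model, each of which is 1.\<close>

lemma chi_convolution_trivial:
  assumes v: "finite (supp v)" and h: "\<And>w. h w = (\<Sum>s\<in>supp f. v (w + s) * f s)"
    and x: "x \<in> harmonic_model f"
  shows "chi h x = 1"
proof -
  define W where "W = (\<lambda>(w, s). w + s) ` (supp v \<times> supp f)"
  have finW: "finite W" using v fin_supp by (simp add: W_def)
  have xn: "x t \<noteq> 0" for t using model_norm[OF x, of t] by auto
  have "supp h \<subseteq> W"
  proof
    fix w assume "w \<in> supp h"
    then obtain s where s: "s \<in> supp f" "v (w + s) \<noteq> 0"
      unfolding supp_def h by (auto elim!: sum.not_neutral_contains_not_neutral)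
    then have "(w + s, - s) \<in> supp v \<times> supp f" using supp_minus by (auto simp: supp_def)
    then show "w \<in> W" unfolding W_def by (auto intro!: image_eqI[of _ _ "(w + s, - s)"] simp: add.assoc)
  qed
  then have "chi h x = (\<Prod>w\<in>W. x w powi h w)" by (rule chi_mono[OF finW])
  also have "\<dots> = (\<Prod>w\<in>W. \<Prod>s\<in>supp f. x w powi (v (w + s) * f s))"
    unfolding h using xn by (simp add: powi_sum)
  \<comment> \<open>Symmetry of f replaces w + s by w - s, the form in which substituting w + s for
    w exposes the equations.\<close>
  also have "\<dots> = (\<Prod>w\<in>W. \<Prod>s\<in>supp f. x w powi (v (w - s) * f s))"
  proof (rule prod.cong[OF refl])
    fix w
    show "(\<Prod>s\<in>supp f. x w powi (v (w + s) * f s)) = (\<Prod>s\<in>supp f. x w powi (v (w - s) * f s))"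
      by (rule prod.reindex_bij_witness[of _ uminus uminus]) (auto simp: supp_minus f_sym)
  qed
  also have "\<dots> = (\<Prod>s\<in>supp f. \<Prod>w\<in>W. x w powi (v (w - s) * f s))" by (rule prod.swap)
  also have "\<dots> = (\<Prod>s\<in>supp f. \<Prod>w\<in>supp v. x (w + s) powi (v w * f s))"
  proof (rule prod.cong[OF refl])
    fix s assume s: "s \<in> supp f"
    have "(\<Prod>w\<in>W. x w powi (v (w - s) * f s)) = (\<Prod>w\<in>(\<lambda>w. w + s) ` supp v. x w powi (v (w - s) * f s))"
    proof (rule prod.mono_neutral_right[OF finW])
      show "(\<lambda>w. w + s) ` supp v \<subseteq> W" using s by (auto simp: W_def)
      show "\<forall>w\<in>W - (\<lambda>w. w + s) ` supp v. x w powi (v (w - s) * f s) = 1"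
      proof
        fix w assume "w \<in> W - (\<lambda>w. w + s) ` supp v"
        then have "w - s \<notin> supp v" by (metis DiffD2 diff_add_cancel imageI)
        then show "x w powi (v (w - s) * f s) = 1" by (simp add: supp_def)
      qed
    qed
    also have "\<dots> = (\<Prod>w\<in>supp v. x (w + s) powi (v w * f s))"
      by (subst prod.reindex) (auto simp: inj_on_def)
    finally show "(\<Prod>w\<in>W. x w powi (v (w - s) * f s)) = (\<Prod>w\<in>supp v. x (w + s) powi (v w * f s))" .
  qed
  also have "\<dots> = (\<Prod>w\<in>supp v. \<Prod>s\<in>supp f. x (w + s) powi (v w * f s))" by (rule prod.swap)
  also have "\<dots> = (\<Prod>w\<in>supp v. (\<Prod>s\<in>supp f. x (w + s) powi f s) powi v w)"
    by (simp add: prod_powi_distrib power_int_mult mult.commute)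
  also have "\<dots> = 1" using model_eq[OF x] by simp
  finally show ?thesis .
qed

text \<open>The exponents, on the vertices of the quotient, of the character \<open>chi h\<close>
  read along the orbit at a; see \<open>sum_per\<close>.\<close>

definition per :: "('g \<Rightarrow> int) \<Rightarrow> 'g \<Rightarrow> nat \<Rightarrow> int" where
  "per h a i = (\<Sum>w\<in>supp h. if ix (a + w) = i then h w else 0)"

lemma sum_per: "(\<Sum>i<N. of_int (per h a i) * y i) = (\<Sum>w\<in>supp h. of_int (h w) * y (ix (a + w)))"
proof -
  have "(\<Sum>i<N. of_int (per h a i) * y i) = (\<Sum>i<N. \<Sum>w\<in>supp h. if ix (a + w) = i then of_int (h w) * y i else 0)"
    unfolding per_def of_int_sum sum_distrib_right by (intro sum.cong refl) auto
  also have "\<dots> = (\<Sum>w\<in>supp h. \<Sum>i<N. if ix (a + w) = i then of_int (h w) * y i else 0)" by (rule sum.swap)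
  finally show ?thesis by (simp add: ix_sum_edge)
qed

lemma per_abs_le: "\<bar>per h a i\<bar> \<le> (\<Sum>w\<in>supp h. \<bar>h w\<bar>)"
  unfolding per_def by (intro order_trans[OF sum_abs] sum_mono) auto

lemma wball_mono: "r \<le> r' \<Longrightarrow> wball r \<subseteq> wball r'"
proof (induction r' rule: nat_induct_at_least)
  case (Suc n)
  have "wball n \<subseteq> wball (Suc n)" by (auto intro!: image_eqI[where x = "(w, 0)" for w])
  then show ?case using Suc by blast
qed simp

lemma wball_add: "w \<in> wball r \<Longrightarrow> s \<in> supp f \<Longrightarrow> w + s \<in> wball (Suc r)"
  by (auto intro!: image_eqI[of _ _ "(w, s)"])

lemma reaches_ix_iff: "reaches r {ix b} (ix a) \<Longrightarrow> \<exists>w\<in>wball r. ix b = ix (a + w)"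
  unfolding reaches_def using relpow_adj_wball wball_mono by blast

lemma ix_reaches: "w \<in> wball r \<Longrightarrow> reaches r {ix (a + w)} (ix a)"
  unfolding reaches_def using wball_relpow_adj by blast

lemma reaches_trans: "reaches r {j} i \<Longrightarrow> reaches r' {k} j \<Longrightarrow> reaches (r + r') {k} i"
proof -
  assume "reaches r {j} i" "reaches r' {k} j"
  then obtain m m' where "m \<le> r" "(i, j) \<in> adj ^^ m" "m' \<le> r'" "(j, k) \<in> adj ^^ m'"
    by (auto simp: reaches_def)
  then have "(i, k) \<in> adj ^^ (m + m')" "m + m' \<le> r + r'" by (auto simp: relpow_add)
  then show ?thesis unfolding reaches_def by blast
qed

lemma reaches_sym: "reaches r {j} i \<Longrightarrow> reaches r {i} j"
  unfolding reaches_def using relpow_adj_sym by blast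

text \<open>The potential u from \<open>trivial_character_potential\<close> vanishes beyond distance
  D of a and b: r0 covers the support of h, and the bound (d + 1)^R 2 Mh on u is used up in as many
  layers of width R + 1. Since a and b are far apart and the quotient map is injective near a, the
  part of u near a lifts to a function v on the group whose convolution with f is h.\<close>

lemma trivial_difference_imp_convolution:
  fixes h :: "'g \<Rightarrow> int" and Mh r0 q R :: nat
  defines "D \<equiv> r0 + (nat (dd + 1)) ^ R * (2 * Mh) * (R + 1)"
  assumes dense: "\<And>i. i < N \<Longrightarrow> reaches R B i" and B: "B \<subseteq> {..<N}"
    and finh: "finite (supp h)" and h: "supp h \<subseteq> wball r0" "(\<Sum>w\<in>supp h. \<bar>h w\<bar>) \<le> int Mh"
    and q: "2 * real Mh + 2 * of_int dd * ((of_int dd + 1) ^ R * (2 * real Mh)) < real q"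
    and inj: "inj_on ix (wball (D + 2))"
    and far: "\<not> reaches (2 * D + 2) {ix b} (ix a)"
    and triv: "\<And>y. y \<in> agrp q B \<Longrightarrow> (\<Sum>j<N. of_int (per h a j - per h b j) * y j) \<in> \<int>"
  obtains v where "finite (supp v)" "\<And>w. h w = (\<Sum>s\<in>supp f. v (w + s) * f s)"
proof -
  let ?k = "\<lambda>i. per h a i - per h b i"
  have r0D: "r0 \<le> D" by (simp add: D_def)
  have kb: "\<bar>of_int (?k i)\<bar> \<le> 2 * real Mh" for i
  proof -
    have "\<bar>?k i\<bar> \<le> 2 * int Mh" using per_abs_le[of h a i] per_abs_le[of h b i] h(2) by linarith
    then show ?thesis by linarith
  qed
  obtain u :: "nat \<Rightarrow> int" where ul: "\<And>i. i < N \<Longrightarrow> lap (\<lambda>j. of_int (u j)) i = of_int (?k i)"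
    and uB: "\<And>i. i \<in> B \<Longrightarrow> u i = 0" and ub: "\<And>i. i < N \<Longrightarrow> \<bar>of_int (u i)\<bar> \<le> (of_int dd + 1) ^ R * (2 * real Mh)"
    using trivial_character_potential[OF dense B kb q triv] by blast
  have ub': "\<bar>u i\<bar> \<le> int ((nat (dd + 1)) ^ R * (2 * Mh))" if "i < N" for i
  proof -
    have "real_of_int \<bar>u i\<bar> \<le> real_of_int (int ((nat (dd + 1)) ^ R * (2 * Mh)))"
      using ub[OF that] dd_pos by simp
    then show ?thesis by linarith
  qed
  have per0: "per h c i = 0" if "\<not> reaches r0 {ix c} i" for c i
    unfolding per_def
  proof (intro sum.neutral ballI)
    fix w assume "w \<in> supp h"
    then have "reaches r0 {ix (c + w)} (ix c)" using ix_reaches h by blast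
    then show "(if ix (c + w) = i then h w else 0) = 0" using that reaches_sym by auto
  qed
  have u0: "u i = 0" if "i < N" "\<not> reaches D {ix a, ix b} i" for i
  proof -
    have "\<bar>u i\<bar> \<le> int ((nat (dd + 1)) ^ R * (2 * Mh) - (nat (dd + 1)) ^ R * (2 * Mh))"
    proof (rule integer_potential_decay[OF dense uB _ ub' that(1)])
      show "lap (\<lambda>j. of_int (u j)) i = 0" if "i < N" "\<not> reaches r0 {ix a, ix b} i" for i
        using ul[OF that(1)] per0[of a i] per0[of b i] that(2) by (auto simp: reaches_def)
      show "\<not> reaches (r0 + (nat (dd + 1)) ^ R * (2 * Mh) * (R + 1)) {ix a, ix b} i"
        using that(2) by (simp add: D_def)
    qed
    then show ?thesis by simp
  qed
  have inj': "x = x'" if "x \<in> wball (D + 2)" "x' \<in> wball (D + 2)" "ix (a + x) = ix (a + x')" for x x'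
    using inj_onD[OF inj _ that(1,2)] that(3) unfolding ix_add_left by blast
  define v where "v w = (if w \<in> wball D then u (ix (a + w)) else 0)" for w
  have "finite (supp v)" by (rule finite_subset[OF _ finite_wball[of D]]) (auto simp: supp_def v_def)
  moreover have "h w = (\<Sum>s\<in>supp f. v (w + s) * f s)" for w
  \<comment> \<open>Only within radius D + 1 can a point have a neighbour in the support of v; such
    neighbours lie within D + 2, where \<open>ix\<close> is still injective.\<close>
  proof (cases "w \<in> wball (Suc D)")
    case True
    have v: "v (w + s) = u (ix (a + w + s))" if s: "s \<in> supp f" for s
    proof (cases "w + s \<in> wball D")
      case False
      have ws: "w + s \<in> wball (D + 2)" using wball_add[OF True s] by simp
      have "\<not> reaches D {ix a} (ix (a + w + s))"
      proof
        assume "reaches D {ix a} (ix (a + w + s))"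
        then obtain w' where "w' \<in> wball D" "ix (a + w + s) = ix (a + w')"
          using reaches_ix_iff[OF reaches_sym] by blast
        moreover from this have "w' \<in> wball (D + 2)" using wball_mono[of D "D + 2"] by auto
        ultimately show False using inj'[OF ws] False by (metis add.assoc)
      qed
      moreover have "\<not> reaches D {ix b} (ix (a + w + s))"
      proof
        assume "reaches D {ix b} (ix (a + w + s))"
        moreover have "reaches (D + 2) {ix (a + w + s)} (ix a)"
          using ix_reaches[OF ws, of a] by (simp add: add.assoc)
        ultimately have "reaches (D + 2 + D) {ix b} (ix a)" using reaches_trans by blast
        then show False using far by (simp add: mult_2)
      qed
      ultimately have "\<not> reaches D {ix a, ix b} (ix (a + w + s))" by (auto simp: reaches_def)
      then have "u (ix (a + w + s)) = 0" using u0 ix_lt by blast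
      then show ?thesis using False by (simp add: v_def)
    qed (simp add: v_def add.assoc)
    have "real_of_int (\<Sum>s\<in>supp f. v (w + s) * f s) = (\<Sum>s\<in>supp f. of_int (f s) * of_int (u (ix (a + w + s))))"
      by (simp add: v mult.commute)
    also have "\<dots> = of_int (?k (ix (a + w)))" using ul[OF ix_lt, of "a + w"] by (simp add: lap_ix)
    finally have "(\<Sum>s\<in>supp f. v (w + s) * f s) = ?k (ix (a + w))" by linarith
    moreover have "per h b (ix (a + w)) = 0"
    proof (rule per0)
      show "\<not> reaches r0 {ix b} (ix (a + w))"
      proof
        assume "reaches r0 {ix b} (ix (a + w))"
        then have "reaches (Suc D + r0) {ix b} (ix a)" using reaches_trans[OF ix_reaches[OF True]] by blast
        then have "reaches (2 * D + 2) {ix b} (ix a)" using r0D by (elim reaches_mono) auto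
        with far show False ..
      qed
    qed
    moreover have "per h a (ix (a + w)) = h w"
    proof -
      have "per h a (ix (a + w)) = (\<Sum>w'\<in>supp h. if w' = w then h w' else 0)"
        unfolding per_def
      proof (intro sum.cong refl if_cong)
        fix w' assume "w' \<in> supp h"
        then have "w' \<in> wball (D + 2)" "w \<in> wball (D + 2)"
          using h(1) r0D True wball_mono[of r0 "D + 2"] wball_mono[of "Suc D" "D + 2"] by auto
        then show "(ix (a + w') = ix (a + w)) = (w' = w)" using inj' by blast
      qed
      also have "\<dots> = h w" using finh by (auto simp: sum.delta' supp_def)
      finally show ?thesis .
    qed
    ultimately show ?thesis by simp
  next
    case False
    have "v (w + s) = 0" if s: "s \<in> supp f" for s
    proof -
      have "w + s \<notin> wball D"
      proof
        assume "w + s \<in> wball D"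
        then have "w + s + (- s) \<in> wball (Suc D)" using s supp_minus by (intro wball_add) auto
        with False show False by (simp add: add.assoc)
      qed
      then show ?thesis by (simp add: v_def)
    qed
    moreover have "h w = 0" using False h(1) wball_mono[of r0 "Suc D"] r0D by (auto simp: supp_def)
    ultimately show ?thesis by simp
  qed
  ultimately show ?thesis using that by blast
qed

definition orbit_mean :: "('g \<Rightarrow> int) \<Rightarrow> (nat \<Rightarrow> real) \<Rightarrow> complex" where
  "orbit_mean h y = (\<Sum>i<N. chi h (\<lambda>w. emb y (rep i + w))) / of_nat N"

text \<open>Expanding the square gives, for each pair i, j, a character sum over
  \<open>agrp q B\<close>. A pair farther apart than 2 D + 2 contributes 0, for otherwise
  \<open>chi h\<close> would be trivial on the model, so each i keeps at most a ball of partners.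
  The translate z contributes factors of modulus 1.\<close>

lemma orbit_mean_second_moment:
  fixes h :: "'g \<Rightarrow> int" and Mh r0 q R :: nat and z :: "nat \<Rightarrow> real"
  defines "D \<equiv> r0 + (nat (dd + 1)) ^ R * (2 * Mh) * (R + 1)"
  assumes dense: "\<And>i. i < N \<Longrightarrow> reaches R B i" and B: "B \<subseteq> {..<N}"
    and finh: "finite (supp h)" and h: "supp h \<subseteq> wball r0" "(\<Sum>w\<in>supp h. \<bar>h w\<bar>) \<le> int Mh"
    and nontriv: "x \<in> harmonic_model f" "chi h x \<noteq> 1"
    and q: "2 * real Mh + 2 * of_int dd * ((of_int dd + 1) ^ R * (2 * real Mh)) < real q"
    and inj: "inj_on ix (wball (D + 2))"
  shows "(\<Sum>y\<in>agrp q B. (cmod (orbit_mean h (\<lambda>m. y m + z m)))\<^sup>2) \<le> card (agrp q B) * card (wball (2 * D + 2)) / N"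
proof -
  let ?e = "\<lambda>k y. cis (2 * pi * (\<Sum>m<N. of_int (k m) * y m))"
  define k where "k i j m = per h (rep i) m - per h (rep j) m" for i j m
  define P where "P = {(i, j). i < N \<and> j < N \<and> reaches (2 * D + 2) {j} i}"
  have chi: "chi h (\<lambda>w. emb y (rep i + w)) = ?e (per h (rep i)) y" for y i
    by (simp add: chi_emb sum_per)
  have sq: "complex_of_real ((cmod (orbit_mean h y))\<^sup>2) = (\<Sum>i<N. \<Sum>j<N. ?e (k i j) y) / of_nat N ^ 2" for y
  proof -
    have "complex_of_real ((cmod (orbit_mean h y))\<^sup>2) = orbit_mean h y * cnj (orbit_mean h y)"
      by (rule complex_norm_square)
    also have "\<dots> = (\<Sum>i<N. ?e (per h (rep i)) y) * (\<Sum>j<N. cnj (?e (per h (rep j)) y)) / of_nat N ^ 2"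
      by (simp add: orbit_mean_def chi power2_eq_square)
    also have "(\<Sum>i<N. ?e (per h (rep i)) y) * (\<Sum>j<N. cnj (?e (per h (rep j)) y)) = (\<Sum>i<N. \<Sum>j<N. ?e (k i j) y)"
      unfolding sum_product
      by (intro sum.cong refl) (simp add: cis_cnj cis_mult k_def left_diff_distrib right_diff_distrib sum_subtractf)
    finally show ?thesis .
  qed
  have bound: "cmod (\<Sum>y\<in>agrp q B. ?e (k i j) (\<lambda>m. y m + z m)) \<le> (if (i, j) \<in> P then real (card (agrp q B)) else 0)"
    if ij: "i < N" "j < N" for i j
  proof (cases "(i, j) \<in> P")
    case True
    have "cmod (\<Sum>y\<in>agrp q B. ?e (k i j) (\<lambda>m. y m + z m)) \<le> (\<Sum>y\<in>agrp q B. 1)"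
      by (intro sum_norm_le) simp
    then show ?thesis using True by simp
  next
    case False
    have "\<exists>y0\<in>agrp q B. (\<Sum>m<N. of_int (k i j m) * y0 m) \<notin> \<int>"
    proof (rule ccontr)
      assume "\<not> ?thesis"
      then have triv: "(\<Sum>m<N. of_int (per h (rep i) m - per h (rep j) m) * y m) \<in> \<int>" if "y \<in> agrp q B" for y
        using that by (auto simp: k_def)
      have "\<not> reaches (2 * D + 2) {ix (rep j)} (ix (rep i))"
        using False ij by (simp add: P_def ix_rep)
      then obtain v where "finite (supp v)" "\<And>w. h w = (\<Sum>s\<in>supp f. v (w + s) * f s)"
        using trivial_difference_imp_convolution[OF dense B finh h q inj[unfolded D_def] _ triv]
        unfolding D_def by blast
      then have "chi h x = 1" using chi_convolution_trivial nontriv(1) by blast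
      with nontriv(2) show False ..
    qed
    then have "(\<Sum>y\<in>agrp q B. ?e (k i j) y) = 0" using character_sum_zero by blast
    moreover have "(\<Sum>y\<in>agrp q B. ?e (k i j) (\<lambda>m. y m + z m)) = ?e (k i j) z * (\<Sum>y\<in>agrp q B. ?e (k i j) y)"
      unfolding sum_distrib_left
      by (intro sum.cong refl) (simp add: cis_mult distrib_left sum.distrib add.commute)
    ultimately show ?thesis using False by simp
  qed
  have cardP: "card P \<le> N * card (wball (2 * D + 2))"
  proof -
    have "P \<subseteq> (\<lambda>(i, w). (i, ix (rep i + w))) ` ({..<N} \<times> wball (2 * D + 2))"
    proof
      fix p assume "p \<in> P"
      then obtain i j where ij: "p = (i, j)" "i < N" "j < N" "reaches (2 * D + 2) {ix (rep j)} (ix (rep i))"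
        by (auto simp: P_def ix_rep)
      then obtain w where "w \<in> wball (2 * D + 2)" "ix (rep j) = ix (rep i + w)" using reaches_ix_iff by blast
      then show "p \<in> (\<lambda>(i, w). (i, ix (rep i + w))) ` ({..<N} \<times> wball (2 * D + 2))"
        using ij by (auto simp: ix_rep intro!: image_eqI[of _ _ "(i, w)"])
    qed
    then have "card P \<le> card ({..<N} \<times> wball (2 * D + 2))"
      using surj_card_le[of "{..<N} \<times> wball (2 * D + 2)"] finite_wball by blast
    then show ?thesis by (simp add: card_cartesian_product)
  qed
  have cardP': "real (card P) \<le> real N * real (card (wball (2 * D + 2)))"
    using cardP unfolding of_nat_mult[symmetric] by (rule of_nat_mono)
  have "complex_of_real (\<Sum>y\<in>agrp q B. (cmod (orbit_mean h (\<lambda>m. y m + z m)))\<^sup>2) =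
      (\<Sum>y\<in>agrp q B. \<Sum>i<N. \<Sum>j<N. ?e (k i j) (\<lambda>m. y m + z m)) / of_nat N ^ 2"
    unfolding of_real_sum sq by (simp add: sum_divide_distrib)
  also have "(\<Sum>y\<in>agrp q B. \<Sum>i<N. \<Sum>j<N. ?e (k i j) (\<lambda>m. y m + z m)) =
      (\<Sum>i<N. \<Sum>j<N. \<Sum>y\<in>agrp q B. ?e (k i j) (\<lambda>m. y m + z m))"
    by (subst sum.swap, intro sum.cong refl, rule sum.swap)
  finally have eq: "complex_of_real (\<Sum>y\<in>agrp q B. (cmod (orbit_mean h (\<lambda>m. y m + z m)))\<^sup>2) =
      (\<Sum>i<N. \<Sum>j<N. \<Sum>y\<in>agrp q B. ?e (k i j) (\<lambda>m. y m + z m)) / of_nat N ^ 2" .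
  have "(\<Sum>y\<in>agrp q B. (cmod (orbit_mean h (\<lambda>m. y m + z m)))\<^sup>2) =
      cmod (complex_of_real (\<Sum>y\<in>agrp q B. (cmod (orbit_mean h (\<lambda>m. y m + z m)))\<^sup>2))"
    by (simp add: sum_nonneg del: of_real_sum)
  also have "\<dots> \<le> (\<Sum>i<N. \<Sum>j<N. if (i, j) \<in> P then real (card (agrp q B)) else 0) / real N ^ 2"
  proof -
    have "cmod (\<Sum>i<N. \<Sum>j<N. \<Sum>y\<in>agrp q B. ?e (k i j) (\<lambda>m. y m + z m)) \<le>
        (\<Sum>i<N. \<Sum>j<N. if (i, j) \<in> P then real (card (agrp q B)) else 0)"
      using bound by (intro sum_norm_le) (simp_all only: lessThan_iff)
    then show ?thesis unfolding eq by (simp add: norm_divide norm_power divide_right_mono)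
  qed
  also have "(\<Sum>i<N. \<Sum>j<N. if (i, j) \<in> P then real (card (agrp q B)) else 0) = card (agrp q B) * card P"
  proof -
    have fP: "P \<subseteq> {..<N} \<times> {..<N}" by (auto simp: P_def)
    have "(\<Sum>i<N. \<Sum>j<N. if (i, j) \<in> P then real (card (agrp q B)) else 0) =
        (\<Sum>p\<in>{..<N} \<times> {..<N}. if p \<in> P then real (card (agrp q B)) else 0)"
      by (simp add: sum.cartesian_product case_prod_beta)
    also have "\<dots> = (\<Sum>p\<in>P. real (card (agrp q B)))"
      using fP by (simp add: sum.If_cases Int_absorb1)
    finally show ?thesis by simp
  qed
  also have "card (agrp q B) * card P / real N ^ 2 \<le> card (agrp q B) * (real N * card (wball (2 * D + 2))) / real N ^ 2"
    using cardP' by (intro divide_right_mono) (simp_all add: mult_left_mono del: wball.simps)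
  also have "\<dots> = card (agrp q B) * card (wball (2 * D + 2)) / N"
    using N_pos by (simp add: power2_eq_square del: wball.simps)
  finally show ?thesis .
qed

end


section \<open>Haar measure on closed subgroups of a torus\<close>

lemma compact_PiE_UNIV:
  fixes S :: "'i \<Rightarrow> 'a::topological_space set"
  assumes "\<And>i. compact (S i)"
  shows "compact (PiE UNIV S)"
  using assms compactin_PiE[of "\<lambda>_. euclidean" UNIV S]
  by (simp add: euclidean_product_topology compactin_euclidean_iff)

definition torus :: "('i \<Rightarrow> complex) set" where
  "torus = {x. \<forall>t. cmod (x t) = 1}"

lemma compact_torus: "compact (torus :: ('i \<Rightarrow> complex) set)"
proof -
  have eq: "(torus :: ('i \<Rightarrow> complex) set) = PiE UNIV (\<lambda>_. sphere 0 1)" by (auto simp: torus_def)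
  show ?thesis
    unfolding eq
  proof (rule compact_PiE_UNIV)
    show "compact (sphere (0 :: complex) 1)" by simp
  qed
qed

section \<open>Coding the torus by digit sequences\<close>

lemma binary_expansion:
  assumes "0 \<le> y" "y < 1"
  obtains b :: "nat \<Rightarrow> real" where "\<And>j. b j \<in> {0, 1}" "(\<lambda>j. b j / 2 ^ (j + 1)) sums y"
proof -
  define b where "b j = real_of_int (\<lfloor>2 ^ (j + 1) * y\<rfloor> - 2 * \<lfloor>2 ^ j * y\<rfloor>)" for j
  have "b j \<in> {0, 1}" for j
  proof -
    define z where "z = 2 ^ j * y"
    have "\<lfloor>2 * z\<rfloor> - 2 * \<lfloor>z\<rfloor> = 0 \<or> \<lfloor>2 * z\<rfloor> - 2 * \<lfloor>z\<rfloor> = 1" by linarith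
    then show ?thesis unfolding b_def by (auto simp: z_def mult.assoc)
  qed
  moreover have part: "(\<Sum>j<n. b j / 2 ^ (j + 1)) = \<lfloor>2 ^ n * y\<rfloor> / 2 ^ n" for n
  proof (induction n)
    case 0
    then show ?case using assms floor_unique[of 0 y] by simp
  next
    case (Suc n)
    then show ?case by (simp add: b_def field_simps)
  qed
  have "(\<lambda>n. \<lfloor>2 ^ n * y\<rfloor> / 2 ^ n) \<longlonglongrightarrow> y"
  proof (rule LIMSEQ_I)
    fix e :: real assume "0 < e"
    then obtain n0 where n0: "(1 / 2) ^ n0 < e" using real_arch_pow_inv[of e "1 / 2"] by auto
    have "norm (\<lfloor>2 ^ n * y\<rfloor> / 2 ^ n - y) < e" if "n0 \<le> n" for n
    proof -
      have "\<lfloor>2 ^ n * y\<rfloor> / 2 ^ n - y = (\<lfloor>2 ^ n * y\<rfloor> - 2 ^ n * y) / 2 ^ n" by (simp add: field_simps)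
      moreover have "\<bar>\<lfloor>2 ^ n * y\<rfloor> - 2 ^ n * y\<bar> \<le> 1" by linarith
      ultimately have "norm (\<lfloor>2 ^ n * y\<rfloor> / 2 ^ n - y) \<le> (1 / 2) ^ n"
        by (simp add: abs_divide power_one_over divide_right_mono)
      also have "\<dots> \<le> (1 / 2) ^ n0" using that by (intro power_decreasing) auto
      finally show ?thesis using n0 by linarith
    qed
    then show "\<exists>no. \<forall>n\<ge>no. norm (\<lfloor>2 ^ n * y\<rfloor> / 2 ^ n - y) < e" by blast
  qed
  then have "(\<lambda>j. b j / 2 ^ (j + 1)) sums y" unfolding sums_def part .
  ultimately show ?thesis using that by blast
qed

definition bits :: "(nat \<Rightarrow> real) set" where "bits = PiE UNIV (\<lambda>_. {0, 1})"

lemma bits_bound: "b \<in> bits \<Longrightarrow> 0 \<le> b n \<and> b n \<le> 1"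
proof -
  assume "b \<in> bits"
  then have "b n \<in> {0, 1}" by (auto simp: bits_def PiE_iff)
  then show ?thesis by auto
qed

lemma compact_bits: "compact bits"
  unfolding bits_def by (intro compact_PiE_UNIV) simp

text \<open>Ternary expansions with digits 0 and 2: the digits can be recovered, which embeds the
  compact space of sequences into the real line.\<close>

definition cantor :: "(nat \<Rightarrow> real) \<Rightarrow> real" where
  "cantor b = (\<Sum>n. 2 * b n / 3 ^ (n + 1))"

lemma summable_thirds: "summable (\<lambda>n. 2 / 3 ^ (n + k) :: real)"
proof -
  have "summable (\<lambda>n. (2 / 3 ^ k) * (1 / 3) ^ n :: real)" by (intro summable_mult summable_geometric) simp
  then show ?thesis by (simp add: power_add power_one_over field_simps)
qed

lemma suminf_thirds: "(\<Sum>n. 2 / 3 ^ (n + k) :: real) = 3 / 3 ^ k"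
proof -
  have "(\<Sum>n. (2 / 3 ^ k) * (1 / 3) ^ n :: real) = (2 / 3 ^ k) * (1 / (1 - 1 / 3))"
    by (subst suminf_mult) (auto simp: summable_geometric suminf_geometric)
  then show ?thesis by (simp add: power_add power_one_over field_simps)
qed

lemma summable_cantor: "b \<in> bits \<Longrightarrow> summable (\<lambda>n. 2 * b n / 3 ^ (n + 1))"
  by (rule summable_comparison_test[OF _ summable_thirds[of 1]])
    (use bits_bound in \<open>auto simp: field_simps intro!: exI[of _ 0]\<close>)

lemma continuous_cantor: "continuous_on bits cantor"
proof -
  have "uniform_limit bits (\<lambda>n b. \<Sum>i<n. 2 * b i / 3 ^ (i + 1)) (\<lambda>b. \<Sum>i. 2 * b i / 3 ^ (i + 1)) sequentially"
    by (rule Weierstrass_m_test[OF _ summable_thirds[of 1]]) (use bits_bound in \<open>auto simp: field_simps\<close>)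
  then show ?thesis
    unfolding cantor_def[abs_def]
    by (rule uniform_limit_theorem[rotated])
      (auto intro!: always_eventually continuous_intros continuous_on_subset[OF continuous_on_product_coordinates])
qed

text \<open>The first differing digit contributes 2 / 3^(n+1) to the difference, more than the 1 /
  3^(n+1) that the later digits can cancel.\<close>

lemma inj_cantor: "inj_on cantor bits"
proof (rule inj_onI, rule ccontr)
  fix b b' assume b: "b \<in> bits" "b' \<in> bits" "cantor b = cantor b'" "b \<noteq> b'"
  define n where "n = (LEAST n. b n \<noteq> b' n)"
  have "\<exists>n. b n \<noteq> b' n" using b(4) by (simp add: fun_eq_iff)
  then have n: "b n \<noteq> b' n" unfolding n_def by (rule LeastI_ex)
  have less: "b k = b' k" if "k < n" for k
    using not_less_Least[OF that[unfolded n_def]] by simp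
  define g where "g k = 2 * (b k - b' k) / 3 ^ (k + 1)" for k
  have g: "g = (\<lambda>k. 2 * b k / 3 ^ (k + 1) - 2 * b' k / 3 ^ (k + 1))"
    by (rule ext) (simp only: g_def right_diff_distrib diff_divide_distrib)
  have gs: "summable g"
    unfolding g by (rule summable_diff[OF summable_cantor[OF b(1)] summable_cantor[OF b(2)]])
  have g0: "suminf g = 0"
    unfolding g suminf_diff[OF summable_cantor[OF b(1)] summable_cantor[OF b(2)], symmetric]
    using b(3) by (simp only: cantor_def diff_self)
  have "suminf g = (\<Sum>k. g (k + (n + 1))) + sum g {..<n + 1}"
    by (rule suminf_split_initial_segment[OF gs])
  moreover have "sum g {..<n + 1} = g n" using less by (simp add: g_def)
  ultimately have "\<bar>g n\<bar> = \<bar>\<Sum>k. g (k + (n + 1))\<bar>" using g0 by simp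
  also have "\<dots> \<le> (\<Sum>k. 2 / 3 ^ (k + (n + 2)))"
  proof -
    have le: "norm (g (k + (n + 1))) \<le> 2 / 3 ^ (k + (n + 2))" for k
    proof -
      have "\<bar>b (k + (n + 1)) - b' (k + (n + 1))\<bar> \<le> 1"
        using bits_bound[OF b(1), of "k + (n + 1)"] bits_bound[OF b(2), of "k + (n + 1)"] by auto
      then show ?thesis by (simp add: g_def abs_mult field_simps)
    qed
    then show ?thesis
      using norm_suminf_le[of "\<lambda>k. g (k + (n + 1))" "\<lambda>k. 2 / 3 ^ (k + (n + 2))"] summable_thirds[of "n + 2"]
      by (simp only: real_norm_def)
  qed
  also have "\<dots> = 1 / 3 ^ (n + 1)" unfolding suminf_thirds by simp
  finally have "\<bar>g n\<bar> \<le> 1 / 3 ^ (n + 1)" .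
  moreover have "b n \<in> {0, 1}" "b' n \<in> {0, 1}" using b(1,2) by (auto simp: bits_def PiE_iff)
  then have "\<bar>b n - b' n\<bar> = 1" using n by auto
  then have "\<bar>g n\<bar> = 2 / 3 ^ (n + 1)" by (simp add: g_def abs_mult)
  ultimately show False by (simp add: field_simps)
qed

text \<open>\<open>prod_encode\<close> distributes one digit sequence over countably many
  coordinates, each read as the binary expansion of an angle.\<close>

definition decode :: "(nat \<Rightarrow> real) \<Rightarrow> nat \<Rightarrow> complex" where
  "decode b = (\<lambda>m. cis (2 * pi * (\<Sum>j. b (prod_encode (m, j)) / 2 ^ (j + 1))))"

lemma continuous_decode: "continuous_on bits decode"
  unfolding decode_def
proof (rule continuous_on_coordinatewise_then_product)
  fix m
  have sm: "summable (\<lambda>j. 1 / 2 ^ (j + 1) :: real)"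
    using summable_mult[OF summable_geometric[of "1 / 2 :: real"], of "1 / 2"] by (simp add: power_one_over)
  have "uniform_limit bits (\<lambda>n b. \<Sum>j<n. b (prod_encode (m, j)) / 2 ^ (j + 1))
      (\<lambda>b. \<Sum>j. b (prod_encode (m, j)) / 2 ^ (j + 1)) sequentially"
    by (rule Weierstrass_m_test[OF _ sm]) (use bits_bound in \<open>auto simp: field_simps\<close>)
  then have "continuous_on bits (\<lambda>b. \<Sum>j. b (prod_encode (m, j)) / 2 ^ (j + 1))"
    by (rule uniform_limit_theorem[rotated])
      (auto intro!: always_eventually continuous_intros continuous_on_subset[OF continuous_on_product_coordinates])
  then show "continuous_on bits (\<lambda>b. cis (2 * pi * (\<Sum>j. b (prod_encode (m, j)) / 2 ^ (j + 1))))"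
    by (intro continuous_intros)
qed

lemma decode_surj:
  assumes "x \<in> torus"
  obtains b where "b \<in> bits" "decode b = x"
proof -
  have "\<exists>b::nat \<Rightarrow> real. (\<forall>j. b j \<in> {0, 1}) \<and> cis (2 * pi * (\<Sum>j. b j / 2 ^ (j + 1))) = x m" for m
  proof -
    obtain y where y: "0 \<le> y" "y < 1" "x m = cis (2 * pi * y)"
      using assms unit_circle_cis_2pi[of "x m"] by (auto simp: torus_def)
    obtain b :: "nat \<Rightarrow> real" where "\<And>j. b j \<in> {0, 1}" "(\<lambda>j. b j / 2 ^ (j + 1)) sums y"
      using binary_expansion[OF y(1,2)] by blast
    then show ?thesis using y(3) sums_unique[of "\<lambda>j. b j / 2 ^ (j + 1)" y] by (intro exI[of _ b]) simp
  qed
  then obtain b :: "nat \<Rightarrow> nat \<Rightarrow> real" where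
    b: "\<And>m j. b m j \<in> {0, 1}" "\<And>m. cis (2 * pi * (\<Sum>j. b m j / 2 ^ (j + 1))) = x m" by metis
  define c where "c n = (case prod_decode n of (m, j) \<Rightarrow> b m j)" for n
  have "c n \<in> {0, 1}" for n using b(1) by (auto simp: c_def split: prod.split)
  then have "c \<in> bits" by (simp add: bits_def PiE_iff)
  moreover have "decode c = x" using b(2) by (simp add: decode_def c_def fun_eq_iff)
  ultimately show ?thesis using that by blast
qed

text \<open>The points are coded by reals in the compact Cantor set \<open>C\<close>, where
  tightness of measures on the line yields a weakly convergent subsequence; its limit is carried
  back to the torus by the decoding map \<open>\<Phi>\<close>.\<close>

lemma torus_weak_limit:
  fixes p :: "nat \<Rightarrow> 'a \<Rightarrow> nat \<Rightarrow> complex"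
  assumes A: "\<And>n. finite (A n)" "\<And>n. A n \<noteq> {}" and p: "\<And>n a. a \<in> A n \<Longrightarrow> p n a \<in> torus"
  obtains r \<mu> where "strict_mono (r :: nat \<Rightarrow> nat)" "prob_space \<mu>" "sets \<mu> = sets borel" "AE x in \<mu>. x \<in> torus"
    "\<And>F :: (nat \<Rightarrow> complex) \<Rightarrow> real. continuous_on UNIV F \<Longrightarrow>
      (\<lambda>n. (\<Sum>a\<in>A (r n). F (p (r n) a)) / card (A (r n))) \<longlonglongrightarrow> integral\<^sup>L \<mu> F"
proof -
  define C where "C = cantor ` bits"
  have compC: "compact C" unfolding C_def by (rule compact_continuous_image[OF continuous_cantor compact_bits])
  define g where "g = inv_into bits cantor"
  have gc: "g (cantor b) = b" if "b \<in> bits" for b unfolding g_def by (rule inv_into_f_f[OF inj_cantor that])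
  have contg: "continuous_on C g" unfolding C_def using gc continuous_cantor compact_bits by (intro continuous_on_inv) auto
  have gC: "g ` C \<subseteq> bits" unfolding C_def using gc by auto
  \<comment> \<open>The constant value off \<open>C\<close> only makes the map total; the limit
    measure is shown to live on \<open>C\<close>.\<close>
  define \<Phi> where "\<Phi> t = (if t \<in> C then decode (g t) else (\<lambda>_. 1))" for t
  have cont\<Phi>: "continuous_on C \<Phi>"
  proof -
    have "continuous_on C (decode \<circ> g)"
      by (intro continuous_on_compose contg continuous_on_subset[OF continuous_decode] gC)
    then show ?thesis by (rule continuous_on_eq) (simp add: \<Phi>_def)
  qed
  have \<Phi>_torus: "\<Phi> t \<in> torus" for t by (simp add: \<Phi>_def torus_def decode_def)
  define bb where "bb n a = (SOME b. b \<in> bits \<and> decode b = p n a)" for n a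
  have bb: "bb n a \<in> bits \<and> decode (bb n a) = p n a" if "a \<in> A n" for n a
  proof -
    have "p n a \<in> torus" by (rule p[OF that])
    then obtain b where "b \<in> bits" "decode b = p n a" by (rule decode_surj)
    then show ?thesis unfolding bb_def by (intro someI[of "\<lambda>b. b \<in> bits \<and> decode b = p n a" b]) simp
  qed
  define \<psi> where "\<psi> n a = cantor (bb n a)" for n a
  have \<psi>C: "\<psi> n a \<in> C" and \<Phi>\<psi>: "\<Phi> (\<psi> n a) = p n a" if "a \<in> A n" for n a
    using bb[OF that] by (auto simp: \<psi>_def C_def \<Phi>_def gc)
  define \<mu>s where "\<mu>s n = distr (measure_pmf (pmf_of_set (A n))) borel (\<psi> n)" for n
  have rd: "real_distribution (\<mu>s n)" for n
    unfolding \<mu>s_def by (intro prob_space.real_distribution_distr) (auto intro: measure_pmf.prob_space_axioms)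
  have int: "integral\<^sup>L (\<mu>s n) F = (\<Sum>a\<in>A n. F (\<psi> n a)) / card (A n)" if "F \<in> borel_measurable borel" for F :: "real \<Rightarrow> real" and n
    unfolding \<mu>s_def using that A by (subst integral_distr) (auto simp: integral_pmf_of_set)
  obtain a0 b0 where ab: "C \<subseteq> {a0<..b0}" "a0 < b0"
  proof -
    obtain B where "\<And>x. x \<in> C \<Longrightarrow> \<bar>x\<bar> \<le> B" using compact_imp_bounded[OF compC] by (auto simp: bounded_iff)
    then show ?thesis using that[of "- \<bar>B\<bar> - 1" "\<bar>B\<bar> + 1"] by force
  qed
  have tight: "tight \<mu>s"
    unfolding tight_def
  proof (intro conjI allI impI rd)
    fix e :: real assume "0 < e"
    have "measure (\<mu>s n) {a0<..b0} = 1" for n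
    proof -
      have "measure (\<mu>s n) {a0<..b0} = measure (measure_pmf (pmf_of_set (A n))) (\<psi> n -` {a0<..b0})"
        unfolding \<mu>s_def by (subst measure_distr) auto
      also have "\<dots> = 1" using \<psi>C ab A
        by (subst measure_pmf.prob_eq_1) (auto simp: AE_measure_pmf_iff set_pmf_of_set, force+)
      finally show ?thesis .
    qed
    then show "\<exists>a b. a < b \<and> (\<forall>n. 1 - e < measure (\<mu>s n) {a<..b})"
      using ab(2) \<open>0 < e\<close> by (intro exI[of _ a0] exI[of _ b0]) auto
  qed
  obtain r M where r: "strict_mono (r :: nat \<Rightarrow> nat)" and M: "real_distribution M" "weak_conv_m (\<mu>s \<circ> id \<circ> r) M"
    using tight_imp_convergent_subsubsequence[OF tight strict_mono_id] by blast
  interpret M: real_distribution M by (rule M(1))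
  have lim: "(\<lambda>n. (\<Sum>a\<in>A (r n). F (\<psi> (r n) a)) / card (A (r n))) \<longlonglongrightarrow> integral\<^sup>L M F"
    if F: "continuous_on UNIV F" "\<And>x. norm (F x) \<le> B" for F :: "real \<Rightarrow> real" and B
  proof -
    have "(\<lambda>n. integral\<^sup>L ((\<mu>s \<circ> id \<circ> r) n) F) \<longlonglongrightarrow> integral\<^sup>L M F"
      by (rule weak_conv_imp_integral_bdd_continuous_conv[OF _ M(1) M(2) _ F(2)])
        (use rd F(1) in \<open>auto simp: continuous_on_eq_continuous_at\<close>)
    then show ?thesis using F(1) by (simp add: int borel_measurable_continuous_onI)
  qed
  have AEC: "AE t in M. t \<in> C"
  proof -
    have neC: "C \<noteq> {}" using A(2)[of 0] \<psi>C by blast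
    \<comment> \<open>A bounded continuous function vanishing exactly on \<open>C\<close>: its
      averages are 0, hence so is its integral under the limit.\<close>
    let ?F = "\<lambda>t. min 1 (infdist t C)"
    have F: "continuous_on UNIV ?F" "\<And>t. norm (?F t) \<le> 1" by (auto intro!: continuous_intros simp: infdist_nonneg)
    have "(\<Sum>a\<in>A (r n). ?F (\<psi> (r n) a)) = 0" for n using \<psi>C by (intro sum.neutral) auto
    then have "integral\<^sup>L M ?F = 0" using lim[OF F] LIMSEQ_unique[OF tendsto_const[of 0]] by simp
    moreover have "integrable M ?F"
      using F(2) borel_measurable_continuous_onI[OF F(1)] by (intro M.integrable_const_bound[where B = 1]) auto
    ultimately have "AE t in M. ?F t = 0"
      using integral_nonneg_eq_0_iff_AE[of M ?F] by (auto simp: infdist_nonneg)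
    then show ?thesis
    proof (rule AE_mp, intro AE_I2 impI)
      fix t assume "?F t = 0"
      then have "infdist t C = 0" by (auto simp: min_def split: if_splits)
      then show "t \<in> C" using in_closed_iff_infdist_zero[OF compact_imp_closed[OF compC] neC] by blast
    qed
  qed
  have meas\<Phi>: "\<Phi> \<in> borel_measurable borel"
  proof (rule borel_measurableI)
    fix U :: "(nat \<Rightarrow> complex) set" assume U: "open U"
    obtain T where T: "open T" "\<Phi> -` U \<inter> C = T \<inter> C"
      using continuous_on_open_invariant[THEN iffD1, OF cont\<Phi>] U by metis
    have "\<Phi> -` U = (T \<inter> C) \<union> (if (\<lambda>_. 1) \<in> U then - C else {})"
      unfolding set_eq_iff
    proof (intro allI)
      fix t
      have "t \<in> \<Phi> -` U \<inter> C \<longleftrightarrow> t \<in> T \<inter> C" by (simp only: T(2))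
      then show "t \<in> \<Phi> -` U \<longleftrightarrow> t \<in> (T \<inter> C) \<union> (if (\<lambda>_. 1) \<in> U then - C else {})"
        by (cases "t \<in> C") (simp_all add: \<Phi>_def)
    qed
    moreover have "T \<in> sets borel" "C \<in> sets borel" using T(1) compact_imp_closed[OF compC] by auto
    ultimately show "\<Phi> -` U \<inter> space borel \<in> sets borel" by (auto split: if_splits)
  qed
  define \<mu> where "\<mu> = distr M borel \<Phi>"
  have m\<Phi>: "\<Phi> \<in> measurable M borel" using meas\<Phi> by (simp add: measurable_cong_sets[OF M.events_eq_borel refl])
  show ?thesis
  proof (rule that[OF r, of \<mu>])
    show "prob_space \<mu>" unfolding \<mu>_def by (rule M.prob_space_distr[OF m\<Phi>])
    show "sets \<mu> = sets borel" by (simp add: \<mu>_def)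
    have tor: "closed (torus :: (nat \<Rightarrow> complex) set)" by (rule compact_imp_closed[OF compact_torus])
    show "AE x in \<mu>. x \<in> torus"
      unfolding \<mu>_def using \<Phi>_torus tor by (subst AE_distr_iff[OF m\<Phi>]) auto
    fix F :: "(nat \<Rightarrow> complex) \<Rightarrow> real" assume F: "continuous_on UNIV F"
    have cF: "continuous_on C (\<lambda>t. F (\<Phi> t))"
      using continuous_on_compose[OF cont\<Phi> continuous_on_subset[OF F]] by (simp add: comp_def)
    obtain B where B: "\<And>t. t \<in> C \<Longrightarrow> \<bar>F (\<Phi> t)\<bar> \<le> B"
      using compact_imp_bounded[OF compact_continuous_image[OF cF compC]] by (auto simp: bounded_iff)
    \<comment> \<open>The composition of F with \<open>\<Phi>\<close> is known to be continuous on
      \<open>C\<close> only; a bounded continuous extension to the line makes weak convergence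
      applicable.\<close>
    obtain G where G: "continuous_on UNIV G" "\<And>t. t \<in> C \<Longrightarrow> G t = F (\<Phi> t)" "\<And>t. norm (G t) \<le> \<bar>B\<bar>"
      using Tietze[OF cF, of UNIV "\<bar>B\<bar>"] compact_imp_closed[OF compC] B by (auto simp: closed_closedin[symmetric]) (metis UNIV_I abs_ge_self order_trans)
    have "integral\<^sup>L \<mu> F = integral\<^sup>L M (\<lambda>t. F (\<Phi> t))"
      unfolding \<mu>_def by (rule integral_distr[OF m\<Phi> borel_measurable_continuous_onI[OF F]])
    also have "\<dots> = integral\<^sup>L M G"
    proof (rule integral_cong_AE)
      show "(\<lambda>t. F (\<Phi> t)) \<in> borel_measurable M"
        using measurable_compose[OF m\<Phi> borel_measurable_continuous_onI[OF F]] .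
      show "G \<in> borel_measurable M" using borel_measurable_continuous_onI[OF G(1)] by simp
      show "AE t in M. F (\<Phi> t) = G t" using AEC G(2) by (auto elim: AE_mp)
    qed
    finally have "integral\<^sup>L \<mu> F = integral\<^sup>L M G" .
    moreover have "(\<Sum>a\<in>A (r n). G (\<psi> (r n) a)) = (\<Sum>a\<in>A (r n). F (p (r n) a))" for n
      using \<psi>C G(2) \<Phi>\<psi> by (intro sum.cong) auto
    ultimately show "(\<lambda>n. (\<Sum>a\<in>A (r n). F (p (r n) a)) / card (A (r n))) \<longlonglongrightarrow> integral\<^sup>L \<mu> F"
      using lim[OF G(1,3)] by simp
  qed
qed

text \<open>The indicator of a closed set is the limit of the functions max 0 (1 - n dist), and
  closed sets generate the Borel sets.\<close>

lemma measure_eqI_continuous: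
  fixes M N :: "'a::metric_space measure"
  assumes M: "prob_space M" "sets M = sets borel" and N: "prob_space N" "sets N = sets borel"
    and eq: "\<And>F :: 'a \<Rightarrow> real. continuous_on UNIV F \<Longrightarrow> (\<And>x. 0 \<le> F x \<and> F x \<le> 1) \<Longrightarrow> integral\<^sup>L M F = integral\<^sup>L N F"
  shows "M = N"
proof -
  have lim: "(\<lambda>n. integral\<^sup>L P (\<lambda>x. max 0 (1 - real n * infdist x S))) \<longlonglongrightarrow> measure P S"
    if P: "prob_space P" "sets P = sets borel" and S: "closed S" "S \<noteq> {}" for P :: "'a measure" and S
  proof -
    interpret P: prob_space P by (rule P(1))
    have [measurable]: "S \<in> sets P" using S P by simp
    have "(\<lambda>n. integral\<^sup>L P (\<lambda>x. max 0 (1 - real n * infdist x S))) \<longlonglongrightarrow> integral\<^sup>L P (indicator S)"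
    proof (rule integral_dominated_convergence[where w = "\<lambda>_. 1"])
      show "(\<lambda>x. max 0 (1 - real n * infdist x S)) \<in> borel_measurable P" for n
        unfolding measurable_cong_sets[OF P(2) refl]
        by (intro borel_measurable_continuous_onI continuous_intros)
      show "AE x in P. (\<lambda>n. max 0 (1 - real n * infdist x S)) \<longlonglongrightarrow> indicator S x"
      proof (intro AE_I2)
        fix x
        show "(\<lambda>n. max 0 (1 - real n * infdist x S)) \<longlonglongrightarrow> indicator S x"
        proof (cases "x \<in> S")
          case False
          then have pos: "0 < infdist x S"
            using in_closed_iff_infdist_zero[OF S] infdist_nonneg[of x S] by (metis less_eq_real_def)
          obtain n0 :: nat where "1 / infdist x S < n0" using reals_Archimedean2 by blast
          then have "max 0 (1 - real n * infdist x S) = 0" if "n0 \<le> n" for n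
          proof -
            have "1 < real n * infdist x S"
              using \<open>1 / infdist x S < n0\<close> that pos by (simp add: field_simps) (smt (verit) mult_left_mono of_nat_le_iff mult.commute)
            then show ?thesis by simp
          qed
          then show ?thesis using False by (intro tendsto_eventually) (auto simp: eventually_sequentially)
        qed simp
      qed
      show "AE x in P. norm (max 0 (1 - real n * infdist x S)) \<le> 1" for n
        by (intro AE_I2) (auto simp: infdist_nonneg)
    qed auto
    then show ?thesis by simp
  qed
  interpret M: prob_space M by (rule M(1))
  interpret N: prob_space N by (rule N(1))
  have closed: "measure M S = measure N S" if S: "closed S" for S
  proof (cases "S = {}")
    case False
    have "integral\<^sup>L M (\<lambda>x. max 0 (1 - real n * infdist x S)) = integral\<^sup>L N (\<lambda>x. max 0 (1 - real n * infdist x S))" for n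
      by (rule eq) (auto intro!: continuous_intros simp: infdist_nonneg)
    then show ?thesis using LIMSEQ_unique[OF lim[OF M S False]] lim[OF N S False] by simp
  qed simp
  show ?thesis
  proof (rule measure_eqI_generator_eq[where E = "Collect closed" and \<Omega> = UNIV and A = "\<lambda>_. UNIV"])
    show "Int_stable (Collect closed :: 'a set set)" by (auto simp: Int_stable_def)
    show "emeasure M X = emeasure N X" if "X \<in> Collect closed" for X
      using closed that by (simp add: M.emeasure_eq_measure N.emeasure_eq_measure)
    show "sets M = sigma_sets UNIV (Collect closed)" "sets N = sigma_sets UNIV (Collect closed)"
      unfolding M(2) N(2) borel_eq_closed by auto
  qed auto
qed

section \<open>Existence and uniqueness of Haar measure\<close>

definition pmul :: "('i \<Rightarrow> complex) \<Rightarrow> ('i \<Rightarrow> complex) \<Rightarrow> 'i \<Rightarrow> complex" where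
  "pmul x y = (\<lambda>t. x t * y t)"

definition torus_subgroup :: "('i \<Rightarrow> complex) set \<Rightarrow> bool" where
  "torus_subgroup X \<longleftrightarrow> X \<subseteq> torus \<and> closed X \<and> (\<lambda>_. 1) \<in> X \<and> (\<forall>x\<in>X. \<forall>y\<in>X. pmul x y \<in> X) \<and>
     (\<forall>x\<in>X. (\<lambda>t. cnj (x t)) \<in> X)"

lemma continuous_pmul: "continuous_on UNIV (\<lambda>x. pmul x y)" "continuous_on UNIV (\<lambda>y. pmul x y)"
  unfolding pmul_def
  by (intro continuous_on_coordinatewise_then_product continuous_intros continuous_on_product_coordinates)+

text \<open>A weak limit of averages over products of powers of a dense sequence, the exponents
  running through a box with sides {0..n}. Multiplying by e j shifts one exponent and changes only
  two opposite faces of the box, a fraction of order 1 / n. The limit is therefore invariant under a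
  dense set, and by dominated convergence under all of X.\<close>

lemma torus_haar_exists:
  fixes X :: "(nat \<Rightarrow> complex) set"
  assumes X: "torus_subgroup X"
  obtains \<mu> where "prob_space \<mu>" "sets \<mu> = sets borel" "AE x in \<mu>. x \<in> X"
    "\<And>y. y \<in> X \<Longrightarrow> distr \<mu> borel (\<lambda>x. pmul x y) = \<mu>"
proof -
  have Xt: "X \<subseteq> torus" and Xc: "closed X" and X1: "(\<lambda>_. 1) \<in> X"
    and Xm: "\<And>x y. x \<in> X \<Longrightarrow> y \<in> X \<Longrightarrow> pmul x y \<in> X"
    using X by (auto simp: torus_subgroup_def)
  obtain D where D: "countable D" "D \<subseteq> X" "X \<subseteq> closure D"
    using separable[of X] by blast
  have "D \<noteq> {}" using D X1 by auto
  then obtain e :: "nat \<Rightarrow> nat \<Rightarrow> complex" where e: "range e = D"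
    using D(1) uncountable_def by (metis)
  define A where "A n = ({..<n} \<rightarrow>\<^sub>E {..n})" for n :: nat
  define p where "p n k = (\<lambda>t. \<Prod>i<n. (e i t) ^ (k i))" for n and k :: "nat \<Rightarrow> nat"
  have pX: "p n k \<in> X" for n k
  proof (induction n)
    case 0
    then show ?case using X1 by (simp add: p_def)
  next
    case (Suc n)
    have "(\<lambda>t. (e n t) ^ m) \<in> X" for m
    proof (induction m)
      case (Suc m)
      have "e n \<in> X" using e D(2) by auto
      then have "pmul (e n) (\<lambda>t. (e n t) ^ m) \<in> X" using Suc Xm by blast
      then show ?case by (simp add: pmul_def)
    qed (use X1 in simp)
    then have "pmul (p n k) (\<lambda>t. (e n t) ^ (k n)) \<in> X" using Suc Xm by blast
    then show ?case by (simp add: pmul_def p_def)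
  qed
  have finA: "finite (A n)" and neA: "A n \<noteq> {}" for n
    unfolding A_def by (auto intro!: finite_PiE simp: PiE_eq_empty_iff)
  have cardA: "card (A n) = (n + 1) ^ n" for n by (simp add: A_def card_PiE)
  obtain r \<mu> where r: "strict_mono (r :: nat \<Rightarrow> nat)" and \<mu>: "prob_space \<mu>" "sets \<mu> = sets borel" "AE x in \<mu>. x \<in> torus"
    and lim: "\<And>F :: (nat \<Rightarrow> complex) \<Rightarrow> real. continuous_on UNIV F \<Longrightarrow>
      (\<lambda>n. (\<Sum>k\<in>A (r n). F (p (r n) k)) / card (A (r n))) \<longlonglongrightarrow> integral\<^sup>L \<mu> F"
    using torus_weak_limit[of A p] finA neA pX Xt by blast
  interpret \<mu>: prob_space \<mu> by (rule \<mu>(1))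
  have measF: "F \<in> borel_measurable \<mu>" if "continuous_on UNIV F" for F :: "(nat \<Rightarrow> complex) \<Rightarrow> real"
    using borel_measurable_continuous_onI[OF that] by (simp add: measurable_cong_sets[OF \<mu>(2) refl])
  have AEX: "AE x in \<mu>. x \<in> X"
  proof -
    let ?F = "\<lambda>x. min 1 (infdist x X)"
    have F: "continuous_on UNIV ?F" by (intro continuous_intros)
    have "(\<Sum>k\<in>A (r n). ?F (p (r n) k)) = 0" for n using pX by (intro sum.neutral) auto
    then have "integral\<^sup>L \<mu> ?F = 0" using lim[OF F] LIMSEQ_unique[OF tendsto_const[of 0]] by simp
    moreover have "integrable \<mu> ?F"
      using measF[OF F] by (intro \<mu>.integrable_const_bound[where B = 1]) (auto simp: infdist_nonneg)
    ultimately have "AE x in \<mu>. ?F x = 0"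
      using integral_nonneg_eq_0_iff_AE[of \<mu> ?F] by (auto simp: infdist_nonneg)
    then show ?thesis
    proof (rule AE_mp, intro AE_I2 impI)
      fix x assume "?F x = 0"
      then have "infdist x X = 0" by (auto simp: min_def split: if_splits)
      then show "x \<in> X" using in_closed_iff_infdist_zero[OF Xc] X1 by blast
    qed
  qed
  have invD: "integral\<^sup>L \<mu> (\<lambda>x. F (pmul x (e j))) = integral\<^sup>L \<mu> F"
    if F: "continuous_on UNIV F" "\<And>x. 0 \<le> F x \<and> F x \<le> 1" for F :: "(nat \<Rightarrow> complex) \<Rightarrow> real" and j
  proof -
    have F': "continuous_on UNIV (\<lambda>x. F (pmul x (e j)))"
      using continuous_on_compose[OF continuous_pmul(1) continuous_on_subset[OF F(1)]] by (simp add: comp_def)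
    have bound: "\<bar>(\<Sum>k\<in>A n. F (pmul (p n k) (e j))) / card (A n) - (\<Sum>k\<in>A n. F (p n k)) / card (A n)\<bar> \<le> 2 / (n + 1)"
      if n: "j < n" for n
    proof -
      define B where "B = {k \<in> A n. k j = n}"
      define B' where "B' = {k \<in> A n. k j = 0}"
      have pj: "pmul (p n k) (e j) = p n (k(j := k j + 1))" for k
      proof
        fix t
        have "(\<Prod>i<n. (e i t) ^ ((k(j := k j + 1)) i)) = e j t ^ (k j + 1) * (\<Prod>i\<in>{..<n} - {j}. (e i t) ^ (k i))"
          using n by (subst prod.remove[of _ j]) auto
        moreover have "(\<Prod>i<n. (e i t) ^ (k i)) = e j t ^ k j * (\<Prod>i\<in>{..<n} - {j}. (e i t) ^ (k i))"
          using n by (subst prod.remove[of _ j]) auto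
        ultimately show "pmul (p n k) (e j) t = p n (k(j := k j + 1)) t" by (simp add: pmul_def p_def)
      qed
      have reidx: "(\<Sum>k\<in>A n - B. F (pmul (p n k) (e j))) = (\<Sum>k\<in>A n - B'. F (p n k))"
        unfolding pj
      proof (rule sum.reindex_bij_witness[of _ "\<lambda>k. k(j := k j - 1)" "\<lambda>k. k(j := k j + 1)"])
        fix k assume k: "k \<in> A n - B"
        then have "k j \<le> n" "k j \<noteq> n" using n by (auto simp: A_def B_def PiE_iff)
        then have "Suc (k j) \<le> n" by linarith
        then show "k(j := k j + 1) \<in> A n - B'" using k n by (auto simp: A_def B'_def PiE_iff extensional_def)
      next
        fix k assume k: "k \<in> A n - B'"
        then have kj: "k j \<le> n" "k j \<noteq> 0" using n by (auto simp: A_def B'_def PiE_iff)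
        then have "k j - 1 \<le> n" "k j - 1 \<noteq> n" by linarith+
        moreover have "k \<in> A n" using k by simp
        ultimately show "k(j := k j - 1) \<in> A n - B"
          using n by (auto simp: A_def B_def PiE_iff extensional_def)
        show "(k(j := k j - 1))(j := (k(j := k j - 1)) j + 1) = k" using kj by (simp add: fun_eq_iff)
      qed auto
      have split: "(\<Sum>k\<in>A n. G k) = (\<Sum>k\<in>A n - B. G k) + (\<Sum>k\<in>B. G k)"
        "(\<Sum>k\<in>A n. G k) = (\<Sum>k\<in>A n - B'. G k) + (\<Sum>k\<in>B'. G k)" for G :: "(nat \<Rightarrow> nat) \<Rightarrow> real"
        using sum.subset_diff[of B "A n" G] sum.subset_diff[of B' "A n" G] finA[of n]
        by (simp_all add: B_def B'_def)
      have "(\<Sum>k\<in>A n. F (pmul (p n k) (e j))) - (\<Sum>k\<in>A n. F (p n k)) =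
          (\<Sum>k\<in>B. F (pmul (p n k) (e j))) - (\<Sum>k\<in>B'. F (p n k))"
        using reidx split(1)[of "\<lambda>k. F (pmul (p n k) (e j))"] split(2)[of "\<lambda>k. F (p n k)"] by linarith
      moreover have "0 \<le> (\<Sum>k\<in>B. F (pmul (p n k) (e j)))" "(\<Sum>k\<in>B. F (pmul (p n k) (e j))) \<le> card B"
        "0 \<le> (\<Sum>k\<in>B'. F (p n k))" "(\<Sum>k\<in>B'. F (p n k)) \<le> card B'"
        using F(2) sum_bounded_above[of B "\<lambda>k. F (pmul (p n k) (e j))" 1] sum_bounded_above[of B' "\<lambda>k. F (p n k)" 1]
        by (auto intro!: sum_nonneg)
      moreover have cB: "card {k \<in> A n. k j = c} = (n + 1) ^ (n - 1)" if "c \<le> n" for c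
      proof -
        have "bij_betw (\<lambda>k. k(j := c)) (({..<n} - {j}) \<rightarrow>\<^sub>E {..n}) {k \<in> A n. k j = c}"
        proof (rule bij_betw_byWitness[where f' = "\<lambda>k. k(j := undefined)"])
          show "\<forall>k\<in>({..<n} - {j}) \<rightarrow>\<^sub>E {..n}. (k(j := c))(j := undefined) = k"
            by (auto simp: PiE_iff extensional_def fun_eq_iff)
          show "\<forall>k\<in>{k \<in> A n. k j = c}. (k(j := undefined))(j := c) = k" by (auto simp: fun_eq_iff)
          show "(\<lambda>k. k(j := c)) ` (({..<n} - {j}) \<rightarrow>\<^sub>E {..n}) \<subseteq> {k \<in> A n. k j = c}"
          proof (rule image_subsetI)
            fix k assume k: "k \<in> ({..<n} - {j}) \<rightarrow>\<^sub>E {..n}"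
            have "k(j := c) \<in> A n"
              unfolding A_def
            proof (rule PiE_I)
              show "(k(j := c)) i \<in> {..n}" if "i \<in> {..<n}" for i
                using PiE_mem[OF k, of i] that \<open>c \<le> n\<close> by (cases "i = j") simp_all
              show "(k(j := c)) i = undefined" if "i \<notin> {..<n}" for i
                using PiE_arb[OF k, of i] that n by (cases "i = j") simp_all
            qed
            then show "k(j := c) \<in> {k \<in> A n. k j = c}" by simp
          qed
          show "(\<lambda>k. k(j := undefined)) ` {k \<in> A n. k j = c} \<subseteq> ({..<n} - {j}) \<rightarrow>\<^sub>E {..n}"
          proof (rule image_subsetI)
            fix k assume "k \<in> {k \<in> A n. k j = c}"
            then have k: "k \<in> {..<n} \<rightarrow>\<^sub>E {..n}" by (simp add: A_def)
            show "k(j := undefined) \<in> ({..<n} - {j}) \<rightarrow>\<^sub>E {..n}"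
            proof (rule PiE_I)
              show "(k(j := undefined)) i \<in> {..n}" if "i \<in> {..<n} - {j}" for i
                using PiE_mem[OF k, of i] that by simp
              show "(k(j := undefined)) i = undefined" if "i \<notin> {..<n} - {j}" for i
                using PiE_arb[OF k, of i] that by (cases "i = j") simp_all
            qed
          qed
        qed
        from bij_betw_same_card[OF this] show ?thesis using n by (simp add: card_PiE)
      qed
      ultimately have "\<bar>(\<Sum>k\<in>A n. F (pmul (p n k) (e j))) - (\<Sum>k\<in>A n. F (p n k))\<bar> \<le> real ((n + 1) ^ (n - 1))"
        using cB[of n] cB[of 0] by (simp add: B_def B'_def)
      then have "\<bar>(\<Sum>k\<in>A n. F (pmul (p n k) (e j))) / card (A n) - (\<Sum>k\<in>A n. F (p n k)) / card (A n)\<bar> \<le>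
          real ((n + 1) ^ (n - 1)) / real ((n + 1) ^ n)"
        unfolding cardA diff_divide_distrib[symmetric] abs_divide by (simp add: divide_right_mono)
      also have "real ((n + 1) ^ (n - 1)) / real ((n + 1) ^ n) = 1 / (n + 1)"
      proof -
        have "(n + 1) ^ n = (n + 1) ^ (n - 1) * (n + 1)" using power_minus_mult[of n "n + 1"] n by simp
        then show ?thesis unfolding \<open>(n + 1) ^ n = _\<close> of_nat_mult by simp
      qed
      also have "\<dots> \<le> 2 / (real n + 1)" by (simp add: divide_right_mono add.commute)
      finally show ?thesis .
    qed
    have "(\<lambda>n. (\<Sum>k\<in>A (r n). F (pmul (p (r n) k) (e j))) / card (A (r n)) - (\<Sum>k\<in>A (r n). F (p (r n) k)) / card (A (r n))) \<longlonglongrightarrow>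
        integral\<^sup>L \<mu> (\<lambda>x. F (pmul x (e j))) - integral\<^sup>L \<mu> F"
      by (intro tendsto_diff lim F' F(1))
    moreover have "(\<lambda>n. (\<Sum>k\<in>A (r n). F (pmul (p (r n) k) (e j))) / card (A (r n)) - (\<Sum>k\<in>A (r n). F (p (r n) k)) / card (A (r n))) \<longlonglongrightarrow> 0"
    proof (rule tendsto_rabs_zero_cancel, rule tendsto_sandwich[OF _ _ tendsto_const])
      show "\<forall>\<^sub>F n in sequentially. \<bar>(\<Sum>k\<in>A (r n). F (pmul (p (r n) k) (e j))) / card (A (r n)) - (\<Sum>k\<in>A (r n). F (p (r n) k)) / card (A (r n))\<bar> \<le> 2 / (real n + 1)"
        unfolding eventually_sequentially
      proof (intro exI[of _ "j + 1"] allI impI)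
        fix n assume "j + 1 \<le> n"
        moreover have "n \<le> r n" by (rule seq_suble[OF r])
        moreover from this have "2 / (real (r n) + 1) \<le> 2 / (real n + 1)" by (intro divide_left_mono) auto
        ultimately show "\<bar>(\<Sum>k\<in>A (r n). F (pmul (p (r n) k) (e j))) / card (A (r n)) - (\<Sum>k\<in>A (r n). F (p (r n) k)) / card (A (r n))\<bar> \<le> 2 / (real n + 1)"
          using bound[of "r n"] by force
      qed
      show "(\<lambda>n. 2 / (real n + 1)) \<longlonglongrightarrow> 0" by real_asymp
    qed auto
    ultimately show ?thesis using LIMSEQ_unique by fastforce
  qed
  have inv: "integral\<^sup>L \<mu> (\<lambda>x. F (pmul x y)) = integral\<^sup>L \<mu> F"
    if F: "continuous_on UNIV F" "\<And>x. 0 \<le> F x \<and> F x \<le> 1" and y: "y \<in> X" for F :: "(nat \<Rightarrow> complex) \<Rightarrow> real" and y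
  proof -
    obtain s where s: "\<And>n. s n \<in> D" "s \<longlonglongrightarrow> y" using y D(3) closure_sequential[of y D] by blast
    have F': "continuous_on UNIV (\<lambda>x. F (pmul x y))" for y
      using continuous_on_compose[OF continuous_pmul(1) continuous_on_subset[OF F(1)]] by (simp add: comp_def)
    have "(\<lambda>n. integral\<^sup>L \<mu> (\<lambda>x. F (pmul x (s n)))) \<longlonglongrightarrow> integral\<^sup>L \<mu> (\<lambda>x. F (pmul x y))"
    proof (rule integral_dominated_convergence[where w = "\<lambda>_. 1"])
      show "AE x in \<mu>. (\<lambda>n. F (pmul x (s n))) \<longlonglongrightarrow> F (pmul x y)"
      proof (intro AE_I2)
        fix x
        have "continuous_on UNIV (\<lambda>y. F (pmul x y))"
          using continuous_on_compose[OF continuous_pmul(2) continuous_on_subset[OF F(1)]] by (simp add: comp_def)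
        then have "isCont (\<lambda>y. F (pmul x y)) y" by (simp add: continuous_on_eq_continuous_at)
        then show "(\<lambda>n. F (pmul x (s n))) \<longlonglongrightarrow> F (pmul x y)" using s(2) by (rule isCont_tendsto_compose)
      qed
    qed (use measF[OF F'] F(2) in auto)
    moreover have "integral\<^sup>L \<mu> (\<lambda>x. F (pmul x (s n))) = integral\<^sup>L \<mu> F" for n
    proof -
      obtain j where "s n = e j" using s(1)[of n] e by blast
      then show ?thesis using invD[OF F] by simp
    qed
    ultimately show ?thesis using LIMSEQ_unique[OF _ tendsto_const] by fastforce
  qed
  show ?thesis
  proof (rule that[OF \<mu>(1,2) AEX])
    fix y assume y: "y \<in> X"
    have m: "(\<lambda>x. pmul x y) \<in> measurable \<mu> borel"
      using borel_measurable_continuous_onI[OF continuous_pmul(1)] by (simp add: measurable_cong_sets[OF \<mu>(2) refl])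
    show "distr \<mu> borel (\<lambda>x. pmul x y) = \<mu>"
    proof (rule measure_eqI_continuous)
      fix F :: "(nat \<Rightarrow> complex) \<Rightarrow> real"
      assume F: "continuous_on UNIV F" "\<And>x. 0 \<le> F x \<and> F x \<le> 1"
      show "integral\<^sup>L (distr \<mu> borel (\<lambda>x. pmul x y)) F = integral\<^sup>L \<mu> F"
        using inv[OF F y] integral_distr[OF m borel_measurable_continuous_onI[OF F(1)]] by simp
    qed (use \<mu> \<mu>.prob_space_distr[OF m] in auto)
  qed
qed

text \<open>Fubini for the product of the two measures: the indicator of A at x y integrates to
  \<mu> A when x is integrated first, and to \<nu> A when y is.\<close>

lemma torus_haar_unique:
  fixes \<mu> \<nu> :: "(nat \<Rightarrow> complex) measure"
  assumes \<mu>: "prob_space \<mu>" "sets \<mu> = sets borel" "AE x in \<mu>. x \<in> X"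
    and \<nu>: "prob_space \<nu>" "sets \<nu> = sets borel" "AE x in \<nu>. x \<in> X"
    and inv: "\<And>y. y \<in> X \<Longrightarrow> distr \<mu> borel (\<lambda>x. pmul x y) = \<mu>" "\<And>y. y \<in> X \<Longrightarrow> distr \<nu> borel (\<lambda>x. pmul x y) = \<nu>"
  shows "\<mu> = \<nu>"
proof (rule measure_eqI)
  show "sets \<mu> = sets \<nu>" using \<mu> \<nu> by simp
  interpret \<mu>: prob_space \<mu> by (rule \<mu>(1))
  interpret \<nu>: prob_space \<nu> by (rule \<nu>(1))
  interpret P: pair_sigma_finite \<mu> \<nu> ..
  fix A assume "A \<in> sets \<mu>"
  then have A: "A \<in> sets borel" using \<mu> by simp
  have cont: "continuous_on UNIV (\<lambda>z :: (nat \<Rightarrow> complex) \<times> (nat \<Rightarrow> complex). pmul (fst z) (snd z))"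
    unfolding pmul_def
    by (intro continuous_on_coordinatewise_then_product continuous_on_mult
        continuous_on_compose2[OF continuous_on_product_coordinates continuous_on_fst[OF continuous_on_id]]
        continuous_on_compose2[OF continuous_on_product_coordinates continuous_on_snd[OF continuous_on_id]] subset_UNIV)
  have mp: "(\<lambda>z. pmul (fst z) (snd z)) \<in> measurable (\<mu> \<Otimes>\<^sub>M \<nu>) borel"
    using borel_measurable_continuous_onI[OF cont]
    by (subst measurable_cong_sets[OF sets_pair_measure_cong[OF \<mu>(2) \<nu>(2)] refl]) (simp add: borel_prod)
  have f: "(\<lambda>z. indicator A (pmul (fst z) (snd z)) :: ennreal) \<in> borel_measurable (\<mu> \<Otimes>\<^sub>M \<nu>)"
    by (rule measurable_compose[OF mp]) (use A in measurable)
  have one: "(\<integral>\<^sup>+ x. indicator A (pmul x y) \<partial>M) = emeasure M A"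
    if M: "sets M = sets borel" "distr M borel (\<lambda>x. pmul x y) = M" for M y
  proof -
    have m: "(\<lambda>x. pmul x y) \<in> measurable M borel"
      using borel_measurable_continuous_onI[OF continuous_pmul(1)] by (simp add: measurable_cong_sets[OF M(1) refl])
    have "emeasure M A = (\<integral>\<^sup>+ x. indicator A x \<partial>distr M borel (\<lambda>x. pmul x y))"
      unfolding M(2) using A M(1) by simp
    also have "\<dots> = (\<integral>\<^sup>+ x. indicator A (pmul x y) \<partial>M)"
      using A by (subst nn_integral_distr[OF m]) auto
    finally show ?thesis by simp
  qed
  have "emeasure \<mu> A = (\<integral>\<^sup>+ y. emeasure \<mu> A \<partial>\<nu>)" by (simp add: \<nu>.emeasure_space_1)
  also have "\<dots> = (\<integral>\<^sup>+ y. \<integral>\<^sup>+ x. indicator A (pmul x y) \<partial>\<mu> \<partial>\<nu>)"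
    using \<nu>(3) one[OF \<mu>(2) inv(1)] by (intro nn_integral_cong_AE) (auto elim!: AE_mp)
  also have "\<dots> = (\<integral>\<^sup>+ x. \<integral>\<^sup>+ y. indicator A (pmul x y) \<partial>\<nu> \<partial>\<mu>)"
    using P.Fubini'[of "\<lambda>x y. indicator A (pmul x y)"] f by (simp add: case_prod_beta)
  also have "\<dots> = (\<integral>\<^sup>+ x. emeasure \<nu> A \<partial>\<mu>)"
    using \<mu>(3) one[OF \<nu>(2) inv(2)] by (intro nn_integral_cong_AE) (auto elim!: AE_mp simp: pmul_def mult.commute)
  also have "\<dots> = emeasure \<nu> A" by (simp add: \<mu>.emeasure_space_1)
  finally show "emeasure \<mu> A = emeasure \<nu> A" .
qed

text \<open>An enumeration of the group identifies X with a subgroup of the torus indexed by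
  \<open>nat\<close>, and measures on X with Borel measures on the whole function space carried by
  that subgroup. The fact \<open>image\<close> turns the images in the definition of
  \<open>haar_measure\<close> into preimages under inverse translations.\<close>

lemma haar_unique_exists:
  fixes X :: "('g \<Rightarrow> complex) set"
  assumes cnt: "countable (UNIV :: 'g set)" "infinite (UNIV :: 'g set)" and X: "torus_subgroup X"
  shows "\<exists>!\<mu>. prob_space \<mu> \<and> sets \<mu> = sets (restrict_space borel X) \<and>
     (\<forall>y\<in>X. \<forall>A\<in>sets \<mu>. (\<lambda>x t. x t * y t) ` A \<in> sets \<mu> \<and> measure \<mu> ((\<lambda>x t. x t * y t) ` A) = measure \<mu> A)"
    (is "\<exists>!\<mu>. ?P \<mu>")
proof -
  have Xt: "X \<subseteq> torus" and Xc: "closed X" and X1: "(\<lambda>_. 1) \<in> X"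
    and Xm: "\<And>x y. x \<in> X \<Longrightarrow> y \<in> X \<Longrightarrow> pmul x y \<in> X" and Xi: "\<And>x. x \<in> X \<Longrightarrow> (\<lambda>t. cnj (x t)) \<in> X"
    using X by (auto simp: torus_subgroup_def)
  have XB: "X \<in> sets borel" using Xc by simp
  obtain e :: "nat \<Rightarrow> 'g" where e: "bij e"
    using bij_betw_from_nat_into[OF cnt] by blast
  define T :: "(nat \<Rightarrow> complex) \<Rightarrow> 'g \<Rightarrow> complex" where "T z = (\<lambda>g. z (inv_into UNIV e g))" for z
  define S :: "('g \<Rightarrow> complex) \<Rightarrow> nat \<Rightarrow> complex" where "S x = (\<lambda>n. x (e n))" for x
  have TS: "T (S x) = x" and ST: "S (T z) = z" for x z
    using e by (simp_all add: T_def S_def bij_is_surj surj_f_inv_f bij_is_inj)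
  have contT: "continuous_on UNIV T" unfolding T_def
    by (intro continuous_on_coordinatewise_then_product continuous_on_product_coordinates)
  have contS: "continuous_on UNIV S" unfolding S_def
    by (intro continuous_on_coordinatewise_then_product continuous_on_product_coordinates)
  have mT: "T \<in> measurable borel borel" and mS: "S \<in> measurable borel borel"
    using contT contS by (auto intro: borel_measurable_continuous_onI)
  have Tmul: "T (pmul z w) = pmul (T z) (T w)" and Smul: "S (pmul x y) = pmul (S x) (S y)" for z w x y
    by (simp_all add: T_def S_def pmul_def)
  have cancel: "pmul (pmul x y) (\<lambda>t. cnj (y t)) = x" "pmul (pmul x (\<lambda>t. cnj (y t))) y = x" if "y \<in> X" for x y
  proof -
    have "cmod (y t) = 1" for t using that Xt by (auto simp: torus_def)
    then have yy: "y t * cnj (y t) = 1" "cnj (y t) * y t = 1" for t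
      using complex_norm_square[of "y t"] by (simp_all add: mult.commute)
    show "pmul (pmul x y) (\<lambda>t. cnj (y t)) = x" "pmul (pmul x (\<lambda>t. cnj (y t))) y = x"
      unfolding pmul_def mult.assoc yy by simp_all
  qed
  have image: "(\<lambda>x t. x t * y t) ` A = (\<lambda>x. pmul x (\<lambda>t. cnj (y t))) -` A" if "y \<in> X" for y and A :: "('g \<Rightarrow> complex) set"
  proof -
    have eq: "(\<lambda>x t. x t * y t) = (\<lambda>x. pmul x y)" by (simp add: pmul_def fun_eq_iff)
    show ?thesis
      unfolding eq
    proof (intro equalityI subsetI)
      fix x assume "x \<in> (\<lambda>x. pmul x y) ` A"
      then show "x \<in> (\<lambda>x. pmul x (\<lambda>t. cnj (y t))) -` A" using cancel(1)[OF that] by auto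
    next
      fix x assume "x \<in> (\<lambda>x. pmul x (\<lambda>t. cnj (y t))) -` A"
      then have "pmul (pmul x (\<lambda>t. cnj (y t))) y \<in> (\<lambda>x. pmul x y) ` A" by (intro imageI) simp
      then show "x \<in> (\<lambda>x. pmul x y) ` A" by (simp add: cancel(2)[OF that])
    qed
  qed
  have setsX: "A \<in> sets (restrict_space borel X) \<longleftrightarrow> A \<in> sets borel \<and> A \<subseteq> X" for A
    using XB by (subst sets_restrict_space_iff) auto
  define X' where "X' = T -` X"
  have X': "torus_subgroup X'"
    unfolding torus_subgroup_def
  proof (intro conjI ballI)
    show "X' \<subseteq> torus"
    proof
      fix z assume "z \<in> X'"
      then have "cmod (T z (e n)) = 1" for n using Xt by (auto simp: X'_def torus_def)
      then show "z \<in> torus" using e by (simp add: T_def torus_def bij_is_inj)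
    qed
    show "closed X'" unfolding X'_def using Xc contT by (intro closed_vimage)
    show "(\<lambda>_. 1) \<in> X'" using X1 by (simp add: X'_def T_def)
    show "pmul z w \<in> X'" if "z \<in> X'" "w \<in> X'" for z w using that Xm by (simp add: X'_def Tmul)
    show "(\<lambda>t. cnj (z t)) \<in> X'" if "z \<in> X'" for z using that Xi[of "T z"] by (simp add: X'_def T_def)
  qed
  obtain \<mu>0 where \<mu>0: "prob_space \<mu>0" "sets \<mu>0 = sets borel" "AE x in \<mu>0. x \<in> X'"
    "\<And>y. y \<in> X' \<Longrightarrow> distr \<mu>0 borel (\<lambda>x. pmul x y) = \<mu>0"
    using torus_haar_exists[OF X'] by blast
  interpret \<mu>0: prob_space \<mu>0 by (rule \<mu>0(1))
  have mT0: "T \<in> measurable \<mu>0 borel" using mT by (simp add: measurable_cong_sets[OF \<mu>0(2) refl])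
  define \<mu> where "\<mu> = restrict_space (distr \<mu>0 borel T) X"
  have sets\<mu>: "sets \<mu> = sets (restrict_space borel X)" by (simp add: \<mu>_def sets_restrict_space)
  have em\<mu>: "emeasure \<mu> A = emeasure \<mu>0 (T -` A)" if "A \<in> sets \<mu>" for A
  proof -
    have A: "A \<in> sets borel" "A \<subseteq> X" using that setsX unfolding sets\<mu> by auto
    have sp: "space \<mu>0 = UNIV" using sets_eq_imp_space_eq[OF \<mu>0(2)] by simp
    have "emeasure \<mu> A = emeasure (distr \<mu>0 borel T) A"
      unfolding \<mu>_def using A XB by (intro emeasure_restrict_space) auto
    also have "\<dots> = emeasure \<mu>0 (T -` A)" using A mT0 by (simp add: emeasure_distr sp)
    finally show ?thesis .
  qed
  have "?P \<mu>"
  proof (intro conjI ballI sets\<mu>)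
    have "space \<mu> = X" using sets_eq_imp_space_eq[OF sets\<mu>] by (simp add: space_restrict_space)
    then have "emeasure \<mu> (space \<mu>) = emeasure \<mu>0 X'"
      using em\<mu>[of X] sets.top[of \<mu>] by (simp add: X'_def)
    moreover have "emeasure \<mu>0 X' = 1"
      using \<mu>0(2,3) X' by (intro \<mu>0.emeasure_eq_1_AE) (auto simp: torus_subgroup_def)
    ultimately show "prob_space \<mu>" by (intro prob_spaceI) simp
    fix y A assume y: "y \<in> X" and A: "A \<in> sets \<mu>"
    have A': "A \<in> sets borel" "A \<subseteq> X" using A setsX unfolding sets\<mu> by auto
    have yc: "(\<lambda>t. cnj (y t)) \<in> X" by (rule Xi[OF y])
    let ?B = "(\<lambda>x. pmul x (\<lambda>t. cnj (y t))) -` A"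
    have "?B \<in> sets borel"
      using measurable_sets[OF borel_measurable_continuous_onI[OF continuous_pmul(1)] A'(1)] by simp
    moreover have "?B \<subseteq> X"
    proof
      fix x assume "x \<in> ?B"
      then have "pmul x (\<lambda>t. cnj (y t)) \<in> X" using A'(2) by auto
      then have "pmul (pmul x (\<lambda>t. cnj (y t))) y \<in> X" by (rule Xm[OF _ y])
      then show "x \<in> X" by (simp only: cancel(2)[OF y])
    qed
    ultimately have B: "?B \<in> sets \<mu>" unfolding sets\<mu> setsX by blast
    then show "(\<lambda>x t. x t * y t) ` A \<in> sets \<mu>" unfolding image[OF y] .
    have "emeasure \<mu> ?B = emeasure \<mu>0 (T -` ?B)" by (rule em\<mu>[OF B])
    also have "T -` ?B = (\<lambda>z. pmul z (S (\<lambda>t. cnj (y t)))) -` (T -` A)"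
      by (auto simp: Tmul TS)
    also have "emeasure \<mu>0 \<dots> = emeasure (distr \<mu>0 borel (\<lambda>z. pmul z (S (\<lambda>t. cnj (y t))))) (T -` A)"
    proof -
      have m: "(\<lambda>z. pmul z (S (\<lambda>t. cnj (y t)))) \<in> measurable \<mu>0 borel"
        using borel_measurable_continuous_onI[OF continuous_pmul(1)] by (simp add: measurable_cong_sets[OF \<mu>0(2) refl])
      have "T -` A \<in> sets borel" using measurable_sets[OF mT A'(1)] by simp
      then show ?thesis using m sets_eq_imp_space_eq[OF \<mu>0(2)] by (simp add: emeasure_distr)
    qed
    also have "\<dots> = emeasure \<mu> A"
      using \<mu>0(4)[of "S (\<lambda>t. cnj (y t))"] yc em\<mu>[OF A] by (simp add: X'_def TS)
    finally show "measure \<mu> ((\<lambda>x t. x t * y t) ` A) = measure \<mu> A"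
      unfolding image[OF y] by (simp add: measure_def)
  qed
  moreover have "\<mu>1 = \<mu>2" if P1: "?P \<mu>1" and P2: "?P \<mu>2" for \<mu>1 \<mu>2
  proof -
    have push: "prob_space (distr \<nu> borel S) \<and> (AE x in distr \<nu> borel S. x \<in> X') \<and>
        (\<forall>w\<in>X'. distr (distr \<nu> borel S) borel (\<lambda>x. pmul x w) = distr \<nu> borel S) \<and>
        (\<forall>A\<in>sets \<nu>. emeasure \<nu> A = emeasure (distr \<nu> borel S) (T -` A))" if P: "?P \<nu>" for \<nu>
    proof -
      interpret \<nu>: prob_space \<nu> using P by blast
      have sets\<nu>: "sets \<nu> = sets (restrict_space borel X)" using P by blast
      have sp: "space \<nu> = X" using sets_eq_imp_space_eq[OF sets\<nu>] by (simp add: space_restrict_space)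
      have mS\<nu>: "S \<in> measurable \<nu> borel"
        using measurable_restrict_space1[OF mS] by (simp add: measurable_cong_sets[OF sets\<nu> refl])
      have setin: "{x \<in> X. S x \<in> A} \<in> sets \<nu>" if "A \<in> sets borel" for A
        using measurable_sets[OF mS\<nu> that] by (simp add: sp vimage_def Int_def conj_commute)
      have emS: "emeasure (distr \<nu> borel S) A = emeasure \<nu> {x \<in> X. S x \<in> A}" if "A \<in> sets borel" for A
        using that mS\<nu> by (simp add: emeasure_distr sp vimage_def Int_def conj_commute)
      have "AE x in distr \<nu> borel S. x \<in> X'"
      proof (subst AE_distr_iff[OF mS\<nu>])
        show "{x \<in> space borel. x \<in> X'} \<in> sets borel" using X' by (simp add: torus_subgroup_def)
        show "AE x in \<nu>. S x \<in> X'" by (intro AE_I2) (simp add: X'_def TS sp)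
      qed
      moreover have "distr (distr \<nu> borel S) borel (\<lambda>x. pmul x w) = distr \<nu> borel S" if w: "w \<in> X'" for w
      proof (rule measure_eqI)
        fix A assume "A \<in> sets (distr (distr \<nu> borel S) borel (\<lambda>x. pmul x w))"
        then have A: "A \<in> sets borel" by simp
        have mw: "(\<lambda>x. pmul x w) \<in> measurable borel (borel :: (nat \<Rightarrow> complex) measure)"
          by (rule borel_measurable_continuous_onI[OF continuous_pmul(1)])
        have A': "(\<lambda>x. pmul x w) -` A \<in> sets borel" using measurable_sets[OF mw A] by simp
        define y where "y = (\<lambda>t. cnj (T w t))"
        have Tw: "T w \<in> X" using w by (simp add: X'_def)
        have y: "y \<in> X" unfolding y_def by (rule Xi[OF Tw])
        have "emeasure (distr (distr \<nu> borel S) borel (\<lambda>x. pmul x w)) A = emeasure (distr \<nu> borel S) ((\<lambda>x. pmul x w) -` A)"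
          using A mw by (simp add: emeasure_distr)
        also have "\<dots> = emeasure \<nu> {x \<in> X. S x \<in> (\<lambda>x. pmul x w) -` A}" by (rule emS[OF A'])
        also have "{x \<in> X. S x \<in> (\<lambda>x. pmul x w) -` A} = (\<lambda>x t. x t * y t) ` {x \<in> X. S x \<in> A}"
        proof -
          have "(\<lambda>x. pmul x (\<lambda>t. cnj (y t))) -` {x \<in> X. S x \<in> A} = {x \<in> X. S x \<in> (\<lambda>x. pmul x w) -` A}"
          proof -
            have cy: "(\<lambda>t. cnj (y t)) = T w" by (simp add: y_def)
            have "pmul x (T w) \<in> X \<longleftrightarrow> x \<in> X" for x
              using Xm[of "pmul x (T w)" "\<lambda>t. cnj (T w t)"] Xm[OF _ Tw] Xi[OF Tw] cancel(1)[OF Tw] by metis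
            moreover have "S (pmul x (T w)) = pmul (S x) w" for x by (simp add: Smul ST)
            ultimately show ?thesis unfolding cy by auto
          qed
          then show ?thesis using image[OF y] by simp
        qed
        also have "emeasure \<nu> \<dots> = emeasure \<nu> {x \<in> X. S x \<in> A}"
          using P y setin[OF A] by (simp add: \<nu>.emeasure_eq_measure)
        also have "\<dots> = emeasure (distr \<nu> borel S) A" by (rule emS[OF A, symmetric])
        finally show "emeasure (distr (distr \<nu> borel S) borel (\<lambda>x. pmul x w)) A = emeasure (distr \<nu> borel S) A" .
      qed simp
      moreover have "emeasure \<nu> A = emeasure (distr \<nu> borel S) (T -` A)" if "A \<in> sets \<nu>" for A
      proof -
        have A: "A \<in> sets borel" "A \<subseteq> X" using that setsX unfolding sets\<nu> by auto
        have "T -` A \<in> sets borel" using measurable_sets[OF mT A(1)] by simp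
        moreover have "{x \<in> X. S x \<in> T -` A} = A" using A(2) by (auto simp: TS)
        ultimately show ?thesis using emS[of "T -` A"] by simp
      qed
      ultimately show ?thesis using \<nu>.prob_space_distr[OF mS\<nu>] by blast
    qed
    note p1 = push[OF P1] and p2 = push[OF P2]
    have eq: "distr \<mu>1 borel S = distr \<mu>2 borel S"
    proof (rule torus_haar_unique[where X = X'])
      show "prob_space (distr \<mu>1 borel S)" using p1 by blast
      show "prob_space (distr \<mu>2 borel S)" using p2 by blast
      show "AE x in distr \<mu>1 borel S. x \<in> X'" using p1 by blast
      show "AE x in distr \<mu>2 borel S. x \<in> X'" using p2 by blast
      show "distr (distr \<mu>1 borel S) borel (\<lambda>x. pmul x y) = distr \<mu>1 borel S" if "y \<in> X'" for y using p1 that by blast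
      show "distr (distr \<mu>2 borel S) borel (\<lambda>x. pmul x y) = distr \<mu>2 borel S" if "y \<in> X'" for y using p2 that by blast
    qed simp_all
    show ?thesis
    proof (rule measure_eqI)
      show s12: "sets \<mu>1 = sets \<mu>2" using P1 P2 by (simp only: )
      fix A assume A: "A \<in> sets \<mu>1"
      then have A2: "A \<in> sets \<mu>2" by (simp only: s12)
      have "emeasure \<mu>1 A = emeasure (distr \<mu>1 borel S) (T -` A)" using p1 A by blast
      also have "\<dots> = emeasure (distr \<mu>2 borel S) (T -` A)" by (simp only: eq)
      also have "\<dots> = emeasure \<mu>2 A" using p2 A2 by metis
      finally show "emeasure \<mu>1 A = emeasure \<mu>2 A" .
    qed
  qed
  ultimately show ?thesis by blast
qed


section \<open>The spectral measure and the determinant\<close>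

lemma powers_conv_op_delta:
  fixes f :: "'g::group_add \<Rightarrow> int"
  assumes sym: "\<And>s. f (- s) = f s"
  shows "((conv_op (\<lambda>s. real_of_int (f s))) ^^ k) delta_e w = of_int (convpow f k w)"
proof (induction k arbitrary: w)
  case 0
  then show ?case by (simp add: delta_e_def)
next
  case (Suc k)
  let ?T = "conv_op (\<lambda>s. real_of_int (f s))"
  have supp: "{s. f s \<noteq> 0} = supp f" by (simp add: supp_def)
  have "(?T ^^ Suc k) delta_e w = ?T ((?T ^^ k) delta_e) w" by simp
  also have "\<dots> = of_int (convpow f (Suc k) w)" by (subst conv_op_def) (simp add: supp Suc sym)
  finally show ?case .
qed

lemma vN_trace_poly_op:
  fixes f :: "'g::group_add \<Rightarrow> int"
  assumes sym: "\<And>s. f (- s) = f s"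
  shows "vN_trace (poly_op p (conv_op (\<lambda>s. real_of_int (f s)))) =
    complex_of_real (\<Sum>i\<le>degree p. coeff p i * of_int (convpow f i 0))"
  by (simp add: vN_trace_def poly_op_def powers_conv_op_delta[of f, OF sym])

lemma convpow_add:
  fixes f :: "'g::group_add \<Rightarrow> int"
  assumes fin: "finite (supp f)"
  shows "convpow f (j + k) w = (\<Sum>v\<in>supp (convpow f j). convpow f j v * convpow f k (- v + w))"
proof (induction k arbitrary: w)
  case 0
  have "(\<Sum>v\<in>supp (convpow f j). convpow f j v * convpow f 0 (- v + w)) =
      (\<Sum>v\<in>supp (convpow f j). if v = w then convpow f j v else 0)"
  proof (intro sum.cong refl)
    fix v
    have "- v + w = 0 \<longleftrightarrow> v = w" by (metis add.inverse_inverse add_eq_0_iff2 add.left_inverse minus_unique)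
    then show "convpow f j v * convpow f 0 (- v + w) = (if v = w then convpow f j v else 0)" by simp
  qed
  also have "\<dots> = convpow f j w"
    using finite_supp_convpow[OF fin, of j] by (simp add: sum.delta' supp_def)
  finally show ?case by simp
next
  case (Suc k)
  have "convpow f (j + Suc k) w = (\<Sum>s\<in>supp f. \<Sum>v\<in>supp (convpow f j). convpow f j v * convpow f k (- v + (w - s)) * f s)"
    by (simp add: Suc sum_distrib_right)
  also have "\<dots> = (\<Sum>v\<in>supp (convpow f j). \<Sum>s\<in>supp f. convpow f j v * convpow f k (- v + (w - s)) * f s)"
    by (rule sum.swap)
  also have "\<dots> = (\<Sum>v\<in>supp (convpow f j). convpow f j v * convpow f (Suc k) (- v + w))"
    by (simp add: sum_distrib_left mult.assoc add_diff_eq)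
  finally show ?case .
qed

lemma convpow_1: "convpow f (Suc 0) w = (if finite (supp f) then f w else 0)"
proof (cases "finite (supp f)")
  case True
  have "convpow f (Suc 0) w = (\<Sum>s\<in>supp f. if s = w then f s else 0)"
    by (simp, intro sum.cong refl) auto
  then show ?thesis using True by (simp add: sum.delta supp_def)
qed simp

text \<open>Inversion reverses the order of the factors, so the recursion produces f on the left;
  \<open>convpow_add\<close> with first exponent 1 moves it back to the right.\<close>

lemma convpow_sym:
  fixes f :: "'g::group_add \<Rightarrow> int"
  assumes sym: "\<And>s. f (- s) = f s" and fin: "finite (supp f)"
  shows "convpow f k (- w) = convpow f k w"
proof (induction k arbitrary: w)
  case 0
  then show ?case by simp
next
  case (Suc k)
  have supp1: "supp (convpow f (Suc 0)) = supp f" using fin by (auto simp: supp_def convpow_1 simp del: convpow.simps)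
  have "convpow f (Suc k) (- w) = (\<Sum>s\<in>supp f. convpow f k (- (s + w)) * f s)"
    by (simp add: minus_add)
  also have "\<dots> = (\<Sum>s\<in>supp f. convpow f k (s + w) * f s)" by (simp add: Suc del: minus_add_distrib)
  also have "\<dots> = (\<Sum>s\<in>supp f. f s * convpow f k (- s + w))"
    by (rule sum.reindex_bij_witness[of _ uminus uminus]) (auto simp: sym supp_def)
  also have "\<dots> = convpow f (Suc 0 + k) w"
    using convpow_add[OF fin, of "Suc 0" k w] fin by (simp add: supp1 convpow_1 del: convpow.simps)
  finally show ?case by simp
qed

section \<open>Norm bounds and moments\<close>

lemma l2_finite_supp:
  assumes "finite (supp x)"
  shows "l2 x" "(l2norm x)\<^sup>2 = (\<Sum>t\<in>supp x. (cmod (x t))\<^sup>2)"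
proof -
  have "((\<lambda>t. (cmod (x t))\<^sup>2) has_sum (\<Sum>t\<in>supp x. (cmod (x t))\<^sup>2)) UNIV"
    by (rule has_sum_finite_neutralI[OF assms]) (auto simp: supp_def)
  then show "l2 x" "(l2norm x)\<^sup>2 = (\<Sum>t\<in>supp x. (cmod (x t))\<^sup>2)"
    by (auto simp: l2_def l2norm_def infsumI sum_nonneg intro: has_sum_imp_summable)
qed

text \<open>A crude Cauchy-Schwarz bound; its purpose is that the supremum defining
  \<open>op_norm\<close> is taken over a bounded set.\<close>

lemma l2norm_conv_op_le:
  fixes f :: "'g::group_add \<Rightarrow> real"
  assumes fin: "finite (supp f)" and x: "l2 x"
  shows "(l2norm (conv_op f x))\<^sup>2 \<le> (\<Sum>s\<in>{s. f (- s) \<noteq> 0}. (f (- s))\<^sup>2) * card {s. f (- s) \<noteq> 0} * (l2norm x)\<^sup>2"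
    and "l2 (conv_op f x)"
proof -
  let ?S = "{s. f (- s) \<noteq> 0}"
  define K where "K = (\<Sum>s\<in>?S. (f (- s))\<^sup>2)"
  have finS: "finite ?S"
  proof -
    have "?S = uminus ` supp f" by (force simp: supp_def image_iff intro!: exI[where x = "- s" for s])
    then show ?thesis using fin by simp
  qed
  have tr: "((\<lambda>w. (cmod (x (w - s)))\<^sup>2) has_sum (\<Sum>\<^sub>\<infinity>t. (cmod (x t))\<^sup>2)) UNIV" for s
  proof -
    have "((\<lambda>t. (cmod (x t))\<^sup>2) has_sum (\<Sum>\<^sub>\<infinity>t. (cmod (x t))\<^sup>2)) UNIV"
      using x by (simp add: l2_def)
    moreover have "bij_betw (\<lambda>w. w - s) UNIV UNIV"
      by (rule bij_betw_byWitness[where f' = "\<lambda>w. w + s"]) auto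
    ultimately show ?thesis using has_sum_reindex_bij_betw[of "\<lambda>w. w - s" UNIV UNIV "\<lambda>t. (cmod (x t))\<^sup>2"] by simp
  qed
  have sum: "((\<lambda>w. K * (\<Sum>s\<in>?S. (cmod (x (w - s)))\<^sup>2)) has_sum K * (\<Sum>s\<in>?S. \<Sum>\<^sub>\<infinity>t. (cmod (x t))\<^sup>2)) UNIV"
  proof (rule has_sum_cmult_right)
    show "((\<lambda>w. \<Sum>s\<in>?S. (cmod (x (w - s)))\<^sup>2) has_sum (\<Sum>s\<in>?S. \<Sum>\<^sub>\<infinity>t. (cmod (x t))\<^sup>2)) UNIV"
      using finS by (rule finite_induct) (simp_all add: has_sum_add tr del: sum_constant)
  qed
  have le: "(cmod (conv_op f x w))\<^sup>2 \<le> K * (\<Sum>s\<in>?S. (cmod (x (w - s)))\<^sup>2)" for w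
  proof -
    have "cmod (conv_op f x w) \<le> (\<Sum>s\<in>?S. \<bar>f (- s)\<bar> * cmod (x (w - s)))"
      unfolding conv_op_def by (rule order_trans[OF norm_sum]) (simp add: norm_mult mult.commute)
    then have "(cmod (conv_op f x w))\<^sup>2 \<le> (\<Sum>s\<in>?S. \<bar>f (- s)\<bar> * cmod (x (w - s)))\<^sup>2"
      by (intro power_mono) auto
    also have "\<dots> \<le> (\<Sum>s\<in>?S. \<bar>f (- s)\<bar>\<^sup>2) * (\<Sum>s\<in>?S. (cmod (x (w - s)))\<^sup>2)"
      by (rule Cauchy_Schwarz_ineq_sum)
    finally show ?thesis by (simp add: K_def)
  qed
  have summ: "(\<lambda>w. (cmod (conv_op f x w))\<^sup>2) summable_on UNIV"
    by (rule summable_on_comparison_test[OF has_sum_imp_summable[OF sum]]) (use le in auto)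
  then show "l2 (conv_op f x)" by (simp add: l2_def)
  have "(\<Sum>\<^sub>\<infinity>w. (cmod (conv_op f x w))\<^sup>2) \<le> K * (\<Sum>s\<in>?S. \<Sum>\<^sub>\<infinity>t. (cmod (x t))\<^sup>2)"
    using infsum_mono[OF summ has_sum_imp_summable[OF sum]] le infsumI[OF sum] by simp
  then show "(l2norm (conv_op f x))\<^sup>2 \<le> (\<Sum>s\<in>?S. (f (- s))\<^sup>2) * card ?S * (l2norm x)\<^sup>2"
    by (simp add: l2norm_def infsum_nonneg K_def mult_ac)
qed

lemma conv_op_scale: "conv_op f (\<lambda>t. of_real a * x t) = (\<lambda>w. of_real a * conv_op f x w)"
  by (simp add: conv_op_def sum_distrib_left mult_ac)

lemma l2norm_scale: "l2norm (\<lambda>t. of_real a * x t) = \<bar>a\<bar> * l2norm x"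
proof -
  have "(\<Sum>\<^sub>\<infinity>t. (cmod (of_real a * x t))\<^sup>2) = a\<^sup>2 * (\<Sum>\<^sub>\<infinity>t. (cmod (x t))\<^sup>2)"
    by (simp add: norm_mult power_mult_distrib infsum_cmult_right')
  then show ?thesis by (simp add: l2norm_def real_sqrt_mult)
qed

lemma l2norm_op_norm_le:
  fixes f :: "'g::group_add \<Rightarrow> real"
  assumes fin: "finite (supp f)" and x: "l2 x"
  shows "l2norm (conv_op f x) \<le> op_norm (conv_op f) * l2norm x" "0 \<le> op_norm (conv_op f)"
proof -
  define K where "K = (\<Sum>s\<in>{s. f (- s) \<noteq> 0}. (f (- s))\<^sup>2) * card {s. f (- s) \<noteq> 0}"
  have K: "0 \<le> K" by (simp add: K_def sum_nonneg)
  have nn: "0 \<le> l2norm y" for y :: "'g \<Rightarrow> complex" by (simp add: l2norm_def infsum_nonneg)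
  have bdd: "bdd_above {l2norm (conv_op f y) | y. l2 y \<and> l2norm y \<le> 1}"
  proof (rule bdd_aboveI, clarify)
    fix y :: "'g \<Rightarrow> complex" assume y: "l2 y" "l2norm y \<le> 1"
    have "(l2norm (conv_op f y))\<^sup>2 \<le> K * (l2norm y)\<^sup>2" unfolding K_def by (rule l2norm_conv_op_le(1)[OF fin y(1)])
    also have "\<dots> \<le> K * 1" using y(2) nn K by (intro mult_left_mono power_le_one) auto
    finally show "l2norm (conv_op f y) \<le> sqrt K" using nn by (simp add: real_le_rsqrt)
  qed
  have upper: "l2norm (conv_op f y) \<le> op_norm (conv_op f)" if "l2 y" "l2norm y \<le> 1" for y
    unfolding op_norm_def using that by (intro cSup_upper[OF _ bdd]) blast
  have z: "l2 (\<lambda>_. 0 :: complex)" by (simp add: l2_def)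
  show "0 \<le> op_norm (conv_op f)"
    using order_trans[OF nn upper[OF z]] by (simp add: l2norm_def)
  show "l2norm (conv_op f x) \<le> op_norm (conv_op f) * l2norm x"
  proof (cases "l2norm x = 0")
    case True
    have "(l2norm (conv_op f x))\<^sup>2 \<le> K * (l2norm x)\<^sup>2" unfolding K_def by (rule l2norm_conv_op_le(1)[OF fin x])
    then show ?thesis using True by simp
  next
    case False
    then have pos: "0 < l2norm x" using nn[of x] by simp
    let ?y = "\<lambda>t. of_real (1 / l2norm x) * x t"
    have "l2 ?y" unfolding l2_def norm_mult power_mult_distrib
      using x by (intro summable_on_cmult_right) (simp add: l2_def)
    moreover have ny: "l2norm ?y = 1" using pos by (subst l2norm_scale) simp
    ultimately have "l2norm (conv_op f ?y) \<le> op_norm (conv_op f)" by (intro upper) auto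
    then show ?thesis using pos by (subst (asm) conv_op_scale, subst (asm) l2norm_scale) (simp add: field_simps)
  qed
qed

text \<open>By symmetry the value at 0 of the 2k-th power is the square norm of the k-th power of
  the operator applied to \<open>delta_e\<close>. These moments will confine the spectral measure to
  [0, \<open>op_norm\<close>].\<close>

lemma convpow_even_le:
  fixes f :: "'g::group_add \<Rightarrow> int"
  assumes sym: "\<And>s. f (- s) = f s" and fin: "finite (supp f)"
  shows "real_of_int (convpow f (2 * k) 0) \<le> op_norm (conv_op (\<lambda>s. real_of_int (f s))) ^ (2 * k)"
proof -
  let ?T = "conv_op (\<lambda>s. real_of_int (f s))"
  have finf: "finite (supp (\<lambda>s. real_of_int (f s)))" using fin by (simp add: supp_def)
  have eq: "(?T ^^ k) delta_e = (\<lambda>w. of_int (convpow f k w))" for k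
    using powers_conv_op_delta[of f, OF sym] by (simp add: fun_eq_iff)
  have fs: "finite (supp (\<lambda>w. complex_of_int (convpow f k w)))" for k
    using finite_supp_convpow[OF fin, of k] by (simp add: supp_def)
  have "l2norm ((?T ^^ k) delta_e) \<le> op_norm ?T ^ k"
  proof (induction k)
    case 0
    have "supp (delta_e :: 'g \<Rightarrow> complex) = {0}" by (auto simp: supp_def delta_e_def)
    then have "(l2norm (delta_e :: 'g \<Rightarrow> complex))\<^sup>2 = 1" using l2_finite_supp(2)[of "delta_e :: 'g \<Rightarrow> complex"] by (simp add: delta_e_def)
    then show ?case by (auto simp: power2_eq_1_iff)
  next
    case (Suc k)
    have "l2norm (?T ((?T ^^ k) delta_e)) \<le> op_norm ?T * l2norm ((?T ^^ k) delta_e)"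
      using l2_finite_supp(1)[OF fs[of k]] by (intro l2norm_op_norm_le(1)[OF finf]) (simp add: eq)
    also have "\<dots> \<le> op_norm ?T * op_norm ?T ^ k"
      using Suc l2norm_op_norm_le(2)[OF finf l2_finite_supp(1)[OF fs[of 0]]] by (intro mult_left_mono) auto
    finally show ?case by simp
  qed
  moreover have "0 \<le> l2norm ((?T ^^ k) delta_e)" by (simp add: l2norm_def infsum_nonneg)
  ultimately have "(l2norm ((?T ^^ k) delta_e))\<^sup>2 \<le> (op_norm ?T ^ k)\<^sup>2" by (intro power_mono)
  moreover have "(l2norm ((?T ^^ k) delta_e))\<^sup>2 = real_of_int (convpow f (2 * k) 0)"
  proof -
    have "(l2norm ((?T ^^ k) delta_e))\<^sup>2 = (\<Sum>t\<in>supp (convpow f k). (real_of_int (convpow f k t))\<^sup>2)"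
      unfolding eq l2_finite_supp(2)[OF fs] by (simp add: supp_def)
    also have "\<dots> = real_of_int (\<Sum>t\<in>supp (convpow f k). convpow f k t * convpow f k (- t + 0))"
      by (simp add: convpow_sym[of f, OF sym fin] power2_eq_square)
    also have "(\<Sum>t\<in>supp (convpow f k). convpow f k t * convpow f k (- t + 0)) = convpow f (k + k) 0"
      by (rule convpow_add[OF fin, symmetric])
    finally show ?thesis by (simp add: mult_2)
  qed
  ultimately show ?thesis by (simp add: power_mult[symmetric] mult.commute)
qed

lemma poly_approximation:
  fixes F :: "real \<Rightarrow> real"
  assumes "continuous_on {a..b} F" "0 < \<eta>"
  obtains p :: "real poly" where "\<And>t. t \<in> {a..b} \<Longrightarrow> \<bar>F t - poly p t\<bar> < \<eta>"
proof -
  obtain g where g: "real_polynomial_function g" "\<And>t. t \<in> {a..b} \<Longrightarrow> \<bar>F t - g t\<bar> < \<eta>"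
    using Stone_Weierstrass_real_polynomial_function[OF compact_Icc assms] by blast
  obtain c n where "g = (\<lambda>x. \<Sum>i\<le>n. c i * x ^ i)" using g(1) unfolding real_polynomial_function_iff_sum by blast
  then have "g t = poly (\<Sum>i\<le>n. monom (c i) i) t" for t by (simp add: poly_sum poly_monom)
  then show ?thesis using that[of "\<Sum>i\<le>n. monom (c i) i"] g(2) by simp
qed

text \<open>On a compact interval polynomials approximate continuous functions uniformly, so the
  moments determine the measure.\<close>

lemma real_measure_eqI_moments:
  assumes M: "prob_space M" "sets M = sets borel" "AE t in M. t \<in> {0..b::real}"
    and N: "prob_space N" "sets N = sets borel" "AE t in N. t \<in> {0..b}"
    and eq: "\<And>p. integral\<^sup>L M (poly p) = integral\<^sup>L N (poly p)"
  shows "M = N"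
proof (rule measure_eqI_continuous[OF M(1,2) N(1,2)])
  fix F :: "real \<Rightarrow> real" assume F: "continuous_on UNIV F" "\<And>x. 0 \<le> F x \<and> F x \<le> 1"
  have near: "\<bar>integral\<^sup>L P F - integral\<^sup>L P (poly p)\<bar> \<le> \<eta>"
    if P: "prob_space P" "sets P = sets borel" "AE t in P. t \<in> {0..b}" and p: "\<And>t. t \<in> {0..b} \<Longrightarrow> \<bar>F t - poly p t\<bar> < \<eta>" for P p \<eta>
  proof -
    interpret P: prob_space P by (rule P(1))
    have m: "F \<in> borel_measurable P" "poly p \<in> borel_measurable P"
      unfolding measurable_cong_sets[OF P(2) refl] using F(1) by (auto intro!: borel_measurable_continuous_onI continuous_intros)
    obtain C where C: "\<And>t. t \<in> {0..b} \<Longrightarrow> \<bar>poly p t\<bar> \<le> C"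
    proof -
      have "bounded (poly p ` {0..b})"
        by (intro compact_imp_bounded compact_continuous_image continuous_intros compact_Icc)
      then show ?thesis using that unfolding bounded_iff by (metis imageI real_norm_def)
    qed
    have i1: "integrable P F"
      using m(1) F(2) by (intro P.integrable_const_bound[where B = 1] AE_I2) auto
    have "AE t in P. norm (poly p t) \<le> C" using P(3) by eventually_elim (simp add: C)
    then have i2: "integrable P (poly p)" using m(2) by (rule P.integrable_const_bound)
    note i = i1 i2
    have "\<bar>integral\<^sup>L P F - integral\<^sup>L P (poly p)\<bar> = \<bar>integral\<^sup>L P (\<lambda>t. F t - poly p t)\<bar>" using i by simp
    also have "\<dots> \<le> integral\<^sup>L P (\<lambda>t. \<bar>F t - poly p t\<bar>)" by (rule integral_abs_bound)
    also have "\<dots> \<le> integral\<^sup>L P (\<lambda>t. \<eta>)"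
    proof (rule integral_mono_AE)
      show "AE t in P. \<bar>F t - poly p t\<bar> \<le> \<eta>" using P(3) by eventually_elim (rule less_imp_le[OF p])
    qed (use i in auto)
    also have "\<dots> = \<eta>" by (simp add: P.prob_space)
    finally show ?thesis .
  qed
  have "\<bar>integral\<^sup>L M F - integral\<^sup>L N F\<bar> \<le> e" if e: "0 < e" for e
  proof -
    obtain p :: "real poly" where p: "\<And>t. t \<in> {0..b} \<Longrightarrow> \<bar>F t - poly p t\<bar> < e / 2"
      by (rule poly_approximation[OF continuous_on_subset[OF F(1) subset_UNIV], of "e / 2" 0 b]) (use e in auto)
    show ?thesis using near[OF M p] near[OF N p] eq[of p] by linarith
  qed
  then show "integral\<^sup>L M F = integral\<^sup>L N F" using field_le_epsilon by (metis abs_le_zero_iff add_0 eq_iff_diff_eq_0)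
qed

text \<open>The spectral measure arises as a weak limit of the eigenvalue distributions of the
  quotients, whose moments are eventually the required ones. The eigenvalue bound gives support in
  [0, L], and the growth of the even moments improves this to [0, \<open>op_norm T\<close>]. Moments
  determine a measure on that interval, so the definite description is met.\<close>

lemma spectral_measure_props:
  fixes f :: "'g::group_add \<Rightarrow> int" and lam :: "nat \<Rightarrow> nat \<Rightarrow> real" and N :: "nat \<Rightarrow> nat" and L :: real
  assumes sym: "\<And>s. f (- s) = f s" and fin: "finite (supp f)"
    and lam: "\<And>n k. k < N n \<Longrightarrow> 0 \<le> lam n k \<and> lam n k \<le> L" and N: "\<And>n. 0 < N n"
    and mom: "\<And>m. eventually (\<lambda>n. (\<Sum>k<N n. lam n k ^ m) = real (N n) * of_int (convpow f m 0)) sequentially"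
  defines "T \<equiv> conv_op (\<lambda>s. real_of_int (f s))"
  shows "prob_space (spectral_measure T)" "sets (spectral_measure T) = sets (restrict_space borel {0..op_norm T})"
    "\<And>p. integral\<^sup>L (spectral_measure T) (poly p) = (\<Sum>i\<le>degree p. coeff p i * of_int (convpow f i 0))"
proof -
  let ?P = "\<lambda>\<mu>. prob_space \<mu> \<and> sets \<mu> = sets (restrict_space borel {0..op_norm T}) \<and>
      (\<forall>p. complex_of_real (integral\<^sup>L \<mu> (poly p)) = vN_trace (poly_op p T))"
  define B where "B = op_norm T"
  have finf: "finite (supp (\<lambda>s. real_of_int (f s)))" using fin by (simp add: supp_def)
  have B0: "0 \<le> B" unfolding B_def T_def by (rule l2norm_op_norm_le(2)[OF finf, of "\<lambda>_. 0"]) (simp add: l2_def)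
  have tr: "vN_trace (poly_op p T) = complex_of_real (\<Sum>i\<le>degree p. coeff p i * of_int (convpow f i 0))" for p
    unfolding T_def by (rule vN_trace_poly_op[of f, OF sym])
  have L0: "0 \<le> L" using lam[of 0 0] N[of 0] by linarith
  define \<mu>s where "\<mu>s n = distr (measure_pmf (pmf_of_set {..<N n})) borel (lam n)" for n
  have rd: "real_distribution (\<mu>s n)" for n
    unfolding \<mu>s_def by (intro prob_space.real_distribution_distr) (auto intro: measure_pmf.prob_space_axioms)
  have int: "integral\<^sup>L (\<mu>s n) F = (\<Sum>k<N n. F (lam n k)) / N n" if "F \<in> borel_measurable borel" for F :: "real \<Rightarrow> real" and n
    unfolding \<mu>s_def using that N[of n] by (subst integral_distr) (auto simp: integral_pmf_of_set lessThan_empty_iff)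
  have tight: "tight \<mu>s"
    unfolding tight_def
  proof (intro conjI allI impI rd)
    fix e :: real assume "0 < e"
    have "measure (\<mu>s n) {- 1<..L} = 1" for n
    proof -
      have "measure (\<mu>s n) {- 1<..L} = measure (measure_pmf (pmf_of_set {..<N n})) (lam n -` {- 1<..L})"
        unfolding \<mu>s_def by (subst measure_distr) auto
      also have "\<dots> = 1"
        using lam[of _ n] N[of n] by (subst measure_pmf.prob_eq_1) (force simp: AE_measure_pmf_iff set_pmf_of_set lessThan_empty_iff)+
      finally show ?thesis .
    qed
    then show "\<exists>a b. a < b \<and> (\<forall>n. 1 - e < measure (\<mu>s n) {a<..b})"
      using L0 \<open>0 < e\<close> by (intro exI[of _ "- 1"] exI[of _ L]) auto
  qed
  obtain r M where r: "strict_mono (r :: nat \<Rightarrow> nat)" and M: "real_distribution M" "weak_conv_m (\<mu>s \<circ> id \<circ> r) M"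
    using tight_imp_convergent_subsubsequence[OF tight strict_mono_id] by blast
  interpret M: real_distribution M by (rule M(1))
  have lim: "(\<lambda>n. (\<Sum>k<N (r n). F (lam (r n) k)) / N (r n)) \<longlonglongrightarrow> integral\<^sup>L M F"
    if F: "continuous_on UNIV F" "\<And>x. norm (F x) \<le> C" for F :: "real \<Rightarrow> real" and C
  proof -
    have "(\<lambda>n. integral\<^sup>L ((\<mu>s \<circ> id \<circ> r) n) F) \<longlonglongrightarrow> integral\<^sup>L M F"
      by (rule weak_conv_imp_integral_bdd_continuous_conv[OF _ M(1) M(2) _ F(2)])
        (use rd F(1) in \<open>auto simp: continuous_on_eq_continuous_at\<close>)
    then show ?thesis using F(1) by (simp add: int borel_measurable_continuous_onI)
  qed
  have AEL: "AE t in M. t \<in> {0..L}"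
  proof -
    let ?F = "\<lambda>t. min 1 (infdist t {0..L})"
    have F: "continuous_on UNIV ?F" "\<And>t. norm (?F t) \<le> 1" by (auto intro!: continuous_intros simp: infdist_nonneg)
    have "(\<Sum>k<N (r n). ?F (lam (r n) k)) = 0" for n using lam by (intro sum.neutral) auto
    then have "integral\<^sup>L M ?F = 0" using lim[OF F] LIMSEQ_unique[OF tendsto_const[of 0]] by simp
    moreover have "integrable M ?F"
      using F(2) borel_measurable_continuous_onI[OF F(1)] by (intro M.integrable_const_bound[where B = 1]) auto
    ultimately have "AE t in M. ?F t = 0"
      using integral_nonneg_eq_0_iff_AE[of M ?F] by (auto simp: infdist_nonneg)
    then show ?thesis
    proof (rule AE_mp, intro AE_I2 impI)
      fix t assume "?F t = 0"
      then have "infdist t {0..L} = 0" by (auto simp: min_def split: if_splits)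
      then show "t \<in> {0..L}" using in_closed_iff_infdist_zero[of "{0..L}" t] L0 by auto
    qed
  qed
  have momM: "integrable M (\<lambda>t. t ^ m)" "integral\<^sup>L M (\<lambda>t. t ^ m) = of_int (convpow f m 0)" for m
  proof -
    \<comment> \<open>Truncation to [0, L] leaves the eigenvalues unchanged and makes the power
      bounded, as weak convergence requires.\<close>
    let ?c = "\<lambda>t. max 0 (min L t)"
    have F: "continuous_on UNIV (\<lambda>t. (?c t) ^ m)" by (intro continuous_intros)
    have bd: "norm ((?c t) ^ m) \<le> L ^ m" for t using L0 by (auto simp: power_abs intro!: power_mono)
    have AE: "AE t in M. t ^ m = (?c t) ^ m" using AEL by eventually_elim auto
    have mm: "(\<lambda>t::real. t ^ m) \<in> borel_measurable M" "(\<lambda>t. (?c t) ^ m) \<in> borel_measurable M" by auto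
    have ic: "integrable M (\<lambda>t. (?c t) ^ m)" using bd mm(2) by (intro M.integrable_const_bound[where B = "L ^ m"]) auto
    show "integrable M (\<lambda>t. t ^ m)" using integrable_cong_AE[OF mm AE] ic by blast
    have "(\<lambda>n. (\<Sum>k<N (r n). (?c (lam (r n) k)) ^ m) / N (r n)) \<longlonglongrightarrow> integral\<^sup>L M (\<lambda>t. (?c t) ^ m)"
      by (rule lim[OF F bd])
    moreover have "(\<Sum>k<N (r n). (?c (lam (r n) k)) ^ m) = (\<Sum>k<N (r n). lam (r n) k ^ m)" for n
      using lam by (intro sum.cong) auto
    moreover have "eventually (\<lambda>n. (\<Sum>k<N (r n). lam (r n) k ^ m) / N (r n) = of_int (convpow f m 0)) sequentially"
      using eventually_subseq[OF r mom[of m]] by eventually_elim (use N in \<open>simp add: less_imp_neq[symmetric]\<close>)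
    ultimately have "integral\<^sup>L M (\<lambda>t. (?c t) ^ m) = of_int (convpow f m 0)"
      using LIMSEQ_unique[OF _ tendsto_eventually] by fastforce
    then show "integral\<^sup>L M (\<lambda>t. t ^ m) = of_int (convpow f m 0)" using integral_cong_AE[OF mm AE] by simp
  qed
  have AEB: "AE t in M. t \<in> {0..B}"
  proof -
    have "AE t in M. t < B + 1 / real (Suc j)" for j
    proof -
      define b where "b = B + 1 / real (Suc j)"
      have b: "0 < b" "B < b" using B0 by (auto simp: b_def add_nonneg_pos)
      \<comment> \<open>Markov's inequality for the 2k-th moment; the bound tends to 0 because b
        exceeds the operator norm B.\<close>
      have "measure M {b..} \<le> (B / b) ^ (2 * k)" for k
      proof -
        have "measure M {b..} * b ^ (2 * k) = integral\<^sup>L M (\<lambda>t. b ^ (2 * k) * indicator {b..} t)" by simp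
        also have "\<dots> \<le> integral\<^sup>L M (\<lambda>t. t ^ (2 * k))"
        proof (intro integral_mono momM(1))
          show "b ^ (2 * k) * indicator {b..} t \<le> t ^ (2 * k)" for t
            using b power_mono[of b t "2 * k"] zero_le_even_power'[of t k] by (auto simp: indicator_def)
        qed (simp_all add: integrable_real_indicator M.emeasure_eq_measure)
        also have "\<dots> \<le> B ^ (2 * k)"
          unfolding momM(2) B_def T_def by (rule convpow_even_le[of f, OF sym fin])
        finally show ?thesis using b by (simp add: power_divide field_simps)
      qed
      moreover have "(\<lambda>k. (B / b) ^ (2 * k)) \<longlonglongrightarrow> 0"
        unfolding power_mult using b B0 by (intro LIMSEQ_power_zero) (simp add: power_divide power_strict_mono)
      ultimately have "measure M {b..} \<le> 0" by (intro LIMSEQ_le_const) auto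
      then have "measure M {b..} = 0" by (simp add: measure_le_0_iff)
      then have "AE t in M. t \<notin> {b..}" using M.prob_eq_0[of "{b..}"] by auto
      then show ?thesis unfolding b_def by eventually_elim auto
    qed
    then have "AE t in M. \<forall>j. t < B + 1 / real (Suc j)" by (simp add: AE_all_countable)
    then show ?thesis using AEL
    proof eventually_elim
      case (elim t)
      have "t \<le> B"
      proof (rule ccontr)
        assume "\<not> t \<le> B"
        then obtain j where "1 / real (Suc j) < t - B" using reals_Archimedean[of "t - B"] by (auto simp: inverse_eq_divide)
        then show False using elim(1)[rule_format, of j] by linarith
      qed
      then show ?case using elim by auto
    qed
  qed
  have Bb: "{0..B} \<in> sets borel" by simp
  have "?P (restrict_space M {0..B})"
  proof (intro conjI allI)
    show "prob_space (restrict_space M {0..B})"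
      using AEB by (intro prob_space_restrict_space M.emeasure_eq_1_AE) auto
    show "sets (restrict_space M {0..B}) = sets (restrict_space borel {0..op_norm T})"
      by (simp add: sets_restrict_space B_def)
    fix p
    have "integral\<^sup>L (restrict_space M {0..B}) (poly p) = integral\<^sup>L M (\<lambda>t. indicator {0..B} t *\<^sub>R poly p t)"
      by (rule integral_restrict_space) simp
    also have "\<dots> = integral\<^sup>L M (poly p)"
    proof (rule integral_cong_AE)
      have pm: "poly p \<in> borel_measurable borel" by (intro borel_measurable_continuous_onI continuous_intros)
      then show "poly p \<in> borel_measurable M" by simp
      show "(\<lambda>t. indicator {0..B} t *\<^sub>R poly p t) \<in> borel_measurable M" using pm by measurable
      show "AE t in M. indicator {0..B} t *\<^sub>R poly p t = poly p t" using AEB by eventually_elim simp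
    qed
    also have "\<dots> = integral\<^sup>L M (\<lambda>t. \<Sum>i\<le>degree p. coeff p i * t ^ i)"
      by (intro arg_cong[where f = "integral\<^sup>L M"] ext) (simp add: poly_altdef)
    also have "\<dots> = (\<Sum>i\<le>degree p. coeff p i * of_int (convpow f i 0))"
      using momM by (subst Bochner_Integration.integral_sum) auto
    finally show "complex_of_real (integral\<^sup>L (restrict_space M {0..B}) (poly p)) = vN_trace (poly_op p T)"
      unfolding tr by (simp only:)
  qed
  moreover have "\<mu>1 = \<mu>2" if P: "?P \<mu>1" "?P \<mu>2" for \<mu>1 \<mu>2
  proof -
    have push: "prob_space (distr \<nu> borel (\<lambda>t. t)) \<and> (AE t in distr \<nu> borel (\<lambda>t. t). t \<in> {0..B}) \<and>
        (\<forall>p. integral\<^sup>L (distr \<nu> borel (\<lambda>t. t)) (poly p) = (\<Sum>i\<le>degree p. coeff p i * of_int (convpow f i 0))) \<and>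
        (\<forall>A\<in>sets \<nu>. emeasure \<nu> A = emeasure (distr \<nu> borel (\<lambda>t. t)) A)" if Q: "?P \<nu>" for \<nu> :: "real measure"
    proof -
      interpret \<nu>: prob_space \<nu> using Q by blast
      have s: "sets \<nu> = sets (restrict_space borel {0..B})" using Q by (simp add: B_def)
      have sp: "space \<nu> = {0..B}" using sets_eq_imp_space_eq[OF s] by (simp add: space_restrict_space)
      have m: "(\<lambda>t. t) \<in> measurable \<nu> borel"
        unfolding measurable_cong_sets[OF s refl] by (rule measurable_restrict_space1) simp
      have "AE t in distr \<nu> borel (\<lambda>t. t). t \<in> {0..B}"
        by (subst AE_distr_iff[OF m]) (auto intro!: AE_I2 simp: sp)
      moreover have "integral\<^sup>L (distr \<nu> borel (\<lambda>t. t)) (poly p) = (\<Sum>i\<le>degree p. coeff p i * of_int (convpow f i 0))" for p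
      proof -
        have "integral\<^sup>L (distr \<nu> borel (\<lambda>t. t)) (poly p) = integral\<^sup>L \<nu> (poly p)"
          by (rule integral_distr[OF m]) (auto intro!: borel_measurable_continuous_onI continuous_intros)
        moreover have "complex_of_real (integral\<^sup>L \<nu> (poly p)) = complex_of_real (\<Sum>i\<le>degree p. coeff p i * of_int (convpow f i 0))"
          using Q tr by metis
        ultimately show ?thesis by (simp only: of_real_eq_iff)
      qed
      moreover have "emeasure \<nu> A = emeasure (distr \<nu> borel (\<lambda>t. t)) A" if "A \<in> sets \<nu>" for A
      proof -
        have A: "A \<in> sets borel" "A \<subseteq> {0..B}"
          using that Bb unfolding s by (auto simp: sets_restrict_space_iff)
        then have "A \<inter> {0..B} = A" by blast
        then show ?thesis using A by (subst emeasure_distr[OF m]) (auto simp: sp)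
      qed
      ultimately show ?thesis using \<nu>.prob_space_distr[OF m] by blast
    qed
    note p1 = push[OF P(1)] and p2 = push[OF P(2)]
    have eq: "distr \<mu>1 borel (\<lambda>t. t) = distr \<mu>2 borel (\<lambda>t. t)"
    proof (rule real_measure_eqI_moments[where b = B])
      show "prob_space (distr \<mu>1 borel (\<lambda>t. t))" using p1 by blast
      show "prob_space (distr \<mu>2 borel (\<lambda>t. t))" using p2 by blast
      show "AE t in distr \<mu>1 borel (\<lambda>t. t). t \<in> {0..B}" using p1 by blast
      show "AE t in distr \<mu>2 borel (\<lambda>t. t). t \<in> {0..B}" using p2 by blast
      show "integral\<^sup>L (distr \<mu>1 borel (\<lambda>t. t)) (poly p) = integral\<^sup>L (distr \<mu>2 borel (\<lambda>t. t)) (poly p)" for p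
        using p1 p2 by presburger
    qed simp_all
    show ?thesis
    proof (rule measure_eqI)
      show s12: "sets \<mu>1 = sets \<mu>2" using P by (simp only: )
      fix A assume A: "A \<in> sets \<mu>1"
      then have A2: "A \<in> sets \<mu>2" by (simp only: s12)
      have "emeasure \<mu>1 A = emeasure (distr \<mu>1 borel (\<lambda>t. t)) A" using p1 A by blast
      also have "\<dots> = emeasure (distr \<mu>2 borel (\<lambda>t. t)) A" by (simp only: eq)
      also have "\<dots> = emeasure \<mu>2 A" using p2 A2 by metis
      finally show "emeasure \<mu>1 A = emeasure \<mu>2 A" .
    qed
  qed
  ultimately have "\<exists>!\<mu>. ?P \<mu>" by blast
  from theI'[OF this] have S: "?P (spectral_measure T)" unfolding spectral_measure_def .
  then show "prob_space (spectral_measure T)" "sets (spectral_measure T) = sets (restrict_space borel {0..op_norm T})" by blast+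
  show "integral\<^sup>L (spectral_measure T) (poly p) = (\<Sum>i\<le>degree p. coeff p i * of_int (convpow f i 0))" for p
    using S tr[of p] of_real_eq_iff by metis
qed


section \<open>Passing to the limit in the logarithm\<close>

lemma ln_ratio_small:
  fixes a e :: real
  assumes "1 \<le> a" "0 < e"
  obtains r :: nat where "ln (a * (2 * real (4 * r + 1))) / (real r + 1) < e"
proof -
  have "(\<lambda>r::nat. ln (a * (2 * real (4 * r + 1))) / (real r + 1)) \<longlonglongrightarrow> 0"
    using assms(1) by real_asymp
  then have "eventually (\<lambda>r::nat. ln (a * (2 * real (4 * r + 1))) / (real r + 1) < e) sequentially"
    using assms(2) by (rule order_tendstoD(2))
  then obtain r :: nat where "ln (a * (2 * real (4 * r + 1))) / (real r + 1) < e"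
    unfolding eventually_sequentially by blast
  then show ?thesis by (rule that)
qed

text \<open>For fixed \<kappa> the function ln (\<kappa> + t) is continuous on the spectrum, so its
  eigenvalue averages converge to \<Lambda> \<kappa>. The bounds \<open>up\<close> and
  \<open>lo\<close> keep these averages close to a n = ln (\<tau> n) / N n, with an error that is
  small for small \<kappa> once n is large. So a is Cauchy, and its limit is that of \<Lambda>
  \<kappa> as \<kappa> tends to 0, which monotone convergence identifies with the integral of
  ln.\<close>

lemma spectral_log_limit:
  fixes lam :: "nat \<Rightarrow> nat \<Rightarrow> real" and N :: "nat \<Rightarrow> nat" and \<tau> c :: "nat \<Rightarrow> real" and L B d :: real
  assumes M: "prob_space M" "sets M = sets (restrict_space borel {0..B})"
    and c: "\<And>p. integral\<^sup>L M (poly p) = (\<Sum>i\<le>degree p. coeff p i * c i)"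
    and lam: "\<And>n k. k < N n \<Longrightarrow> 0 \<le> lam n k \<and> lam n k \<le> L" and N: "\<And>n. 0 < N n"
    and mom: "\<And>m. eventually (\<lambda>n. (\<Sum>k<N n. lam n k ^ m) = real (N n) * c m) sequentially"
    and large: "\<And>m. eventually (\<lambda>n. m < N n) sequentially"
    and \<tau>: "\<And>n. 1 \<le> \<tau> n" and d: "1 \<le> d"
    and up: "\<And>n \<kappa>. 0 < \<kappa> \<Longrightarrow> \<kappa> * \<tau> n \<le> (\<Prod>k<N n. \<kappa> + lam n k)"
    and lo: "\<And>n \<kappa> r. 0 < \<kappa> \<Longrightarrow> r < N n \<Longrightarrow> (\<Prod>k<N n. \<kappa> + lam n k) \<le>
      ((d + \<kappa>) * (2 * real (4 * r + 1))) powr (real (N n) / (real r + 1)) * (1 + 4 * real r * \<kappa>) ^ N n * \<tau> n"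
  obtains l :: real where
    "enn2ereal (\<integral>\<^sup>+ t. indicator {0<..B} t * ennreal (max 0 (ln t)) \<partial>M)
     - enn2ereal (\<integral>\<^sup>+ t. indicator {0<..B} t * ennreal (max 0 (- ln t)) \<partial>M) = ereal l"
    "(\<lambda>n. ln (\<tau> n) / N n) \<longlonglongrightarrow> l"
proof -
  interpret M: prob_space M by (rule M(1))
  have sp: "space M = {0..B}" using sets_eq_imp_space_eq[OF M(2)] by (simp add: space_restrict_space)
  have B0: "0 \<le> B" using M.not_empty by (simp add: sp)
  have meas: "F \<in> borel_measurable M" if "F \<in> borel_measurable borel" for F :: "real \<Rightarrow> real"
    unfolding measurable_cong_sets[OF M(2) refl] using that by (rule measurable_restrict_space1)
  have measc: "F \<in> borel_measurable M" if "continuous_on {0..B} F" for F :: "real \<Rightarrow> real"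
    unfolding measurable_cong_sets[OF M(2) refl] using that by (intro borel_measurable_continuous_on_restrict)
  have intc: "integrable M F" if F: "continuous_on {0..B} F" for F :: "real \<Rightarrow> real"
  proof -
    have "bounded (F ` {0..B})" using compact_continuous_image[OF F] compact_imp_bounded by blast
    then obtain K where K: "\<forall>y\<in>F ` {0..B}. norm y \<le> K" unfolding bounded_iff by blast
    show ?thesis
      by (rule M.integrable_const_bound[where B = K]) (use K measc[OF F] in \<open>auto intro!: AE_I2 simp: sp\<close>)
  qed
  define C where "C = max B L"
  have lim: "(\<lambda>n. (\<Sum>k<N n. F (lam n k)) / N n) \<longlonglongrightarrow> integral\<^sup>L M F" if F: "continuous_on {0..C} F" for F :: "real \<Rightarrow> real"
  proof (rule LIMSEQ_I)
    fix e :: real assume e: "0 < e"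
    obtain p :: "real poly" where p: "\<And>t. t \<in> {0..C} \<Longrightarrow> \<bar>F t - poly p t\<bar> < e / 3"
      using poly_approximation[OF F, of "e / 3"] e by auto
    have FB: "continuous_on {0..B} F" by (rule continuous_on_subset[OF F]) (simp add: C_def)
    have pB: "continuous_on {0..B} (poly p)" by (intro continuous_intros)
    have "\<bar>integral\<^sup>L M F - integral\<^sup>L M (poly p)\<bar> = \<bar>integral\<^sup>L M (\<lambda>t. F t - poly p t)\<bar>"
      using intc[OF FB] intc[OF pB] by simp
    also have "\<dots> \<le> integral\<^sup>L M (\<lambda>t. \<bar>F t - poly p t\<bar>)" by (rule integral_abs_bound)
    also have "\<dots> \<le> integral\<^sup>L M (\<lambda>t. e / 3)"
    proof (rule integral_mono)
      show "integrable M (\<lambda>t. \<bar>F t - poly p t\<bar>)" using intc[OF FB] intc[OF pB] by simp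
      show "\<bar>F t - poly p t\<bar> \<le> e / 3" if "t \<in> space M" for t
      proof -
        have "t \<in> {0..C}" using that by (auto simp: sp C_def)
        then show ?thesis using p[of t] by linarith
      qed
    qed simp
    also have "\<dots> = e / 3" by (simp add: M.prob_space)
    finally have 1: "\<bar>integral\<^sup>L M F - integral\<^sup>L M (poly p)\<bar> \<le> e / 3" .
    have "eventually (\<lambda>n. \<forall>m\<in>{..degree p}. (\<Sum>k<N n. lam n k ^ m) = real (N n) * c m) sequentially"
      using mom by (intro eventually_ball_finite) auto
    then have "eventually (\<lambda>n. norm ((\<Sum>k<N n. F (lam n k)) / N n - integral\<^sup>L M F) < e) sequentially"
    proof eventually_elim
      case (elim n)
      have "(\<Sum>k<N n. poly p (lam n k)) = (\<Sum>m\<le>degree p. coeff p m * (\<Sum>k<N n. lam n k ^ m))"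
        unfolding poly_altdef sum_distrib_left by (rule sum.swap)
      also have "\<dots> = (\<Sum>m\<le>degree p. coeff p m * (real (N n) * c m))" using elim by (intro sum.cong) auto
      also have "\<dots> = real (N n) * integral\<^sup>L M (poly p)" unfolding c sum_distrib_left by (simp add: mult_ac)
      finally have 2: "(\<Sum>k<N n. poly p (lam n k)) = real (N n) * integral\<^sup>L M (poly p)" .
      have "\<bar>(\<Sum>k<N n. F (lam n k)) - (\<Sum>k<N n. poly p (lam n k))\<bar> \<le> (\<Sum>k<N n. \<bar>F (lam n k) - poly p (lam n k)\<bar>)"
        unfolding sum_subtractf[symmetric] by (rule sum_abs)
      also have "\<dots> \<le> (\<Sum>k<N n. e / 3)" 
      proof (rule sum_mono)
        fix k assume "k \<in> {..<N n}"
        then have "lam n k \<in> {0..C}" using lam[of k n] by (auto simp: C_def)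
        then show "\<bar>F (lam n k) - poly p (lam n k)\<bar> \<le> e / 3" using p[of "lam n k"] by linarith
      qed
      finally have "\<bar>(\<Sum>k<N n. F (lam n k)) - real (N n) * integral\<^sup>L M (poly p)\<bar> \<le> real (N n) * (e / 3)"
        unfolding 2 by simp
      then have "\<bar>(\<Sum>k<N n. F (lam n k)) / N n - integral\<^sup>L M (poly p)\<bar> \<le> e / 3"
        using N[of n] by (simp add: abs_le_iff field_simps)
      then show ?case using 1 e unfolding real_norm_def by linarith
    qed
    then show "\<exists>no. \<forall>n\<ge>no. norm ((\<Sum>k<N n. F (lam n k)) / N n - integral\<^sup>L M F) < e"
      by (simp add: eventually_sequentially)
  qed
  define \<Lambda> where "\<Lambda> \<kappa> = integral\<^sup>L M (\<lambda>t. ln (\<kappa> + t))" for \<kappa>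
  define A where "A \<kappa> n = (\<Sum>k<N n. ln (\<kappa> + lam n k)) / N n" for \<kappa> n
  define a where "a n = ln (\<tau> n) / N n" for n
  have cont: "continuous_on {0..b} (\<lambda>t. ln (\<kappa> + t))" if "0 < \<kappa>" for \<kappa> b :: real
    using that by (intro continuous_intros) auto
  have A: "A \<kappa> \<longlonglongrightarrow> \<Lambda> \<kappa>" if "0 < \<kappa>" for \<kappa>
    unfolding A_def \<Lambda>_def by (rule lim[OF cont[OF that]])
  have a0: "0 \<le> a n" for n using \<tau>[of n] by (simp add: a_def)
  have lnprod: "ln (\<Prod>k<N n. \<kappa> + lam n k) = N n * A \<kappa> n" "0 < (\<Prod>k<N n. \<kappa> + lam n k)" if "0 < \<kappa>" for \<kappa> n
  proof -
    have pos: "0 < \<kappa> + lam n k" if "k < N n" for k using lam[OF that] \<open>0 < \<kappa>\<close> by linarith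
    show "ln (\<Prod>k<N n. \<kappa> + lam n k) = N n * A \<kappa> n"
      using N[of n] pos by (subst ln_prod) (force simp: A_def)+
    show "0 < (\<Prod>k<N n. \<kappa> + lam n k)" using pos by (intro prod_pos) auto
  qed
  have upA: "a n + ln \<kappa> / N n \<le> A \<kappa> n" if \<kappa>: "0 < \<kappa>" for \<kappa> n
  proof -
    have "ln \<kappa> + ln (\<tau> n) = ln (\<kappa> * \<tau> n)" using \<kappa> \<tau>[of n] by (simp add: ln_mult)
    also have "\<dots> \<le> ln (\<Prod>k<N n. \<kappa> + lam n k)"
      using \<kappa> \<tau>[of n] up[OF \<kappa>, of n] by (intro ln_mono) auto
    also have "\<dots> = N n * A \<kappa> n" by (rule lnprod(1)[OF \<kappa>])
    finally show ?thesis using N[of n] by (simp add: a_def field_simps)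
  qed
  have loA: "A \<kappa> n \<le> a n + ln ((d + \<kappa>) * (2 * real (4 * r + 1))) / (real r + 1) + ln (1 + 4 * real r * \<kappa>)"
    if \<kappa>: "0 < \<kappa>" and r: "r < N n" for \<kappa> n r
  proof -
    define Y where "Y = (d + \<kappa>) * (2 * real (4 * r + 1))"
    define Z where "Z = 1 + 4 * real r * \<kappa>"
    have Y: "0 < Y" using d \<kappa> by (simp add: Y_def)
    have Z: "0 < Z" using \<kappa> by (simp add: Z_def add_pos_nonneg)
    have "N n * A \<kappa> n = ln (\<Prod>k<N n. \<kappa> + lam n k)" by (rule lnprod(1)[OF \<kappa>, symmetric])
    also have "\<dots> \<le> ln (Y powr (real (N n) / (real r + 1)) * Z ^ N n * \<tau> n)"
      by (rule ln_mono[OF lo[OF \<kappa> r, folded Y_def Z_def] lnprod(2)[OF \<kappa>]])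
    also have "\<dots> = real (N n) / (real r + 1) * ln Y + N n * ln Z + ln (\<tau> n)"
      using Y Z \<tau>[of n] by (simp add: ln_mult ln_powr ln_realpow)
    also have "\<dots> = N n * (ln Y / (real r + 1) + ln Z + a n)"
      using N[of n] by (simp add: a_def algebra_simps)
    finally show ?thesis using N[of n] by (simp add: Y_def Z_def)
  qed
  have near: "\<exists>\<kappa>0>0. \<kappa>0 \<le> 1 \<and> (\<forall>\<kappa>. 0 < \<kappa> \<longrightarrow> \<kappa> \<le> \<kappa>0 \<longrightarrow> eventually (\<lambda>n. \<bar>a n - \<Lambda> \<kappa>\<bar> < e) sequentially)"
    if e: "0 < e" for e :: real
  proof -
    \<comment> \<open>The order of choice: r from e, then \<kappa> small against r, then n large
      against \<kappa> and r.\<close>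
    obtain r :: nat where r: "ln ((d + 1) * (2 * real (4 * r + 1))) / (real r + 1) < e / 4"
      using ln_ratio_small[of "d + 1" "e / 4"] d e by auto
    define \<kappa>0 where "\<kappa>0 = min 1 (e / (4 * (4 * real r + 1)))"
    have \<kappa>0: "0 < \<kappa>0" "\<kappa>0 \<le> 1" using e by (auto simp: \<kappa>0_def)
    have "eventually (\<lambda>n. \<bar>a n - \<Lambda> \<kappa>\<bar> < e) sequentially" if \<kappa>: "0 < \<kappa>" "\<kappa> \<le> \<kappa>0" for \<kappa>
    proof -
      have "4 * real r * \<kappa> \<le> (4 * real r + 1) * (e / (4 * (4 * real r + 1)))"
        using \<kappa> \<kappa>0 by (intro mult_mono) (auto simp: \<kappa>0_def)
      also have "(4 * real r + 1) * (e / (4 * (4 * real r + 1))) = e / 4"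
        using nonzero_mult_divide_mult_cancel_right[of "4 * real r + 1" e 4] by (simp add: mult.commute)
      finally have k4: "4 * real r * \<kappa> \<le> e / 4" .
      have "ln (1 + 4 * real r * \<kappa>) \<le> 4 * real r * \<kappa>" using \<kappa> by (intro ln_add_one_self_le_self) simp
      then have l1: "ln (1 + 4 * real r * \<kappa>) \<le> e / 4" using k4 by linarith
      have "ln ((d + \<kappa>) * (2 * real (4 * r + 1))) / (real r + 1) \<le> ln ((d + 1) * (2 * real (4 * r + 1))) / (real r + 1)"
        using \<kappa> \<kappa>0 d by (intro divide_right_mono ln_mono mult_right_mono) auto
      then have l2: "ln ((d + \<kappa>) * (2 * real (4 * r + 1))) / (real r + 1) < e / 4" using r by linarith
      have e1: "eventually (\<lambda>n. \<bar>A \<kappa> n - \<Lambda> \<kappa>\<bar> < e / 4) sequentially"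
        using tendstoD[OF A[OF \<kappa>(1)], of "e / 4"] e by (simp add: dist_real_def)
      obtain m :: nat where m: "- ln \<kappa> / (e / 4) < real m" using reals_Archimedean2 by blast
      have e2: "eventually (\<lambda>n. - ln \<kappa> / N n \<le> e / 4) sequentially" using large[of m]
      proof eventually_elim
        case (elim n)
        then have "- ln \<kappa> / (e / 4) \<le> real (N n)" using m by linarith
        then show ?case using e N[of n] by (simp add: field_simps)
      qed
      show ?thesis using e1 e2 large[of r]
      proof eventually_elim
        case (elim n)
        have "a n - (- ln \<kappa> / N n) \<le> A \<kappa> n" using upA[OF \<kappa>(1), of n] by simp
        moreover note loA[OF \<kappa>(1) elim(3)]
        ultimately show ?case using elim l1 l2 e by linarith
      qed
    qed
    then show ?thesis using \<kappa>0 by blast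
  qed
  have "Cauchy a"
  proof (rule metric_CauchyI)
    fix e :: real assume e: "0 < e"
    obtain \<kappa> where \<kappa>: "0 < \<kappa>" "eventually (\<lambda>n. \<bar>a n - \<Lambda> \<kappa>\<bar> < e / 2) sequentially"
      using near[of "e / 2"] e by auto
    then obtain n0 where n0: "\<And>n. n0 \<le> n \<Longrightarrow> \<bar>a n - \<Lambda> \<kappa>\<bar> < e / 2" by (auto simp: eventually_sequentially)
    have "dist (a m) (a n) < e" if "n0 \<le> m" "n0 \<le> n" for m n
      using n0[OF that(1)] n0[OF that(2)] unfolding dist_real_def by linarith
    then show "\<exists>M. \<forall>m\<ge>M. \<forall>n\<ge>M. dist (a m) (a n) < e" by blast
  qed
  then obtain l where l: "a \<longlonglongrightarrow> l" using Cauchy_convergent convergent_def by blast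
  define \<kappa> where "\<kappa> j = 1 / real (Suc j)" for j
  have \<kappa>: "0 < \<kappa> j" "\<kappa> j \<le> 1" for j by (auto simp: \<kappa>_def)
  have \<kappa>lim: "\<kappa> \<longlonglongrightarrow> 0" unfolding \<kappa>_def by real_asymp
  have \<Lambda>lim: "(\<lambda>j. \<Lambda> (\<kappa> j)) \<longlonglongrightarrow> l"
  proof (rule LIMSEQ_I)
    fix e :: real assume e: "0 < e"
    obtain \<kappa>0 where \<kappa>0: "0 < \<kappa>0" "\<And>\<kappa>. 0 < \<kappa> \<Longrightarrow> \<kappa> \<le> \<kappa>0 \<Longrightarrow> eventually (\<lambda>n. \<bar>a n - \<Lambda> \<kappa>\<bar> < e / 2) sequentially"
      using near[of "e / 2"] e by auto
    have "eventually (\<lambda>j. \<kappa> j < \<kappa>0) sequentially" using order_tendstoD(2)[OF \<kappa>lim \<kappa>0(1)] .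
    then have "eventually (\<lambda>j. norm (\<Lambda> (\<kappa> j) - l) < e) sequentially"
    proof eventually_elim
      case (elim j)
      have "eventually (\<lambda>n. \<bar>a n - \<Lambda> (\<kappa> j)\<bar> < e / 2) sequentially" using \<kappa>0(2)[OF \<kappa>(1)] elim by simp
      then have "eventually (\<lambda>n. \<bar>a n - \<Lambda> (\<kappa> j)\<bar> \<le> e / 2) sequentially" by eventually_elim simp
      then have "\<bar>l - \<Lambda> (\<kappa> j)\<bar> \<le> e / 2"
        by (intro tendsto_upperbound[OF tendsto_rabs[OF tendsto_diff[OF l tendsto_const]]]) auto
      then show ?case using e unfolding real_norm_def by linarith
    qed
    then show "\<exists>no. \<forall>j\<ge>no. norm (\<Lambda> (\<kappa> j) - l) < e" by (simp add: eventually_sequentially)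
  qed
  \<comment> \<open>\<open>up\<close> together with \<tau> n at least 1 makes the averages
    asymptotically non-negative.\<close>
  have \<Lambda>0: "0 \<le> \<Lambda> \<kappa>" if \<kappa>: "0 < \<kappa>" "\<kappa> \<le> 1" for \<kappa>
  proof -
    have "(\<lambda>n. A \<kappa> n - ln \<kappa> / N n) \<longlonglongrightarrow> \<Lambda> \<kappa> - 0"
    proof (intro tendsto_diff A \<kappa>)
      have "filterlim (\<lambda>n. real (N n)) at_top sequentially"
        by (rule filterlim_compose[OF filterlim_real_sequentially])
          (auto simp: filterlim_at_top intro!: eventually_mono[OF large] less_imp_le)
      then show "(\<lambda>n. ln \<kappa> / N n) \<longlonglongrightarrow> 0" by (rule tendsto_divide_0[OF tendsto_const filterlim_at_top_imp_at_infinity])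
    qed
    moreover have "0 \<le> A \<kappa> n - ln \<kappa> / N n" for n using upA[OF \<kappa>(1), of n] a0[of n] by linarith
    ultimately show ?thesis using LIMSEQ_le_const by fastforce
  qed
  \<comment> \<open>An atom at 0 would push \<Lambda> \<kappa> to minus infinity as \<kappa> tends
    to 0, against the lower bound 0 just obtained.\<close>
  have null: "measure M {0} = 0"
  proof (rule ccontr)
    assume "measure M {0} \<noteq> 0"
    then have m: "0 < measure M {0}" using zero_less_measure_iff by blast
    have s0: "{0} \<in> sets M" using B0 unfolding M(2) by (auto simp: sets_restrict_space_iff)
    have b: "y * measure M {0} \<le> ln (1 + B)" if y: "0 \<le> y" for y
    proof -
      define \<kappa> where "\<kappa> = exp (- y)"
      have \<kappa>: "0 < \<kappa>" "\<kappa> \<le> 1" "ln \<kappa> = - y" using y by (auto simp: \<kappa>_def)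
      have i1: "integrable M (indicator {0} :: real \<Rightarrow> real)"
        using s0 by (simp add: M.emeasure_eq_measure)
      have "0 \<le> \<Lambda> \<kappa>" by (rule \<Lambda>0[OF \<kappa>(1,2)])
      also have "\<Lambda> \<kappa> \<le> integral\<^sup>L M (\<lambda>t. - y * indicator {0} t + ln (1 + B))"
        unfolding \<Lambda>_def
      proof (rule integral_mono[OF intc[OF cont[OF \<kappa>(1)]]])
        show "integrable M (\<lambda>t. - y * indicator {0} t + ln (1 + B))" using i1 by simp
        fix t assume t: "t \<in> space M"
        show "ln (\<kappa> + t) \<le> - y * indicator {0} t + ln (1 + B)"
        proof (cases "t = 0")
          case True
          then show ?thesis using \<kappa> B0 by simp
        next
          case False
          then show ?thesis using t \<kappa> by (auto simp: sp intro!: ln_mono)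
        qed
      qed
      also have "\<dots> = - y * measure M {0} + ln (1 + B)"
        using i1 s0 by (simp add: M.prob_space)
      finally show ?thesis by simp
    qed
    have "0 \<le> ln (1 + B)" using B0 by simp
    then show False using b[of "(ln (1 + B) + 1) / measure M {0}"] m by (simp add: field_simps)
  qed
  have pos: "AE t in M. 0 < t \<and> t \<le> B"
  proof -
    have s0: "{0} \<in> sets M" using B0 unfolding M(2) by (auto simp: sets_restrict_space_iff)
    then have "AE t in M. t \<notin> {0}" using null M.prob_eq_0[of "{0}"] by simp
    moreover have "AE t in M. t \<in> {0..B}" by (rule AE_I2) (simp add: sp)
    ultimately show ?thesis by eventually_elim auto
  qed
  have mln: "(\<lambda>t. - ln t) \<in> borel_measurable M" by (rule meas) simp
  \<comment> \<open>The sign is reversed because - ln (\<kappa> j + t) increases with j, the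
    direction in which monotone convergence applies.\<close>
  have I: "integrable M (\<lambda>t. - ln t)" "integral\<^sup>L M (\<lambda>t. - ln t) = - l"
  proof -
    have i: "integrable M (\<lambda>t. - ln (\<kappa> j + t))" for j using intc[OF cont[OF \<kappa>(1)]] by simp
    have mono: "AE t in M. mono (\<lambda>j. - ln (\<kappa> j + t))" using pos
    proof eventually_elim
      case (elim t)
      show ?case
      proof (rule monoI)
        fix i j :: nat assume "i \<le> j"
        then have "\<kappa> j \<le> \<kappa> i" by (simp add: \<kappa>_def frac_le)
        then show "- ln (\<kappa> i + t) \<le> - ln (\<kappa> j + t)" using elim \<kappa>(1)[of j] by (simp add: add_pos_pos)
      qed
    qed
    have lm: "AE t in M. (\<lambda>j. - ln (\<kappa> j + t)) \<longlonglongrightarrow> - ln t" using pos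
    proof eventually_elim
      case (elim t)
      have "(\<lambda>j. \<kappa> j + t) \<longlonglongrightarrow> 0 + t" by (intro tendsto_intros \<kappa>lim)
      then show ?case using elim by (intro tendsto_minus tendsto_ln) auto
    qed
    have il: "(\<lambda>j. integral\<^sup>L M (\<lambda>t. - ln (\<kappa> j + t))) \<longlonglongrightarrow> - l"
      using tendsto_minus[OF \<Lambda>lim] by (simp add: \<Lambda>_def)
    show "integrable M (\<lambda>t. - ln t)" by (rule integrable_monotone_convergence[OF i mono lm il mln])
    show "integral\<^sup>L M (\<lambda>t. - ln t) = - l" by (rule integral_monotone_convergence[OF i mono lm il mln])
  qed
  have part: "enn2ereal (\<integral>\<^sup>+ t. indicator {0<..B} t * ennreal (max 0 (F t)) \<partial>M) = ereal (integral\<^sup>L M (\<lambda>t. max 0 (F t)))"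
    if F: "integrable M F" for F :: "real \<Rightarrow> real"
  proof -
    have Fm: "integrable M (\<lambda>t. max 0 (F t))" using F by (intro integrable_max) auto
    have "(\<integral>\<^sup>+ t. indicator {0<..B} t * ennreal (max 0 (F t)) \<partial>M) = (\<integral>\<^sup>+ t. ennreal (max 0 (F t)) \<partial>M)"
    proof (rule nn_integral_cong_AE)
      show "AE t in M. indicator {0<..B} t * ennreal (max 0 (F t)) = ennreal (max 0 (F t))" using pos by eventually_elim simp
    qed
    also have "\<dots> = ennreal (integral\<^sup>L M (\<lambda>t. max 0 (F t)))"
      by (rule nn_integral_eq_integral[OF Fm]) simp
    finally show ?thesis by (simp add: enn2ereal_ennreal integral_nonneg_AE)
  qed
  have Iln: "integrable M ln" using integrable_minus[OF I(1)] by simp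
  have "enn2ereal (\<integral>\<^sup>+ t. indicator {0<..B} t * ennreal (max 0 (ln t)) \<partial>M)
     - enn2ereal (\<integral>\<^sup>+ t. indicator {0<..B} t * ennreal (max 0 (- ln t)) \<partial>M)
     = ereal (integral\<^sup>L M (\<lambda>t. max 0 (ln t)) - integral\<^sup>L M (\<lambda>t. max 0 (- ln t)))"
    using part[OF Iln] part[OF I(1)] by simp
  also have "integral\<^sup>L M (\<lambda>t. max 0 (ln t)) - integral\<^sup>L M (\<lambda>t. max 0 (- ln t)) =
      integral\<^sup>L M (\<lambda>t. max 0 (ln t) - max 0 (- ln t))"
    using Iln I(1) by (intro Bochner_Integration.integral_diff[symmetric] integrable_max) auto
  also have "(\<lambda>t. max 0 (ln t) - max 0 (- ln t)) = (\<lambda>t. ln t :: real)" by (auto simp: max_def)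
  also have "integral\<^sup>L M (\<lambda>t. ln t) = l" using I(2) by simp
  finally show ?thesis using that l unfolding a_def by blast
qed

context quot
begin

lemma eigenvalue_bounds:
  defines "\<tau> \<equiv> real (card (components (fix_set H (harmonic_model f))))"
  obtains lam :: "nat \<Rightarrow> real" where "\<And>k. k < N \<Longrightarrow> 0 \<le> lam k \<and> lam k \<le> 2 * of_int (f 0)"
    "\<And>m. supp (convpow f m) \<inter> H \<subseteq> {0} \<Longrightarrow> (\<Sum>k<N. lam k ^ m) = real N * of_int (convpow f m 0)"
    "\<And>\<kappa>. 0 < \<kappa> \<Longrightarrow> \<kappa> * \<tau> \<le> (\<Prod>k<N. \<kappa> + lam k)"
    "\<And>\<kappa> r. 0 < \<kappa> \<Longrightarrow> r < N \<Longrightarrow> (\<Prod>k<N. \<kappa> + lam k) \<le>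
      ((of_int (f 0) + \<kappa>) * (2 * real (4 * r + 1))) powr (real N / (real r + 1)) * (1 + 4 * real r * \<kappa>) ^ N * \<tau>"
proof -
  have \<tau>: "\<tau> = real tau" by (simp add: \<tau>_def card_components_fix)
  obtain lam :: "nat \<Rightarrow> real" where lam: "\<And>k. k < N \<Longrightarrow> 0 \<le> lam k \<and> lam k \<le> 2 * of_int dd"
    "\<And>t. fdet N (kmat (\<lambda>_. t) {}) = (\<Prod>k<N. t + lam k)"
    "\<And>m. (\<Sum>i<N. fpow N (\<lambda>i j. of_int (imat {} i j)) m i i) = (\<Sum>k<N. lam k ^ m)"
    by (rule laplacian_eigenvalues) blast
  have mom: "(\<Sum>k<N. lam k ^ m) = real N * of_int (convpow f m 0)" if "supp (convpow f m) \<inter> H \<subseteq> {0}" for m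
    using lam(3)[of m] trace_fpow[OF that] by simp
  have up: "\<kappa> * \<tau> \<le> (\<Prod>k<N. \<kappa> + lam k)" if "0 < \<kappa>" for \<kappa>
    using det_resolvent_ge[OF that] by (simp only: lam(2) \<tau>)
  have lo: "(\<Prod>k<N. \<kappa> + lam k) \<le>
      ((of_int dd + \<kappa>) * (2 * real (4 * r + 1))) powr (real N / (real r + 1)) * (1 + 4 * real r * \<kappa>) ^ N * \<tau>"
    if \<kappa>: "0 < \<kappa>" and r: "r < N" for \<kappa> r
  proof -
    obtain B where B: "B \<subseteq> {..<N}" "0 \<in> B" "card B * (r + 1) \<le> N" "\<And>i. i < N \<Longrightarrow> reaches (2 * r) B i"
      using sparse_dense_set[OF r] by metis
    define Y where "Y = (of_int dd + \<kappa>) * (2 * real (4 * r + 1))"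
    have dd1: "1 \<le> real_of_int dd" using dd_pos by simp
    then have Y: "1 \<le> Y" using \<kappa> mult_mono[of 1 "of_int dd + \<kappa>" 1 "2 * real (4 * r + 1)"] by (simp add: Y_def)
    have "real (card B * (r + 1)) \<le> real N" using B(3) by (simp only: of_nat_le_iff)
    then have cB: "real (card B) \<le> real N / (real r + 1)" by (simp add: field_simps)
    have "(\<Prod>k<N. \<kappa> + lam k) = fdet N (kmat (\<lambda>_. \<kappa>) {})" by (simp only: lam(2))
    also have "\<dots> \<le> (of_int dd + \<kappa>) ^ card B * (1 + 2 * real (2 * r) * \<kappa>) ^ N * (2 * real (2 * (2 * r) + 1)) ^ card B * tau"
      by (rule det_resolvent_le[OF B(4) B(1,2) \<kappa>])
    also have "\<dots> = Y ^ card B * (1 + 4 * real r * \<kappa>) ^ N * \<tau>"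
      by (simp add: Y_def power_mult_distrib \<tau> mult_ac)
    also have "Y ^ card B = Y powr real (card B)" using Y by (simp add: powr_realpow)
    also have "Y powr real (card B) * (1 + 4 * real r * \<kappa>) ^ N * \<tau> \<le> Y powr (real N / (real r + 1)) * (1 + 4 * real r * \<kappa>) ^ N * \<tau>"
      using cB Y \<kappa> by (intro mult_right_mono powr_mono) (auto simp: \<tau>)
    finally show ?thesis unfolding Y_def .
  qed
  show ?thesis using that[OF _ mom up] lam(1) lo unfolding dd_def by blast
qed

end

section \<open>The sequence of finite quotients\<close>

locale sofic_model =
  fixes Gs :: "nat \<Rightarrow> 'g::group_add set" and f :: "'g \<Rightarrow> int"
  assumes cnt: "countable (UNIV :: 'g set)" and inf: "infinite (UNIV :: 'g set)"
    and Gs: "\<And>n. normal_subgrp (Gs n)" "\<And>n. finite_index (Gs n)"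
    and Gs_Int: "(\<Inter>n. \<Union>i\<in>{n..}. Gs i) = {0}"
    and wb: "well_balanced (\<lambda>s. real_of_int (f s))"
begin

abbreviation "idx n \<equiv> card (cosets (Gs n))"
abbreviation "cmps n \<equiv> card (components (fix_set (Gs n) (harmonic_model f)))"

lemma quot_n: obtains ix rep where "quot (Gs n) f ix rep (idx n)"
  using quot_exists[OF wb inf Gs(1) Gs(2)] by blast

lemma idx_pos: "0 < idx n"
proof -
  obtain ix rep where "quot (Gs n) f ix rep (idx n)" by (rule quot_n)
  then interpret quot "Gs n" f ix rep "idx n" .
  show ?thesis by (rule N_pos)
qed

lemma cmps_pos: "1 \<le> cmps n"
proof -
  obtain ix rep where "quot (Gs n) f ix rep (idx n)" by (rule quot_n)
  then interpret quot "Gs n" f ix rep "idx n" .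
  show ?thesis using tau_pos by (simp add: card_components_fix)
qed

lemma f_facts: "finite (supp f)" "f (- s) = f s" "1 \<le> f 0"
proof -
  obtain ix rep where "quot (Gs 0) f ix rep (idx 0)" by (rule quot_n)
  then interpret quot "Gs 0" f ix rep "idx 0" .
  show "finite (supp f)" "f (- s) = f s" "1 \<le> f 0"
    using fin_supp f_sym dd_pos by (simp_all add: dd_def)
qed

text \<open>A non-zero element lies in only finitely many of the subgroups, their upper limit being
  {0}.\<close>

lemma eventually_avoid:
  assumes "finite A"
  shows "eventually (\<lambda>n. A \<inter> Gs n \<subseteq> {0}) sequentially"
proof -
  have "eventually (\<lambda>n. a \<in> Gs n \<longrightarrow> a = 0) sequentially" for a
  proof (cases "a = 0")
    case False
    then obtain n where "\<forall>i\<ge>n. a \<notin> Gs i" using Gs_Int by blast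
    then show ?thesis unfolding eventually_sequentially by blast
  qed simp
  then have "eventually (\<lambda>n. \<forall>a\<in>A. a \<in> Gs n \<longrightarrow> a = 0) sequentially"
    using assms by (intro eventually_ball_finite) auto
  then show ?thesis by eventually_elim auto
qed

lemma eventually_inj:
  assumes "finite A"
  shows "eventually (\<lambda>n. inj_on (\<lambda>g. lcoset g (Gs n)) A) sequentially"
proof -
  have "finite ((\<lambda>(a, b). - a + b) ` (A \<times> A))" using assms by simp
  from eventually_avoid[OF this] show ?thesis
  proof eventually_elim
    case (elim n)
    show ?case
    proof (rule inj_onI)
      fix a b assume ab: "a \<in> A" "b \<in> A" "lcoset a (Gs n) = lcoset b (Gs n)"
      have sub: "subgrp (Gs n)" using Gs(1)[of n] by (simp add: normal_subgrp_def)
      have "- a + b \<in> Gs n" using ab(3) lcoset_eq_iff[OF sub] by blast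
      moreover have "- a + b \<in> (\<lambda>(a, b). - a + b) ` (A \<times> A)" using ab(1,2) by auto
      ultimately have "- a + b = 0" using elim by blast
      then have "a + (- a + b) = a + 0" by simp
      then show "a = b" by (simp add: add.assoc[symmetric])
    qed
  qed
qed

lemma idx_large: "eventually (\<lambda>n. m < idx n) sequentially"
proof -
  obtain A :: "'g set" where A: "finite A" "card A = Suc m" using infinite_arbitrarily_large[OF inf] by metis
  from eventually_inj[OF A(1)] show ?thesis
  proof eventually_elim
    case (elim n)
    have "card ((\<lambda>g. lcoset g (Gs n)) ` A) \<le> idx n"
      using Gs(2)[of n] by (intro card_mono) (auto simp: finite_index_def cosets_def)
    then show ?case using A(2) by (simp add: card_image[OF elim])
  qed
qed

lemma log_det_limit:
  obtains l where "fk_log_det (conv_op (\<lambda>s. real_of_int (f s))) = ereal l"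
    "(\<lambda>n. ln (real (cmps n)) / idx n) \<longlonglongrightarrow> l"
proof -
  let ?T = "conv_op (\<lambda>s. real_of_int (f s))"
  let ?Q = "\<lambda>n lam. (\<forall>k<idx n. 0 \<le> lam k \<and> lam k \<le> 2 * real_of_int (f 0)) \<and>
    (\<forall>m. supp (convpow f m) \<inter> Gs n \<subseteq> {0} \<longrightarrow> (\<Sum>k<idx n. lam k ^ m) = real (idx n) * of_int (convpow f m 0)) \<and>
    (\<forall>\<kappa>>0. \<kappa> * real (cmps n) \<le> (\<Prod>k<idx n. \<kappa> + lam k)) \<and>
    (\<forall>\<kappa> r. 0 < \<kappa> \<longrightarrow> r < idx n \<longrightarrow> (\<Prod>k<idx n. \<kappa> + lam k) \<le>
      ((of_int (f 0) + \<kappa>) * (2 * real (4 * r + 1))) powr (real (idx n) / (real r + 1)) * (1 + 4 * real r * \<kappa>) ^ idx n * real (cmps n))"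
  have "\<exists>lam. ?Q n lam" for n
  proof -
    obtain ix rep where "quot (Gs n) f ix rep (idx n)" by (rule quot_n)
    then interpret quot "Gs n" f ix rep "idx n" .
    show ?thesis by (rule eigenvalue_bounds) blast
  qed
  then have "\<exists>lam. \<forall>n. ?Q n (lam n)" by (intro choice allI)
  then obtain lam where Q: "\<And>n. ?Q n (lam n)" by blast
  have b: "0 \<le> lam n k \<and> lam n k \<le> 2 * real_of_int (f 0)" if "k < idx n" for n k using Q[of n] that by blast
  have mom: "eventually (\<lambda>n. (\<Sum>k<idx n. lam n k ^ m) = real (idx n) * of_int (convpow f m 0)) sequentially" for m
    using eventually_avoid[OF finite_supp_convpow[OF f_facts(1), of m]] by eventually_elim (use Q in blast)
  note sp = spectral_measure_props[of f, OF f_facts(2,1) b idx_pos mom]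
  have up: "\<kappa> * real (cmps n) \<le> (\<Prod>k<idx n. \<kappa> + lam n k)" if "0 < \<kappa>" for n \<kappa> using Q[of n] that by blast
  have lo: "(\<Prod>k<idx n. \<kappa> + lam n k) \<le>
      ((of_int (f 0) + \<kappa>) * (2 * real (4 * r + 1))) powr (real (idx n) / (real r + 1)) * (1 + 4 * real r * \<kappa>) ^ idx n * real (cmps n)"
    if "0 < \<kappa>" "r < idx n" for n \<kappa> r using Q[of n] that by blast
  have \<tau>1: "1 \<le> real (cmps n)" for n using cmps_pos[of n] by simp
  have d1: "1 \<le> real_of_int (f 0)" using f_facts(3) by simp
  obtain l where l: "enn2ereal (\<integral>\<^sup>+ t. indicator {0<..op_norm ?T} t * ennreal (max 0 (ln t)) \<partial>spectral_measure ?T)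
     - enn2ereal (\<integral>\<^sup>+ t. indicator {0<..op_norm ?T} t * ennreal (max 0 (- ln t)) \<partial>spectral_measure ?T) = ereal l"
    "(\<lambda>n. ln (real (cmps n)) / idx n) \<longlonglongrightarrow> l"
    by (rule spectral_log_limit[OF sp(1) sp(2) sp(3) b idx_pos mom idx_large \<tau>1 d1 up lo]) blast+
  show ?thesis using that[of l] l unfolding fk_log_det_def by blast
qed

end


section \<open>Characters of the harmonic model\<close>

lemma inverse_eq_cnj: "cmod z = 1 \<Longrightarrow> inverse z = cnj z"
  using complex_norm_square[of z] by (intro inverse_unique) simp

lemma powi_unit: "cmod z = 1 \<Longrightarrow> z powi k = (if 0 \<le> k then z ^ nat k else cnj z ^ nat (- k))"
  by (simp add: power_int_def inverse_eq_cnj)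

lemma continuous_prod_powi:
  fixes g :: "'s \<Rightarrow> 'i"
  shows "continuous_on torus (\<lambda>x. \<Prod>s\<in>A. x (g s) powi k s)"
proof -
  have c: "continuous_on torus (\<lambda>x::'i \<Rightarrow> complex. x w)" for w
    by (rule continuous_on_subset[OF continuous_on_product_coordinates subset_UNIV])
  have "continuous_on torus (\<lambda>x::'i \<Rightarrow> complex. x (g s) powi k s)" for s
  proof -
    have "continuous_on torus (\<lambda>x::'i \<Rightarrow> complex. if 0 \<le> k s then x (g s) ^ nat (k s) else cnj (x (g s)) ^ nat (- k s))"
      by (cases "0 \<le> k s") (simp_all add: continuous_on_power continuous_on_cnj c)
    then show ?thesis
      by (subst continuous_on_cong[OF refl powi_unit]) (auto simp: torus_def)
  qed
  then show ?thesis by (intro continuous_on_prod)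
qed

lemma closed_torus: "closed (torus :: ('i \<Rightarrow> complex) set)"
  by (rule compact_imp_closed[OF compact_torus])

lemma closed_torus_eq:
  fixes g :: "'s \<Rightarrow> 'i"
  shows "closed {x \<in> torus. (\<Prod>s\<in>A. x (g s) powi k s) = 1}"
proof -
  have "closed ((\<lambda>x. \<Prod>s\<in>A. x (g s) powi k s) -` {1} \<inter> torus)"
    using continuous_on_closed_vimage[OF closed_torus, THEN iffD1, OF continuous_prod_powi] by blast
  moreover have "(\<lambda>x. \<Prod>s\<in>A. x (g s) powi k s) -` {1} \<inter> torus = {x \<in> torus. (\<Prod>s\<in>A. x (g s) powi k s) = 1}" by auto
  ultimately show ?thesis by simp
qed

lemma harmonic_model_eq: "harmonic_model f = (\<Inter>t. {x \<in> torus. (\<Prod>s\<in>supp f. x (t + s) powi f s) = 1})"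
  by (auto simp: harmonic_model_def torus_def)

lemma harmonic_model_torus: "harmonic_model f \<subseteq> torus"
  by (auto simp: harmonic_model_eq)

lemma torus_subgroup_harmonic_model: "torus_subgroup (harmonic_model f)"
proof -
  have "closed (harmonic_model f)" unfolding harmonic_model_eq by (intro closed_INT ballI closed_torus_eq)
  moreover have "(\<lambda>_. 1) \<in> harmonic_model f" by (simp add: harmonic_model_def)
  moreover have "pmul x y \<in> harmonic_model f" if "x \<in> harmonic_model f" "y \<in> harmonic_model f" for x y
    using that by (simp add: harmonic_model_def pmul_def norm_mult power_int_mult_distrib prod.distrib)
  moreover have "(\<lambda>t. cnj (x t)) \<in> harmonic_model f" if "x \<in> harmonic_model f" for x
  proof -
    have "(\<Prod>s\<in>supp f. cnj (x (t + s)) powi f s) = inverse (\<Prod>s\<in>supp f. x (t + s) powi f s)" for t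
    proof -
      have "(\<Prod>s\<in>supp f. cnj (x (t + s)) powi f s) = (\<Prod>s\<in>supp f. inverse (x (t + s) powi f s))"
      proof (rule prod.cong[OF refl])
        fix s
        have "cnj (x (t + s)) = inverse (x (t + s))" using that by (simp add: harmonic_model_def inverse_eq_cnj)
        then show "cnj (x (t + s)) powi f s = inverse (x (t + s) powi f s)" by (simp only: power_int_inverse)
      qed
      also have "\<dots> = inverse (\<Prod>s\<in>supp f. x (t + s) powi f s)"
        using prod_inversef[of "\<lambda>s. x (t + s) powi f s" "supp f"] by (simp add: o_def)
      finally show ?thesis .
    qed
    then show ?thesis using that by (simp add: harmonic_model_def)
  qed
  ultimately show ?thesis using harmonic_model_torus[of f] unfolding torus_subgroup_def by blast
qed

section \<open>Haar integrals of characters and trigonometric approximation\<close>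

lemma chi_pmul: "chi h (pmul x y) = chi h x * chi h y"
  by (simp add: chi_def pmul_def power_int_mult_distrib prod.distrib)

lemma norm_chi: "x \<in> torus \<Longrightarrow> cmod (chi h x) = 1"
  by (simp add: chi_def prod_norm[symmetric] norm_powi_1 torus_def)

lemma chi_add:
  assumes "x \<in> torus" "finite (supp h)" "finite (supp k)"
  shows "chi (\<lambda>w. h w + k w) x = chi h x * chi k x"
proof -
  let ?W = "supp h \<union> supp k"
  have nz: "x w \<noteq> 0" for w
  proof -
    have "cmod (x w) = 1" using assms(1) by (simp add: torus_def)
    then show ?thesis by auto
  qed
  have s: "supp (\<lambda>w. h w + k w) \<subseteq> ?W" by (auto simp: supp_def)
  have "chi (\<lambda>w. h w + k w) x = (\<Prod>w\<in>?W. x w powi (h w + k w))" using assms s by (intro chi_mono) auto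
  also have "\<dots> = (\<Prod>w\<in>?W. x w powi h w) * (\<Prod>w\<in>?W. x w powi k w)" by (simp add: power_int_add nz prod.distrib)
  also have "\<dots> = chi h x * chi k x" using assms chi_mono[of ?W h x] chi_mono[of ?W k x] by simp
  finally show ?thesis .
qed

lemma chi_uminus: "x \<in> torus \<Longrightarrow> chi (\<lambda>w. - h w) x = cnj (chi h x)"
  by (simp add: inverse_eq_cnj[symmetric] norm_chi)
    (simp add: chi_def supp_def power_int_minus prod_inversef[symmetric] o_def)

lemma continuous_chi: "X \<subseteq> torus \<Longrightarrow> continuous_on X (chi h)"
  unfolding chi_def by (rule continuous_on_subset[OF continuous_prod_powi[where g = "\<lambda>w. w"]])

lemma haar_measure_props:
  fixes X :: "('g \<Rightarrow> complex) set"
  assumes cnt: "countable (UNIV :: 'g set)" "infinite (UNIV :: 'g set)" and X: "torus_subgroup X"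
  shows "prob_space (haar_measure X)" "sets (haar_measure X) = sets (restrict_space borel X)"
    "space (haar_measure X) = X"
    "\<And>y. y \<in> X \<Longrightarrow> distr (haar_measure X) (haar_measure X) (\<lambda>x. pmul x y) = haar_measure X"
    "\<And>y. y \<in> X \<Longrightarrow> (\<lambda>x. pmul x y) \<in> measurable (haar_measure X) (haar_measure X)"
proof -
  let ?P = "\<lambda>\<mu>. prob_space \<mu> \<and> sets \<mu> = sets (restrict_space borel X) \<and>
     (\<forall>y\<in>X. \<forall>A\<in>sets \<mu>. (\<lambda>x t. x t * y t) ` A \<in> sets \<mu> \<and> measure \<mu> ((\<lambda>x t. x t * y t) ` A) = measure \<mu> A)"
  have P: "?P (haar_measure X)" unfolding haar_measure_def by (rule theI'[OF haar_unique_exists[OF cnt X]])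
  show ps: "prob_space (haar_measure X)" and st: "sets (haar_measure X) = sets (restrict_space borel X)" using P by blast+
  show sp: "space (haar_measure X) = X" using sets_eq_imp_space_eq[OF st] by (simp add: space_restrict_space)
  interpret prob_space "haar_measure X" by (rule ps)
  have X': "X \<subseteq> torus" "\<And>x y. x \<in> X \<Longrightarrow> y \<in> X \<Longrightarrow> pmul x y \<in> X" "\<And>x. x \<in> X \<Longrightarrow> (\<lambda>t. cnj (x t)) \<in> X"
    using X by (auto simp: torus_subgroup_def)
  have inv: "(\<lambda>x t. x t * y t) ` A \<in> sets (haar_measure X)"
      "measure (haar_measure X) ((\<lambda>x t. x t * y t) ` A) = measure (haar_measure X) A"
    if "y \<in> X" "A \<in> sets (haar_measure X)" for y A
    using P[THEN conjunct2, THEN conjunct2, THEN bspec, OF that(1), THEN bspec, OF that(2)] by simp_all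
  have vim: "(\<lambda>x. pmul x y) -` A \<inter> X = (\<lambda>x t. x t * cnj (y t)) ` A" if y: "y \<in> X" and A: "A \<subseteq> X" for y A
  proof -
    have c: "y t * cnj (y t) = 1" for t
    proof -
      have "cmod (y t) = 1" using y X'(1) by (auto simp: torus_def)
      then show ?thesis using complex_norm_square[of "y t"] by simp
    qed
    show ?thesis
    proof (intro equalityI subsetI)
      fix x assume "x \<in> (\<lambda>x. pmul x y) -` A \<inter> X"
      moreover have "x = (\<lambda>t. pmul x y t * cnj (y t))" by (simp add: pmul_def mult.assoc c)
      ultimately show "x \<in> (\<lambda>x t. x t * cnj (y t)) ` A" by (intro image_eqI[where x = "pmul x y"]) auto
    next
      fix x assume "x \<in> (\<lambda>x t. x t * cnj (y t)) ` A"
      then obtain a where a: "a \<in> A" "x = pmul a (\<lambda>t. cnj (y t))" by (auto simp: pmul_def)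
      have "pmul x y = a" by (simp add: a(2) pmul_def mult.assoc mult.commute[of "cnj _"] c)
      moreover have "x \<in> X" unfolding a(2) using X'(2)[OF _ X'(3)[OF y]] a(1) A by blast
      ultimately show "x \<in> (\<lambda>x. pmul x y) -` A \<inter> X" using a(1) by simp
    qed
  qed
  fix y assume y: "y \<in> X"
  have sub: "A \<subseteq> X" if "A \<in> sets (haar_measure X)" for A using sets.sets_into_space[OF that] by (simp add: sp)
  show m: "(\<lambda>x. pmul x y) \<in> measurable (haar_measure X) (haar_measure X)"
  proof (rule measurableI)
    show "pmul x y \<in> space (haar_measure X)" if "x \<in> space (haar_measure X)" for x using that X'(2) y by (simp add: sp)
    show "(\<lambda>x. pmul x y) -` A \<inter> space (haar_measure X) \<in> sets (haar_measure X)" if A: "A \<in> sets (haar_measure X)" for A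
      unfolding sp vim[OF y sub[OF A]] by (rule inv(1)[OF X'(3)[OF y] A])
  qed
  show "distr (haar_measure X) (haar_measure X) (\<lambda>x. pmul x y) = haar_measure X"
  proof (rule measure_eqI)
    fix A assume "A \<in> sets (distr (haar_measure X) (haar_measure X) (\<lambda>x. pmul x y))"
    then have A: "A \<in> sets (haar_measure X)" by simp
    have "emeasure (distr (haar_measure X) (haar_measure X) (\<lambda>x. pmul x y)) A =
        emeasure (haar_measure X) ((\<lambda>x t. x t * cnj (y t)) ` A)"
      using emeasure_distr[OF m A] by (simp only: sp vim[OF y sub[OF A]])
    also have "\<dots> = emeasure (haar_measure X) A"
      unfolding emeasure_eq_measure inv(2)[OF X'(3)[OF y] A] ..
    finally show "emeasure (distr (haar_measure X) (haar_measure X) (\<lambda>x. pmul x y)) A = emeasure (haar_measure X) A" .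
  qed simp
qed

lemma haar_integrable:
  fixes X :: "('g \<Rightarrow> complex) set" and F :: "('g \<Rightarrow> complex) \<Rightarrow> 'b::{banach, second_countable_topology}"
  assumes cnt: "countable (UNIV :: 'g set)" "infinite (UNIV :: 'g set)" and X: "torus_subgroup X"
    and F: "continuous_on X F"
  shows "F \<in> borel_measurable (haar_measure X)" "integrable (haar_measure X) F"
proof -
  note h = haar_measure_props[OF cnt X]
  interpret prob_space "haar_measure X" by (rule h(1))
  show m: "F \<in> borel_measurable (haar_measure X)"
    unfolding measurable_cong_sets[OF h(2) refl] by (rule borel_measurable_continuous_on_restrict[OF F])
  have "compact X"
    using X compact_Int_closed[OF compact_torus, of X] by (auto simp: torus_subgroup_def Int_absorb1)
  then have "bounded (F ` X)" using compact_continuous_image[OF F] compact_imp_bounded by blast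
  then obtain K where "\<And>x. x \<in> X \<Longrightarrow> norm (F x) \<le> K" unfolding bounded_iff by blast
  then show "integrable (haar_measure X) F"
    using m by (intro integrable_const_bound[where B = K] AE_I2) (auto simp: h(3))
qed

lemma haar_integral_chi:
  fixes X :: "('g \<Rightarrow> complex) set"
  assumes cnt: "countable (UNIV :: 'g set)" "infinite (UNIV :: 'g set)" and X: "torus_subgroup X"
  shows "integral\<^sup>L (haar_measure X) (chi h) = (if \<forall>x\<in>X. chi h x = 1 then 1 else 0)"
proof -
  note hm = haar_measure_props[OF cnt X]
  interpret prob_space "haar_measure X" by (rule hm(1))
  have Xt: "X \<subseteq> torus" using X by (simp add: torus_subgroup_def)
  note ci = haar_integrable[OF cnt X continuous_chi[OF Xt, of h]]
  show ?thesis
  proof (cases "\<forall>x\<in>X. chi h x = 1")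
    case True
    have "integral\<^sup>L (haar_measure X) (chi h) = integral\<^sup>L (haar_measure X) (\<lambda>_. 1)"
      by (rule Bochner_Integration.integral_cong[OF refl]) (use True hm(3) in auto)
    then show ?thesis using True by (simp add: prob_space)
  next
    case False
    then obtain y where y: "y \<in> X" "chi h y \<noteq> 1" by blast
    have "integral\<^sup>L (haar_measure X) (chi h) = integral\<^sup>L (distr (haar_measure X) (haar_measure X) (\<lambda>x. pmul x y)) (chi h)"
      by (simp only: hm(4)[OF y(1)])
    also have "\<dots> = integral\<^sup>L (haar_measure X) (\<lambda>x. chi h (pmul x y))" by (rule integral_distr[OF hm(5)[OF y(1)] ci(1)])
    also have "\<dots> = integral\<^sup>L (haar_measure X) (\<lambda>x. chi h x * chi h y)" by (simp only: chi_pmul)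
    also have "\<dots> = integral\<^sup>L (haar_measure X) (chi h) * chi h y" by simp
    finally have "integral\<^sup>L (haar_measure X) (chi h) = 0" using y(2) by simp
    then show ?thesis using False by (simp only: if_False)
  qed
qed

text \<open>Trigonometric polynomials, generated so that closure properties go by induction.
  Products and conjugates are expressed by such polynomials on the torus, where values are
  invertible and inverses are conjugates; hence the closure lemmas speak of agreement on
  \<open>torus\<close>.\<close>

inductive trig :: "(('g \<Rightarrow> complex) \<Rightarrow> complex) \<Rightarrow> bool" where
  trig_chi: "finite (supp h) \<Longrightarrow> trig (\<lambda>x. c * chi h x)"
| trig_add: "trig F \<Longrightarrow> trig G \<Longrightarrow> trig (\<lambda>x. F x + G x)"

lemma trig_mult_chi:
  assumes "trig F" "finite (supp h)"
  shows "\<exists>K. trig K \<and> (\<forall>x\<in>torus. K x = c * chi h x * F x)"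
  using assms(1)
proof induction
  case (trig_chi k b)
  have fin: "finite (supp (\<lambda>w. h w + k w))"
    by (rule finite_subset[of _ "supp h \<union> supp k"]) (use assms(2) trig_chi in \<open>auto simp: supp_def\<close>)
  show ?case
    by (intro exI[of _ "\<lambda>x. (c * b) * chi (\<lambda>w. h w + k w) x"] conjI trig.trig_chi fin ballI)
      (simp add: chi_add assms(2) trig_chi)
next
  case (trig_add F G)
  then obtain K K' where "trig K" "trig K'" "\<forall>x\<in>torus. K x = c * chi h x * F x" "\<forall>x\<in>torus. K' x = c * chi h x * G x"
    by blast
  then show ?case by (intro exI[of _ "\<lambda>x. K x + K' x"]) (simp add: trig.trig_add algebra_simps)
qed

lemma trig_mult:
  assumes "trig F" "trig G"
  shows "\<exists>K. trig K \<and> (\<forall>x\<in>torus. K x = F x * G x)"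
  using assms(1)
proof induction
  case (trig_chi h c)
  then show ?case using trig_mult_chi[OF assms(2), of h c] by blast
next
  case (trig_add F F')
  then obtain K K' where "trig K" "trig K'" "\<forall>x\<in>torus. K x = F x * G x" "\<forall>x\<in>torus. K' x = F' x * G x"
    by blast
  then show ?case by (intro exI[of _ "\<lambda>x. K x + K' x"]) (simp add: trig.trig_add algebra_simps)
qed

lemma trig_cnj:
  assumes "trig F"
  shows "\<exists>K. trig K \<and> (\<forall>x\<in>torus. K x = cnj (F x))"
  using assms
proof induction
  case (trig_chi h c)
  have "finite (supp (\<lambda>w. - h w))" using trig_chi by (simp add: supp_def)
  then show ?case by (intro exI[of _ "\<lambda>x. cnj c * chi (\<lambda>w. - h w) x"]) (simp add: trig.trig_chi chi_uminus)
next
  case (trig_add F F')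
  then obtain K K' where "trig K" "trig K'" "\<forall>x\<in>torus. K x = cnj (F x)" "\<forall>x\<in>torus. K' x = cnj (F' x)"
    by blast
  then show ?case by (intro exI[of _ "\<lambda>x. K x + K' x"]) (simp add: trig.trig_add)
qed

lemma trig_const: "\<exists>K. trig K \<and> (\<forall>x. K x = c)"
proof -
  have "finite (supp (\<lambda>_. 0 :: int))" by (simp add: supp_def)
  from trig_chi[OF this, of c] show ?thesis by (intro exI) (auto simp: chi_def supp_def)
qed

lemma continuous_trig: "trig F \<Longrightarrow> X \<subseteq> torus \<Longrightarrow> continuous_on X F"
  by (induction rule: trig.induct) (auto intro!: continuous_intros continuous_chi)

lemma trig_sum:
  assumes "trig F"
  shows "\<exists>A c. finite A \<and> (\<forall>h\<in>A. finite (supp h)) \<and> (\<forall>x. F x = (\<Sum>h\<in>A. c h * chi h x))"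
  using assms
proof induction
  case (trig_chi h c)
  then show ?case by (intro exI[of _ "{h}"] exI[of _ "\<lambda>_. c"]) simp
next
  case (trig_add F G)
  let ?T = "\<lambda>F A c. finite A \<and> (\<forall>h\<in>A. finite (supp h)) \<and> (\<forall>x. F x = (\<Sum>h\<in>A. c h * chi h x))"
  obtain A c where "?T F A c" using trig_add.IH(1) by (elim exE) (rule that)
  then have A: "finite A" "\<forall>h\<in>A. finite (supp h)" "\<And>x. F x = (\<Sum>h\<in>A. c h * chi h x)" by blast+
  obtain A' c' where "?T G A' c'" using trig_add.IH(2) by (elim exE) (rule that)
  then have A': "finite A'" "\<forall>h\<in>A'. finite (supp h)" "\<And>x. G x = (\<Sum>h\<in>A'. c' h * chi h x)" by blast+
  let ?c = "\<lambda>h. (if h \<in> A then c h else 0) + (if h \<in> A' then c' h else 0)"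
  have "F x + G x = (\<Sum>h\<in>A \<union> A'. ?c h * chi h x)" for x
  proof -
    have "F x = (\<Sum>h\<in>A \<union> A'. (if h \<in> A then c h else 0) * chi h x)"
      unfolding A(3) using A(1) A'(1) by (intro sum.mono_neutral_cong_left) auto
    moreover have "G x = (\<Sum>h\<in>A \<union> A'. (if h \<in> A' then c' h else 0) * chi h x)"
      unfolding A'(3) using A(1) A'(1) by (intro sum.mono_neutral_cong_left) auto
    ultimately show ?thesis by (simp only: distrib_right sum.distrib)
  qed
  then have "?T (\<lambda>x. F x + G x) (A \<union> A') ?c" using A(1,2) A'(1,2) by blast
  then show ?case by (intro exI)
qed

text \<open>Stone-Weierstrass for the real parts of trigonometric polynomials. They form a ring
  because Re F Re G = Re (F (G + cnj G) / 2), and the real and imaginary parts of coordinates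
  separate points.\<close>

lemma trig_approximation:
  fixes X :: "('g \<Rightarrow> complex) set" and p :: "('g \<Rightarrow> complex) \<Rightarrow> real"
  assumes X: "X \<subseteq> torus" "closed X" and p: "continuous_on X p" and e: "0 < e"
  shows "\<exists>A c. finite A \<and> (\<forall>h\<in>A. finite (supp h)) \<and> (\<forall>x\<in>X. \<bar>p x - Re (\<Sum>h\<in>A. c h * chi h x)\<bar> < e)"
proof -
  define R where "R = {p :: ('g \<Rightarrow> complex) \<Rightarrow> real. \<exists>F. trig F \<and> (\<forall>x\<in>X. p x = Re (F x))}"
  interpret function_ring_on R X
  proof
    show "compact X" using compact_Int_closed[OF compact_torus X(2)] X(1) by (simp add: Int_absorb1)
    show "continuous_on X p" if "p \<in> R" for p
    proof -
      obtain F where F: "trig F" "\<And>x. x \<in> X \<Longrightarrow> p x = Re (F x)" using \<open>p \<in> R\<close> unfolding R_def by blast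
      have "continuous_on X (\<lambda>x. Re (F x))" by (intro continuous_intros continuous_trig F X(1))
      then show ?thesis by (subst continuous_on_cong[OF refl F(2)]) auto
    qed
    show "(\<lambda>x. p x + q x) \<in> R" if pq: "p \<in> R" "q \<in> R" for p q
    proof -
      obtain F where F: "trig F" "\<And>x. x \<in> X \<Longrightarrow> p x = Re (F x)" using pq(1) unfolding R_def by blast
      obtain G where G: "trig G" "\<And>x. x \<in> X \<Longrightarrow> q x = Re (G x)" using pq(2) unfolding R_def by blast
      show ?thesis unfolding R_def mem_Collect_eq
        by (intro exI[of _ "\<lambda>x. F x + G x"]) (simp add: trig_add F G)
    qed
    show "(\<lambda>x. p x * q x) \<in> R" if pq: "p \<in> R" "q \<in> R" for p q
    proof -
      obtain F where F: "trig F" "\<And>x. x \<in> X \<Longrightarrow> p x = Re (F x)" using pq(1) unfolding R_def by blast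
      obtain G where G: "trig G" "\<And>x. x \<in> X \<Longrightarrow> q x = Re (G x)" using pq(2) unfolding R_def by blast
      obtain C where C: "trig C" "\<And>x. x \<in> torus \<Longrightarrow> C x = cnj (G x)" using trig_cnj[OF G(1)] by blast
      obtain H :: "('g \<Rightarrow> complex) \<Rightarrow> complex" where H: "trig H" "\<And>x. H x = 1 / 2" using trig_const[of "1 / 2"] by blast
      obtain K where K: "trig K" "\<And>x. x \<in> torus \<Longrightarrow> K x = F x * (G x + C x)"
        using trig_mult[OF F(1) trig_add[OF G(1) C(1)]] by blast
      obtain K' where K': "trig K'" "\<And>x. x \<in> torus \<Longrightarrow> K' x = H x * K x" using trig_mult[OF H(1) K(1)] by blast
      have "p x * q x = Re (K' x)" if "x \<in> X" for x
      proof -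
        have x: "x \<in> torus" using that X(1) by blast
        have "G x + C x = of_real (2 * Re (G x))" unfolding C(2)[OF x] by (rule complex_add_cnj)
        then have "K' x = of_real (Re (G x)) * F x" using K(2)[OF x] K'(2)[OF x] by (simp add: H(2))
        then show ?thesis using F(2)[OF that] G(2)[OF that] by simp
      qed
      then show ?thesis unfolding R_def mem_Collect_eq using K'(1) by blast
    qed
    show "(\<lambda>_. c) \<in> R" for c
    proof -
      obtain K :: "('g \<Rightarrow> complex) \<Rightarrow> complex" where "trig K" "\<And>x. K x = of_real c" using trig_const[of "of_real c"] by blast
      then show ?thesis unfolding R_def mem_Collect_eq by (intro exI[of _ K]) simp
    qed
    show "\<exists>p\<in>R. p x \<noteq> p y" if xy: "x \<in> X" "y \<in> X" "x \<noteq> y" for x y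
    proof -
      obtain w where w: "x w \<noteq> y w" using xy(3) by blast
      let ?h = "\<lambda>v. if v = w then 1 else 0 :: int"
      have s: "supp ?h = {w}" by (auto simp: supp_def)
      have c: "chi ?h z = z w" for z by (simp add: chi_def s)
      have t: "trig (\<lambda>z. b * z w)" for b using trig_chi[of ?h b] unfolding c by (simp add: s)
      have in1: "(\<lambda>z. Re (b * z w)) \<in> R" for b unfolding R_def mem_Collect_eq using t[of b] by blast
      show ?thesis
      proof (cases "Re (x w) = Re (y w)")
        case False
        then show ?thesis using in1[of 1] by (intro bexI[of _ "\<lambda>z. Re (1 * z w)"]) auto
      next
        case True
        then have "Im (x w) \<noteq> Im (y w)" using w complex_eqI by blast
        then show ?thesis using in1[of \<i>] by (intro bexI[of _ "\<lambda>z. Re (\<i> * z w)"]) auto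
      qed
    qed
  qed
  obtain g where g: "g \<in> R" "\<forall>x\<in>X. \<bar>p x - g x\<bar> < e" using Stone_Weierstrass_basic[OF p e] by blast
  obtain F where F: "trig F" "\<And>x. x \<in> X \<Longrightarrow> g x = Re (F x)" using g(1) unfolding R_def by blast
  obtain A c where "finite A" "\<forall>h\<in>A. finite (supp h)" "\<And>x. F x = (\<Sum>h\<in>A. c h * chi h x)" using trig_sum[OF F(1)] by blast
  then show ?thesis using g(2) F(2) by (intro exI[of _ A] exI[of _ c]) auto
qed

text \<open>The torus points that are not e-close on W to any point of the model form a compact set
  containing no solution of all the equations, so finitely many closed equations already exclude
  every point of it.\<close>

lemma harmonic_model_near:
  fixes f :: "'g::group_add \<Rightarrow> int"
  assumes W: "finite W" and e: "0 < e"
  obtains P where "finite P" "\<And>z. z \<in> torus \<Longrightarrow> (\<And>t. t \<in> P \<Longrightarrow> (\<Prod>s\<in>supp f. z (t + s) powi f s) = 1) \<Longrightarrow>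
    \<exists>x\<in>harmonic_model f. \<forall>w\<in>W. cmod (x w - z w) < e"
proof -
  define U where "U = (\<Union>x\<in>harmonic_model f. \<Inter>w\<in>W. (\<lambda>z. z w) -` ball (x w) e)"
  have "open U" unfolding U_def using W by (intro open_UN ballI open_INT open_coordinate_vimage open_ball) auto
  then have comp: "compact (torus - U)" using compact_diff[OF compact_torus] by blast
  let ?K = "\<lambda>t. {z \<in> torus. (\<Prod>s\<in>supp f. z (t + s) powi f s) = 1}"
  have "\<exists>P. finite P \<and> (torus - U) \<inter> (\<Inter>t\<in>P. ?K t) = {}"
  proof (rule ccontr)
    assume no: "\<not> ?thesis"
    have "(torus - U) \<inter> (\<Inter>t\<in>UNIV. ?K t) \<noteq> {}"
      by (rule compact_imp_fip_image[OF comp closed_torus_eq]) (use no in blast)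
    then obtain z where z: "z \<in> harmonic_model f" "z \<notin> U" unfolding harmonic_model_eq by blast
    then show False using e unfolding U_def by auto
  qed
  then obtain P where P: "finite P" "(torus - U) \<inter> (\<Inter>t\<in>P. ?K t) = {}" by blast
  show ?thesis
  proof (rule that[OF P(1)])
    fix z assume z: "z \<in> torus" "\<And>t. t \<in> P \<Longrightarrow> (\<Prod>s\<in>supp f. z (t + s) powi f s) = 1"
    then have "z \<in> (\<Inter>t\<in>P. ?K t)" by blast
    then have "z \<in> U" using z(1) P(2) by blast
    then show "\<exists>x\<in>harmonic_model f. \<forall>w\<in>W. cmod (x w - z w) < e" unfolding U_def by (auto simp: dist_norm)
  qed
qed


section \<open>Lower bound\<close>

context quot
begin

lemma wball_plus: "v \<in> wball r' \<Longrightarrow> w \<in> wball r \<Longrightarrow> w + v \<in> wball (r + r')"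
proof (induction r' arbitrary: v)
  case 0
  then show ?case by simp
next
  case (Suc r')
  then obtain u s where u: "u \<in> wball r'" "s \<in> insert 0 (supp f)" "v = u + s" by auto
  have "w + u \<in> wball (r + r')" by (rule Suc.IH[OF u(1) Suc.prems(2)])
  then show ?case using u(2,3) by (auto simp: add.assoc[symmetric] intro!: image_eqI[where x = "(w + u, s)"])
qed

lemma supp_wball: "s \<in> supp f \<Longrightarrow> s \<in> wball (Suc 0)"
  by (auto intro!: image_eqI[where x = "(0, s)"])

lemma uminus_wball: "w \<in> wball r \<Longrightarrow> - w \<in> wball r"
proof (induction r arbitrary: w)
  case 0
  then show ?case by simp
next
  case (Suc r)
  then obtain u s where u: "u \<in> wball r" "s \<in> insert 0 (supp f)" "w = u + s" by auto
  have "- s \<in> wball (Suc 0)"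
  proof (cases "s = 0")
    case True
    then show ?thesis by (auto intro!: image_eqI[where x = "(0, 0)"])
  next
    case False
    then show ?thesis using u(2) supp_wball[of "- s"] supp_minus by auto
  qed
  then have "- s + - u \<in> wball (Suc 0 + r)" by (rule wball_plus[OF Suc.IH[OF u(1)]])
  moreover have "- w = - s + - u" unfolding u(3) by (simp add: minus_add)
  ultimately show ?case by (simp del: wball.simps)
qed

lemma finite_subset_wball:
  assumes "finite A"
  shows "\<exists>r. A \<subseteq> wball r"
proof -
  have sub: "subgrp (\<Union>r. wball r)"
    unfolding subgrp_def
  proof (intro conjI ballI)
    show "0 \<in> (\<Union>r. wball r)" by (rule UN_I[of 0]) auto
    show "a + b \<in> (\<Union>r. wball r)" if "a \<in> (\<Union>r. wball r)" "b \<in> (\<Union>r. wball r)" for a b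
      using that wball_plus by blast
    show "- a \<in> (\<Union>r. wball r)" if "a \<in> (\<Union>r. wball r)" for a
      using that uminus_wball by blast
  qed
  have "gen_subgrp (supp f) \<subseteq> (\<Union>r. wball r)"
    unfolding gen_subgrp_def using sub supp_wball by (intro Inter_lower) blast
  moreover have "gen_subgrp (supp f) = UNIV"
  proof -
    have "supp (\<lambda>s. real_of_int (f s)) = supp f" by (simp add: supp_def)
    then show ?thesis using wb by (simp add: well_balanced_def)
  qed
  ultimately have "\<exists>r. a \<in> wball r" for a by blast
  then obtain r where r: "\<And>a. a \<in> wball (r a)" by metis
  have "A \<subseteq> wball (Max (r ` A))"
  proof
    fix a assume a: "a \<in> A"
    then have "r a \<le> Max (r ` A)" using assms by simp
    then show "a \<in> wball (Max (r ` A))" using wball_mono r by blast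
  qed
  then show ?thesis by blast
qed

text \<open>Were the two close everywhere, their difference would be within 1 / (4 d) of integers m.
  The remainder then has an integral Laplacian of size at most 2 d / (4 d) = 1 / 2, so it is
  harmonic; it vanishes at vertex 0, hence everywhere, and representatives in [0, 1) that differ by
  integers coincide.\<close>

lemma torus_sol_separated:
  assumes \<kappa>: "\<kappa> \<in> torus_sol N (imat {0})" "\<kappa>' \<in> torus_sol N (imat {0})" and ne: "\<kappa> \<noteq> \<kappa>'"
  shows "\<exists>i<N. 1 - cos (2 * pi * (1 / (4 * of_int dd))) \<le> cmod (cis (2 * pi * \<kappa> i) - cis (2 * pi * \<kappa>' i))"
proof (rule ccontr)
  assume "\<not> ?thesis"
  then have close: "\<And>i. i < N \<Longrightarrow> cmod (cis (2 * pi * \<kappa> i) - cis (2 * pi * \<kappa>' i)) < 1 - cos (2 * pi * (1 / (4 * of_int dd)))"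
    by (meson not_le)
  have d: "1 \<le> real_of_int dd" using dd_pos by simp
  have small_int: "x = 0" if "x \<in> \<int>" "\<bar>x\<bar> < 1" for x :: real
    using that by (auto elim!: Ints_cases)
  define u where "u i = \<kappa> i - \<kappa>' i" for i
  have "\<exists>m::int. \<bar>u i - m\<bar> < 1 / (4 * of_int dd)" if i: "i < N" for i
  proof -
    have "cis (2 * pi * u i) - 1 = (cis (2 * pi * \<kappa> i) - cis (2 * pi * \<kappa>' i)) * cis (- (2 * pi * \<kappa>' i))"
      by (simp add: u_def left_diff_distrib cis_mult right_diff_distrib)
    then have "cmod (cis (2 * pi * u i) - 1) = cmod (cis (2 * pi * \<kappa> i) - cis (2 * pi * \<kappa>' i))"
      by (simp add: norm_mult)
    then have "cmod (cis (2 * pi * u i) - 1) < 1 - cos (2 * pi * (1 / (4 * of_int dd)))" using close[OF i] by simp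
    then obtain m :: int where "\<bar>u i - m\<bar> < 1 / (4 * of_int dd)"
      by (rule cis_near_1) (use d in \<open>auto simp: field_simps\<close>)
    then show ?thesis by blast
  qed
  then obtain m :: "nat \<Rightarrow> int" where m: "\<And>i. i < N \<Longrightarrow> \<bar>u i - m i\<bar> < 1 / (4 * of_int dd)" by metis
  define v where "v i = u i - m i" for i
  have lapv: "lap v i = 0" if i: "i < N" for i
  proof -
    have "lap (\<lambda>j. of_int (m j)) i \<in> \<int>"
      unfolding lap_def by (intro Ints_diff Ints_mult Ints_sum Ints_of_int)
    moreover have "lap u i \<in> \<int>"
      unfolding u_def lap_diff by (intro Ints_diff torus_sol_0(2)[OF \<kappa>(1) i] torus_sol_0(2)[OF \<kappa>(2) i])
    ultimately have int: "lap v i \<in> \<int>" unfolding v_def lap_diff by (intro Ints_diff)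
    have "\<bar>lap v i\<bar> \<le> of_int dd * \<bar>v i\<bar> + (\<Sum>j<N. of_int (cc i j) * \<bar>v j\<bar>)"
    proof -
      have "\<bar>\<Sum>j<N. real_of_int (cc i j) * v j\<bar> \<le> (\<Sum>j<N. of_int (cc i j) * \<bar>v j\<bar>)"
        by (rule order_trans[OF sum_abs]) (simp add: abs_mult cc_nonneg)
      moreover have "\<bar>of_int dd * v i\<bar> = of_int dd * \<bar>v i\<bar>" using d by (simp add: abs_mult)
      ultimately show ?thesis unfolding lap_def by linarith
    qed
    also have "\<dots> \<le> of_int dd * (1 / (4 * of_int dd)) + (\<Sum>j<N. of_int (cc i j) * (1 / (4 * of_int dd)))"
      using m i d by (intro add_mono mult_left_mono sum_mono) (auto simp: v_def cc_nonneg less_imp_le)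
    also have "\<dots> = of_int dd * (1 / (4 * of_int dd)) + of_int (\<Sum>j<N. cc i j) * (1 / (4 * of_int dd))"
      by (simp add: sum_distrib_right sum_divide_distrib)
    also have "\<dots> = 1 / 2" using d by (simp add: cc_sum[OF i])
    finally have "\<bar>lap v i\<bar> < 1" by simp
    then show "lap v i = 0" by (rule small_int[OF int])
  qed
  have m0: "m 0 = 0"
  proof -
    have "\<bar>real_of_int (m 0)\<bar> < 1 / (4 * of_int dd)"
      using m[OF N_pos] torus_sol_0(1)[OF \<kappa>(1)] torus_sol_0(1)[OF \<kappa>(2)] by (simp add: u_def)
    also have "\<dots> \<le> 1" using d by simp
    finally show ?thesis by simp
  qed
  have v0: "\<bar>v i\<bar> \<le> 0" if i: "i < N" for i
  proof (rule harmonic_abs_le[of 0 "{0}", OF _ N_pos _ _ i])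
    show "\<bar>v i\<bar> \<le> 0" if "i < N" "i \<in> {0}" for i
      using that m0 torus_sol_0(1)[OF \<kappa>(1)] torus_sol_0(1)[OF \<kappa>(2)] by (simp add: v_def u_def)
  qed (use lapv in auto)
  have "\<kappa> i = \<kappa>' i" if i: "i < N" for i
  proof -
    have "\<kappa> i - \<kappa>' i = of_int (m i)" using v0[OF i] by (simp add: v_def u_def)
    then have "\<kappa> i - \<kappa>' i \<in> \<int>" by (simp only: Ints_of_int)
    moreover have "\<bar>\<kappa> i - \<kappa>' i\<bar> < 1" using torus_sol_0(3)[OF \<kappa>(1) i] torus_sol_0(3)[OF \<kappa>(2) i] by linarith
    ultimately have "\<kappa> i - \<kappa>' i = 0" by (rule small_int)
    then show ?thesis by simp
  qed
  moreover have "\<kappa> i = \<kappa>' i" if "\<not> i < N" for i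
    using \<kappa> that by (auto simp: torus_sol_def PiE_iff extensional_def)
  ultimately show False using ne by (meson ext)
qed

section \<open>Maps following the orbit of a torus point\<close>

lemma emb_cong: "ix a = ix b \<Longrightarrow> emb y a = emb y b"
  by (simp add: emb_def)

lemma norm_emb: "cmod (emb y a) = 1"
  by (simp add: emb_def)

lemma emb_torus: "(\<lambda>w. emb y (a + w)) \<in> torus"
  by (simp add: torus_def norm_emb)

lemma const_model: "cmod c = 1 \<Longrightarrow> (\<lambda>_. c) \<in> harmonic_model f"
  using powi_sum[of c f "supp f"] sum_f by (cases "c = 0") (auto simp: harmonic_model_def)

lemma card_bad_le:
  assumes P: "finite P" and B: "B \<subseteq> {..<N}"
  shows "card {i. i < N \<and> (\<exists>t\<in>P. ix (rep i + t) \<in> B)} \<le> card P * card B"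
proof -
  have finB: "finite B" using B finite_subset by blast
  have "{i. i < N \<and> (\<exists>t\<in>P. ix (rep i + t) \<in> B)} = (\<Union>t\<in>P. {i. i < N \<and> ix (rep i + t) \<in> B})" by blast
  also have "card \<dots> \<le> (\<Sum>t\<in>P. card {i. i < N \<and> ix (rep i + t) \<in> B})" by (rule card_UN_le[OF P])
  also have "\<dots> \<le> (\<Sum>t\<in>P. card B)"
  proof (rule sum_mono)
    fix t
    show "card {i. i < N \<and> ix (rep i + t) \<in> B} \<le> card B"
    proof (rule card_inj_on_le[OF _ _ finB])
      show "inj_on (\<lambda>i. ix (rep i + t)) {i. i < N \<and> ix (rep i + t) \<in> B}"
      proof (rule inj_onI)
        fix i j assume ij: "i \<in> {i. i < N \<and> ix (rep i + t) \<in> B}" "j \<in> {i. i < N \<and> ix (rep i + t) \<in> B}"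
          "ix (rep i + t) = ix (rep j + t)"
        have "ix (rep i) = ix (rep j)" using ix_add[OF ij(3), of "- t"] by simp
        then show "i = j" using ij(1,2) by (simp add: ix_rep)
      qed
    qed auto
  qed
  finally show ?thesis by simp
qed

text \<open>The coset \<open>crep i\<close> is that of \<open>- rep i\<close>, so an equivariant map would send it to the
  shift of \<open>emb z\<close> by \<open>- rep i\<close>, whose value at \<open>w\<close> is \<open>emb z (rep i + w)\<close>.\<close>

definition near_orbit :: "'g set \<Rightarrow> real \<Rightarrow> real \<Rightarrow> (nat \<Rightarrow> real) \<Rightarrow> ('g set \<Rightarrow> 'g \<Rightarrow> complex) \<Rightarrow> bool" where
  "near_orbit W e b z \<phi> \<longleftrightarrow> \<phi> \<in> cosets H \<rightarrow>\<^sub>E harmonic_model f \<and> (\<forall>i<N. cmod (\<phi> (crep i) 0 - emb z (rep i)) \<le> e) \<and>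
     (\<exists>E\<subseteq>{..<N}. real (card E) \<le> b * N \<and> (\<forall>i<N. i \<notin> E \<longrightarrow> (\<forall>w\<in>W. cmod (\<phi> (crep i) w - emb z (rep i + w)) \<le> e)))"

text \<open>The index i is exceptional only if some translate of it by P falls on the defect set B.
  There a constant function with the correct coordinate at 0 is used: constants belong to the model,
  and keeping that coordinate at every coset is what preserves separation in
  \<open>rhoinf\<close>.\<close>

lemma near_orbit_exists:
  assumes P: "finite P" "\<And>z. z \<in> torus \<Longrightarrow> (\<And>t. t \<in> P \<Longrightarrow> (\<Prod>s\<in>supp f. z (t + s) powi f s) = 1) \<Longrightarrow>
      \<exists>x\<in>harmonic_model f. \<forall>w\<in>W. cmod (x w - z w) < e"
    and W: "0 \<in> W" and e: "0 < e"
    and B: "B \<subseteq> {..<N}" "card B * (r + 1) \<le> N" and lap: "\<And>i. i < N \<Longrightarrow> i \<notin> B \<Longrightarrow> lap z i \<in> \<int>"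
  shows "\<exists>\<phi>. near_orbit W e (card P / (real r + 1)) z \<phi>"
proof -
  define E where "E = {i. i < N \<and> (\<exists>t\<in>P. ix (rep i + t) \<in> B)}"
  have good: "\<exists>x\<in>harmonic_model f. \<forall>w\<in>W. cmod (x w - emb z (rep i + w)) < e" if i: "i < N" "i \<notin> E" for i
  proof (rule P(2)[OF emb_torus])
    fix t assume t: "t \<in> P"
    have "ix (rep i + t) \<notin> B" using i t by (auto simp: E_def)
    then have "lap z (ix (rep i + t)) \<in> \<int>" using lap ix_lt by blast
    then show "(\<Prod>s\<in>supp f. emb z (rep i + (t + s)) powi f s) = 1"
      using prod_emb[of z "rep i + t"] by (simp add: add.assoc cis_2pi_eq_1_iff)
  qed
  then have "\<exists>x. i < N \<longrightarrow> x \<in> harmonic_model f \<and> cmod (x 0 - emb z (rep i)) \<le> e \<and>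
      (i \<notin> E \<longrightarrow> (\<forall>w\<in>W. cmod (x w - emb z (rep i + w)) \<le> e))" for i
  proof (cases "i < N \<and> i \<notin> E")
    case True
    then obtain x where x: "x \<in> harmonic_model f" "\<forall>w\<in>W. cmod (x w - emb z (rep i + w)) < e" using good by blast
    have "cmod (x 0 - emb z (rep i)) \<le> e" using bspec[OF x(2) W] by simp
    then show ?thesis using x by (intro exI[of _ x]) (auto intro: less_imp_le)
  next
    case False
    then show ?thesis using const_model[OF norm_emb, of z "rep i"] e
      by (intro exI[of _ "\<lambda>_. emb z (rep i)"]) auto
  qed
  then obtain \<psi> where \<psi>: "\<And>i. i < N \<Longrightarrow> \<psi> i \<in> harmonic_model f" "\<And>i. i < N \<Longrightarrow> cmod (\<psi> i 0 - emb z (rep i)) \<le> e"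
    "\<And>i w. i < N \<Longrightarrow> i \<notin> E \<Longrightarrow> w \<in> W \<Longrightarrow> cmod (\<psi> i w - emb z (rep i + w)) \<le> e" by metis
  define \<phi> where "\<phi> = restrict (\<lambda>C. \<psi> (inv_into {..<N} crep C)) (cosets H)"
  have inv: "inv_into {..<N} crep (crep i) = i" if "i < N" for i
    using crep_bij that by (intro inv_into_f_f) (auto simp: bij_betw_def)
  have crep_in: "crep i \<in> cosets H" for i by (simp add: crep_def cosets_def)
  have \<phi>c: "\<phi> (crep i) = \<psi> i" if "i < N" for i by (simp add: \<phi>_def crep_in inv that)
  have "\<phi> \<in> cosets H \<rightarrow>\<^sub>E harmonic_model f"
  proof (rule PiE_I)
    fix C assume "C \<in> cosets H"
    then obtain i where "i < N" "C = crep i" using crep_bij by (auto simp: bij_betw_def)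
    then show "\<phi> C \<in> harmonic_model f" by (simp add: \<phi>c \<psi>(1))
  qed (simp add: \<phi>_def)
  moreover have "real (card E) \<le> real (card P) / (real r + 1) * N"
  proof -
    have "card E * (r + 1) \<le> card P * card B * (r + 1)"
      unfolding E_def by (rule mult_right_mono[OF card_bad_le[OF P(1) B(1)]]) simp
    also have "\<dots> = card P * (card B * (r + 1))" by (simp only: mult.assoc)
    also have "\<dots> \<le> card P * N" using B(2) by (rule mult_left_mono) simp
    finally have "real (card E * (r + 1)) \<le> real (card P * N)" by (simp only: of_nat_le_iff)
    then show ?thesis by (simp add: field_simps)
  qed
  moreover have "E \<subseteq> {..<N}" by (auto simp: E_def)
  moreover have "\<forall>i<N. cmod (\<phi> (crep i) 0 - emb z (rep i)) \<le> e" using \<psi>(2) by (simp add: \<phi>c)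
  moreover have "\<forall>i<N. i \<notin> E \<longrightarrow> (\<forall>w\<in>W. cmod (\<phi> (crep i) w - emb z (rep i + w)) \<le> e)" using \<psi>(3) by (simp add: \<phi>c)
  ultimately have "near_orbit W e (real (card P) / (real r + 1)) z \<phi>" unfolding near_orbit_def by blast
  then show ?thesis by blast
qed

text \<open>Off E the two sides differ by at most 2 e, one error from each point; on E by at most 2.
  The squares give the terms 4 e^2 and 4 b.\<close>

lemma near_orbit_sofic:
  assumes \<phi>: "near_orbit W e b z \<phi>" and S: "\<And>s. s \<in> S \<Longrightarrow> - s \<in> W" and e: "0 \<le> e"
    and \<delta>: "0 \<le> \<delta>" "4 * e\<^sup>2 + 4 * b \<le> \<delta>\<^sup>2"
  shows "\<phi> \<in> sofic_maps shift (harmonic_model f) rho0 H S \<delta>"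
proof -
  obtain E where E: "E \<subseteq> {..<N}" "real (card E) \<le> b * N"
      "\<And>i w. i < N \<Longrightarrow> i \<notin> E \<Longrightarrow> w \<in> W \<Longrightarrow> cmod (\<phi> (crep i) w - emb z (rep i + w)) \<le> e"
    and P: "\<phi> \<in> cosets H \<rightarrow>\<^sub>E harmonic_model f" and at0: "\<And>i. i < N \<Longrightarrow> cmod (\<phi> (crep i) 0 - emb z (rep i)) \<le> e"
    using \<phi> unfolding near_orbit_def by blast
  have finE: "finite E" using E(1) finite_subset by blast
  have inX: "\<phi> (crep i) \<in> harmonic_model f" for i using P by (auto simp: crep_def cosets_def)
  have "rho2 (cosets H) rho0 (\<lambda>C. \<phi> (lcoset s C)) (\<lambda>C. shift s (\<phi> C)) \<le> \<delta>" if s: "s \<in> S" for s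
    unfolding rho2_le_iff[OF \<delta>(1)]
  proof -
    have le: "(rho0 (\<phi> (lcoset s (crep i))) (shift s (\<phi> (crep i))))\<^sup>2 \<le> 4 * e\<^sup>2 + (if i \<in> E then 4 else 0)" if i: "i < N" for i
    proof -
      define j where "j = ix (rep i + - s)"
      have j: "lcoset s (crep i) = crep j" using lcoset_crep[OF i, of "- s"] by (simp add: j_def)
      have jN: "j < N" by (simp add: j_def ix_lt)
      have rho: "rho0 (\<phi> (lcoset s (crep i))) (shift s (\<phi> (crep i))) = cmod (\<phi> (crep j) 0 - \<phi> (crep i) (- s))"
        by (simp add: rho0_def shift_def j)
      show ?thesis
      proof (cases "i \<in> E")
        case True
        have "cmod (\<phi> (crep j) 0 - \<phi> (crep i) (- s)) \<le> 2"
          using norm_triangle_ineq4[of "\<phi> (crep j) 0" "\<phi> (crep i) (- s)"] model_norm[OF inX] by simp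
        then have "(cmod (\<phi> (crep j) 0 - \<phi> (crep i) (- s)))\<^sup>2 \<le> 2\<^sup>2" by (intro power_mono) auto
        moreover have "0 \<le> 4 * e\<^sup>2" by simp
        ultimately have "(cmod (\<phi> (crep j) 0 - \<phi> (crep i) (- s)))\<^sup>2 \<le> 4 * e\<^sup>2 + 4"
          unfolding power2_eq_square[of "2 :: real"] by linarith
        then show ?thesis using True unfolding rho by simp
      next
        case False
        have 1: "cmod (\<phi> (crep i) (- s) - emb z (rep i + - s)) \<le> e" by (rule E(3)[OF i False S[OF s]])
        have "emb z (rep j) = emb z (rep i + - s)" by (rule emb_cong) (simp only: ix_rep[OF jN], simp only: j_def)
        then have 2: "cmod (\<phi> (crep j) 0 - emb z (rep i + - s)) \<le> e" using at0[OF jN] by simp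
        have "cmod (\<phi> (crep j) 0 - \<phi> (crep i) (- s)) \<le> e + e"
          using norm_triangle_mono[OF 2 1[unfolded norm_minus_commute[of "\<phi> (crep i) (- s)"]]] by simp
        then have "(cmod (\<phi> (crep j) 0 - \<phi> (crep i) (- s)))\<^sup>2 \<le> (2 * e)\<^sup>2" by (intro power_mono) auto
        then show ?thesis using False unfolding rho by (simp add: power_mult_distrib)
      qed
    qed
    have "(\<Sum>i<N. (rho0 (\<phi> (lcoset s (crep i))) (shift s (\<phi> (crep i))))\<^sup>2) \<le> (\<Sum>i<N. 4 * e\<^sup>2 + (if i \<in> E then 4 else 0))"
      using le by (intro sum_mono) auto
    also have "\<dots> = N * (4 * e\<^sup>2) + 4 * card E"
    proof -
      have "(\<Sum>i<N. if i \<in> E then 4 else 0 :: real) = (\<Sum>i\<in>E. 4)"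
        using E(1) by (subst sum.inter_restrict[symmetric]) (auto simp: Int_absorb1)
      then show ?thesis by (simp add: sum.distrib)
    qed
    also have "\<dots> \<le> N * (4 * e\<^sup>2) + 4 * (b * N)" using E(2) by simp
    also have "\<dots> = (4 * e\<^sup>2 + 4 * b) * N" by (simp add: algebra_simps)
    also have "\<dots> \<le> \<delta>\<^sup>2 * N" using \<delta>(2) by (rule mult_right_mono) simp
    finally show "(\<Sum>i<N. (rho0 (\<phi> (lcoset s (crep i))) (shift s (\<phi> (crep i))))\<^sup>2) \<le> \<delta>\<^sup>2 * N" .
  qed
  then show ?thesis using P by (simp add: sofic_maps_def)
qed

text \<open>On E two unimodular values differ by at most 2; elsewhere a character with exponents of
  total size Mh changes by at most Mh e.\<close>

lemma near_orbit_average: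
  fixes Mh :: real
  assumes \<phi>: "near_orbit W e b z \<phi>" and h: "finite (supp h)" "supp h \<subseteq> W" "(\<Sum>w\<in>supp h. \<bar>real_of_int (h w)\<bar>) \<le> Mh"
    and e: "0 \<le> e"
  shows "cmod ((\<Sum>C\<in>cosets H. chi h (\<phi> C)) / N - orbit_mean h z) \<le> Mh * e + 2 * b"
proof -
  obtain E where E: "E \<subseteq> {..<N}" "real (card E) \<le> b * N"
      "\<And>i w. i < N \<Longrightarrow> i \<notin> E \<Longrightarrow> w \<in> W \<Longrightarrow> cmod (\<phi> (crep i) w - emb z (rep i + w)) \<le> e"
    and P: "\<phi> \<in> cosets H \<rightarrow>\<^sub>E harmonic_model f"
    using \<phi> unfolding near_orbit_def by blast
  have inX: "\<phi> (crep i) \<in> harmonic_model f" for i using P by (auto simp: crep_def cosets_def)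
  have Mh0: "0 \<le> Mh" by (rule order_trans[OF _ h(3)]) (simp add: sum_nonneg)
  have le: "cmod (chi h (\<phi> (crep i)) - chi h (\<lambda>w. emb z (rep i + w))) \<le> Mh * e + (if i \<in> E then 2 else 0)" if i: "i < N" for i
  proof (cases "i \<in> E")
    case True
    have "\<phi> (crep i) \<in> torus" using inX harmonic_model_torus by blast
    then have "cmod (chi h (\<phi> (crep i)) - chi h (\<lambda>w. emb z (rep i + w))) \<le> 1 + 1"
      using norm_triangle_ineq4[of "chi h (\<phi> (crep i))" "chi h (\<lambda>w. emb z (rep i + w))"] by (simp add: norm_chi emb_torus)
    then show ?thesis using True mult_nonneg_nonneg[OF Mh0 e] by simp
  next
    case False
    have "cmod (chi h (\<phi> (crep i)) - chi h (\<lambda>w. emb z (rep i + w))) \<le> (\<Sum>w\<in>supp h. \<bar>real_of_int (h w)\<bar>) * e"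
      unfolding chi_def by (rule norm_prod_powi_diff_le) (use model_norm[OF inX] norm_emb E(3)[OF i False] h(2) in auto)
    also have "\<dots> \<le> Mh * e" using h(3) e by (rule mult_right_mono)
    finally show ?thesis using False by simp
  qed
  have "(\<Sum>C\<in>cosets H. chi h (\<phi> C)) / N - orbit_mean h z =
      (\<Sum>i<N. chi h (\<phi> (crep i)) - chi h (\<lambda>w. emb z (rep i + w))) / N"
    by (simp add: sum_cosets orbit_mean_def sum_subtractf diff_divide_distrib)
  also have "cmod \<dots> \<le> (\<Sum>i<N. Mh * e + (if i \<in> E then 2 else 0)) / N"
    unfolding norm_divide norm_of_nat using le by (intro divide_right_mono order_trans[OF norm_sum] sum_mono) auto
  also have "(\<Sum>i<N. Mh * e + (if i \<in> E then 2 else 0)) = N * (Mh * e) + 2 * card E"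
  proof -
    have "(\<Sum>i<N. if i \<in> E then 2 else 0 :: real) = (\<Sum>i\<in>E. 2)"
      using E(1) by (subst sum.inter_restrict[symmetric]) (auto simp: Int_absorb1)
    then show ?thesis by (simp add: sum.distrib)
  qed
  also have "(N * (Mh * e) + 2 * card E) / N \<le> (N * (Mh * e) + 2 * (b * N)) / N"
    using E(2) by (intro divide_right_mono) auto
  also have "\<dots> = Mh * e + 2 * b" using N_pos by (simp add: field_simps)
  finally show ?thesis .
qed

text \<open>The common translate y contributes a factor of modulus 1, which leaves the distance of
  the two normalised solutions; each map loses at most e of it.\<close>

lemma near_orbit_separated:
  assumes \<phi>: "near_orbit W e b (\<lambda>m. y m + \<kappa> m) \<phi>" "near_orbit W' e b' (\<lambda>m. y m + \<kappa>' m) \<phi>'"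
    and \<kappa>: "\<kappa> \<in> torus_sol N (imat {0})" "\<kappa>' \<in> torus_sol N (imat {0})" "\<kappa> \<noteq> \<kappa>'"
  shows "1 - cos (2 * pi * (1 / (4 * of_int dd))) - 2 * e \<le> rhoinf (cosets H) rho0 \<phi> \<phi>'"
proof -
  obtain i where i: "i < N" "1 - cos (2 * pi * (1 / (4 * of_int dd))) \<le> cmod (cis (2 * pi * \<kappa> i) - cis (2 * pi * \<kappa>' i))"
    using torus_sol_separated[OF \<kappa>] by blast
  let ?a = "emb (\<lambda>m. y m + \<kappa> m) (rep i)" and ?b = "emb (\<lambda>m. y m + \<kappa>' m) (rep i)"
  have "?a - ?b = cis (2 * pi * y i) * (cis (2 * pi * \<kappa> i) - cis (2 * pi * \<kappa>' i))"
    using i(1) by (simp add: emb_def ix_rep right_diff_distrib cis_mult distrib_left)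
  then have "cmod (?a - ?b) = cmod (cis (2 * pi * \<kappa> i) - cis (2 * pi * \<kappa>' i))" by (simp add: norm_mult)
  moreover have "cmod (\<phi> (crep i) 0 - ?a) \<le> e" "cmod (\<phi>' (crep i) 0 - ?b) \<le> e"
    using \<phi> i(1) unfolding near_orbit_def by blast+
  moreover have "cmod (?a - ?b) \<le> cmod (\<phi> (crep i) 0 - ?a) + cmod (\<phi> (crep i) 0 - \<phi>' (crep i) 0) + cmod (\<phi>' (crep i) 0 - ?b)"
    using norm_triangle_ineq[of "?a - \<phi> (crep i) 0" "\<phi> (crep i) 0 - ?b"]
      norm_triangle_ineq[of "\<phi> (crep i) 0 - \<phi>' (crep i) 0" "\<phi>' (crep i) 0 - ?b"]
    by (simp add: norm_minus_commute)
  moreover have "rho0 (\<phi> (crep i)) (\<phi>' (crep i)) \<le> rhoinf (cosets H) rho0 \<phi> \<phi>'"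
    unfolding rhoinf_def using finite_cosets by (intro Max_ge) (auto simp: crep_def cosets_def)
  ultimately show ?thesis using i(2) by (simp add: rho0_def)
qed

text \<open>Double counting. Chebyshev's inequality and the second moment bound the set of bad y for
  each h and \<kappa>. By the assumption on N the pairs of some y and a bad \<kappa> make up at most
  half of all pairs, so some y leaves at least half of the periodic points good for all h in
  A.\<close>

lemma good_translate_exists:
  fixes Mh r0 q r :: nat and \<theta> :: real
  defines "D \<equiv> r0 + (nat (dd + 1)) ^ (2 * r) * (2 * Mh) * (2 * r + 1)"
  assumes dense: "\<And>i. i < N \<Longrightarrow> reaches (2 * r) B i" and B: "B \<subseteq> {..<N}" "0 \<in> B"
    and A: "finite A" "\<And>h. h \<in> A \<Longrightarrow> finite (supp h)" "\<And>h. h \<in> A \<Longrightarrow> supp h \<subseteq> wball r0"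
      "\<And>h. h \<in> A \<Longrightarrow> (\<Sum>w\<in>supp h. \<bar>h w\<bar>) \<le> int Mh" "\<And>h. h \<in> A \<Longrightarrow> \<exists>x\<in>harmonic_model f. chi h x \<noteq> 1"
    and q: "2 * real Mh + 2 * of_int dd * ((of_int dd + 1) ^ (2 * r) * (2 * real Mh)) < real q"
    and inj: "inj_on ix (wball (D + 2))"
    and N: "2 * real (card A * card (wball (2 * D + 2))) \<le> \<theta>\<^sup>2 * N" and \<theta>: "0 < \<theta>"
  obtains y K where "y \<in> agrp q B" "K \<subseteq> torus_sol N (imat {0})" "tau \<le> 2 * card K"
    "\<And>\<kappa> h. \<kappa> \<in> K \<Longrightarrow> h \<in> A \<Longrightarrow> cmod (orbit_mean h (\<lambda>m. y m + \<kappa> m)) \<le> \<theta>"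
proof -
  let ?T = "torus_sol N (imat {0})"
  have "0 \<le> 2 * real Mh + 2 * of_int dd * ((of_int dd + 1) ^ (2 * r) * (2 * real Mh))"
    using dd_pos by (intro add_nonneg_nonneg mult_nonneg_nonneg zero_le_power) auto
  then have q0: "0 < q" using q by linarith
  have finG: "finite (agrp q B)" by (rule finite_agrp[OF B(2) N_pos q0])
  have finT: "finite ?T" using imat_det_pos[of 0 "{0}"] N_pos by (intro finite_torus_sol) auto
  have G0: "0 < card (agrp q B)" using agrp_nonempty finG card_gt_0_iff by blast
  have N0: "0 < real N" using N_pos by simp
  define bad where "bad h \<kappa> = {y \<in> agrp q B. \<theta> < cmod (orbit_mean h (\<lambda>m. y m + \<kappa> m))}" for h \<kappa>
  define V where "V = real (card (wball (2 * D + 2)))"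
  have bad: "\<theta>\<^sup>2 * card (bad h \<kappa>) \<le> card (agrp q B) * V / N" if h: "h \<in> A" for h \<kappa>
  proof -
    obtain x where x: "x \<in> harmonic_model f" "chi h x \<noteq> 1" using A(5)[OF h] by blast
    have "\<theta>\<^sup>2 * card (bad h \<kappa>) = (\<Sum>y\<in>bad h \<kappa>. \<theta>\<^sup>2)" by simp
    also have "\<dots> \<le> (\<Sum>y\<in>bad h \<kappa>. (cmod (orbit_mean h (\<lambda>m. y m + \<kappa> m)))\<^sup>2)"
      using \<theta> by (intro sum_mono power_mono) (auto simp: bad_def)
    also have "\<dots> \<le> (\<Sum>y\<in>agrp q B. (cmod (orbit_mean h (\<lambda>m. y m + \<kappa> m)))\<^sup>2)"
      using finG by (intro sum_mono2) (auto simp: bad_def)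
    also have "\<dots> \<le> card (agrp q B) * V / N"
      using orbit_mean_second_moment[OF dense B(1) A(2)[OF h] A(3)[OF h] A(4)[OF h] x q inj[unfolded D_def], of \<kappa>]
      unfolding V_def D_def of_nat_mult .
    finally show ?thesis .
  qed
  have "\<exists>y\<in>agrp q B. 2 * card {\<kappa> \<in> ?T. \<exists>h\<in>A. y \<in> bad h \<kappa>} \<le> tau"
  proof (rule ccontr)
    assume "\<not> ?thesis"
    then have big: "\<And>y. y \<in> agrp q B \<Longrightarrow> tau < 2 * card {\<kappa> \<in> ?T. \<exists>h\<in>A. y \<in> bad h \<kappa>}" by (meson not_le)
    have "card (agrp q B) * tau < (\<Sum>y\<in>agrp q B. 2 * card {\<kappa> \<in> ?T. \<exists>h\<in>A. y \<in> bad h \<kappa>})"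
    proof -
      have "(\<Sum>y\<in>agrp q B. tau) < (\<Sum>y\<in>agrp q B. 2 * card {\<kappa> \<in> ?T. \<exists>h\<in>A. y \<in> bad h \<kappa>})"
        using G0 by (intro sum_strict_mono[OF finG]) (auto intro: big)
      then show ?thesis by simp
    qed
    also have "\<dots> \<le> (\<Sum>y\<in>agrp q B. 2 * (\<Sum>h\<in>A. card {\<kappa> \<in> ?T. y \<in> bad h \<kappa>}))"
    proof (intro sum_mono mult_left_mono)
      fix y
      have "{\<kappa> \<in> ?T. \<exists>h\<in>A. y \<in> bad h \<kappa>} = (\<Union>h\<in>A. {\<kappa> \<in> ?T. y \<in> bad h \<kappa>})" by blast
      then show "card {\<kappa> \<in> ?T. \<exists>h\<in>A. y \<in> bad h \<kappa>} \<le> (\<Sum>h\<in>A. card {\<kappa> \<in> ?T. y \<in> bad h \<kappa>})"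
        using card_UN_le[OF A(1)] by simp
    qed simp
    also have "\<dots> = 2 * (\<Sum>h\<in>A. \<Sum>y\<in>agrp q B. card {\<kappa> \<in> ?T. y \<in> bad h \<kappa>})"
      by (subst sum.swap) (simp add: sum_distrib_left)
    also have "(\<Sum>h\<in>A. \<Sum>y\<in>agrp q B. card {\<kappa> \<in> ?T. y \<in> bad h \<kappa>}) = (\<Sum>h\<in>A. \<Sum>\<kappa>\<in>?T. card (bad h \<kappa>))"
    proof (rule sum.cong[OF refl])
      fix h
      have "(\<Sum>y\<in>agrp q B. card {\<kappa> \<in> ?T. y \<in> bad h \<kappa>}) = (\<Sum>\<kappa>\<in>?T. card {y \<in> agrp q B. y \<in> bad h \<kappa>})"
        by (rule sum_multicount_gen[OF finG finT]) auto
      then show "(\<Sum>y\<in>agrp q B. card {\<kappa> \<in> ?T. y \<in> bad h \<kappa>}) = (\<Sum>\<kappa>\<in>?T. card (bad h \<kappa>))"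
        by (simp add: bad_def)
    qed
    finally have lt: "real (card (agrp q B) * tau) < real (2 * (\<Sum>h\<in>A. \<Sum>\<kappa>\<in>?T. card (bad h \<kappa>)))"
      by (simp only: of_nat_less_iff)
    have "\<theta>\<^sup>2 * real (card (agrp q B) * tau) < \<theta>\<^sup>2 * real (2 * (\<Sum>h\<in>A. \<Sum>\<kappa>\<in>?T. card (bad h \<kappa>)))"
      using lt \<theta> by (intro mult_strict_left_mono) auto
    also have "\<dots> = 2 * (\<Sum>h\<in>A. \<Sum>\<kappa>\<in>?T. \<theta>\<^sup>2 * card (bad h \<kappa>))"
      by (simp add: sum_distrib_left mult.left_commute)
    also have "\<dots> \<le> 2 * (\<Sum>h\<in>A. \<Sum>\<kappa>\<in>?T. card (agrp q B) * V / N)"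
      using bad by (intro mult_left_mono sum_mono) auto
    also have "\<dots> = (2 * real (card A * card (wball (2 * D + 2)))) * (tau * card (agrp q B) / N)"
      by (simp add: V_def tau_def del: wball.simps)
    also have "\<dots> \<le> (\<theta>\<^sup>2 * N) * (tau * card (agrp q B) / N)"
      using N by (intro mult_right_mono) auto
    also have "\<dots> = \<theta>\<^sup>2 * real (card (agrp q B) * tau)" using N0 by simp
    finally show False by simp
  qed
  then obtain y where y: "y \<in> agrp q B" "2 * card {\<kappa> \<in> ?T. \<exists>h\<in>A. y \<in> bad h \<kappa>} \<le> tau" by blast
  define K where "K = ?T - {\<kappa> \<in> ?T. \<exists>h\<in>A. y \<in> bad h \<kappa>}"
  have "card K = tau - card {\<kappa> \<in> ?T. \<exists>h\<in>A. y \<in> bad h \<kappa>}"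
    unfolding K_def tau_def using finT by (intro card_Diff_subset) auto
  then have "tau \<le> 2 * card K" using y(2) by linarith
  moreover have "cmod (orbit_mean h (\<lambda>m. y m + \<kappa> m)) \<le> \<theta>" if "\<kappa> \<in> K" "h \<in> A" for \<kappa> h
    using that y(1) unfolding K_def bad_def by (simp add: not_less)
  ultimately show ?thesis using that[of y K] y(1) unfolding K_def by blast
qed

lemma separated_orbits_exist:
  fixes Mh r0 r :: nat and \<theta> e :: real
  defines "D \<equiv> r0 + (nat (dd + 1)) ^ (2 * r) * (2 * Mh) * (2 * r + 1)"
  assumes P: "finite P" "\<And>z. z \<in> torus \<Longrightarrow> (\<And>t. t \<in> P \<Longrightarrow> (\<Prod>s\<in>supp f. z (t + s) powi f s) = 1) \<Longrightarrow>
      \<exists>x\<in>harmonic_model f. \<forall>w\<in>W. cmod (x w - z w) < e"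
    and W: "0 \<in> W" and e: "0 < e" and r: "r < N"
    and A: "finite A" "\<And>h. h \<in> A \<Longrightarrow> finite (supp h)" "\<And>h. h \<in> A \<Longrightarrow> supp h \<subseteq> wball r0"
      "\<And>h. h \<in> A \<Longrightarrow> (\<Sum>w\<in>supp h. \<bar>h w\<bar>) \<le> int Mh" "\<And>h. h \<in> A \<Longrightarrow> \<exists>x\<in>harmonic_model f. chi h x \<noteq> 1"
    and inj: "inj_on ix (wball (D + 2))"
    and N: "2 * real (card A * card (wball (2 * D + 2))) \<le> \<theta>\<^sup>2 * N" and \<theta>: "0 < \<theta>"
    and small: "2 * e < 1 - cos (2 * pi * (1 / (4 * of_int dd)))"
  obtains F where "finite F" "tau \<le> 2 * card F"
    "\<And>\<phi> \<phi>'. \<phi> \<in> F \<Longrightarrow> \<phi>' \<in> F \<Longrightarrow> \<phi> \<noteq> \<phi>' \<Longrightarrow>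
       1 - cos (2 * pi * (1 / (4 * of_int dd))) - 2 * e \<le> rhoinf (cosets H) rho0 \<phi> \<phi>'"
    "\<And>\<phi>. \<phi> \<in> F \<Longrightarrow> \<exists>z. near_orbit W e (card P / (real r + 1)) z \<phi> \<and> (\<forall>h\<in>A. cmod (orbit_mean h z) \<le> \<theta>)"
proof -
  obtain B where B: "B \<subseteq> {..<N}" "0 \<in> B" "card B * (r + 1) \<le> N" "\<And>i. i < N \<Longrightarrow> reaches (2 * r) B i"
    using sparse_dense_set[OF r] by metis
  \<comment> \<open>The estimates for the translates are uniform in q, so it may be as large as the
    integrality argument demands.\<close>
  obtain q :: nat where q: "2 * real Mh + 2 * of_int dd * ((of_int dd + 1) ^ (2 * r) * (2 * real Mh)) < real q"
    using reals_Archimedean2 by blast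
  obtain y K where y: "y \<in> agrp q B" and K: "K \<subseteq> torus_sol N (imat {0})" "tau \<le> 2 * card K"
    "\<And>\<kappa> h. \<kappa> \<in> K \<Longrightarrow> h \<in> A \<Longrightarrow> cmod (orbit_mean h (\<lambda>m. y m + \<kappa> m)) \<le> \<theta>"
    by (rule good_translate_exists[OF B(4) B(1,2) A q inj[unfolded D_def] N[unfolded D_def] \<theta>]) blast+
  have finK: "finite K"
    using K(1) imat_det_pos[of 0 "{0}"] N_pos by (intro finite_subset[OF K(1)] finite_torus_sol) auto
  have "\<exists>\<phi>. near_orbit W e (card P / (real r + 1)) (\<lambda>m. y m + \<kappa> m) \<phi>" if \<kappa>: "\<kappa> \<in> K" for \<kappa>
  proof (rule near_orbit_exists[OF P W e B(1,3)])
    fix i assume i: "i < N" "i \<notin> B"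
    have "lap y i \<in> \<int>" using y i by (auto simp: agrp_iff)
    moreover have "lap \<kappa> i \<in> \<int>" using torus_sol_0(2) \<kappa> K(1) i(1) by blast
    ultimately show "lap (\<lambda>m. y m + \<kappa> m) i \<in> \<int>" unfolding lap_add by (rule Ints_add)
  qed
  then obtain \<Phi> where \<Phi>: "\<And>\<kappa>. \<kappa> \<in> K \<Longrightarrow> near_orbit W e (card P / (real r + 1)) (\<lambda>m. y m + \<kappa> m) (\<Phi> \<kappa>)" by metis
  have sep: "1 - cos (2 * pi * (1 / (4 * of_int dd))) - 2 * e \<le> rhoinf (cosets H) rho0 (\<Phi> \<kappa>) (\<Phi> \<kappa>')"
    if "\<kappa> \<in> K" "\<kappa>' \<in> K" "\<kappa> \<noteq> \<kappa>'" for \<kappa> \<kappa>'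
    using that K(1) by (intro near_orbit_separated[OF \<Phi> \<Phi>]) auto
  have "inj_on \<Phi> K"
  proof (rule inj_onI, rule ccontr)
    fix \<kappa> \<kappa>' assume k: "\<kappa> \<in> K" "\<kappa>' \<in> K" "\<Phi> \<kappa> = \<Phi> \<kappa>'" "\<kappa> \<noteq> \<kappa>'"
    have "rhoinf (cosets H) rho0 (\<Phi> \<kappa>) (\<Phi> \<kappa>') = 0"
    proof -
      have "cosets H \<noteq> {}" by (auto simp: cosets_def)
      then show ?thesis unfolding rhoinf_def k(3) by (simp add: rho0_def image_constant_conv)
    qed
    then show False using sep[OF k(1,2,4)] small by linarith
  qed
  then have "card (\<Phi> ` K) = card K" by (rule card_image)
  moreover have "1 - cos (2 * pi * (1 / (4 * of_int dd))) - 2 * e \<le> rhoinf (cosets H) rho0 \<phi> \<phi>'"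
    if \<phi>: "\<phi> \<in> \<Phi> ` K" "\<phi>' \<in> \<Phi> ` K" "\<phi> \<noteq> \<phi>'" for \<phi> \<phi>'
  proof -
    obtain \<kappa> \<kappa>' where "\<kappa> \<in> K" "\<kappa>' \<in> K" "\<phi> = \<Phi> \<kappa>" "\<phi>' = \<Phi> \<kappa>'" using \<phi>(1,2) by blast
    then show ?thesis using sep \<phi>(3) by blast
  qed
  moreover have "\<exists>z. near_orbit W e (card P / (real r + 1)) z \<phi> \<and> (\<forall>h\<in>A. cmod (orbit_mean h z) \<le> \<theta>)" if \<phi>: "\<phi> \<in> \<Phi> ` K" for \<phi>
    using \<phi> \<Phi> K(3) by blast
  ultimately show ?thesis using that[of "\<Phi> ` K"] finK K(2) by auto
qed

end


section \<open>Entropy\<close>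

lemma elog_le: "x \<le> ereal b \<Longrightarrow> 0 < b \<Longrightarrow> elog x \<le> ereal (ln b)"
  by (cases x) (auto simp: elog_def)

lemma elog_ge: "ereal b \<le> x \<Longrightarrow> 0 < b \<Longrightarrow> ereal (ln b) \<le> elog x"
  by (cases x) (auto simp: elog_def)

text \<open>The approximation error \<eta> is paid twice, under the empirical average and under the
  Haar integral; K \<beta> accounts for the characters.\<close>

lemma average_close:
  fixes X :: "('g \<Rightarrow> complex) set" and p :: "('g \<Rightarrow> complex) \<Rightarrow> real"
  assumes cnt: "countable (UNIV :: 'g set)" "infinite (UNIV :: 'g set)" and X: "torus_subgroup X"
    and Q: "finite Q" "Q \<noteq> {}" "\<And>C. C \<in> Q \<Longrightarrow> \<phi> C \<in> X" and p: "continuous_on X p"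
    and A: "finite A" "\<And>x. x \<in> X \<Longrightarrow> \<bar>p x - Re (\<Sum>h\<in>A. c h * chi h x)\<bar> < \<eta>"
    and avg: "\<And>h. h \<in> A \<Longrightarrow> cmod ((\<Sum>C\<in>Q. chi h (\<phi> C)) / card Q - integral\<^sup>L (haar_measure X) (chi h)) \<le> \<beta>"
    and K: "(\<Sum>h\<in>A. cmod (c h)) \<le> K" and \<beta>: "0 \<le> \<beta>"
  shows "\<bar>(\<Sum>C\<in>Q. p (\<phi> C)) / card Q - integral\<^sup>L (haar_measure X) p\<bar> \<le> 2 * \<eta> + K * \<beta>"
proof -
  let ?S = "\<lambda>x. \<Sum>h\<in>A. c h * chi h x"
  interpret prob_space "haar_measure X" by (rule haar_measure_props(1)[OF cnt X])
  have Xt: "X \<subseteq> torus" using X by (simp add: torus_subgroup_def)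
  have sp: "space (haar_measure X) = X" by (rule haar_measure_props(3)[OF cnt X])
  have ichi: "integrable (haar_measure X) (chi h)" for h by (rule haar_integrable(2)[OF cnt X continuous_chi[OF Xt]])
  have ip: "integrable (haar_measure X) p" by (rule haar_integrable(2)[OF cnt X p])
  have iS: "integrable (haar_measure X) ?S" using ichi by (intro Bochner_Integration.integrable_sum integrable_mult_right) auto
  have Q0: "0 < real (card Q)" using Q(1,2) by (simp add: card_gt_0_iff)
  have "\<bar>integral\<^sup>L (haar_measure X) p - Re (integral\<^sup>L (haar_measure X) ?S)\<bar> =
      \<bar>integral\<^sup>L (haar_measure X) (\<lambda>x. p x - Re (?S x))\<bar>"
    using ip iS by (simp only: integral_Re[symmetric] Bochner_Integration.integral_diff integrable_Re)
  also have "\<dots> \<le> integral\<^sup>L (haar_measure X) (\<lambda>x. \<bar>p x - Re (?S x)\<bar>)" by (rule integral_abs_bound)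
  also have "\<dots> \<le> integral\<^sup>L (haar_measure X) (\<lambda>x. \<eta>)"
  proof (rule integral_mono)
    show "integrable (haar_measure X) (\<lambda>x. \<bar>p x - Re (?S x)\<bar>)"
      using ip iS by (intro integrable_abs Bochner_Integration.integrable_diff integrable_Re)
    show "\<bar>p x - Re (?S x)\<bar> \<le> \<eta>" if "x \<in> space (haar_measure X)" for x
      using A(2)[of x] that unfolding sp by linarith
  qed simp
  also have "\<dots> = \<eta>" by (simp add: prob_space)
  finally have 1: "\<bar>integral\<^sup>L (haar_measure X) p - Re (integral\<^sup>L (haar_measure X) ?S)\<bar> \<le> \<eta>" .
  have "\<bar>(\<Sum>C\<in>Q. p (\<phi> C)) - Re (\<Sum>C\<in>Q. ?S (\<phi> C))\<bar> = \<bar>\<Sum>C\<in>Q. p (\<phi> C) - Re (?S (\<phi> C))\<bar>"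
    by (simp only: Re_sum[of "\<lambda>C. ?S (\<phi> C)" Q] sum_subtractf)
  also have "\<dots> \<le> (\<Sum>C\<in>Q. \<bar>p (\<phi> C) - Re (?S (\<phi> C))\<bar>)" by (rule sum_abs)
  also have "\<dots> \<le> (\<Sum>C\<in>Q. \<eta>)"
  proof (rule sum_mono)
    fix C assume "C \<in> Q"
    then show "\<bar>p (\<phi> C) - Re (?S (\<phi> C))\<bar> \<le> \<eta>" using A(2)[OF Q(3)] by (intro less_imp_le)
  qed
  finally have "\<bar>(\<Sum>C\<in>Q. p (\<phi> C)) - Re (\<Sum>C\<in>Q. ?S (\<phi> C))\<bar> / card Q \<le> \<eta>" using Q0 by (simp add: divide_le_eq mult.commute)
  then have 2: "\<bar>(\<Sum>C\<in>Q. p (\<phi> C)) / card Q - Re ((\<Sum>C\<in>Q. ?S (\<phi> C)) / card Q)\<bar> \<le> \<eta>"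
    using Q0 by (simp add: abs_divide diff_divide_distrib[symmetric])
  have int: "integral\<^sup>L (haar_measure X) ?S = (\<Sum>h\<in>A. c h * integral\<^sup>L (haar_measure X) (chi h))"
    using ichi by (subst Bochner_Integration.integral_sum) auto
  have "(\<Sum>C\<in>Q. ?S (\<phi> C)) / card Q = (\<Sum>h\<in>A. c h * ((\<Sum>C\<in>Q. chi h (\<phi> C)) / card Q))"
    by (subst sum.swap) (simp add: sum_distrib_left sum_divide_distrib)
  then have "(\<Sum>C\<in>Q. ?S (\<phi> C)) / card Q - integral\<^sup>L (haar_measure X) ?S =
      (\<Sum>h\<in>A. c h * ((\<Sum>C\<in>Q. chi h (\<phi> C)) / card Q - integral\<^sup>L (haar_measure X) (chi h)))"
    unfolding int by (simp add: sum_subtractf right_diff_distrib)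
  also have "cmod \<dots> \<le> (\<Sum>h\<in>A. cmod (c h) * \<beta>)"
    using avg by (intro order_trans[OF norm_sum] sum_mono) (simp add: norm_mult mult_left_mono)
  also have "\<dots> \<le> K * \<beta>" unfolding sum_distrib_right[symmetric] using K \<beta> by (rule mult_right_mono)
  finally have "\<bar>Re ((\<Sum>C\<in>Q. ?S (\<phi> C)) / card Q) - Re (integral\<^sup>L (haar_measure X) ?S)\<bar> \<le> K * \<beta>"
    using abs_Re_le_cmod[of "(\<Sum>C\<in>Q. ?S (\<phi> C)) / card Q - integral\<^sup>L (haar_measure X) ?S"]
    unfolding minus_complex.sel by linarith
  then show ?thesis using 1 2 by linarith
qed

context sofic_model
begin

abbreviation "X \<equiv> harmonic_model f"

text \<open>The separation constant of \<open>torus_sol_separated\<close> with degree f 0; it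
  depends on f alone and so serves all quotients.\<close>

definition eps0 :: real where
  "eps0 = 1 - cos (2 * pi * (1 / (4 * of_int (f 0))))"

lemma eps0_pos: "0 < eps0"
proof -
  have d: "1 \<le> real_of_int (f 0)" using f_facts(3) by simp
  have "2 * pi * (1 / (4 * of_int (f 0))) \<le> pi" using d by (simp add: field_simps)
  then have "cos (2 * pi * (1 / (4 * of_int (f 0)))) < cos 0"
    using d by (intro cos_monotone_0_pi) auto
  then show ?thesis by (simp add: eps0_def)
qed

text \<open>All parameters depend only on W, L, \<delta> and f; n enters last, through the size of
  the index and injectivity of the quotient map on a fixed ball. Characters trivial on the model
  average to exactly 1; the others, collected in \<open>A1\<close>, have Haar integral 0 and are
  controlled by the translate.\<close>

lemma lower_maps:
  assumes W: "finite W" and L: "finite L" "\<forall>p\<in>L. continuous_on X p" and \<delta>: "0 < \<delta>"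
  shows "eventually (\<lambda>n. \<exists>F. finite F \<and> F \<subseteq> sofic_maps_meas shift X rho0 (haar_measure X) (Gs n) W L \<delta> \<and>
    cmps n \<le> 2 * card F \<and> (\<forall>a\<in>F. \<forall>b\<in>F. a \<noteq> b \<longrightarrow> eps0 / 3 < rhoinf (cosets (Gs n)) rho0 a b)) sequentially"
proof -
  have tX: "torus_subgroup X" by (rule torus_subgroup_harmonic_model)
  then have Xt: "X \<subseteq> torus" and Xc: "closed X" by (auto simp: torus_subgroup_def)
  let ?R = "\<lambda>p A c. finite A \<and> (\<forall>h\<in>A. finite (supp h)) \<and> (\<forall>x\<in>X. \<bar>p x - Re (\<Sum>h\<in>A. c h * chi h x)\<bar> < \<delta> / 4)"
  have "\<exists>A c. ?R p A c" if "p \<in> L" for p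
    using trig_approximation[OF Xt Xc bspec[OF L(2) that], of "\<delta> / 4"] \<delta> by simp
  then obtain A c where Ac: "\<And>p. p \<in> L \<Longrightarrow> ?R p (A p) (c p)" by metis
  define A0 where "A0 = (\<Union>p\<in>L. A p)"
  have A0: "finite A0" "\<And>h. h \<in> A0 \<Longrightarrow> finite (supp h)" using Ac L(1) by (auto simp: A0_def)
  define C where "C = (\<Sum>p\<in>L. \<Sum>h\<in>A p. cmod (c p h))"
  have C0: "0 \<le> C" by (simp add: C_def sum_nonneg)
  have C: "(\<Sum>h\<in>A p. cmod (c p h)) \<le> C" if "p \<in> L" for p
    unfolding C_def using that L(1) by (intro member_le_sum) (auto simp: sum_nonneg)
  define Mh where "Mh = nat (\<Sum>h\<in>A0. \<Sum>w\<in>supp h. \<bar>h w\<bar>)"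
  have Mh: "(\<Sum>w\<in>supp h. \<bar>h w\<bar>) \<le> int Mh" if "h \<in> A0" for h
  proof -
    have "(\<Sum>w\<in>supp h. \<bar>h w\<bar>) \<le> (\<Sum>h\<in>A0. \<Sum>w\<in>supp h. \<bar>h w\<bar>)"
      using that A0(1) by (intro member_le_sum) (auto simp: sum_nonneg)
    then show ?thesis unfolding Mh_def by simp
  qed
  \<comment> \<open>Negatives of W occur because the shift by s reads coordinate - s.\<close>
  define Wd where "Wd = insert 0 (uminus ` W \<union> (\<Union>h\<in>A0. supp h))"
  have finWd: "finite Wd" using W A0 by (auto simp: Wd_def)
  \<comment> \<open>3 \<omega> is the error of one character average, made up of Mh e, 2 b and the
    orbit mean, each at most \<omega>; the 12 then brings C (3 \<omega>) below \<delta> / 4.\<close>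
  define \<omega> where "\<omega> = \<delta> / (12 * (C + 1))"
  have \<omega>: "0 < \<omega>" using \<delta> C0 by (simp add: \<omega>_def)
  have C\<omega>: "C * (3 * \<omega>) \<le> \<delta> / 4"
  proof -
    have "C * (3 * \<omega>) \<le> (C + 1) * (3 * \<omega>)" using \<omega> by (intro mult_right_mono) auto
    also have "\<dots> = \<delta> / 4" using C0 by (simp add: \<omega>_def divide_simps) 
    finally show ?thesis .
  qed
  \<comment> \<open>With e at most eps0 / 4 the separation eps0 - 2 e still exceeds eps0 / 3; the
    other two bounds serve approximate equivariance and the character averages.\<close>
  define e where "e = min (eps0 / 4) (min (\<delta> / 4) (\<omega> / (real Mh + 1)))"
  have e: "0 < e" "e \<le> eps0 / 4" "e \<le> \<delta> / 4" "e \<le> \<omega> / (real Mh + 1)"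
    using eps0_pos \<delta> \<omega> unfolding e_def by (simp, linarith+)
  have Me: "real Mh * e \<le> \<omega>"
  proof -
    have "real Mh * e \<le> (real Mh + 1) * (\<omega> / (real Mh + 1))" using e by (intro mult_mono) auto
    also have "\<dots> = \<omega>" by simp
    finally show ?thesis .
  qed
  obtain P where P: "finite P" "\<And>z. z \<in> torus \<Longrightarrow> (\<And>t. t \<in> P \<Longrightarrow> (\<Prod>s\<in>supp f. z (t + s) powi f s) = 1) \<Longrightarrow>
      \<exists>x\<in>X. \<forall>w\<in>Wd. cmod (x w - z w) < e"
    using harmonic_model_near[OF finWd e(1), of f] by blast
  \<comment> \<open>Chosen so that the exceptional fraction b = card P / (r + 1) is at most
    \<delta>^2 / 16 and \<omega> / 2.\<close>
  obtain r :: nat where r: "max (16 * card P / \<delta>\<^sup>2) (2 * card P / \<omega>) < real r" using reals_Archimedean2 by blast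
  define b where "b = real (card P) / (real r + 1)"
  have b1: "4 * b \<le> \<delta>\<^sup>2 / 4"
  proof -
    have "16 * card P / \<delta>\<^sup>2 \<le> real r + 1" using r by simp
    then have "16 * card P \<le> (real r + 1) * \<delta>\<^sup>2" using \<delta> by (simp add: pos_divide_le_eq)
    then have "16 * card P / (real r + 1) \<le> \<delta>\<^sup>2" by (simp add: pos_divide_le_eq mult.commute)
    then show ?thesis by (simp add: b_def)
  qed
  have b2: "2 * b \<le> \<omega>"
  proof -
    have "2 * card P / \<omega> \<le> real r + 1" using r by simp
    then have "2 * card P \<le> (real r + 1) * \<omega>" using \<omega> by (simp add: pos_divide_le_eq)
    then have "2 * card P / (real r + 1) \<le> \<omega>" by (simp add: pos_divide_le_eq mult.commute)
    then show ?thesis by (simp add: b_def)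
  qed
  \<comment> \<open>The balls depend on f only, so any one quotient serves to find r0 before n is
    fixed.\<close>
  obtain r0 where r0: "(\<Union>h\<in>A0. supp h) \<subseteq> quot.wball f r0"
  proof -
    obtain ix rep where "quot (Gs 0) f ix rep (idx 0)" by (rule quot_n)
    then interpret quot "Gs 0" f ix rep "idx 0" .
    show ?thesis using finite_subset_wball[of "\<Union>h\<in>A0. supp h"] A0 that by blast
  qed
  define A1 where "A1 = {h \<in> A0. \<exists>x\<in>X. chi h x \<noteq> 1}"
  define D where "D = r0 + (nat (f 0 + 1)) ^ (2 * r) * (2 * Mh) * (2 * r + 1)"
  have finb: "finite (quot.wball f k)" for k
  proof -
    obtain ix rep where "quot (Gs 0) f ix rep (idx 0)" by (rule quot_n)
    then interpret quot "Gs 0" f ix rep "idx 0" .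
    show ?thesis by (rule finite_wball)
  qed
  obtain m :: nat where m: "2 * real (card A1 * card (quot.wball f (2 * D + 2))) / \<omega>\<^sup>2 < real m" using reals_Archimedean2 by blast
  show ?thesis using idx_large[of r] idx_large[of m] eventually_inj[OF finb[of "D + 2"]]
  proof eventually_elim
    case (elim n)
    obtain ix rep where "quot (Gs n) f ix rep (idx n)" by (rule quot_n)
    then interpret quot "Gs n" f ix rep "idx n" .
    have inj: "inj_on ix (wball (D + 2))"
    proof (rule inj_onI)
      fix a b assume ab: "a \<in> wball (D + 2)" "b \<in> wball (D + 2)" "ix a = ix b"
      then have "lcoset a (Gs n) = lcoset b (Gs n)" using ix_eq lcoset_eq_iff[OF subgrp_H] by blast
      then show "a = b" using elim(3) ab(1,2) by (meson inj_onD)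
    qed
    have "2 * real (card A1 * card (wball (2 * D + 2))) / \<omega>\<^sup>2 \<le> real (idx n)" using m elim(2) by linarith
    then have large: "2 * real (card A1 * card (wball (2 * D + 2))) \<le> \<omega>\<^sup>2 * idx n"
      using \<omega> by (simp add: pos_divide_le_eq mult.commute del: wball.simps)
    have small: "2 * e < 1 - cos (2 * pi * (1 / (4 * of_int dd)))"
    proof -
      have "2 * e < eps0" using e(2) eps0_pos by linarith
      then show ?thesis unfolding eps0_def dd_def .
    qed
    have A1: "finite A1" "\<And>h. h \<in> A1 \<Longrightarrow> finite (supp h)" "\<And>h. h \<in> A1 \<Longrightarrow> supp h \<subseteq> wball r0"
      "\<And>h. h \<in> A1 \<Longrightarrow> (\<Sum>w\<in>supp h. \<bar>h w\<bar>) \<le> int Mh" "\<And>h. h \<in> A1 \<Longrightarrow> \<exists>x\<in>X. chi h x \<noteq> 1"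
      using A0 r0 Mh by (auto simp: A1_def)
    have W0: "0 \<in> Wd" by (simp add: Wd_def)
    obtain F where F: "finite F" "tau \<le> 2 * card F"
      "\<And>\<phi> \<phi>'. \<phi> \<in> F \<Longrightarrow> \<phi>' \<in> F \<Longrightarrow> \<phi> \<noteq> \<phi>' \<Longrightarrow>
         1 - cos (2 * pi * (1 / (4 * of_int dd))) - 2 * e \<le> rhoinf (cosets (Gs n)) rho0 \<phi> \<phi>'"
      "\<And>\<phi>. \<phi> \<in> F \<Longrightarrow> \<exists>z. near_orbit Wd e (card P / (real r + 1)) z \<phi> \<and> (\<forall>h\<in>A1. cmod (orbit_mean h z) \<le> \<omega>)"
      by (rule separated_orbits_exist[OF P W0 e(1) elim(1) A1 inj[unfolded D_def dd_def[symmetric]]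
            large[unfolded D_def dd_def[symmetric]] \<omega> small]) blast+
    have "\<phi> \<in> sofic_maps_meas shift X rho0 (haar_measure X) (Gs n) W L \<delta>" if \<phi>: "\<phi> \<in> F" for \<phi>
    proof -
      obtain z where "near_orbit Wd e (card P / (real r + 1)) z \<phi>" and om: "\<And>h. h \<in> A1 \<Longrightarrow> cmod (orbit_mean h z) \<le> \<omega>"
        using F(4)[OF \<phi>] by blast
      then have no: "near_orbit Wd e b z \<phi>" by (simp add: b_def add.commute)
      have "4 * e\<^sup>2 \<le> 4 * (\<delta> / 4)\<^sup>2" using e by (intro mult_left_mono power_mono) auto
      moreover have "4 * (\<delta> / 4)\<^sup>2 = \<delta>\<^sup>2 / 4" by (simp add: power_divide)
      ultimately have "4 * e\<^sup>2 + 4 * b \<le> \<delta>\<^sup>2" using b1 zero_le_power2[of \<delta>] by linarith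
      then have sm: "\<phi> \<in> sofic_maps shift X rho0 (Gs n) W \<delta>"
        using e \<delta> by (intro near_orbit_sofic[OF no]) (auto simp: Wd_def)
      have \<phi>X: "\<phi> C \<in> X" if "C \<in> cosets (Gs n)" for C using no that by (auto simp: near_orbit_def)
      have avg: "cmod ((\<Sum>C\<in>cosets (Gs n). chi h (\<phi> C)) / card (cosets (Gs n)) - integral\<^sup>L (haar_measure X) (chi h)) \<le> 3 * \<omega>"
        if h: "h \<in> A0" for h
      proof (cases "h \<in> A1")
        case True
        have int0: "integral\<^sup>L (haar_measure X) (chi h) = 0"
          using haar_integral_chi[OF cnt inf tX, of h] A1(5)[OF True] by auto
        have "real_of_int (\<Sum>w\<in>supp h. \<bar>h w\<bar>) \<le> real_of_int (int Mh)" using Mh[OF h] by (simp only: of_int_le_iff)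
        then have "(\<Sum>w\<in>supp h. \<bar>real_of_int (h w)\<bar>) \<le> real Mh" by simp
        moreover have "supp h \<subseteq> Wd" using h by (auto simp: Wd_def)
        ultimately have "cmod ((\<Sum>C\<in>cosets (Gs n). chi h (\<phi> C)) / idx n - orbit_mean h z) \<le> real Mh * e + 2 * b"
          using e by (intro near_orbit_average[OF no A0(2)[OF h]]) auto
        then have "cmod ((\<Sum>C\<in>cosets (Gs n). chi h (\<phi> C)) / idx n) \<le> real Mh * e + 2 * b + \<omega>"
          using norm_triangle_mono[OF _ om[OF True]] by fastforce
        then show ?thesis using Me b2 unfolding int0 by simp
      next
        case False
        then have one: "\<forall>x\<in>X. chi h x = 1" using h by (auto simp: A1_def)
        have "(\<Sum>C\<in>cosets (Gs n). chi h (\<phi> C)) = (\<Sum>C\<in>cosets (Gs n). 1)" using one \<phi>X by (intro sum.cong) auto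
        then have "(\<Sum>C\<in>cosets (Gs n). chi h (\<phi> C)) / card (cosets (Gs n)) = 1" using N_pos by simp
        then show ?thesis using haar_integral_chi[OF cnt inf tX, of h] one \<omega> by simp
      qed
      have "\<bar>(\<Sum>C\<in>cosets (Gs n). p (\<phi> C)) / real (card (cosets (Gs n))) - integral\<^sup>L (haar_measure X) p\<bar> \<le> \<delta>" if p: "p \<in> L" for p
      proof -
        have "\<bar>(\<Sum>C\<in>cosets (Gs n). p (\<phi> C)) / card (cosets (Gs n)) - integral\<^sup>L (haar_measure X) p\<bar> \<le> 2 * (\<delta> / 4) + C * (3 * \<omega>)"
        proof (rule average_close[OF cnt inf tX finite_cosets _ \<phi>X bspec[OF L(2) p]])
          show "cosets (Gs n) \<noteq> {}" by (auto simp: cosets_def)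
          show "finite (A p)" using Ac[OF p] by blast
          show "\<bar>p x - Re (\<Sum>h\<in>A p. c p h * chi h x)\<bar> < \<delta> / 4" if "x \<in> X" for x using Ac[OF p] that by blast
          show "cmod ((\<Sum>C\<in>cosets (Gs n). chi h (\<phi> C)) / card (cosets (Gs n)) - integral\<^sup>L (haar_measure X) (chi h)) \<le> 3 * \<omega>"
            if "h \<in> A p" for h using avg[of h] that p by (auto simp: A0_def)
          show "(\<Sum>h\<in>A p. cmod (c p h)) \<le> C" by (rule C[OF p])
        qed (use \<omega> in auto)
        then show ?thesis using C\<omega> \<delta> by linarith
      qed
      then show ?thesis using sm by (simp add: sofic_maps_meas_def)
    qed
    moreover have "eps0 / 3 < rhoinf (cosets (Gs n)) rho0 a b" if "a \<in> F" "b \<in> F" "a \<noteq> b" for a b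
    proof -
      have "eps0 - 2 * e \<le> rhoinf (cosets (Gs n)) rho0 a b" using F(3)[OF that] unfolding eps0_def dd_def .
      then show ?thesis using e(2) eps0_pos by linarith
    qed
    ultimately show ?case using F(1,2) unfolding card_components_fix by blast
  qed
qed

text \<open>Keeping only half of the periodic points costs ln 2 / idx n, which tends to 0; the scale
  eps0 / 3 bounds the supremum over scales from below.\<close>

lemma sofic_meas_entropy_ge:
  assumes l: "(\<lambda>n. ln (real (cmps n)) / idx n) \<longlonglongrightarrow> l"
  shows "ereal l \<le> sofic_meas_entropy shift X rho0 (haar_measure X) Gs"
proof -
  have "ereal l \<le> limsup (\<lambda>n. elog (sep_number (rhoinf (cosets (Gs n)) rho0) (eps0 / 3)
      (sofic_maps_meas shift X rho0 (haar_measure X) (Gs n) W L \<delta>)) / ereal (real (idx n)))"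
    if W: "finite W" and L: "finite L" "\<forall>p\<in>L. continuous_on X p" and \<delta>: "0 < \<delta>" for W L \<delta>
  proof -
    have "filterlim (\<lambda>n. real (idx n)) at_top sequentially"
      by (rule filterlim_compose[OF filterlim_real_sequentially])
        (auto simp: filterlim_at_top intro!: eventually_mono[OF idx_large] less_imp_le)
    then have "(\<lambda>n. ln 2 / real (idx n)) \<longlonglongrightarrow> 0" by (rule tendsto_divide_0[OF tendsto_const filterlim_at_top_imp_at_infinity])
    from tendsto_diff[OF l this] have lim: "(\<lambda>n. ln (real (cmps n) / 2) / idx n) \<longlonglongrightarrow> l"
      using cmps_pos by (simp add: ln_div diff_divide_distrib Suc_le_eq)
    have "ereal l = limsup (\<lambda>n. ereal (ln (real (cmps n) / 2) / idx n))"
      using lim by (intro lim_imp_Limsup[symmetric]) auto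
    also have "\<dots> \<le> limsup (\<lambda>n. elog (sep_number (rhoinf (cosets (Gs n)) rho0) (eps0 / 3)
      (sofic_maps_meas shift X rho0 (haar_measure X) (Gs n) W L \<delta>)) / ereal (real (idx n)))"
    proof (rule Limsup_mono)
      show "eventually (\<lambda>n. ereal (ln (real (cmps n) / 2) / idx n) \<le> elog (sep_number (rhoinf (cosets (Gs n)) rho0) (eps0 / 3)
          (sofic_maps_meas shift X rho0 (haar_measure X) (Gs n) W L \<delta>)) / ereal (real (idx n))) sequentially"
        using lower_maps[OF W L \<delta>]
      proof eventually_elim
        case (elim n)
        then obtain F where F: "finite F" "F \<subseteq> sofic_maps_meas shift X rho0 (haar_measure X) (Gs n) W L \<delta>"
          "cmps n \<le> 2 * card F" "\<forall>a\<in>F. \<forall>b\<in>F. a \<noteq> b \<longrightarrow> eps0 / 3 < rhoinf (cosets (Gs n)) rho0 a b" by blast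
        let ?s = "sep_number (rhoinf (cosets (Gs n)) rho0) (eps0 / 3) (sofic_maps_meas shift X rho0 (haar_measure X) (Gs n) W L \<delta>)"
        have "real (cmps n) \<le> real (2 * card F)" using F(3) by (simp only: of_nat_le_iff)
        then have "ereal (real (cmps n) / 2) \<le> ereal (real (card F))" by simp
        also have "\<dots> \<le> ?s" unfolding sep_number_def using F by (intro Sup_upper) blast
        finally have "ereal (ln (real (cmps n) / 2)) \<le> elog ?s" using cmps_pos[of n] by (intro elog_ge) auto
        then have "ereal (ln (real (cmps n) / 2)) / ereal (real (idx n)) \<le> elog ?s / ereal (real (idx n))"
          using idx_pos[of n] by (intro ereal_divide_right_mono) auto
        then show ?case using idx_pos[of n] by simp
      qed
    qed
    finally show ?thesis .
  qed
  then show ?thesis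
    unfolding sofic_meas_entropy_def using eps0_pos
    by (intro SUP_upper2[of "eps0 / 3"] INF_greatest) auto
qed

text \<open>The order of choice matters: q from \<epsilon>, r from q and e, t from e, \<eta> from
  \<epsilon> and r, and finally \<delta> against all of them.\<close>

lemma small_parameters:
  fixes \<epsilon> e :: real
  assumes \<epsilon>: "0 < \<epsilon>" and e: "0 < e"
  obtains q r :: nat and t \<eta> \<delta> :: real where "0 < q" "0 < t" "t \<le> 1" "0 < \<eta>" "\<eta> \<le> 1 / 2" "0 < \<delta>"
    "2 * of_int (f 0) * sqrt \<delta> < 1 - cos (2 * pi * \<eta>)"
    "4 * pi * (1 / q + (of_int (f 0) + 1) ^ (2 * r) * \<eta>) \<le> \<epsilon>"
    "- (card (supp f) * \<delta>) * ln t + ln (1 + t) + (card (supp f) * \<delta> + 1 / (real r + 1)) * ln (real q * (2 * real (4 * r + 1))) \<le> e"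
proof -
  have d: "1 \<le> real_of_int (f 0)" using f_facts(3) by simp
  obtain q :: nat where q: "8 * pi / \<epsilon> < real q" using reals_Archimedean2 by blast
  have q0: "0 < real q" using q \<epsilon> by (smt (verit) divide_pos_pos pi_gt_zero mult_pos_pos)
  have q1: "4 * pi * (1 / q) \<le> \<epsilon> / 2"
  proof -
    have "8 * pi \<le> q * \<epsilon>" using q \<epsilon> by (simp add: pos_divide_less_eq less_imp_le)
    then show ?thesis using q0 by (simp add: field_simps)
  qed
  obtain r :: nat where r: "ln (real q * (2 * real (4 * r + 1))) / (real r + 1) < e / 4"
    using ln_ratio_small[of "real q" "e / 4"] q0 e by auto
  define t where "t = min 1 (e / 4)"
  have t: "0 < t" "t \<le> 1" "t \<le> e / 4" using e by (auto simp: t_def)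
  have lnt: "ln (1 + t) \<le> e / 4" using ln_add_one_self_le_self[of t] t by linarith
  define Z where "Z = (of_int (f 0) + 1 :: real) ^ (2 * r)"
  have Z: "0 < Z" using d by (simp add: Z_def)
  define \<eta> where "\<eta> = min (1 / 2) (\<epsilon> / (8 * pi * Z))"
  have \<eta>: "0 < \<eta>" "\<eta> \<le> 1 / 2" using \<epsilon> Z by (auto simp: \<eta>_def)
  have "4 * pi * (Z * \<eta>) \<le> 4 * pi * (Z * (\<epsilon> / (8 * pi * Z)))"
    using Z by (intro mult_left_mono) (auto simp: \<eta>_def)
  also have "\<dots> = \<epsilon> / 2" using Z by simp
  finally have cl: "4 * pi * (1 / q + Z * \<eta>) \<le> \<epsilon>" using q1 by (simp add: distrib_left)
  have cos1: "0 < 1 - cos (2 * pi * \<eta>)"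
  proof -
    have "cos (2 * pi * \<eta>) < cos 0" using \<eta> by (intro cos_monotone_0_pi) auto
    then show ?thesis by simp
  qed
  define \<delta>1 where "\<delta>1 = ((1 - cos (2 * pi * \<eta>)) / (4 * of_int (f 0)))\<^sup>2"
  define a where "a = real (card (supp f))"
  define lq where "lq = ln (real q * (2 * real (4 * r + 1)))"
  define S where "S = a * (\<bar>ln t\<bar> + \<bar>lq\<bar>) + 1"
  have a0: "0 \<le> a" by (simp add: a_def)
  have S: "0 < S" using a0 by (simp add: S_def add_nonneg_pos)
  define \<delta> where "\<delta> = min \<delta>1 (e / (2 * S))"
  have \<delta>1: "0 < \<delta>1" using cos1 d by (simp add: \<delta>1_def)
  have \<delta>: "0 < \<delta>" "\<delta> \<le> \<delta>1" "\<delta> \<le> e / (2 * S)" using \<delta>1 e S by (auto simp: \<delta>_def)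
  have "2 * of_int (f 0) * sqrt \<delta> \<le> 2 * of_int (f 0) * sqrt \<delta>1" using \<delta> d by (intro mult_left_mono) auto
  also have "sqrt \<delta>1 = (1 - cos (2 * pi * \<eta>)) / (4 * of_int (f 0))" unfolding \<delta>1_def using cos1 d by (simp add: abs_of_nonneg)
  also have "2 * of_int (f 0) * ((1 - cos (2 * pi * \<eta>)) / (4 * of_int (f 0))) = (1 - cos (2 * pi * \<eta>)) / 2" using d by simp
  also have "\<dots> < 1 - cos (2 * pi * \<eta>)" using cos1 by simp
  finally have sq: "2 * of_int (f 0) * sqrt \<delta> < 1 - cos (2 * pi * \<eta>)" .
  have "\<delta> * S \<le> e / (2 * S) * S" using \<delta>(3) S by (intro mult_right_mono) auto
  then have dS: "\<delta> * S \<le> e / 2" using S by simp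
  have "- (a * \<delta>) * ln t + a * \<delta> * lq \<le> (a * \<delta>) * (\<bar>ln t\<bar> + \<bar>lq\<bar>)"
  proof -
    have "(a * \<delta>) * (- ln t + lq) \<le> (a * \<delta>) * (\<bar>ln t\<bar> + \<bar>lq\<bar>)" using a0 \<delta>(1) by (intro mult_left_mono) auto
    then show ?thesis by (simp add: algebra_simps)
  qed
  also have "\<dots> \<le> \<delta> * S" using \<delta>(1) by (simp add: S_def algebra_simps)
  finally have "- (a * \<delta>) * ln t + a * \<delta> * lq \<le> e / 2" using dS by linarith
  moreover have "(a * \<delta> + 1 / (real r + 1)) * lq = a * \<delta> * lq + lq / (real r + 1)" by (simp add: distrib_right)
  ultimately have "- (a * \<delta>) * ln t + ln (1 + t) + (a * \<delta> + 1 / (real r + 1)) * lq \<le> e"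
    using lnt r unfolding lq_def by linarith
  then show ?thesis
    using that[of q t \<eta> \<delta> r] q0 t \<eta> \<delta>(1) sq cl unfolding Z_def a_def lq_def by simp
qed

text \<open>W = supp f is a good enough choice in the infimum, since approximate equivariance along
  the generators already yields approximate solutions of the Laplace equation.\<close>

lemma sofic_entropy_le:
  assumes l: "(\<lambda>n. ln (real (cmps n)) / idx n) \<longlonglongrightarrow> l"
  shows "sofic_entropy shift X rho0 Gs \<le> ereal l"
  unfolding sofic_entropy_def
proof (rule SUP_least, rule ereal_le_epsilon2)
  fix \<epsilon> e :: real assume "\<epsilon> \<in> {0<..}" and e: "0 < e"
  then have \<epsilon>: "0 < \<epsilon>" by simp
  obtain q r :: nat and t \<eta> \<delta> :: real where p: "0 < q" "0 < t" "t \<le> 1" "0 < \<eta>" "\<eta> \<le> 1 / 2" "0 < \<delta>"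
    "2 * of_int (f 0) * sqrt \<delta> < 1 - cos (2 * pi * \<eta>)"
    "4 * pi * (1 / q + (of_int (f 0) + 1) ^ (2 * r) * \<eta>) \<le> \<epsilon>"
    and small: "- (card (supp f) * \<delta>) * ln t + ln (1 + t) + (card (supp f) * \<delta> + 1 / (real r + 1)) * ln (real q * (2 * real (4 * r + 1))) \<le> e"
    by (rule small_parameters[OF \<epsilon> e])
  define \<sigma> where "\<sigma> = card (supp f) * \<delta>"
  let ?h = "\<lambda>n. elog (sep_number (rhoinf (cosets (Gs n)) rho0) \<epsilon> (sofic_maps shift X rho0 (Gs n) (supp f) \<delta>)) / ereal (real (idx n))"
  have "eventually (\<lambda>n. ?h n \<le> ereal (ln (real (cmps n)) / idx n + e)) sequentially"
    using idx_large[of r]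
  proof eventually_elim
    case (elim n)
    obtain ix rep where "quot (Gs n) f ix rep (idx n)" by (rule quot_n)
    then interpret quot "Gs n" f ix rep "idx n" .
    define Y where "Y = real q * (2 * real (4 * r + 1))"
    have Y: "0 < Y" using p(1) by (simp add: Y_def)
    define b where "b = t powr (- (\<sigma> * idx n)) * (1 + t) ^ idx n * Y powr (\<sigma> * idx n + idx n / (real r + 1)) * real tau"
    have tau0: "0 < real tau" using tau_pos by simp
    have b: "0 < b" using p tau0 Y by (simp add: b_def)
    have "sep_number (rhoinf (cosets (Gs n)) rho0) \<epsilon> (sofic_maps shift X rho0 (Gs n) (supp f) \<delta>) \<le> ereal b"
      unfolding sep_number_def
    proof (rule Sup_least)
      fix x assume "x \<in> {ereal (real (card F)) |F. F \<subseteq> sofic_maps shift X rho0 (Gs n) (supp f) \<delta> \<and> finite F \<and>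
          (\<forall>a\<in>F. \<forall>b\<in>F. a \<noteq> b \<longrightarrow> \<epsilon> < rhoinf (cosets (Gs n)) rho0 a b)}"
      then obtain F where F: "x = ereal (real (card F))" "F \<subseteq> sofic_maps shift X rho0 (Gs n) (supp f) \<delta>" "finite F"
          "\<And>a b. a \<in> F \<Longrightarrow> b \<in> F \<Longrightarrow> a \<noteq> b \<Longrightarrow> \<epsilon> < rhoinf (cosets (Gs n)) rho0 a b" by blast
      have "real (card F) \<le> t powr (- (card (supp f) * \<delta> * idx n)) * (1 + t) ^ idx n *
          (real q * (2 * real (4 * r + 1))) powr (card (supp f) * \<delta> * idx n + idx n / (real r + 1)) * tau"
        by (rule separated_card_le[OF F(2,3,4) p(6) elim p(1,2,3) p(7)[folded dd_def] p(4,5) p(8)[folded dd_def]])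
      then show "x \<le> ereal b" unfolding F(1) b_def \<sigma>_def Y_def by (simp add: add.commute)
    qed
    then have "elog (sep_number (rhoinf (cosets (Gs n)) rho0) \<epsilon> (sofic_maps shift X rho0 (Gs n) (supp f) \<delta>)) \<le> ereal (ln b)"
      by (rule elog_le[OF _ b])
    then have "?h n \<le> ereal (ln b) / ereal (real (idx n))"
      using N_pos by (intro ereal_divide_right_mono) auto
    also have "\<dots> = ereal (ln b / idx n)" using N_pos by simp
    also have "ln b = - (\<sigma> * idx n) * ln t + idx n * ln (1 + t) + (\<sigma> * idx n + idx n / (real r + 1)) * ln Y + ln (real tau)"
      unfolding b_def using p(2) Y tau0 by (simp add: ln_mult ln_powr ln_realpow)
    also have "\<dots> = idx n * (- \<sigma> * ln t + ln (1 + t) + (\<sigma> + 1 / (real r + 1)) * ln Y) + ln (real tau)"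
      by (simp add: algebra_simps)
    also have "\<dots> / idx n = (- \<sigma> * ln t + ln (1 + t) + (\<sigma> + 1 / (real r + 1)) * ln Y) + ln (real tau) / idx n"
      using N_pos by (simp add: add_divide_distrib)
    also have "ereal \<dots> \<le> ereal (ln (real tau) / idx n + e)" using small unfolding \<sigma>_def Y_def by simp
    finally show ?case unfolding card_components_fix .
  qed
  then have "limsup ?h \<le> limsup (\<lambda>n. ereal (ln (real (cmps n)) / idx n + e))" by (rule Limsup_mono)
  also have "\<dots> = ereal (l + e)" using tendsto_add[OF l tendsto_const[of e]] by (intro lim_imp_Limsup) auto
  finally have le: "limsup ?h \<le> ereal l + ereal e" by simp
  have "0 \<in> supp f" using f_facts(3) by (simp add: supp_def)
  then have sf: "supp f \<in> {W. finite W \<and> W \<noteq> {}}" using f_facts(1) by blast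
  show "(INF W\<in>{W. finite W \<and> W \<noteq> {}}. INF \<delta>\<in>{0<..}. limsup (\<lambda>n. elog (sep_number (rhoinf (cosets (Gs n)) rho0) \<epsilon>
      (sofic_maps shift X rho0 (Gs n) W \<delta>)) / ereal (real (idx n)))) \<le> ereal l + ereal e"
    by (rule INF_lower2[OF sf], rule INF_lower2[of \<delta>]) (use p(6) le in auto)
qed

text \<open>With L empty the condition on averages is void, and the infimum over L lies below that
  value.\<close>

lemma sofic_meas_entropy_le: "sofic_meas_entropy shift X rho0 \<nu> Gs \<le> sofic_entropy shift X rho0 Gs"
proof -
  have "sofic_maps_meas shift X rho0 \<nu> H W {} \<delta> = sofic_maps shift X rho0 H W \<delta>" for H W \<delta>
    by (simp add: sofic_maps_meas_def)
  then show ?thesis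
    unfolding sofic_meas_entropy_def sofic_entropy_def
    by (intro SUP_mono' INF_mono' INF_lower2[of "{}"]) auto
qed

end

theorem theorem1p1:
  fixes Gs :: "nat \<Rightarrow> 'g::group_add set" and f :: "'g \<Rightarrow> int"
  assumes "countable (UNIV :: 'g set)" and "infinite (UNIV :: 'g set)"
    and "\<forall>n. normal_subgrp (Gs n) \<and> finite_index (Gs n)"
    and "(\<Inter>n. \<Union>i\<in>{n..}. Gs i) = {0}"
    and "well_balanced (\<lambda>s. real_of_int (f s))"
  shows "sofic_meas_entropy shift (harmonic_model f) rho0 (haar_measure (harmonic_model f)) Gs
           = sofic_entropy shift (harmonic_model f) rho0 Gs
       \<and> sofic_entropy shift (harmonic_model f) rho0 Gs
           = fk_log_det (conv_op (\<lambda>s. real_of_int (f s)))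
       \<and> (\<lambda>n. elog (ereal (real (card (components (fix_set (Gs n) (harmonic_model f))))))
                / ereal (real (card (cosets (Gs n)))))
           \<longlonglongrightarrow> fk_log_det (conv_op (\<lambda>s. real_of_int (f s)))"
proof -
  interpret sofic_model Gs f using assms by unfold_locales auto
  obtain l where det: "fk_log_det (conv_op (\<lambda>s. real_of_int (f s))) = ereal l"
    and l: "(\<lambda>n. ln (real (cmps n)) / idx n) \<longlonglongrightarrow> l"
    by (rule log_det_limit)
  have "sofic_meas_entropy shift X rho0 (haar_measure X) Gs = ereal l" "sofic_entropy shift X rho0 Gs = ereal l"
    using sofic_meas_entropy_ge[OF l] sofic_meas_entropy_le[of "haar_measure X"] sofic_entropy_le[OF l] by auto
  moreover have "elog (ereal (real (cmps n))) / ereal (real (idx n)) = ereal (ln (real (cmps n)) / idx n)" for n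
    using cmps_pos[of n] idx_pos[of n] by (simp add: elog_def)
  ultimately show ?thesis using l by (simp add: det)
qed

end
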